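(* Work in the generalised semi-varying coefficient model with the notation of the context. Assume the following. (1) The kernel $K(\cdot)$ is a continuous and symmetric probability density function with compact support. (2a) $\mathsf E(Q_{i1}\mid X_i,U_i)=0$ a.s., $u\mapsto\mathsf E(Q_{i1}^2\mid U_i=u)$ is continuous for $u\in[0,1]$, and for some $m_0>2$, uniformly for $u\in[0,1]$, $$\max_{1\le j\le d_n}\mathsf E[|Q_{i1}x_{ij}|^{m_0}\mid U_i=u]+\max_{1\le j,k\le d_n}\mathsf E[|Q_{i2}x_{ij}x_{ik}|^{m_0}\mid U_i=u]<\infty\quad\text{a.s.}$$ (2b) $q_2(s,y)<0$ for all $s\in\mathbb R$ and all $y$ in the range of the response variable; and there exists $M(X,U,y)>0$ such that, with $r(X,U)=\sum_{j=1}^{d_n}a_j(U)x_j$, $|q_2[r(X,U)+\delta_*,y]-q_2[r(X,U),y]|\le M(X,U,y)|\delta_*|$ and, uniformly for $u\in[0,1]$, $\max_{1\le j,k,l\le d_n}\mathsf E[|x_{ij}x_{ik}x_{il}M(X_i,U_i,y_i)|^{m_0}\mid U_i=u]<\infty$ a.s. (2c) There exist constants $0<\rho_1\le\rho_2<\infty$ such that, with probability approaching one, $$\rho_1\le\inf_{u\in[0,1]}\inf_{\mathbf v\in\boldsymbol\Omega_0(b)}\mathbf v^{\mathrm T}[-\ddot{\mathcal L}_n(u)]\mathbf v\le\sup_{u\in[0,1]}\sup_{\mathbf v\in\boldsymbol\Omega_0(b)}\mathbf v^{\mathrm T}[-\ddot{\mathcal L}_n(u)]\mathbf v\le\rho_2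 .$$ (3) The density $f_U(\cdot)$ of $U$ has a continuous second-order derivative, and $f_U(u)$ is bounded away from zero and infinity for $u\in[0,1]$. (4) The functional coefficients $a_j(\cdot)$ have continuous second-order derivatives for $j=1,\ldots,d_n$. (5) $d_n\propto n^{\tau_1}$ with $0\le\tau_1<\infty$; $\frac{nh}{(nd_n^3)^{2/m_0}\log h^{-1}}\to\infty$; $h\propto n^{-\delta_1}$ with $0<\delta_1<1$; $s_{n2}h^2+\left(\frac{\log h^{-1}}{nh}\right)^{1/2}=o(\lambda_1)$; $\lambda_1\propto\lambda_2$; and $s_{n2}\lambda_1^2h^{-2}+s_{n2}^2\lambda_1=o(1)$. (6a) $s_{n2}h^2\propto(nh)^{-1/2}$, $\lambda_4\sim\lambda_4^\ast$, $\lambda_4=o(n^{1/2})$, and $h^{-1/2}\left[(\log h^{-1})^{1/2}+s_{n2}^{1/2}(1+\lambda_1\sqrt{nh})\right]=o(\lambda_4)$. (6b) There exists a constant $b_\diamond>0$ such that, with probability approaching one, $\min_{1\le j\le s_{n2}}\|\boldsymbol\alpha_{j0}\|\ge b_\diamond n^{1/2}$ and $\min_{1\le j\le s_{n1}}D_j\ge b_\diamond n^{1/2}$. Furthermore, uniformly for $k=s_{n2}+1,\ldots,d_n,d_n+s_{n1}+1,\ldots,2d_n$, $$\sup_{u\in[0,1]}\sup_{\|\mathbf w^o\|=1}\left|\ddot{\mathcal L}_n(u\mid k)\,\mathbf w^o\right|=O_P(1),$$ where $\ddot{\mathcal L}_n(u\mid k)$ is the $k$th row of $\ddot{\mathcal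 L}_n(u)$ and $\mathbf w^o=[(\mathbf w_1^o)^{\mathrm T},(\mathbf w_2^o)^{\mathrm T}]^{\mathrm T}$ ranges over unit vectors such that $\mathbf w_1^o,\mathbf w_2^o\in\mathbb R^{d_n}$, the last $d_n-s_{n2}$ elements of $\mathbf w_1^o$ are zero and the last $d_n-s_{n1}$ elements of $\mathbf w_2^o$ are zero. Then for any $s_{n1}$-dimensional vector $\mathbf B_n$ with $\|\mathbf B_n\|=1$, $$\sqrt{nh}\,\mathbf B_n^{\mathrm T}\overline{\mathbf D}_n=o_P(1);$$ and for any $(s_{n2}-s_{n1})$-dimensional vector $\mathbf A_n$ with $\|\mathbf A_n\|=1$, $$\sqrt n\,\mathbf A_n^{\mathrm T}\left(\overline{\mathbf C}_n-\mathbf C_n^{uo}\right)=o_P(1).$$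
   Context: Conventions: limits are as $n\to\infty$; $\alpha_n\propto\beta_n$ means $c_1\beta_n\le\alpha_n\le c_2\beta_n$ for all sufficiently large $n$, for some constants $0<c_1\le c_2<\infty$; $\alpha_n\sim\beta_n$ means $\alpha_n/\beta_n\to1$; $\|\mathbf u\|^2=\mathbf u^{\mathrm T}\mathbf u$; $\dot f,\ddot f$ denote first and second derivatives of a function $f$ of one variable; $z_+=\max(z,0)$. Model. $(U_i,X_i,y_i)$, $i=1,\ldots,n$, is an independent and identically distributed sample, where $X_i=(x_{i1},\ldots,x_{id_n})^{\mathrm T}$ is a vector of covariates whose dimension $d_n$ depends on $n$ with $d_n\to\infty$ (possibly larger than $n$), the index variable $U$ has support $[0,1]$, and $y$ is the response. With $m(U,X)=\mathsf E(y\mid U,X)$, the log conditional density (or log probability mass function) of $y$ given $(U,X)$ is $\ell(m(U,X),y)$ with $g(m(U,X))=\sum_{j=1}^{d_n}a_j(U)x_j$, where $\ell$ and the link $g$ are known and the functional coefficients $a_j(\cdot)$ are unknown. There are integers $1\le s_{n1}<s_{n2}<d_n$ such that $a_j(\cdot)$ is non-constant for $1\le j\le s_{n1}$, $a_j(\cdot)\equiv c_j$ is a nonzero constant for $s_{n1}+1\le j\le s_{n2}$, and $a_j(\cdot)\equiv0$ for $s_{n2}+1\le j\le d_n$; $s_{n2}$ may diverge with $n$ but is much smaller than $n$ and $d_n$. Put $\boldsymbol\alpha_{j0}=[a_j(U_1),\ldots,a_j(U_n)]^{\mathrm T}$ and $D_j=\{\sum_{k=1}^n[a_j(U_k)-\frac1n\sum_{l=1}^na_j(U_l)]^2\}^{1/2}$.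 Derivatives of the log-likelihood. $q_1(s,y)=\partial\ell[g^{-1}(s),y]/\partial s$, $q_2(s,y)=\partial^2\ell[g^{-1}(s),y]/\partial s^2$, $Q_{i1}=q_1[\sum_{j=1}^{d_n}a_j(U_i)x_{ij},y_i]$, $Q_{i2}=q_2[\sum_{j=1}^{d_n}a_j(U_i)x_{ij},y_i]$. Preliminary estimator. With kernel $K$, bandwidth $h$, $K_h(\cdot)=h^{-1}K(\cdot/h)$, $\mathbf a_k=(\alpha_{1k},\ldots,\alpha_{d_nk})^{\mathrm T}$ and $\mathbf b_k=(\beta_{1k},\ldots,\beta_{d_nk})^{\mathrm T}$, let $$\mathcal L_{nk}(\mathbf a_k,\mathbf b_k)=\frac1n\sum_{i=1}^n\ell\Big(g^{-1}\Big\{\sum_{j=1}^{d_n}[\alpha_{jk}+\beta_{jk}(U_i-U_k)]x_{ij}\Big\},y_i\Big)K_h(U_i-U_k).$$ $(\widetilde{\mathbf a}_k,\widetilde{\mathbf b}_k)$ is the maximiser of $\mathcal L_{nk}(\mathbf a_k,\mathbf b_k)-\lambda_1\sum_{j=1}^{d_n}|\alpha_{jk}|-\lambda_2\sum_{j=1}^{d_n}h|\beta_{jk}|$, with tuning parameters $\lambda_1,\lambda_2$. Write $\widetilde{\mathbf a}_k=[\widetilde a_1(U_k),\ldots,\widetilde a_{d_n}(U_k)]^{\mathrm T}$, $\widetilde{\mathcal A}_n=(\widetilde{\mathbf a}_1^{\mathrm T},\ldots,\widetilde{\mathbf a}_n^{\mathrm T})^{\mathrm T}$, $\widetilde{\mathcal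 B}_n=(\widetilde{\mathbf b}_1^{\mathrm T},\ldots,\widetilde{\mathbf b}_n^{\mathrm T})^{\mathrm T}$, $\widetilde{\boldsymbol\alpha}_j=[\widetilde a_j(U_1),\ldots,\widetilde a_j(U_n)]^{\mathrm T}$, and $\widetilde D_j=\{\sum_{k=1}^n[\widetilde a_j(U_k)-\frac1n\sum_{l=1}^n\widetilde a_j(U_l)]^2\}^{1/2}$. Quadratic approximation. For $\mathcal A=(\mathbf a_1^{\mathrm T},\ldots,\mathbf a_n^{\mathrm T})^{\mathrm T}$, $\mathcal B=(\mathbf b_1^{\mathrm T},\ldots,\mathbf b_n^{\mathrm T})^{\mathrm T}$, let $\mathcal L_n(\mathcal A,\mathcal B)=\sum_{k=1}^n\mathcal L_{nk}(\mathbf a_k,\mathbf b_k)$, $\mathcal V_n(\mathcal A,h\mathcal B)=(\mathbf a_1^{\mathrm T},h\mathbf b_1^{\mathrm T},\ldots,\mathbf a_n^{\mathrm T},h\mathbf b_n^{\mathrm T})^{\mathrm T}$, $\boldsymbol\beta_j=(\beta_{j1},\ldots,\beta_{jn})^{\mathrm T}$, $\boldsymbol\alpha_j=(\alpha_{j1},\ldots,\alpha_{jn})^{\mathrm T}$, $$\dot{\mathcal L}_{nk}(\mathbf a_k,\mathbf b_k)=\frac1n\sum_{i=1}^nq_1\Big\{\sum_{j=1}^{d_n}[\alpha_{jk}+\beta_{jk}(U_i-U_k)]x_{ij},y_i\Big\}\begin{pmatrix}X_i\\ \frac{U_i-U_k}{h}X_i\end{pmatrix}K_h(U_i-U_k),$$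 $$\ddot{\mathcal L}_{nk}(\mathbf a_k,\mathbf b_k,l)=\frac1n\sum_{i=1}^nq_2\Big\{\sum_{j=1}^{d_n}[\alpha_{jk}+\beta_{jk}(U_i-U_k)]x_{ij},y_i\Big\}\Big(\frac{U_i-U_k}{h}\Big)^lX_iX_i^{\mathrm T}K_h(U_i-U_k),\quad l=0,1,2,$$ $$\ddot{\mathcal L}_{nk}(\mathbf a_k,\mathbf b_k)=\begin{pmatrix}\ddot{\mathcal L}_{nk}(\mathbf a_k,\mathbf b_k,0)&\ddot{\mathcal L}_{nk}(\mathbf a_k,\mathbf b_k,1)\\ \ddot{\mathcal L}_{nk}(\mathbf a_k,\mathbf b_k,1)&\ddot{\mathcal L}_{nk}(\mathbf a_k,\mathbf b_k,2)\end{pmatrix},$$ $\dot{\mathcal L}_n(\mathcal A,\mathcal B)=[\dot{\mathcal L}_{n1}^{\mathrm T}(\mathbf a_1,\mathbf b_1),\ldots,\dot{\mathcal L}_{nn}^{\mathrm T}(\mathbf a_n,\mathbf b_n)]^{\mathrm T}$, and $\ddot{\mathcal L}_n(\mathcal A,\mathcal B)$ the block-diagonal matrix with diagonal blocks $\ddot{\mathcal L}_{n1}(\mathbf a_1,\mathbf b_1),\ldots,\ddot{\mathcal L}_{nn}(\mathbf a_n,\mathbf b_n)$. With $\Delta=\mathcal V_n(\mathcal A,h\mathcal B)-\mathcal V_n(\widetilde{\mathcal A}_n,h\widetilde{\mathcal B}_n)$, set $$\mathcal L_n^\diamond(\mathcal A,\mathcal B)=\mathcal L_n(\widetilde{\mathcal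 A}_n,\widetilde{\mathcal B}_n)+\Delta^{\mathrm T}\dot{\mathcal L}_n(\widetilde{\mathcal A}_n,\widetilde{\mathcal B}_n)+\tfrac12\Delta^{\mathrm T}\ddot{\mathcal L}_n(\widetilde{\mathcal A}_n,\widetilde{\mathcal B}_n)\Delta .$$ Group-SCAD estimators. For a tuning parameter $\lambda>0$ and $z\ge0$, the SCAD derivative is $\dot p_\lambda(z)=\lambda\big[I(z\le\lambda)+\frac{(a_0\lambda-z)_+}{(a_0-1)\lambda}I(z>\lambda)\big]$ with $a_0=3.7$. With tuning parameters $\lambda_4,\lambda_4^\ast$, $$\mathcal Q_n^2(\mathcal A,\mathcal B)=\mathcal L_n^\diamond(\mathcal A,\mathcal B)-\sum_{j=1}^{d_n}\dot p_{\lambda_4}(\|\widetilde{\boldsymbol\alpha}_j\|)\|\boldsymbol\alpha_j\|-\sum_{j=1}^{d_n}\dot p_{\lambda_4^\ast}(\widetilde D_j)\|h\boldsymbol\beta_j\|.$$ The maximiser of $\mathcal Q_n^2$ has components $\overline{\boldsymbol\alpha}_j=(\overline\alpha_{j1},\ldots,\overline\alpha_{jn})^{\mathrm T}$, $\overline{\boldsymbol\beta}_j=(\overline\beta_{j1},\ldots,\overline\beta_{jn})^{\mathrm T}$, $j=1,\ldots,d_n$. Put $\overline a_j(U_k)=\overline\alpha_{jk}$ for $1\le j\le s_{n1}$ and $\overline c_j=n^{-1}\sum_{i=1}^n\overline\alpha_{ji}$ for $s_{n1}+1\le j\le s_{n2}$. Unbiased oracle estimators. Let $(\mathcal A^{uo},\mathcal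 B^{uo})$ be the maximiser of the unpenalised function $\mathcal L_n^\diamond(\mathcal A^o,\mathcal B^o)$ over all $\mathcal A^o=[(\mathbf a_1^o)^{\mathrm T},\ldots,(\mathbf a_n^o)^{\mathrm T}]^{\mathrm T}$ and $\mathcal B^o=[(\mathbf b_1^o)^{\mathrm T},\ldots,(\mathbf b_n^o)^{\mathrm T}]^{\mathrm T}$ where each $\mathbf a_k^o\in\mathbb R^{d_n}$ has its last $d_n-s_{n2}$ elements equal to zero and each $\mathbf b_k^o\in\mathbb R^{d_n}$ has its last $d_n-s_{n1}$ elements equal to zero. Write $\alpha_{jk}^{uo}$ for the $j$th element of the $k$th block of $\mathcal A^{uo}$. Put $a_j^{uo}(U_k)=\alpha_{jk}^{uo}$ for $1\le j\le s_{n1}$ and $c_j^{uo}=n^{-1}\sum_{i=1}^n\alpha_{ji}^{uo}$ for $s_{n1}+1\le j\le s_{n2}$. Vectors in the conclusion. $$\overline{\mathbf D}_n=\Big(\max_{1\le k\le n}|\overline a_1(U_k)-a_1^{uo}(U_k)|,\ldots,\max_{1\le k\le n}|\overline a_{s_{n1}}(U_k)-a_{s_{n1}}^{uo}(U_k)|\Big)^{\mathrm T},$$ $\mathbf C_n^{uo}=(c_{s_{n1}+1}^{uo},\ldots,c_{s_{n2}}^{uo})^{\mathrm T}$, $\overline{\mathbf C}_n=(\overline c_{s_{n1}+1},\ldots,\overline c_{s_{n2}})^{\mathrm T}$. Objects in the restricted eigenvalue condition. $\ddot{\mathcal L}_n(u)$ (one argument $u\in[0,1]$) is the $2d_n\times2d_n$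 matrix $$\ddot{\mathcal L}_n(u)=\begin{pmatrix}\ddot{\mathcal L}_n(u,0)&\ddot{\mathcal L}_n(u,1)\\ \ddot{\mathcal L}_n(u,1)&\ddot{\mathcal L}_n(u,2)\end{pmatrix},\qquad \ddot{\mathcal L}_n(u,l)=\frac1n\sum_{i=1}^nq_2\Big[\sum_{j=1}^{d_n}a_j(U_i)x_{ij},y_i\Big]X_iX_i^{\mathrm T}\Big(\frac{U_i-u}{h}\Big)^lK_h(U_i-u).$$ $b=\max\{\lambda_1/\lambda_2,\lambda_2/\lambda_1\}+\delta$ for any $\delta>0$, and $$\boldsymbol\Omega_0(b)=\Big\{\mathbf v=(v_{11},\ldots,v_{1d_n},v_{21},\ldots,v_{2d_n})^{\mathrm T}:\|\mathbf v\|=1,\ \sum_{j=1}^{d_n}(|v_{1j}|+|v_{2j}|)\le2(1+b)\sum_{j=1}^{s_{n2}}(|v_{1j}|+|v_{2j}|)\Big\}.$$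
   Formalization: The coefficients may depend on n; their second derivatives are assumed bounded by one constant for all n and j (without this the claim fails, e.g. a_1(u)=2sin(2πn⁵u) in a Gaussian model), and the moment bounds in (2a), (2b) are taken uniform in n. *)

theory Defs
  imports "HOL-Probability.Probability"
begin

definition propto :: "(nat \<Rightarrow> real) \<Rightarrow> (nat \<Rightarrow> real) \<Rightarrow> bool" where
  "propto f g \<longleftrightarrow> (\<exists>c1 c2. 0 < c1 \<and> c1 \<le> c2 \<and>
     (\<forall>\<^sub>F n in sequentially. c1 * g n \<le> f n \<and> f n \<le> c2 * g n))"

text \<open>Estimators are arbitrary selections of maximisers and need not be measurable, and suprema
  over uncountable sets need not be measurable either. Events are therefore measured from inside by
  measurable subsets; on measurable events the notions below are the usual ones.\<close>

definition with_prob_to_1 :: "'w measure \<Rightarrow> (nat \<Rightarrow> 'w \<Rightarrow> bool) \<Rightarrow> bool" where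
  "with_prob_to_1 M E \<longleftrightarrow> (\<exists>A. (\<forall>n. A n \<in> sets M \<and> A n \<subseteq> {\<omega> \<in> space M. E n \<omega>}) \<and>
     (\<lambda>n. measure M (A n)) \<longlonglongrightarrow> 1)"

definition op_one :: "'w measure \<Rightarrow> (nat \<Rightarrow> 'w \<Rightarrow> real) \<Rightarrow> bool" where
  "op_one M Z \<longleftrightarrow> (\<forall>\<epsilon>>0. with_prob_to_1 M (\<lambda>n \<omega>. \<bar>Z n \<omega>\<bar> < \<epsilon>))"

definition Op_one :: "'w measure \<Rightarrow> (nat \<Rightarrow> 'w \<Rightarrow> ereal) \<Rightarrow> bool" where
  "Op_one M Z \<longleftrightarrow> (\<forall>\<epsilon>>0. \<exists>C::real. \<forall>\<^sub>F n in sequentially.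
     \<exists>A\<in>sets M. A \<subseteq> {\<omega> \<in> space M. \<bar>Z n \<omega>\<bar> \<le> ereal C} \<and> 1 - \<epsilon> \<le> measure M A)"

text \<open>\<open>f2\<close> is a continuous second derivative of \<open>f\<close> on \<open>[0,1]\<close> (one-sided at the end points).\<close>
definition cont_second_deriv :: "(real \<Rightarrow> real) \<Rightarrow> (real \<Rightarrow> real) \<Rightarrow> bool" where
  "cont_second_deriv f f2 \<longleftrightarrow> (\<exists>f1.
     (\<forall>u\<in>{0..1}. (f has_real_derivative f1 u) (at u within {0..1}) \<and>
                 (f1 has_real_derivative f2 u) (at u within {0..1}))) \<and>
     continuous_on {0..1} f2"

text \<open>The measure with respect to which the response has its conditional density: Lebesgue measure
  on the range \<open>R\<close> of the response, or counting measure on \<open>R\<close> (probability mass function).\<close>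
definition response_measure :: "real set \<Rightarrow> real measure \<Rightarrow> bool" where
  "response_measure R \<nu> \<longleftrightarrow>
     \<nu> = density lborel (indicator R) \<or>
     countable R \<and> \<nu> = distr (count_space R) borel (\<lambda>y. y)"

definition regressor_space :: "nat \<Rightarrow> (real \<times> (nat \<Rightarrow> real)) measure" where
  "regressor_space d = borel \<Otimes>\<^sub>M PiM {1..d} (\<lambda>_. borel)"

definition obs_space :: "nat \<Rightarrow> ((real \<times> (nat \<Rightarrow> real)) \<times> real) measure" where
  "obs_space d = regressor_space d \<Otimes>\<^sub>M borel"

text \<open>In the following two definitions \<open>lik s y\<close> stands for the log-likelihood as a function
  of the linear predictor \<open>s\<close>, that is \<open>\<ell>(g\<^sup>-\<^sup>1(s), y)\<close>.\<close>

definition q1 :: "(real \<Rightarrow> real \<Rightarrow> real) \<Rightarrow> real \<Rightarrow> real \<Rightarrow> real" where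
  "q1 lik s y = deriv (\<lambda>t. lik t y) s"

definition q2 :: "(real \<Rightarrow> real \<Rightarrow> real) \<Rightarrow> real \<Rightarrow> real \<Rightarrow> real" where
  "q2 lik s y = deriv (\<lambda>t. q1 lik t y) s"

text \<open>A realised sample \<open>(U\<^sub>i, X\<^sub>i, y\<^sub>i)\<close>, \<open>i = 1, \<dots>, nobs\<close>, with \<open>X\<^sub>i\<close> of dimension \<open>dim\<close>, together with
  the kernel, the bandwidth and the log-likelihood \<open>lik\<close>. All indices start at 1; only the
  entries of \<open>idx\<close>, \<open>cov\<close>, \<open>resp\<close> with indices in range are ever used.\<close>
record problem =
  nobs :: nat
  dim :: nat
  idx :: "nat \<Rightarrow> real"
  cov :: "nat \<Rightarrow> nat \<Rightarrow> real"
  resp :: "nat \<Rightarrow> real"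
  lik :: "real \<Rightarrow> real \<Rightarrow> real"
  kern :: "real \<Rightarrow> real"
  bw :: real

definition Kh :: "problem \<Rightarrow> real \<Rightarrow> real" where
  "Kh P z = kern P (z / bw P) / bw P"

definition local_pred :: "problem \<Rightarrow> nat \<Rightarrow> (nat \<Rightarrow> real) \<Rightarrow> (nat \<Rightarrow> real) \<Rightarrow> nat \<Rightarrow> real" where
  "local_pred P k \<alpha> \<beta> i = (\<Sum>j=1..dim P. (\<alpha> j + \<beta> j * (idx P i - idx P k)) * cov P i j)"

definition L_nk :: "problem \<Rightarrow> nat \<Rightarrow> (nat \<Rightarrow> real) \<Rightarrow> (nat \<Rightarrow> real) \<Rightarrow> real" where
  "L_nk P k \<alpha> \<beta> = (1 / real (nobs P)) *
     (\<Sum>i=1..nobs P. lik P (local_pred P k \<alpha> \<beta> i) (resp P i) * Kh P (idx P i - idx P k))"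

definition prelim_objective ::
    "problem \<Rightarrow> real \<Rightarrow> real \<Rightarrow> nat \<Rightarrow> (nat \<Rightarrow> real) \<Rightarrow> (nat \<Rightarrow> real) \<Rightarrow> real" where
  "prelim_objective P lam1 lam2 k \<alpha> \<beta> = L_nk P k \<alpha> \<beta>
     - lam1 * (\<Sum>j=1..dim P. \<bar>\<alpha> j\<bar>) - lam2 * (\<Sum>j=1..dim P. bw P * \<bar>\<beta> j\<bar>)"

text \<open>Coefficient arrays are functions \<open>A\<close> with \<open>A j k = \<alpha>\<^sub>j\<^sub>k\<close>: \<open>A j\<close> is the vector \<open>\<alpha>\<^sub>j\<close> over the
  observations and \<open>\<lambda>j. A j k\<close> is the vector \<open>a\<^sub>k\<close> over the covariates.\<close>

definition is_prelim_estimator ::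
    "problem \<Rightarrow> real \<Rightarrow> real \<Rightarrow> (nat \<Rightarrow> nat \<Rightarrow> real) \<Rightarrow> (nat \<Rightarrow> nat \<Rightarrow> real) \<Rightarrow> bool" where
  "is_prelim_estimator P lam1 lam2 At Bt \<longleftrightarrow> (\<forall>k\<in>{1..nobs P}. \<forall>\<alpha> \<beta>.
     prelim_objective P lam1 lam2 k \<alpha> \<beta> \<le> prelim_objective P lam1 lam2 k (\<lambda>j. At j k) (\<lambda>j. Bt j k))"

text \<open>Vectors of length \<open>2d\<close> and \<open>2d \<times> 2d\<close> matrices are indexed by \<open>1, \<dots>, 2d\<close>. The block matrix
  with blocks \<open>H 0\<close>, \<open>H 1\<close>, \<open>H 1\<close>, \<open>H 2\<close>:\<close>
definition block_matrix :: "nat \<Rightarrow> (nat \<Rightarrow> nat \<Rightarrow> nat \<Rightarrow> real) \<Rightarrow> nat \<Rightarrow> nat \<Rightarrow> real" where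
  "block_matrix d H r c =
     H (of_bool (d < r) + of_bool (d < c)) (if r \<le> d then r else r - d) (if c \<le> d then c else c - d)"

definition stack :: "nat \<Rightarrow> (nat \<Rightarrow> real) \<Rightarrow> (nat \<Rightarrow> real) \<Rightarrow> nat \<Rightarrow> real" where
  "stack d v w r = (if r \<le> d then v r else w (r - d))"

definition quad_form :: "nat \<Rightarrow> (nat \<Rightarrow> nat \<Rightarrow> real) \<Rightarrow> (nat \<Rightarrow> real) \<Rightarrow> real" where
  "quad_form m H v = (\<Sum>r=1..m. \<Sum>c=1..m. v r * H r c * v c)"

definition dL_nk :: "problem \<Rightarrow> nat \<Rightarrow> (nat \<Rightarrow> real) \<Rightarrow> (nat \<Rightarrow> real) \<Rightarrow> nat \<Rightarrow> real" where
  "dL_nk P k \<alpha> \<beta> r = (1 / real (nobs P)) *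
     (\<Sum>i=1..nobs P. q1 (lik P) (local_pred P k \<alpha> \<beta> i) (resp P i)
        * stack (dim P) (cov P i) (\<lambda>j. (idx P i - idx P k) / bw P * cov P i j) r
        * Kh P (idx P i - idx P k))"

definition ddL_nk_block ::
    "problem \<Rightarrow> nat \<Rightarrow> (nat \<Rightarrow> real) \<Rightarrow> (nat \<Rightarrow> real) \<Rightarrow> nat \<Rightarrow> nat \<Rightarrow> nat \<Rightarrow> real" where
  "ddL_nk_block P k \<alpha> \<beta> l j j' = (1 / real (nobs P)) *
     (\<Sum>i=1..nobs P. q2 (lik P) (local_pred P k \<alpha> \<beta> i) (resp P i)
        * ((idx P i - idx P k) / bw P) ^ l * cov P i j * cov P i j'
        * Kh P (idx P i - idx P k))"

definition ddL_nk ::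
    "problem \<Rightarrow> nat \<Rightarrow> (nat \<Rightarrow> real) \<Rightarrow> (nat \<Rightarrow> real) \<Rightarrow> nat \<Rightarrow> nat \<Rightarrow> real" where
  "ddL_nk P k \<alpha> \<beta> = block_matrix (dim P) (ddL_nk_block P k \<alpha> \<beta>)"

definition L_n :: "problem \<Rightarrow> (nat \<Rightarrow> nat \<Rightarrow> real) \<Rightarrow> (nat \<Rightarrow> nat \<Rightarrow> real) \<Rightarrow> real" where
  "L_n P A B = (\<Sum>k=1..nobs P. L_nk P k (\<lambda>j. A j k) (\<lambda>j. B j k))"

text \<open>The \<open>k\<close>-th block of length \<open>2d\<close> of the difference of the stacked vectors
  \<open>\<V>\<^sub>n(A, hB) - \<V>\<^sub>n(A', hB')\<close>.\<close>
definition Delta_block ::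
    "problem \<Rightarrow> (nat \<Rightarrow> nat \<Rightarrow> real) \<Rightarrow> (nat \<Rightarrow> nat \<Rightarrow> real) \<Rightarrow> (nat \<Rightarrow> nat \<Rightarrow> real) \<Rightarrow>
     (nat \<Rightarrow> nat \<Rightarrow> real) \<Rightarrow> nat \<Rightarrow> nat \<Rightarrow> real" where
  "Delta_block P A B A' B' k =
     stack (dim P) (\<lambda>j. A j k - A' j k) (\<lambda>j. bw P * B j k - bw P * B' j k)"

text \<open>The Hessian of the whole problem is block diagonal in \<open>k\<close>, so the linear and quadratic terms
  are sums over the blocks.\<close>
definition L_diamond ::
    "problem \<Rightarrow> (nat \<Rightarrow> nat \<Rightarrow> real) \<Rightarrow> (nat \<Rightarrow> nat \<Rightarrow> real) \<Rightarrow> (nat \<Rightarrow> nat \<Rightarrow> real) \<Rightarrow>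
     (nat \<Rightarrow> nat \<Rightarrow> real) \<Rightarrow> real" where
  "L_diamond P At Bt A B = L_n P At Bt
     + (\<Sum>k=1..nobs P. \<Sum>r=1..2 * dim P.
          Delta_block P A B At Bt k r * dL_nk P k (\<lambda>j. At j k) (\<lambda>j. Bt j k) r)
     + 1 / 2 * (\<Sum>k=1..nobs P.
          quad_form (2 * dim P) (ddL_nk P k (\<lambda>j. At j k) (\<lambda>j. Bt j k)) (Delta_block P A B At Bt k))"

definition scad_deriv :: "real \<Rightarrow> real \<Rightarrow> real" where
  "scad_deriv lam z = (let a0 = 37 / 10 in
     lam * (of_bool (z \<le> lam) + max (a0 * lam - z) 0 / ((a0 - 1) * lam) * of_bool (lam < z)))"

definition deviation :: "nat \<Rightarrow> (nat \<Rightarrow> real) \<Rightarrow> real" where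
  "deviation n v = sqrt (\<Sum>k=1..n. (v k - 1 / real n * (\<Sum>l=1..n. v l))\<^sup>2)"

definition Q2_objective ::
    "problem \<Rightarrow> real \<Rightarrow> real \<Rightarrow> (nat \<Rightarrow> nat \<Rightarrow> real) \<Rightarrow> (nat \<Rightarrow> nat \<Rightarrow> real) \<Rightarrow>
     (nat \<Rightarrow> nat \<Rightarrow> real) \<Rightarrow> (nat \<Rightarrow> nat \<Rightarrow> real) \<Rightarrow> real" where
  "Q2_objective P lam4 lam4s At Bt A B = L_diamond P At Bt A B
     - (\<Sum>j=1..dim P. scad_deriv lam4 (L2_set (At j) {1..nobs P}) * L2_set (A j) {1..nobs P})
     - (\<Sum>j=1..dim P. scad_deriv lam4s (deviation (nobs P) (At j))
          * L2_set (\<lambda>k. bw P * B j k) {1..nobs P})"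

definition is_scad_estimator ::
    "problem \<Rightarrow> real \<Rightarrow> real \<Rightarrow> (nat \<Rightarrow> nat \<Rightarrow> real) \<Rightarrow> (nat \<Rightarrow> nat \<Rightarrow> real) \<Rightarrow>
     (nat \<Rightarrow> nat \<Rightarrow> real) \<Rightarrow> (nat \<Rightarrow> nat \<Rightarrow> real) \<Rightarrow> bool" where
  "is_scad_estimator P lam4 lam4s At Bt Ab Bb \<longleftrightarrow>
     (\<forall>A B. Q2_objective P lam4 lam4s At Bt A B \<le> Q2_objective P lam4 lam4s At Bt Ab Bb)"

definition oracle_feasible ::
    "problem \<Rightarrow> nat \<Rightarrow> nat \<Rightarrow> (nat \<Rightarrow> nat \<Rightarrow> real) \<Rightarrow> (nat \<Rightarrow> nat \<Rightarrow> real) \<Rightarrow> bool" where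
  "oracle_feasible P s1 s2 A B \<longleftrightarrow> (\<forall>k\<in>{1..nobs P}.
     (\<forall>j\<in>{s2+1..dim P}. A j k = 0) \<and> (\<forall>j\<in>{s1+1..dim P}. B j k = 0))"

definition is_oracle_estimator ::
    "problem \<Rightarrow> nat \<Rightarrow> nat \<Rightarrow> (nat \<Rightarrow> nat \<Rightarrow> real) \<Rightarrow> (nat \<Rightarrow> nat \<Rightarrow> real) \<Rightarrow>
     (nat \<Rightarrow> nat \<Rightarrow> real) \<Rightarrow> (nat \<Rightarrow> nat \<Rightarrow> real) \<Rightarrow> bool" where
  "is_oracle_estimator P s1 s2 At Bt Auo Buo \<longleftrightarrow> oracle_feasible P s1 s2 Auo Buo \<and>
     (\<forall>A B. oracle_feasible P s1 s2 A B \<longrightarrow> L_diamond P At Bt A B \<le> L_diamond P At Bt Auo Buo)"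

text \<open>Here \<open>\<eta> i\<close> is the true linear predictor of observation \<open>i\<close>.\<close>

definition ddL_block :: "problem \<Rightarrow> (nat \<Rightarrow> real) \<Rightarrow> real \<Rightarrow> nat \<Rightarrow> nat \<Rightarrow> nat \<Rightarrow> real" where
  "ddL_block P \<eta> u l j j' = (1 / real (nobs P)) *
     (\<Sum>i=1..nobs P. q2 (lik P) (\<eta> i) (resp P i) * cov P i j * cov P i j'
        * ((idx P i - u) / bw P) ^ l * Kh P (idx P i - u))"

definition ddL :: "problem \<Rightarrow> (nat \<Rightarrow> real) \<Rightarrow> real \<Rightarrow> nat \<Rightarrow> nat \<Rightarrow> real" where
  "ddL P \<eta> u = block_matrix (dim P) (ddL_block P \<eta> u)"

definition Omega0 :: "nat \<Rightarrow> nat \<Rightarrow> real \<Rightarrow> (nat \<Rightarrow> real) set" where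
  "Omega0 d s2 b = {v. L2_set v {1..2 * d} = 1 \<and>
     (\<Sum>j=1..d. \<bar>v j\<bar> + \<bar>v (d + j)\<bar>) \<le> 2 * (1 + b) * (\<Sum>j=1..s2. \<bar>v j\<bar> + \<bar>v (d + j)\<bar>)}"

definition oracle_directions :: "nat \<Rightarrow> nat \<Rightarrow> nat \<Rightarrow> (nat \<Rightarrow> real) set" where
  "oracle_directions d s1 s2 = {w. L2_set w {1..2 * d} = 1 \<and>
     (\<forall>j\<in>{s2+1..d}. w j = 0) \<and> (\<forall>j\<in>{s1+1..d}. w (d + j) = 0)}"

end

theory Submission
  imports Defs
begin

text \<open>With probability tending to one the group-SCAD estimator coincides with the unbiased oracle
  estimator, so that both differences in the conclusion vanish exactly. A truncated Bernstein inequality, conditional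
  on the \<open>k\<close>th observation, bounds the kernel averages of scores, Hessians and third-order remainders at all sample
  points simultaneously. On that event the restricted eigenvalue condition places every preliminary fit within
  \<open>C \<surd>s\<^sub>n\<^sub>2 \<lambda>\<^sub>1\<close> of the truth. Hence the SCAD weights vanish on the true model and equal \<open>\<lambda>\<^sub>4\<close> off
  it, while the gradient of the quadratic approximation at the oracle estimator stays below \<open>\<lambda>\<^sub>4\<close> off the model.
  By concavity the oracle estimator is then the unique maximiser of the penalised criterion.\<close>

section \<open>Exponential inequality for leave-one-out sums\<close>

text \<open>Only the local fits at the sampled values \<open>U n k \<omega>\<close> enter the
  estimators, so finitely many kernel averages have to be controlled, and a union bound over
  observations and index triples replaces a covering of the unit interval. The price is that the
  centre of the kernel is itself an observation, hence the leave-one-out form. Moments of order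
  \<open>m0\<close> give no exponential tail; the truncation level is balanced so that the union
  bound over \<open>n * d^3\<close> terms and the range condition of Bernstein's inequality are both
  served by the rate condition on \<open>n * h\<close>. The Hessian is controlled only at the truth,
  so every curvature used later, at the preliminary fit or at an intermediate point, is compared
  with it through a Lipschitz remainder that costs l1 norms. Along the cone an l1 norm is at most a
  constant times \<open>sqrt s2\<close> times an l2 norm, and this is where
  \<open>s2^2 * lam1\<close> tending to zero is used. The gradient off the model then has size
  \<open>lam1 * sqrt s2\<close>; over \<open>n\<close> observations this grows to
  \<open>sqrt n * lam1 * sqrt s2\<close>, which is exactly the last term in the lower bound on
  \<open>lam4\<close>.\<close>

lemma exp_le_quadratic:
  fixes x :: real
  assumes "\<bar>x\<bar> \<le> 1"
  shows "exp x \<le> 1 + x + x\<^sup>2"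
proof (cases "0 \<le> x")
  case True
  then show ?thesis using assms exp_bound by auto
next
  case False
  define y where "y = - x"
  have y: "0 \<le> y" "y \<le> 1" using False assms by (auto simp: y_def)
  have pos: "0 < 1 - y + y\<^sup>2"
    using y by (smt (verit) zero_less_power2 power2_eq_square mult_nonneg_nonneg)
  \<comment> \<open>For negative arguments the claim is
    \<open>1 \<le> (1 - y + y^2) * exp y\<close>; with \<open>exp y\<close> replaced by its
    quadratic Taylor polynomial the linear terms cancel and all remaining coefficients are
    positive.\<close>
  have "1 \<le> (1 - y + y\<^sup>2) * (1 + y + y\<^sup>2 / 2)"
  proof -
    have "(1 - y + y\<^sup>2) * (1 + y + y\<^sup>2 / 2) = 1 + y\<^sup>2 / 2 + y ^ 3 / 2 + y ^ 4 / 2"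
      by (simp add: field_simps power2_eq_square power3_eq_cube power4_eq_xxxx)
    then show ?thesis using y by simp
  qed
  also have "\<dots> \<le> (1 - y + y\<^sup>2) * exp y"
    using pos exp_lower_Taylor_quadratic[OF y(1)] by (intro mult_left_mono) auto
  finally have "exp (- y) \<le> 1 - y + y\<^sup>2"
    by (simp add: exp_minus field_simps)
  then show ?thesis by (simp add: y_def)
qed

context prob_space
begin

text \<open>The quadratic bound on the exponential is integrated termwise and
  \<open>1 + x \<le> exp x\<close> closes. The mean is carried along rather than assumed zero
  because truncation destroys centring; the nonnegative integral is the form in which independent
  factors multiply without integrability side conditions.\<close>

lemma Bernstein_mgf:
  assumes [measurable]: "X \<in> borel_measurable M" and bd: "\<And>\<omega>. \<bar>l * X \<omega>\<bar> \<le> 1" and l: "0 \<le> l"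
    and mean: "expectation X \<le> m" and var: "expectation (\<lambda>\<omega>. (X \<omega>)\<^sup>2) \<le> v"
  shows "(\<integral>\<^sup>+\<omega>. ennreal (exp (l * X \<omega>)) \<partial>M) \<le> ennreal (exp (l * m + l\<^sup>2 * v))"
proof -
  have i1: "integrable M (\<lambda>\<omega>. l * X \<omega>)"
    by (rule integrable_const_bound[where B=1]) (use bd in auto)
  have i2: "integrable M (\<lambda>\<omega>. (l * X \<omega>)\<^sup>2)"
    by (rule integrable_const_bound[where B=1]) (use bd abs_square_le_1 in \<open>auto simp del: abs_mult\<close>)
  have ie: "integrable M (\<lambda>\<omega>. exp (l * X \<omega>))"
    by (rule integrable_const_bound[where B="exp 1"]) (use bd abs_le_D1 in \<open>auto simp del: abs_mult\<close>)
  have "expectation (\<lambda>\<omega>. exp (l * X \<omega>)) \<le> expectation (\<lambda>\<omega>. 1 + l * X \<omega> + (l * X \<omega>)\<^sup>2)"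
    using i1 i2 ie bd by (intro integral_mono exp_le_quadratic) auto
  also have "\<dots> = 1 + l * expectation X + l\<^sup>2 * expectation (\<lambda>\<omega>. (X \<omega>)\<^sup>2)"
    using i1 i2 by (simp add: prob_space power_mult_distrib)
  also have "\<dots> \<le> 1 + (l * m + l\<^sup>2 * v)"
    using mean var l by (smt (verit) mult_left_mono zero_le_power2)
  also have "\<dots> \<le> exp (l * m + l\<^sup>2 * v)"
    by simp
  finally show ?thesis
    using ie by (subst nn_integral_eq_integral) auto
qed

text \<open>Chernoff's inequality with the moment generating function factored by independence. The
  parameter \<open>l\<close> stays free: later it is the target rate
  \<open>sqrt (ln (1 / h) / (n * h))\<close> itself.\<close>

lemma Bernstein_tail:
  fixes X :: "'i \<Rightarrow> 'a \<Rightarrow> real" and l :: real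
  assumes I: "finite I" and ind: "indep_vars (\<lambda>_. borel) X I"
    and bd: "\<And>i \<omega>. i \<in> I \<Longrightarrow> \<bar>l * X i \<omega>\<bar> \<le> 1" and l: "0 < l"
    and mean: "\<And>i. i \<in> I \<Longrightarrow> expectation (X i) \<le> m"
    and var: "\<And>i. i \<in> I \<Longrightarrow> expectation (\<lambda>\<omega>. (X i \<omega>)\<^sup>2) \<le> v"
  shows "prob {\<omega> \<in> space M. x \<le> (\<Sum>i\<in>I. X i \<omega>)} \<le> exp (- l * x + card I * (l * m + l\<^sup>2 * v))"
proof -
  have [measurable]: "\<And>i. i \<in> I \<Longrightarrow> X i \<in> borel_measurable M"
    using ind by (auto simp: indep_vars_def)
  have "emeasure M {\<omega> \<in> space M. x \<le> (\<Sum>i\<in>I. X i \<omega>)}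
      \<le> ennreal (exp (- l * x)) * (\<integral>\<^sup>+\<omega>\<in>space M. ennreal (exp (l * (\<Sum>i\<in>I. X i \<omega>))) \<partial>M)"
    using Chernoff_ineq_nn_integral_ge[where s=l and f="\<lambda>\<omega>. \<Sum>i\<in>I. X i \<omega>" and A="space M" and a=x and M=M] l by simp
  also have "(\<integral>\<^sup>+\<omega>\<in>space M. ennreal (exp (l * (\<Sum>i\<in>I. X i \<omega>))) \<partial>M)
      = (\<integral>\<^sup>+\<omega>. (\<Prod>i\<in>I. ennreal (exp (l * X i \<omega>))) \<partial>M)"
    by (intro nn_integral_cong) (simp add: sum_distrib_left exp_sum I prod_ennreal)
  also have "\<dots> = (\<Prod>i\<in>I. \<integral>\<^sup>+\<omega>. ennreal (exp (l * X i \<omega>)) \<partial>M)"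
    by (intro indep_vars_nn_integral I indep_vars_compose2[OF ind]) auto
  also have "\<dots> \<le> (\<Prod>i\<in>I. ennreal (exp (l * m + l\<^sup>2 * v)))"
    using bd l mean var by (intro prod_mono_ennreal Bernstein_mgf) auto
  also have "\<dots> = ennreal (exp (card I * (l * m + l\<^sup>2 * v)))"
    by (simp add: ennreal_power exp_of_nat_mult)
  also have "ennreal (exp (- l * x)) * ennreal (exp (card I * (l * m + l\<^sup>2 * v)))
      = ennreal (exp (- l * x + card I * (l * m + l\<^sup>2 * v)))"
    by (simp add: ennreal_mult[symmetric] mult_exp_exp algebra_simps)
  finally show ?thesis
    by (simp add: emeasure_eq_measure mult_left_mono)
qed

text \<open>Fubini for the product law of the pair: a bound valid for every section in the first
  coordinate survives integration. It replaces an explicit conditional probability given the first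
  variable.\<close>

lemma indep_var_prob_le:
  assumes ind: "indep_var A X B Y" and S: "S \<in> sets (A \<Otimes>\<^sub>M B)"
    and bd: "\<And>x. x \<in> space A \<Longrightarrow> prob {\<omega> \<in> space M. (x, Y \<omega>) \<in> S} \<le> p"
  shows "prob {\<omega> \<in> space M. (X \<omega>, Y \<omega>) \<in> S} \<le> p"
proof -
  have [measurable]: "X \<in> measurable M A" "Y \<in> measurable M B"
    using indep_var_rv1[OF ind] indep_var_rv2[OF ind] by auto
  note [measurable] = S
  interpret A: prob_space "distr M A X" by (rule prob_space_distr) simp
  interpret B: prob_space "distr M B Y" by (rule prob_space_distr) simp
  \<comment> \<open>The return from extended to real numbers needs \<open>0 \<le> p\<close>, which
    is read off from any one section; a point of \<open>A\<close> exists because the sample space is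
    nonempty.\<close>
  have "space A \<noteq> {}" using not_empty measurable_space[of X M A] by auto
  then obtain x0 where "x0 \<in> space A" by auto
  then have p0: "0 \<le> p" using bd[of x0] measure_nonneg order_trans by blast
  have eq: "distr M A X \<Otimes>\<^sub>M distr M B Y = distr M (A \<Otimes>\<^sub>M B) (\<lambda>\<omega>. (X \<omega>, Y \<omega>))"
    using ind indep_var_distribution_eq by blast
  have "emeasure M {\<omega> \<in> space M. (X \<omega>, Y \<omega>) \<in> S} = emeasure (distr M (A \<Otimes>\<^sub>M B) (\<lambda>\<omega>. (X \<omega>, Y \<omega>))) S"
    by (subst emeasure_distr) (auto intro!: arg_cong[where f="emeasure M"])
  also have "\<dots> = (\<integral>\<^sup>+x. emeasure (distr M B Y) (Pair x -` S) \<partial>distr M A X)"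
    unfolding eq[symmetric] by (rule B.emeasure_pair_measure_alt) simp
  also have "\<dots> \<le> (\<integral>\<^sup>+x. ennreal p \<partial>distr M A X)"
  proof (intro nn_integral_mono)
    fix x assume x: "x \<in> space (distr M A X)"
    have "emeasure (distr M B Y) (Pair x -` S) = emeasure M {\<omega> \<in> space M. (x, Y \<omega>) \<in> S}"
      by (subst emeasure_distr) (auto intro!: arg_cong[where f="emeasure M"] sets_Pair1[OF S])
    also have "\<dots> \<le> ennreal p"
      using bd[of x] x by (simp add: emeasure_eq_measure ennreal_leI)
    finally show "emeasure (distr M B Y) (Pair x -` S) \<le> ennreal p" .
  qed
  also have "\<dots> = ennreal p"
    using A.emeasure_space_1 by simp
  finally show ?thesis
    using p0 by (simp add: emeasure_eq_measure)
qed

text \<open>Conditioning on observation \<open>k\<close> turns the sum over the other observations into a sum of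
  independent terms.\<close>

lemma leave_one_out_tail:
  fixes f :: "'i \<Rightarrow> real \<Rightarrow> 'b \<Rightarrow> real" and l m v x :: real
  assumes I: "finite I" "k \<in> I" and ind: "indep_vars N Z I"
    and g[measurable]: "g \<in> borel_measurable (N k)"
    and f: "\<And>i. i \<in> I \<Longrightarrow> (\<lambda>(u, z). f i u z) \<in> borel_measurable (borel \<Otimes>\<^sub>M N i)"
    and bd: "\<And>i u z. i \<in> I \<Longrightarrow> \<bar>l * f i u z\<bar> \<le> 1" and l: "0 < l"
    and mean: "\<And>i u. i \<in> I \<Longrightarrow> expectation (\<lambda>\<omega>. f i u (Z i \<omega>)) \<le> m"
    and var: "\<And>i u. i \<in> I \<Longrightarrow> expectation (\<lambda>\<omega>. (f i u (Z i \<omega>))\<^sup>2) \<le> v"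
    and nn: "0 \<le> l * m + l\<^sup>2 * v"
  shows "prob {\<omega> \<in> space M. x \<le> (\<Sum>i\<in>I - {k}. f i (g (Z k \<omega>)) (Z i \<omega>))}
      \<le> exp (- l * x + card I * (l * m + l\<^sup>2 * v))"
proof -
  let ?J = "I - {k}"
  let ?A = "PiM {k} N" and ?B = "PiM ?J N"
  have meas: "(\<lambda>z. f i (g (fst z k)) (snd z i)) \<in> borel_measurable (?A \<Otimes>\<^sub>M ?B)" if "i \<in> ?J" for i
  proof -
    have "(\<lambda>z. (g (fst z k), snd z i)) \<in> measurable (?A \<Otimes>\<^sub>M ?B) (borel \<Otimes>\<^sub>M N i)"
      using that by measurable
    from measurable_compose[OF this f] that show ?thesis by simp
  qed
  define S where "S = {z \<in> space (?A \<Otimes>\<^sub>M ?B). x \<le> (\<Sum>i\<in>?J. f i (g (fst z k)) (snd z i))}"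
  have S: "S \<in> sets (?A \<Otimes>\<^sub>M ?B)"
    unfolding S_def using meas by measurable
  have iv: "indep_var ?A (\<lambda>\<omega>. restrict (\<lambda>i. Z i \<omega>) {k}) ?B (\<lambda>\<omega>. restrict (\<lambda>i. Z i \<omega>) ?J)"
    using I by (intro indep_var_restrict[OF ind]) auto
  have rv: "\<And>\<omega>. \<omega> \<in> space M \<Longrightarrow> restrict (\<lambda>i. Z i \<omega>) {k} \<in> space ?A"
       "\<And>\<omega>. \<omega> \<in> space M \<Longrightarrow> restrict (\<lambda>i. Z i \<omega>) ?J \<in> space ?B"
    using indep_var_rv1[OF iv] indep_var_rv2[OF iv] by (auto dest: measurable_space)
  have "prob {\<omega> \<in> space M. (restrict (\<lambda>i. Z i \<omega>) {k}, restrict (\<lambda>i. Z i \<omega>) ?J) \<in> S}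
      \<le> exp (- l * x + card I * (l * m + l\<^sup>2 * v))"
  proof (rule indep_var_prob_le[OF iv S])
    fix y assume y: "y \<in> space ?A"
    have fm: "(\<lambda>z. f i (g (y k)) z) \<in> borel_measurable (N i)" if "i \<in> I" for i
      using measurable_compose[OF measurable_Pair1' f[OF that], of "g (y k)"] by simp
    have "{\<omega> \<in> space M. (y, restrict (\<lambda>i. Z i \<omega>) ?J) \<in> S}
        = {\<omega> \<in> space M. x \<le> (\<Sum>i\<in>?J. f i (g (y k)) (Z i \<omega>))}"
      using y rv by (auto simp: S_def space_pair_measure)
    also have "prob \<dots> \<le> exp (- l * x + card ?J * (l * m + l\<^sup>2 * v))"
    proof (rule Bernstein_tail)
      show "indep_vars (\<lambda>_. borel) (\<lambda>i \<omega>. f i (g (y k)) (Z i \<omega>)) ?J"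
        by (rule indep_vars_compose2[OF indep_vars_subset[OF ind]]) (use fm in auto)
    qed (use I bd l mean var in auto)
    \<comment> \<open>One summand fewer than \<open>card I\<close> is present; the hypothesis
      \<open>nn\<close> makes the exponent monotone in the count.\<close>
    also have "\<dots> \<le> exp (- l * x + card I * (l * m + l\<^sup>2 * v))"
      using nn I by (simp add: card_Diff_singleton mult_right_mono)
    finally show "prob {\<omega> \<in> space M. (y, restrict (\<lambda>i. Z i \<omega>) ?J) \<in> S}
      \<le> exp (- l * x + card I * (l * m + l\<^sup>2 * v))" .
  qed
  also have "{\<omega> \<in> space M. (restrict (\<lambda>i. Z i \<omega>) {k}, restrict (\<lambda>i. Z i \<omega>) ?J) \<in> S}
      = {\<omega> \<in> space M. x \<le> (\<Sum>i\<in>?J. f i (g (Z k \<omega>)) (Z i \<omega>))}"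
    using rv by (auto simp: S_def space_pair_measure)
  finally show ?thesis .
qed

end

context prob_space
begin

text \<open>The second moment bound follows from \<open>z\<^sup>2 \<le> 1 + |z|\<^sup>m\<close>, and truncation changes the mean by at
  most \<open>E[|W|\<^sup>m] T\<^sup>1\<^sup>-\<^sup>m\<close>.\<close>

lemma kernel_sum_tail:
  fixes V W :: "'i \<Rightarrow> 'a \<Rightarrow> real" and \<kappa> :: "real \<Rightarrow> real" and T :: real
  defines "W' \<equiv> (\<lambda>i \<omega>. if \<bar>W i \<omega>\<bar> \<le> T then W i \<omega> else 0)"
  assumes I: "finite I" "k \<in> I"
    and ind: "indep_vars (\<lambda>_. borel \<Otimes>\<^sub>M borel) (\<lambda>i \<omega>. (V i \<omega>, W i \<omega>)) I"
    and \<kappa>[measurable]: "\<kappa> \<in> borel_measurable borel"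
    and \<kappa>_bd: "\<And>z. \<bar>\<kappa> z\<bar> \<le> B * indicator {- c..c} z" and pos: "0 \<le> B" "0 \<le> c" "0 < h" "0 < T"
    and ball: "\<And>i a b. i \<in> I \<Longrightarrow> a \<le> b \<Longrightarrow> prob {\<omega> \<in> space M. V i \<omega> \<in> {a..b}} \<le> c2 * (b - a)"
    and m0: "2 < m0" and C: "0 \<le> C" and \<mu>: "0 \<le> \<mu>"
    and W_int: "\<And>i. i \<in> I \<Longrightarrow> integrable M (\<lambda>\<omega>. \<bar>W i \<omega>\<bar> powr m0)"
    and W_mom: "\<And>i S. i \<in> I \<Longrightarrow> S \<in> sets borel \<Longrightarrow>
      expectation (\<lambda>\<omega>. indicator S (V i \<omega>) * \<bar>W i \<omega>\<bar> powr m0) \<le> C * prob {\<omega> \<in> space M. V i \<omega> \<in> S}"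
    and W_mean: "\<And>i u. i \<in> I \<Longrightarrow> \<bar>expectation (\<lambda>\<omega>. W i \<omega> * \<kappa> ((V i \<omega> - u) / h))\<bar>
      \<le> \<mu> * B * prob {\<omega> \<in> space M. V i \<omega> \<in> {u - c * h..u + c * h}}"
    and l: "0 < l" "l * T * B \<le> 1"
  shows "prob {\<omega> \<in> space M. x \<le> \<bar>\<Sum>i\<in>I - {k}. W' i \<omega> * \<kappa> ((V i \<omega> - V k \<omega>) / h)\<bar>}
    \<le> 2 * exp (- l * x + card I * (l * ((\<mu> + C * T powr (1 - m0)) * B * (c2 * (2 * c * h)))
        + l\<^sup>2 * (B\<^sup>2 * (C + 1) * (c2 * (2 * c * h)))))"
proof -
  define m where "m = (\<mu> + C * T powr (1 - m0)) * B * (c2 * (2 * c * h))"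
  define v where "v = B\<^sup>2 * (C + 1) * (c2 * (2 * c * h))"
  define tr where "tr = (\<lambda>w::real. if \<bar>w\<bar> \<le> T then w else 0)"
  have [measurable]: "tr \<in> borel_measurable borel" unfolding tr_def by measurable
  have W'_tr: "W' i \<omega> = tr (W i \<omega>)" for i \<omega> by (simp add: W'_def tr_def)
  have [measurable]: "V i \<in> borel_measurable M" "W i \<in> borel_measurable M" if "i \<in> I" for i
  proof -
    have "(\<lambda>\<omega>. (V i \<omega>, W i \<omega>)) \<in> measurable M (borel \<Otimes>\<^sub>M borel)"
      using ind that by (auto simp: indep_vars_def)
    from measurable_compose[OF this measurable_fst] measurable_compose[OF this measurable_snd]
    show "V i \<in> borel_measurable M" "W i \<in> borel_measurable M" by auto
  qed
  \<comment> \<open>The window outside which the kernel centred at \<open>u\<close> vanishes. Its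
    probability is at most \<open>c2 * (2 * c * h)\<close>, the source of the factor
    \<open>h\<close> in both the mean and the variance bound.\<close>
  define S where "S = (\<lambda>u. {u - c * h..u + c * h})"
  have [measurable]: "S u \<in> sets borel" for u by (simp add: S_def)
  have c2: "0 \<le> c2"
  proof -
    have "0 \<le> c2 * (1 - 0)" by (rule order_trans[OF measure_nonneg ball[OF I(2), of 0 1]]) simp
    then show ?thesis by simp
  qed
  have pS: "prob {\<omega> \<in> space M. V i \<omega> \<in> S u} \<le> c2 * (2 * c * h)" if "i \<in> I" for i u
    using ball[OF that, of "u - c * h" "u + c * h"] pos by (simp add: S_def algebra_simps)
  have \<kappa>S: "\<bar>\<kappa> ((z - u) / h)\<bar> \<le> B * indicator (S u) z" for z u
    using \<kappa>_bd[of "(z - u) / h"] pos by (auto simp: S_def indicator_def field_simps split: if_splits)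
  have \<kappa>B: "\<bar>\<kappa> z\<bar> \<le> B" for z
    using \<kappa>_bd[of z] pos by (cases "z \<in> {- c..c}") auto
  have nn: "0 \<le> m" "0 \<le> v"
    using pos C \<mu> c2 by (auto simp: m_def v_def)
  \<comment> \<open>The sign \<open>s\<close> lets one argument serve both tails:
    \<open>s = 1\<close> and \<open>s = -1\<close> give the two one-sided events that make up the
    event on the absolute value.\<close>
  define f where "f = (\<lambda>(s::real) u (z :: real \<times> real). s * (tr (snd z) * \<kappa> ((fst z - u) / h)))"
  have tail: "prob {\<omega> \<in> space M. x \<le> (\<Sum>i\<in>I - {k}. f s (fst (V k \<omega>, W k \<omega>)) (V i \<omega>, W i \<omega>))}
      \<le> exp (- l * x + card I * (l * m + l\<^sup>2 * v))" if s: "\<bar>s\<bar> = 1" for s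
  proof (rule leave_one_out_tail[OF I ind, where f = "\<lambda>_. f s" and g = fst])
    show "(\<lambda>(u, z). f s u z) \<in> borel_measurable (borel \<Otimes>\<^sub>M (borel \<Otimes>\<^sub>M borel))"
      unfolding f_def by measurable
    show "\<bar>l * f s u z\<bar> \<le> 1" for u z
    proof -
      have "\<bar>l * f s u z\<bar> \<le> l * (T * B)"
        using s l pos \<kappa>B by (auto simp: f_def abs_mult tr_def intro!: mult_mono mult_left_mono)
      then show ?thesis using l by (simp add: mult.assoc)
    qed
    show "expectation (\<lambda>\<omega>. f s u (V i \<omega>, W i \<omega>)) \<le> m" if i: "i \<in> I" for i u
    proof -
      note [measurable] = i
      let ?k = "\<lambda>\<omega>. \<kappa> ((V i \<omega> - u) / h)"
      let ?R = "\<lambda>\<omega>. T powr (1 - m0) * B * (indicator (S u) (V i \<omega>) * \<bar>W i \<omega>\<bar> powr m0)"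
      have absW: "\<bar>w\<bar> \<le> T + T powr (1 - m0) * \<bar>w\<bar> powr m0"
        and absW2: "\<not> \<bar>w\<bar> \<le> T \<Longrightarrow> \<bar>w\<bar> \<le> T powr (1 - m0) * \<bar>w\<bar> powr m0" for w :: real
      proof -
        have *: "\<bar>w\<bar> \<le> T powr (1 - m0) * \<bar>w\<bar> powr m0" if "\<not> \<bar>w\<bar> \<le> T"
        proof -
          have "\<bar>w\<bar> = \<bar>w\<bar> powr (1 - m0) * \<bar>w\<bar> powr m0"
            using that pos by (simp add: powr_add[symmetric])
          also have "\<dots> \<le> T powr (1 - m0) * \<bar>w\<bar> powr m0"
            using that pos m0 by (intro mult_right_mono powr_mono2') auto
          finally show ?thesis .
        qed
        then show "\<not> \<bar>w\<bar> \<le> T \<Longrightarrow> \<bar>w\<bar> \<le> T powr (1 - m0) * \<bar>w\<bar> powr m0" .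
        show "\<bar>w\<bar> \<le> T + T powr (1 - m0) * \<bar>w\<bar> powr m0"
        proof (cases "\<bar>w\<bar> \<le> T")
          case True then show ?thesis by (simp add: add_increasing2)
        next
          case False with * pos show ?thesis by linarith
        qed
      qed
      have W1: "integrable M (W i)"
        by (rule Bochner_Integration.integrable_bound[where f="\<lambda>\<omega>. T + T powr (1 - m0) * \<bar>W i \<omega>\<bar> powr m0"])
          (use W_int[OF i] absW pos in auto)
      have Wk: "integrable M (\<lambda>\<omega>. W i \<omega> * ?k \<omega>)"
        by (rule Bochner_Integration.integrable_bound[where f="\<lambda>\<omega>. W i \<omega> * B"])
          (use W1 \<kappa>B pos in \<open>auto simp: abs_mult intro!: mult_left_mono\<close>)
      have tk: "integrable M (\<lambda>\<omega>. tr (W i \<omega>) * ?k \<omega>)"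
        by (rule Bochner_Integration.integrable_bound[where f="\<lambda>\<omega>. W i \<omega> * B"])
          (use W1 \<kappa>B pos in \<open>auto simp: tr_def abs_mult intro!: mult_left_mono\<close>)
      have iR: "integrable M ?R"
        by (intro integrable_mult_right Bochner_Integration.integrable_bound[OF W_int[OF i]])
          (auto simp: indicator_def)
      have dif: "\<bar>tr (W i \<omega>) * ?k \<omega> - W i \<omega> * ?k \<omega>\<bar> \<le> ?R \<omega>" for \<omega>
      proof (cases "\<bar>W i \<omega>\<bar> \<le> T")
        case True then show ?thesis using pos by (simp add: tr_def)
      next
        case False
        then have "\<bar>tr (W i \<omega>) * ?k \<omega> - W i \<omega> * ?k \<omega>\<bar> = \<bar>W i \<omega>\<bar> * \<bar>?k \<omega>\<bar>"
          by (simp add: tr_def abs_mult)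
        also have "\<dots> \<le> (T powr (1 - m0) * \<bar>W i \<omega>\<bar> powr m0) * (B * indicator (S u) (V i \<omega>))"
          using False by (intro mult_mono absW2 \<kappa>S) auto
        finally show ?thesis by (simp add: algebra_simps)
      qed
      have wm: "\<bar>expectation (\<lambda>\<omega>. W i \<omega> * ?k \<omega>)\<bar> \<le> \<mu> * B * prob {\<omega> \<in> space M. V i \<omega> \<in> S u}"
        using W_mean[OF i, of u] by (simp only: S_def)
      have "\<bar>expectation (\<lambda>\<omega>. tr (W i \<omega>) * ?k \<omega>) - expectation (\<lambda>\<omega>. W i \<omega> * ?k \<omega>)\<bar>
          = \<bar>expectation (\<lambda>\<omega>. tr (W i \<omega>) * ?k \<omega> - W i \<omega> * ?k \<omega>)\<bar>"
        using tk Wk by simp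
      also have "\<dots> \<le> expectation (\<lambda>\<omega>. \<bar>tr (W i \<omega>) * ?k \<omega> - W i \<omega> * ?k \<omega>\<bar>)"
        by (rule integral_abs_bound)
      also have "\<dots> \<le> expectation ?R"
        using tk Wk iR dif by (intro integral_mono) auto
      also have "\<dots> = T powr (1 - m0) * B * expectation (\<lambda>\<omega>. indicator (S u) (V i \<omega>) * \<bar>W i \<omega>\<bar> powr m0)"
        by simp
      also have "\<dots> \<le> T powr (1 - m0) * B * (C * prob {\<omega> \<in> space M. V i \<omega> \<in> S u})"
        using pos by (intro mult_left_mono W_mom i) auto
      finally have "\<bar>expectation (\<lambda>\<omega>. tr (W i \<omega>) * ?k \<omega>)\<bar>
          \<le> (\<mu> + C * T powr (1 - m0)) * B * prob {\<omega> \<in> space M. V i \<omega> \<in> S u}"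
        using wm by (simp add: algebra_simps)
      also have "\<dots> \<le> m"
        unfolding m_def using pS[OF i] pos C \<mu> by (intro mult_left_mono) auto
      finally have *: "\<bar>expectation (\<lambda>\<omega>. tr (W i \<omega>) * ?k \<omega>)\<bar> \<le> m" .
      have "expectation (\<lambda>\<omega>. f s u (V i \<omega>, W i \<omega>)) = s * expectation (\<lambda>\<omega>. tr (W i \<omega>) * ?k \<omega>)"
        by (simp add: f_def)
      also have "\<dots> \<le> \<bar>s * expectation (\<lambda>\<omega>. tr (W i \<omega>) * ?k \<omega>)\<bar>" by simp
      also have "\<dots> \<le> m" using * s by (simp add: abs_mult)
      finally show ?thesis .
    qed
    show "expectation (\<lambda>\<omega>. (f s u (V i \<omega>, W i \<omega>))\<^sup>2) \<le> v" if i: "i \<in> I" for i u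
    proof -
      note [measurable] = i
      let ?g = "\<lambda>\<omega>. indicator (S u) (V i \<omega>) * \<bar>W i \<omega>\<bar> powr m0"
      have sq: "w\<^sup>2 \<le> 1 + \<bar>w\<bar> powr m0" for w :: real
      proof (cases "\<bar>w\<bar> \<le> 1")
        case True then show ?thesis using abs_square_le_1[of w] by (simp add: add_increasing2)
      next
        case False
        then have "w\<^sup>2 = \<bar>w\<bar> powr 2" by simp
        also have "\<dots> \<le> \<bar>w\<bar> powr m0" using False m0 by (intro powr_mono) auto
        finally show ?thesis by simp
      qed
      have ig: "integrable M ?g"
        by (rule Bochner_Integration.integrable_bound[OF W_int[OF i]]) (auto simp: indicator_def)
      have iS: "integrable M (\<lambda>\<omega>. indicator (S u) (V i \<omega>) :: real)"
        by (rule integrable_const_bound[where B=1]) (auto simp: indicator_def)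
      have pt: "(f s u (V i \<omega>, W i \<omega>))\<^sup>2 \<le> B\<^sup>2 * (indicator (S u) (V i \<omega>) + ?g \<omega>)" for \<omega>
      proof -
        have "(f s u (V i \<omega>, W i \<omega>))\<^sup>2 = (tr (W i \<omega>))\<^sup>2 * \<bar>\<kappa> ((V i \<omega> - u) / h)\<bar>\<^sup>2"
          using s by (auto simp: f_def power_mult_distrib abs_if split: if_splits)
        also have "\<dots> \<le> (W i \<omega>)\<^sup>2 * (B * indicator (S u) (V i \<omega>))\<^sup>2"
        proof (rule mult_mono)
          show "\<bar>\<kappa> ((V i \<omega> - u) / h)\<bar>\<^sup>2 \<le> (B * indicator (S u) (V i \<omega>))\<^sup>2"
            by (intro power_mono \<kappa>S) auto
        qed (auto simp: tr_def)
        also have "\<dots> = B\<^sup>2 * (indicator (S u) (V i \<omega>) * (W i \<omega>)\<^sup>2)"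
          by (simp add: power_mult_distrib indicator_def)
        also have "\<dots> \<le> B\<^sup>2 * (indicator (S u) (V i \<omega>) * (1 + \<bar>W i \<omega>\<bar> powr m0))"
          by (intro mult_left_mono sq) auto
        finally show ?thesis by (simp add: algebra_simps)
      qed
      have "expectation (\<lambda>\<omega>. (f s u (V i \<omega>, W i \<omega>))\<^sup>2) \<le> expectation (\<lambda>\<omega>. B\<^sup>2 * (indicator (S u) (V i \<omega>) + ?g \<omega>))"
        using pt ig iS by (intro integral_mono' ) auto
      also have "\<dots> = B\<^sup>2 * (prob {\<omega> \<in> space M. V i \<omega> \<in> S u} + expectation ?g)"
      proof -
        have "expectation (\<lambda>\<omega>. indicator (S u) (V i \<omega>)) = expectation (indicator {\<omega> \<in> space M. V i \<omega> \<in> S u})"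
          by (intro Bochner_Integration.integral_cong) (auto simp: indicator_def)
        also have "\<dots> = prob {\<omega> \<in> space M. V i \<omega> \<in> S u}" by simp
        finally show ?thesis using ig iS by simp
      qed
      also have "\<dots> \<le> B\<^sup>2 * (prob {\<omega> \<in> space M. V i \<omega> \<in> S u} + C * prob {\<omega> \<in> space M. V i \<omega> \<in> S u})"
        by (intro mult_left_mono add_left_mono W_mom i) auto
      also have "\<dots> = B\<^sup>2 * (C + 1) * prob {\<omega> \<in> space M. V i \<omega> \<in> S u}"
        by (simp add: algebra_simps)
      also have "\<dots> \<le> v"
        unfolding v_def using pS[OF i] C by (intro mult_left_mono) auto
      finally show ?thesis .
    qed
    show "0 \<le> l * m + l\<^sup>2 * v" using nn l by simp
  qed (use l in auto)
  let ?s = "\<lambda>\<omega>. \<Sum>i\<in>I - {k}. W' i \<omega> * \<kappa> ((V i \<omega> - V k \<omega>) / h)"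
  have sum_m: "?s \<in> borel_measurable M"
    unfolding W'_tr using I by (intro borel_measurable_sum) simp
  have "prob {\<omega> \<in> space M. x \<le> \<bar>?s \<omega>\<bar>} \<le> prob ({\<omega> \<in> space M. x \<le> ?s \<omega>} \<union> {\<omega> \<in> space M. x \<le> - ?s \<omega>})"
    using sum_m by (intro finite_measure_mono) auto
  also have "\<dots> \<le> prob {\<omega> \<in> space M. x \<le> ?s \<omega>} + prob {\<omega> \<in> space M. x \<le> - ?s \<omega>}"
    using sum_m by (intro measure_Un_le) auto
  also have "\<dots> \<le> 2 * exp (- l * x + card I * (l * m + l\<^sup>2 * v))"
    using tail[of 1] tail[of "-1"] by (simp add: f_def W'_tr sum_negf)
  finally show ?thesis by (simp add: m_def v_def)
qed

end

section \<open>Uniform bounds for kernel averages\<close>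

context prob_space
begin

text \<open>The definition asks for one sequence of measurable inner sets, whereas arguments with
  constants depending on \<epsilon> supply a different set for each \<epsilon>. The two agree
  because sets that nearly attain the inner probability at each \<open>n\<close> serve every
  \<epsilon> at once.\<close>

lemma with_prob_to_1_iff_eps:
  "with_prob_to_1 M E \<longleftrightarrow> (\<forall>\<epsilon>>0. \<forall>\<^sub>F n in sequentially.
     \<exists>A\<in>sets M. A \<subseteq> {\<omega> \<in> space M. E n \<omega>} \<and> 1 - \<epsilon> \<le> prob A)" (is "?l \<longleftrightarrow> ?r")
proof
  assume ?l
  then obtain A where A: "\<And>n. A n \<in> sets M" "\<And>n. A n \<subseteq> {\<omega> \<in> space M. E n \<omega>}"
    and lim: "(\<lambda>n. prob (A n)) \<longlonglongrightarrow> 1"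
    unfolding with_prob_to_1_def by blast
  show ?r
  proof (intro allI impI)
    fix \<epsilon> :: real assume "0 < \<epsilon>"
    then have "\<forall>\<^sub>F n in sequentially. 1 - \<epsilon> < prob (A n)"
      using lim by (intro order_tendstoD(1)[OF lim]) auto
    then show "\<forall>\<^sub>F n in sequentially. \<exists>A\<in>sets M. A \<subseteq> {\<omega> \<in> space M. E n \<omega>} \<and> 1 - \<epsilon> \<le> prob A"
      by eventually_elim (use A in \<open>auto intro: less_imp_le\<close>)
  qed
next
  assume r: ?r
  define \<A> where "\<A> n = {A \<in> sets M. A \<subseteq> {\<omega> \<in> space M. E n \<omega>}}" for n
  define s where "s n = (SUP A\<in>\<A> n. prob A)" for n
  have bdd: "bdd_above (prob ` \<A> n)" for n
    by (intro bdd_aboveI[where M=1]) auto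
  have ne: "{} \<in> \<A> n" for n by (auto simp: \<A>_def)
  \<comment> \<open>A deficit of \<open>1 / Suc n\<close> spares the question whether the supremum
    is attained, and it vanishes in the limit.\<close>
  have "\<exists>A. A \<in> \<A> n \<and> s n - 1 / Suc n < prob A" for n
  proof -
    have "s n - 1 / Suc n < (SUP A\<in>\<A> n. prob A)" by (simp add: s_def)
    then show ?thesis
      using less_cSUP_iff[OF _ bdd, of n "s n - 1 / Suc n"] ne by auto
  qed
  then obtain A where A: "\<And>n. A n \<in> \<A> n" "\<And>n. s n - 1 / Suc n < prob (A n)" by metis
  have "(\<lambda>n. prob (A n)) \<longlonglongrightarrow> 1"
  proof (rule order_tendstoI)
    fix a :: real assume "a < 1"
    define \<epsilon> where "\<epsilon> = (1 - a) / 2"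
    have "0 < \<epsilon>" using \<open>a < 1\<close> by (simp add: \<epsilon>_def)
    have "\<forall>\<^sub>F n in sequentially. 1 / Suc n < \<epsilon>"
      using order_tendstoD(2)[OF LIMSEQ_inverse_real_of_nat \<open>0 < \<epsilon>\<close>] by (simp add: inverse_eq_divide)
    moreover from r \<open>0 < \<epsilon>\<close> have "\<forall>\<^sub>F n in sequentially. 1 - \<epsilon> \<le> s n"
    proof -
      from r \<open>0 < \<epsilon>\<close> have "\<forall>\<^sub>F n in sequentially. \<exists>A\<in>sets M. A \<subseteq> {\<omega> \<in> space M. E n \<omega>} \<and> 1 - \<epsilon> \<le> prob A"
        by blast
      then show ?thesis
      proof eventually_elim
        case (elim n)
        then obtain A where "A \<in> \<A> n" "1 - \<epsilon> \<le> prob A" by (auto simp: \<A>_def)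
        then show ?case unfolding s_def using cSUP_upper[OF _ bdd] by fastforce
      qed
    qed
    ultimately show "\<forall>\<^sub>F n in sequentially. a < prob (A n)"
    proof eventually_elim
      case (elim n)
      moreover have "s n - 1 / Suc n < prob (A n)" by (rule A(2))
      ultimately show ?case unfolding \<epsilon>_def by argo
    qed
  next
    fix a :: real assume "1 < a"
    then show "\<forall>\<^sub>F n in sequentially. prob (A n) < a"
      by (intro always_eventually allI) (use prob_le_1 in \<open>auto intro: le_less_trans\<close>)
  qed
  with A(1) show ?l
    unfolding with_prob_to_1_def by (intro exI[of _ A]) (auto simp: \<A>_def)
qed

lemma inner_prob_conj:
  assumes "\<exists>A\<in>sets M. A \<subseteq> {\<omega> \<in> space M. E \<omega>} \<and> 1 - e \<le> prob A"
    and "\<exists>A\<in>sets M. A \<subseteq> {\<omega> \<in> space M. F \<omega>} \<and> 1 - f \<le> prob A"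
  shows "\<exists>A\<in>sets M. A \<subseteq> {\<omega> \<in> space M. E \<omega> \<and> F \<omega>} \<and> 1 - (e + f) \<le> prob A"
proof -
  obtain A B where A: "A \<in> sets M" "A \<subseteq> {\<omega> \<in> space M. E \<omega>}" "1 - e \<le> prob A"
    and B: "B \<in> sets M" "B \<subseteq> {\<omega> \<in> space M. F \<omega>}" "1 - f \<le> prob B"
    using assms by blast
  have "prob (space M - A \<inter> B) \<le> prob ((space M - A) \<union> (space M - B))"
    using A B by (intro finite_measure_mono) auto
  also have "\<dots> \<le> prob (space M - A) + prob (space M - B)"
    using A B by (intro measure_Un_le) auto
  finally have "1 - (e + f) \<le> prob (A \<inter> B)"
    using A B by (simp add: prob_compl)
  then show ?thesis
    using A B by (intro bexI[of _ "A \<inter> B"]) auto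
qed

lemma with_prob_to_1_conj:
  assumes "with_prob_to_1 M E" "with_prob_to_1 M F"
  shows "with_prob_to_1 M (\<lambda>n \<omega>. E n \<omega> \<and> F n \<omega>)"
  unfolding with_prob_to_1_iff_eps
proof (intro allI impI)
  fix \<epsilon> :: real assume "0 < \<epsilon>"
  then have "0 < \<epsilon> / 2" by simp
  with assms have "\<forall>\<^sub>F n in sequentially. \<exists>A\<in>sets M. A \<subseteq> {\<omega> \<in> space M. E n \<omega>} \<and> 1 - \<epsilon> / 2 \<le> prob A"
    "\<forall>\<^sub>F n in sequentially. \<exists>A\<in>sets M. A \<subseteq> {\<omega> \<in> space M. F n \<omega>} \<and> 1 - \<epsilon> / 2 \<le> prob A"
    unfolding with_prob_to_1_iff_eps by blast+
  then show "\<forall>\<^sub>F n in sequentially. \<exists>A\<in>sets M. A \<subseteq> {\<omega> \<in> space M. E n \<omega> \<and> F n \<omega>} \<and> 1 - \<epsilon> \<le> prob A"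
  proof eventually_elim
    case (elim n)
    from inner_prob_conj[OF this] show ?case by simp
  qed
qed

lemma with_prob_to_1_mono:
  assumes "with_prob_to_1 M E"
    and ev: "\<forall>\<^sub>F n in sequentially. \<forall>\<omega>\<in>space M. E n \<omega> \<longrightarrow> F n \<omega>"
  shows "with_prob_to_1 M F"
  unfolding with_prob_to_1_iff_eps
proof (intro allI impI)
  fix \<epsilon> :: real assume "0 < \<epsilon>"
  with assms have "\<forall>\<^sub>F n in sequentially. \<exists>A\<in>sets M. A \<subseteq> {\<omega> \<in> space M. E n \<omega>} \<and> 1 - \<epsilon> \<le> prob A"
    unfolding with_prob_to_1_iff_eps by blast
  with ev show "\<forall>\<^sub>F n in sequentially. \<exists>A\<in>sets M. A \<subseteq> {\<omega> \<in> space M. F n \<omega>} \<and> 1 - \<epsilon> \<le> prob A"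
    by eventually_elim blast
qed

text \<open>An almost sure event need not be measurable, but it contains the complement of a
  measurable null set, and that complement is the required inner set.\<close>

lemma with_prob_to_1_AE:
  assumes "\<And>n. AE \<omega> in M. E n \<omega>"
  shows "with_prob_to_1 M E"
proof -
  have "\<exists>A. A \<in> sets M \<and> A \<subseteq> {\<omega> \<in> space M. E n \<omega>} \<and> prob A = 1" for n
  proof -
    obtain N where N: "{\<omega> \<in> space M. \<not> E n \<omega>} \<subseteq> N" "emeasure M N = 0" "N \<in> sets M"
      using AE_E[OF assms[of n]] by blast
    show ?thesis
      using N by (intro exI[of _ "space M - N"]) (auto simp: prob_compl emeasure_eq_measure)
  qed
  then obtain A where "\<And>n. A n \<in> sets M \<and> A n \<subseteq> {\<omega> \<in> space M. E n \<omega>} \<and> prob (A n) = 1" by metis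
  then show ?thesis
    unfolding with_prob_to_1_def by (intro exI[of _ A]) auto
qed

text \<open>Two families of bad events are removed: some weight reaches the truncation level, by
  Markov's inequality, or some leave-one-out sum is large, by the exponential inequality. Each
  family has \<open>n * card J\<close> members. The diagonal term missing from the leave-one-out
  sums is restored afterwards and accounts for the summand 1 in the constant.\<close>

lemma kernel_average_event:
  fixes V :: "nat \<Rightarrow> 'a \<Rightarrow> real" and W :: "'p \<Rightarrow> nat \<Rightarrow> 'a \<Rightarrow> real" and \<kappa> :: "real \<Rightarrow> real"
    and T B c h c2 m0 C \<mu> l L a' v' A3 :: real
  assumes J: "finite J" and n: "1 \<le> n"
    and ind: "\<And>p. p \<in> J \<Longrightarrow> indep_vars (\<lambda>_. borel \<Otimes>\<^sub>M borel) (\<lambda>i \<omega>. (V i \<omega>, W p i \<omega>)) {1..n}"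
    and \<kappa>[measurable]: "\<kappa> \<in> borel_measurable borel"
    and \<kappa>_bd: "\<And>z. \<bar>\<kappa> z\<bar> \<le> B * indicator {- c..c} z" and pos: "0 \<le> B" "0 \<le> c" "0 < h" "0 < T"
    and ball: "\<And>i a b. i \<in> {1..n} \<Longrightarrow> a \<le> b \<Longrightarrow> prob {\<omega> \<in> space M. V i \<omega> \<in> {a..b}} \<le> c2 * (b - a)"
    and c2: "0 \<le> c2"
    and m0: "2 < m0" and C: "0 \<le> C" and \<mu>: "0 \<le> \<mu>"
    and W_int: "\<And>p i. p \<in> J \<Longrightarrow> i \<in> {1..n} \<Longrightarrow> integrable M (\<lambda>\<omega>. \<bar>W p i \<omega>\<bar> powr m0)"
    and W_mom: "\<And>p i S. p \<in> J \<Longrightarrow> i \<in> {1..n} \<Longrightarrow> S \<in> sets borel \<Longrightarrow>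
      expectation (\<lambda>\<omega>. indicator S (V i \<omega>) * \<bar>W p i \<omega>\<bar> powr m0) \<le> C * prob {\<omega> \<in> space M. V i \<omega> \<in> S}"
    and W_mean: "\<And>p i u. p \<in> J \<Longrightarrow> i \<in> {1..n} \<Longrightarrow> \<bar>expectation (\<lambda>\<omega>. W p i \<omega> * \<kappa> ((V i \<omega> - u) / h))\<bar>
      \<le> \<mu> * B * prob {\<omega> \<in> space M. V i \<omega> \<in> {u - c * h..u + c * h}}"
    and l: "0 < l" "l * T * B \<le> 1" and L: "1 \<le> L" "l\<^sup>2 * (n * h) = L" and Tl: "T powr (1 - m0) \<le> l"
    and a'_def: "a' = B * (c2 * (2 * c))" and v'_def: "v' = B\<^sup>2 * (C + 1) * (c2 * (2 * c))"
  shows "\<exists>A\<in>sets M. A \<subseteq> {\<omega> \<in> space M. \<forall>k\<in>{1..n}. \<forall>p\<in>J.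
      \<bar>1 / n * (\<Sum>i=1..n. W p i \<omega> * (\<kappa> ((V i \<omega> - V k \<omega>) / h) / h))\<bar> \<le> \<mu> * a' + l * (C * a' + v' + A3 + 1)} \<and>
     1 - (n * card J * C / T powr m0 + 2 * n * card J * exp (- A3 * L)) \<le> prob A"
proof -
  \<comment> \<open>The threshold for which \<open>- l * x\<close> plus the mean and variance terms
    collapses to at most \<open>- A3 * (l^2 * (n * h))\<close>, that is \<open>- A3 * L\<close>; so
    \<open>A3\<close> is the surplus available to the union bound.\<close>
  define x where "x = n * h * (\<mu> * a' + l * (C * a' + v' + A3))"
  define W' where "W' = (\<lambda>p i \<omega>. if \<bar>W p i \<omega>\<bar> \<le> T then W p i \<omega> else 0)"
  have VW: "V i \<in> borel_measurable M" "W p i \<in> borel_measurable M" if "i \<in> {1..n}" "p \<in> J" for i p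
  proof -
    have "(\<lambda>\<omega>. (V i \<omega>, W p i \<omega>)) \<in> measurable M (borel \<Otimes>\<^sub>M borel)"
      using ind that by (auto simp: indep_vars_def)
    from measurable_compose[OF this measurable_fst] measurable_compose[OF this measurable_snd]
    show "V i \<in> borel_measurable M" "W p i \<in> borel_measurable M" by auto
  qed
  define F1 where "F1 = (\<lambda>(p, i). {\<omega> \<in> space M. T \<le> \<bar>W p i \<omega>\<bar>})"
  define F2 where "F2 = (\<lambda>(p, k). {\<omega> \<in> space M. x \<le> \<bar>\<Sum>i\<in>{1..n} - {k}. W' p i \<omega> * \<kappa> ((V i \<omega> - V k \<omega>) / h)\<bar>})"
  let ?JI = "J \<times> {1..n}"
  have m1: "F1 q \<in> sets M" if "q \<in> ?JI" for q
  proof -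
    obtain p i where q: "q = (p, i)" "p \<in> J" "i \<in> {1..n}" using \<open>q \<in> ?JI\<close> by auto
    note [measurable] = VW(2)[OF q(3,2)]
    show ?thesis unfolding F1_def q prod.case by measurable
  qed
  have m2: "F2 q \<in> sets M" if "q \<in> ?JI" for q
  proof -
    obtain p k where q: "q = (p, k)" "p \<in> J" "k \<in> {1..n}" using \<open>q \<in> ?JI\<close> by auto
    have [measurable]: "V k \<in> borel_measurable M" using VW(1)[OF q(3,2)] .
    have "(\<lambda>\<omega>. W' p i \<omega> * \<kappa> ((V i \<omega> - V k \<omega>) / h)) \<in> borel_measurable M" if "i \<in> {1..n} - {k}" for i
    proof -
      have [measurable]: "V i \<in> borel_measurable M" "W p i \<in> borel_measurable M"
        using VW[of i p] that q by auto
      show ?thesis unfolding W'_def by measurable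
    qed
    then have "(\<lambda>\<omega>. \<Sum>i\<in>{1..n} - {k}. W' p i \<omega> * \<kappa> ((V i \<omega> - V k \<omega>) / h)) \<in> borel_measurable M"
      by (rule borel_measurable_sum)
    then show ?thesis unfolding F2_def q prod.case by measurable
  qed
  have p1: "prob (F1 q) \<le> C / T powr m0" if "q \<in> ?JI" for q
  proof -
    obtain p i where q: "q = (p, i)" "p \<in> J" "i \<in> {1..n}" using \<open>q \<in> ?JI\<close> by auto
    have "prob {\<omega> \<in> space M. T powr m0 \<le> \<bar>W p i \<omega>\<bar> powr m0}
        \<le> expectation (\<lambda>\<omega>. \<bar>W p i \<omega>\<bar> powr m0) / T powr m0"
      using W_int[OF q(2,3)] pos by (intro integral_Markov_inequality_measure[where A="{}"]) auto
    also have "expectation (\<lambda>\<omega>. \<bar>W p i \<omega>\<bar> powr m0) \<le> C"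
      using W_mom[OF q(2,3), of UNIV] by (simp add: prob_space)
    also have "{\<omega> \<in> space M. T powr m0 \<le> \<bar>W p i \<omega>\<bar> powr m0} = F1 q"
    proof -
      have "T powr m0 \<le> \<bar>w\<bar> powr m0 \<longleftrightarrow> T \<le> \<bar>w\<bar>" for w :: real
        using powr_mono2[of m0 T "\<bar>w\<bar>"] powr_less_mono2[of m0 "\<bar>w\<bar>" T] pos m0 by fastforce
      then show ?thesis by (simp add: F1_def q)
    qed
    finally show ?thesis using pos by (simp add: divide_right_mono)
  qed
  have p2: "prob (F2 q) \<le> 2 * exp (- A3 * L)" if "q \<in> ?JI" for q
  proof -
    obtain p k where q: "q = (p, k)" "p \<in> J" "k \<in> {1..n}" using \<open>q \<in> ?JI\<close> by auto
    have "prob (F2 q) \<le> 2 * exp (- l * x + card {1..n} * (l * ((\<mu> + C * T powr (1 - m0)) * B * (c2 * (2 * c * h)))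
        + l\<^sup>2 * (B\<^sup>2 * (C + 1) * (c2 * (2 * c * h)))))"
      unfolding F2_def q prod.case W'_def
      by (rule kernel_sum_tail[OF _ q(3) ind[OF q(2)] \<kappa> \<kappa>_bd pos ball m0 C \<mu> W_int[OF q(2)] W_mom[OF q(2)] W_mean[OF q(2)] l])
        auto
    also have "- l * x + card {1..n} * (l * ((\<mu> + C * T powr (1 - m0)) * B * (c2 * (2 * c * h)))
        + l\<^sup>2 * (B\<^sup>2 * (C + 1) * (c2 * (2 * c * h))))
      = - l * x + n * h * l * ((\<mu> + C * T powr (1 - m0)) * a' + l * v')"
      by (simp add: a'_def v'_def algebra_simps power2_eq_square)
    also have "\<dots> \<le> - l * x + n * h * l * ((\<mu> + C * l) * a' + l * v')"
      using Tl C pos c2 l n unfolding a'_def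
      by (intro add_left_mono mult_left_mono add_right_mono mult_right_mono) auto
    also have "\<dots> = - A3 * (l\<^sup>2 * (n * h))"
      by (simp add: x_def algebra_simps power2_eq_square)
    finally show ?thesis using L by simp
  qed
  define A where "A = space M - ((\<Union>q\<in>?JI. F1 q) \<union> (\<Union>q\<in>?JI. F2 q))"
  have meas: "(\<Union>q\<in>?JI. F1 q) \<in> sets M" "(\<Union>q\<in>?JI. F2 q) \<in> sets M"
    using m1 m2 J by (auto intro!: sets.finite_UN)
  have "prob ((\<Union>q\<in>?JI. F1 q) \<union> (\<Union>q\<in>?JI. F2 q)) \<le> prob (\<Union>q\<in>?JI. F1 q) + prob (\<Union>q\<in>?JI. F2 q)"
    using meas by (intro measure_Un_le) auto
  also have "prob (\<Union>q\<in>?JI. F1 q) \<le> (\<Sum>q\<in>?JI. prob (F1 q))"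
    using m1 J by (intro measure_UNION_le) auto
  also have "\<dots> \<le> (\<Sum>q\<in>?JI. C / T powr m0)"
    by (intro sum_mono p1)
  also have "prob (\<Union>q\<in>?JI. F2 q) \<le> (\<Sum>q\<in>?JI. prob (F2 q))"
    using m2 J by (intro measure_UNION_le) auto
  also have "\<dots> \<le> (\<Sum>q\<in>?JI. 2 * exp (- A3 * L))"
    by (intro sum_mono p2)
  finally have "1 - (n * card J * C / T powr m0 + 2 * n * card J * exp (- A3 * L)) \<le> prob A"
    using meas by (simp add: A_def prob_compl card_cartesian_product algebra_simps)
  moreover have "A \<in> sets M" using meas by (auto simp: A_def)
  moreover have "\<bar>1 / n * (\<Sum>i=1..n. W p i \<omega> * (\<kappa> ((V i \<omega> - V k \<omega>) / h) / h))\<bar>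
      \<le> \<mu> * a' + l * (C * a' + v' + A3 + 1)"
    if A: "\<omega> \<in> A" and k: "k \<in> {1..n}" and p: "p \<in> J" for \<omega> k p
  proof -
    have WT: "\<bar>W p i \<omega>\<bar> \<le> T" if "i \<in> {1..n}" for i
    proof -
      have "\<omega> \<in> space M" "\<omega> \<notin> F1 (p, i)" using A that p unfolding A_def by blast+
      then show ?thesis by (simp add: F1_def)
    qed
    then have WW: "W' p i \<omega> = W p i \<omega>" if "i \<in> {1..n}" for i
      using that by (simp add: W'_def)
    have \<kappa>B: "\<bar>\<kappa> z\<bar> \<le> B" for z
      using \<kappa>_bd[of z] pos by (cases "z \<in> {- c..c}") auto
    let ?t = "\<lambda>i. W p i \<omega> * \<kappa> ((V i \<omega> - V k \<omega>) / h)"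
    have "\<bar>\<Sum>i\<in>{1..n} - {k}. ?t i\<bar> = \<bar>\<Sum>i\<in>{1..n} - {k}. W' p i \<omega> * \<kappa> ((V i \<omega> - V k \<omega>) / h)\<bar>"
      by (intro arg_cong[where f=abs] sum.cong) (auto simp: WW)
    also have "\<dots> \<le> x"
    proof -
      have "\<omega> \<in> space M" "\<omega> \<notin> F2 (p, k)" using A k p unfolding A_def by blast+
      then show ?thesis by (simp add: F2_def)
    qed
    finally have 1: "\<bar>\<Sum>i\<in>{1..n} - {k}. ?t i\<bar> \<le> x" .
    \<comment> \<open>The term with \<open>i = k\<close> is at most \<open>T * B\<close>. From
      \<open>l * T * B \<le> 1 \<le> L = l^2 * (n * h)\<close> it is at most
      \<open>l * (n * h)\<close>, the order of the target.\<close>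
    have "l * (T * B) \<le> l * (l * (n * h))"
      using l L by (simp add: power2_eq_square mult.assoc)
    then have "T * B \<le> l * (n * h)" using l by simp
    moreover have "\<bar>?t k\<bar> \<le> T * B"
      unfolding abs_mult using WT[OF k] \<kappa>B pos by (intro mult_mono) auto
    ultimately have 2: "\<bar>?t k\<bar> \<le> l * (n * h)" by linarith
    have "\<bar>\<Sum>i=1..n. ?t i\<bar> = \<bar>?t k + (\<Sum>i\<in>{1..n} - {k}. ?t i)\<bar>"
      using k by (subst sum.remove[of "{1..n}" k]) auto
    also have "\<dots> \<le> x + l * (n * h)" using 1 2 by linarith
    also have "\<dots> = n * h * (\<mu> * a' + l * (C * a' + v' + A3 + 1))"
      by (simp add: x_def algebra_simps)
    finally have 3: "\<bar>\<Sum>i=1..n. ?t i\<bar> \<le> n * h * (\<mu> * a' + l * (C * a' + v' + A3 + 1))" .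
    have "1 / n * (\<Sum>i=1..n. W p i \<omega> * (\<kappa> ((V i \<omega> - V k \<omega>) / h) / h)) = (\<Sum>i=1..n. ?t i) / (n * h)"
      by (simp add: sum_divide_distrib mult.commute[of h])
    then show ?thesis
      using 3 pos n by (simp add: abs_divide abs_mult pos_divide_le_eq mult.commute)
  qed
  ultimately show ?thesis
    by (intro bexI[of _ A]) (auto simp: A_def)
qed

end

text \<open>\<open>Q\<close> counts the terms of the union bound and \<open>R\<close> is the
  diverging ratio of the rate condition; by construction
  \<open>l^2 * Q powr (2 / m0) * R = 1\<close>. The truncation level \<open>T\<close> sits midway:
  \<open>l * T = R powr (- 1/4)\<close> tends to zero, which beats any kernel bound
  \<open>B\<close>, while \<open>Q / T powr m0 = R powr (- m0/4)\<close> tends to zero as well,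
  which is the Markov part.\<close>

lemma kernel_rate_facts:
  fixes h :: "nat \<Rightarrow> real" and d :: "nat \<Rightarrow> nat" and m0 \<tau> \<delta>1 B C :: real
  assumes h: "\<And>n. 0 < h n" and d: "\<And>n. 1 \<le> d n" and m0: "2 < m0"
    and tau: "0 \<le> \<tau>" "propto (\<lambda>n. real (d n)) (\<lambda>n. real n powr \<tau>)"
    and del: "0 < \<delta>1" "propto h (\<lambda>n. real n powr (- \<delta>1))"
    and rate: "filterlim (\<lambda>n. real n * h n /
          ((real n * real (d n) ^ 3) powr (2 / m0) * ln (1 / h n))) at_top sequentially"
  defines "l \<equiv> (\<lambda>n. sqrt (ln (1 / h n) / (real n * h n)))"
  shows "\<exists>A3\<ge>0. \<exists>T. (\<forall>\<^sub>F n in sequentially. 1 \<le> n \<and> 0 < T n \<and> 0 < l n \<and> l n * T n * B \<le> 1 \<and>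
       1 \<le> ln (1 / h n) \<and> (l n)\<^sup>2 * (real n * h n) = ln (1 / h n) \<and> T n powr (1 - m0) \<le> l n) \<and>
     (\<lambda>n. real n * real (d n) ^ 3 * C / T n powr m0
        + 2 * real n * real (d n) ^ 3 * exp (- A3 * ln (1 / h n))) \<longlonglongrightarrow> 0"
proof -
  obtain D where D: "0 < D" "\<forall>\<^sub>F n in sequentially. real (d n) \<le> D * real n powr \<tau>"
    using tau(2) unfolding propto_def by (metis (mono_tags, lifting) eventually_mono less_le_trans)
  obtain c where c: "0 < c" "\<forall>\<^sub>F n in sequentially. h n \<le> c * real n powr (- \<delta>1)"
    using del(2) unfolding propto_def by (metis (mono_tags, lifting) eventually_mono less_le_trans)
  define Q where "Q = (\<lambda>n. real n * real (d n) ^ 3)"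
  define R where "R = (\<lambda>n. real n * h n / (Q n powr (2 / m0) * ln (1 / h n)))"
  define T where "T = (\<lambda>n. Q n powr (1 / m0) * R n powr (1 / 4))"
  \<comment> \<open>With \<open>h\<close> at most of order \<open>n powr (- \<delta>1)\<close>, this
    exponent makes \<open>exp (- A3 * ln (1 / h))\<close> at most of order
    \<open>n powr (- (2 + 3 * \<tau>))\<close>, one power of \<open>n\<close> better than cancelling
    the \<open>n powr (1 + 3 * \<tau>)\<close> terms of the union bound.\<close>
  define A3 where "A3 = (2 + 3 * \<tau>) / \<delta>1"
  have A3: "0 \<le> A3" using del tau by (simp add: A3_def)
  have R_lim: "filterlim R at_top sequentially" using rate by (simp add: R_def Q_def)
  have h0: "h \<longlonglongrightarrow> 0"
  proof (rule tendsto_sandwich[of "\<lambda>_. 0"])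
    show "(\<lambda>n. c * real n powr (- \<delta>1)) \<longlonglongrightarrow> 0"
      using tendsto_mult_right_zero[OF tendsto_neg_powr[OF _ filterlim_real_sequentially], of "- \<delta>1" c] del by simp
  qed (use c h in \<open>auto intro: less_imp_le always_eventually\<close>)
  have ev_h: "\<forall>\<^sub>F n in sequentially. h n < exp (- 1)"
    by (rule order_tendstoD(2)[OF h0]) simp
  have ev_n: "\<forall>\<^sub>F n in sequentially. (1::nat) \<le> n" by (rule eventually_ge_at_top)
  \<comment> \<open>The fourth power matches the exponent 1/4 in \<open>T\<close>: from here on
    \<open>R powr (1/4)\<close> is at least 1 and at least \<open>|B|\<close>.\<close>
  have ev_R: "\<forall>\<^sub>F n in sequentially. max 1 (\<bar>B\<bar> ^ 4) \<le> R n"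
    using R_lim unfolding filterlim_at_top by blast
  have ln1: "1 \<le> ln (1 / h n)" if "h n < exp (- 1)" for n
    using that h[of n] ln_less_cancel_iff[of "h n" "exp (- 1)"] by (simp add: ln_div)
  have l2: "(l n)\<^sup>2 * (real n * h n) = ln (1 / h n)" if "h n < exp (- 1)" "1 \<le> n" for n
  proof -
    have "0 \<le> ln (1 / h n) / (real n * h n)"
    proof (rule divide_nonneg_nonneg)
      show "0 \<le> ln (1 / h n)" using ln1[OF that(1)] by linarith
    qed (use h[of n] in simp)
    then show ?thesis using h[of n] that(2) by (simp add: l_def real_sqrt_pow2)
  qed
  have main: "\<forall>\<^sub>F n in sequentially. 1 \<le> n \<and> 0 < T n \<and> 0 < l n \<and> l n * T n * B \<le> 1 \<and>
       1 \<le> ln (1 / h n) \<and> (l n)\<^sup>2 * (real n * h n) = ln (1 / h n) \<and> T n powr (1 - m0) \<le> l n"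
    using ev_h ev_n ev_R
  proof eventually_elim
    case (elim n)
    have L: "1 \<le> ln (1 / h n)" by (rule ln1) fact
    have h1: "h n < 1" by (rule less_trans[OF elim(1)]) simp
    have Q1: "1 \<le> Q n"
      using elim d[of n] unfolding Q_def by (simp add: mult_ge1_I)
    have Qn: "real n \<le> Q n"
      using elim d[of n] unfolding Q_def by simp
    have Rp: "0 < R n" using elim by linarith
    have lp: "0 < l n"
      using L h[of n] elim(2) unfolding l_def real_sqrt_gt_0_iff
    proof (intro divide_pos_pos mult_pos_pos)
      show "0 < ln (1 / h n)" using L by linarith
    qed (use h[of n] elim(2) in auto)
    have Tp: "0 < T n" using Q1 Rp by (simp add: T_def)
    have Q2: "(Q n powr (1 / m0))\<^sup>2 = Q n powr (2 / m0)"
      using Q1 m0 by (simp add: powr_power)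
    have R2: "(R n powr (1 / 4))\<^sup>2 * (R n powr (1 / 4))\<^sup>2 = R n"
      using Rp by (simp add: powr_power powr_add[symmetric])
    have lR: "(l n)\<^sup>2 * Q n powr (2 / m0) * R n = 1"
      using lp h[of n] elim(2) Q1 unfolding R_def l2[OF elim(1,2), symmetric] by (simp add: field_simps)
    have "(l n * T n * R n powr (1 / 4))\<^sup>2 = (l n)\<^sup>2 * (Q n powr (1 / m0))\<^sup>2 * ((R n powr (1 / 4))\<^sup>2 * (R n powr (1 / 4))\<^sup>2)"
      by (simp add: T_def power_mult_distrib algebra_simps)
    also have "\<dots> = 1" unfolding Q2 R2 by (rule lR)
    finally have lT: "l n * T n * R n powr (1 / 4) = 1"
      using lp Tp by (smt (verit) mult_nonneg_nonneg powr_ge_zero power2_eq_1_iff)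
    have R4: "max 1 \<bar>B\<bar> \<le> R n powr (1 / 4)"
    proof -
      have "max 1 \<bar>B\<bar> = (max 1 \<bar>B\<bar> ^ 4) powr (1 / 4)"
        using powr_powr[of "max 1 \<bar>B\<bar>" 4 "1/4"] by (simp add: powr_numeral)
      also have "\<dots> \<le> R n powr (1 / 4)"
        using elim(3) by (intro powr_mono2) (auto simp: max_def split: if_splits)
      finally show ?thesis .
    qed
    have lTB: "l n * T n * B \<le> 1"
    proof -
      have "l n * T n * B \<le> l n * T n * R n powr (1 / 4)"
        using R4 lp Tp by (intro mult_left_mono) auto
      then show ?thesis using lT by simp
    qed
    have lT1: "l n * T n \<le> 1"
    proof -
      have "l n * T n * 1 \<le> l n * T n * R n powr (1 / 4)"
        using R4 lp Tp by (intro mult_left_mono) auto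
      then show ?thesis using lT by simp
    qed
    have Tm: "real n \<le> T n powr m0"
    proof -
      have "Q n powr 1 \<le> Q n powr 1 * R n powr (m0 / 4)"
        using Q1 elim(3) m0 by (simp add: ge_one_powr_ge_zero)
      also have "\<dots> = T n powr m0"
        using Q1 Rp m0 by (simp add: T_def powr_mult powr_powr)
      finally show ?thesis using Qn Q1 by simp
    qed
    \<comment> \<open>The truncation bias. As \<open>T powr m0\<close> is at least \<open>n\<close>,
      it is at most \<open>T / n \<le> 1 / (l * n) = l * (h / ln (1 / h))\<close>, and the last
      factor is at most 1.\<close>
    have Tl: "T n powr (1 - m0) \<le> l n"
    proof -
      have "T n powr (1 - m0) = T n / T n powr m0"
        using Tp by (simp add: powr_diff)
      also have "\<dots> \<le> T n / real n"
        using Tm Tp elim by (intro divide_left_mono) auto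
      also have "\<dots> \<le> (1 / l n) / real n"
        using lT1 lp elim by (intro divide_right_mono) (auto simp: field_simps)
      also have "\<dots> = l n * (h n / ln (1 / h n))"
      proof -
        have "real n * (l n)\<^sup>2 * h n = ln (1 / h n)" using l2[OF elim(1,2)] by (simp add: algebra_simps)
        then show ?thesis using lp elim L by (simp add: field_simps power2_eq_square)
      qed
      also have "\<dots> \<le> l n * 1"
        using lp L h1 h[of n] by (intro mult_left_mono) (auto simp: divide_le_eq)
      finally show ?thesis by simp
    qed
    show ?case using elim L lp Tp lTB Tl l2[OF elim(1,2)] by blast
  qed
  have lim1: "(\<lambda>n. C * R n powr (- (m0 / 4))) \<longlonglongrightarrow> 0"
    using tendsto_mult_right_zero[OF tendsto_neg_powr[OF _ R_lim], of "- (m0 / 4)" C] m0 by simp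
  have lim1': "(\<lambda>n. Q n * C / T n powr m0) \<longlonglongrightarrow> 0"
  proof (rule Lim_transform_eventually[OF lim1])
    show "\<forall>\<^sub>F n in sequentially. C * R n powr (- (m0 / 4)) = Q n * C / T n powr m0"
      using ev_n ev_R
    proof eventually_elim
      case (elim n)
      have Q1: "1 \<le> Q n"
        using elim d[of n] unfolding Q_def by (simp add: mult_ge1_I)
      have "T n powr m0 = Q n * R n powr (m0 / 4)"
        using Q1 elim m0 by (simp add: T_def powr_mult powr_powr)
      then show ?case using Q1 by (simp add: powr_minus field_simps)
    qed
  qed
  define K where "K = 2 * D ^ 3 * c powr A3"
  have lim2: "(\<lambda>n. 2 * Q n * exp (- A3 * ln (1 / h n))) \<longlonglongrightarrow> 0"
  proof (rule tendsto_sandwich[of "\<lambda>_. 0"])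
    show "(\<lambda>n. K * real n powr (- 1)) \<longlonglongrightarrow> 0"
      using tendsto_mult_right_zero[OF tendsto_neg_powr[OF _ filterlim_real_sequentially], of "- 1" K] by simp
    show "\<forall>\<^sub>F n in sequentially. 2 * Q n * exp (- A3 * ln (1 / h n)) \<le> K * real n powr (- 1)"
      using ev_n D(2) c(2)
    proof eventually_elim
      case (elim n)
      have n: "0 < real n" using elim by simp
      have "exp (- A3 * ln (1 / h n)) = h n powr A3"
        using h[of n] by (simp add: powr_def ln_div)
      also have "\<dots> \<le> (c * real n powr (- \<delta>1)) powr A3"
        using elim h[of n] A3 by (intro powr_mono2) auto
      also have "\<dots> = c powr A3 * real n powr (- (2 + 3 * \<tau>))"
        using c n del by (simp add: powr_mult powr_powr A3_def)
      finally have 1: "exp (- A3 * ln (1 / h n)) \<le> c powr A3 * real n powr (- (2 + 3 * \<tau>))" .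
      have "real (d n) ^ 3 \<le> (D * real n powr \<tau>) ^ 3"
        using elim by (intro power_mono) auto
      also have "\<dots> = D ^ 3 * real n powr (3 * \<tau>)"
        using n by (simp add: power_mult_distrib powr_power mult.commute)
      finally have 2: "real (d n) ^ 3 \<le> D ^ 3 * real n powr (3 * \<tau>)" .
      have "2 * Q n * exp (- A3 * ln (1 / h n))
          \<le> 2 * (real n * (D ^ 3 * real n powr (3 * \<tau>))) * (c powr A3 * real n powr (- (2 + 3 * \<tau>)))"
        unfolding Q_def using 1 2 D by (intro mult_mono mult_left_mono) auto
      also have "\<dots> = K * (real n powr 1 * real n powr (3 * \<tau>) * real n powr (- (2 + 3 * \<tau>)))"
        using n by (simp add: K_def algebra_simps)
      also have "real n powr 1 * real n powr (3 * \<tau>) * real n powr (- (2 + 3 * \<tau>)) = real n powr (- 1)"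
        by (simp only: powr_add[symmetric]) simp
      finally show ?case .
    qed
  qed (auto simp: Q_def)
  have "(\<lambda>n. real n * real (d n) ^ 3 * C / T n powr m0
        + 2 * real n * real (d n) ^ 3 * exp (- A3 * ln (1 / h n))) \<longlonglongrightarrow> 0"
    using tendsto_add[OF lim1' lim2] by (simp add: Q_def mult.assoc)
  with A3 main show ?thesis by blast
qed

context prob_space
begin

text \<open>The size \<open>d^3\<close> of the index set accommodates triples of covariates, the
  largest family that occurs. The number \<mu> measures the mean of a weighted kernel term relative
  to its window probability: 0 for scores, whose averages inherit the full rate, and a positive
  constant for absolute values, whose averages are merely bounded.\<close>

lemma kernel_average_bound:
  fixes V :: "nat \<Rightarrow> nat \<Rightarrow> 'a \<Rightarrow> real" and W :: "nat \<Rightarrow> 'p \<Rightarrow> nat \<Rightarrow> 'a \<Rightarrow> real"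
    and \<kappa> :: "real \<Rightarrow> real" and h :: "nat \<Rightarrow> real" and d :: "nat \<Rightarrow> nat" and B c c2 m0 C \<mu> \<tau> \<delta>1 :: real
  assumes J: "\<And>n. finite (J n)" "\<And>n. card (J n) \<le> d n ^ 3"
    and ind: "\<And>n p. p \<in> J n \<Longrightarrow> indep_vars (\<lambda>_. borel \<Otimes>\<^sub>M borel) (\<lambda>i \<omega>. (V n i \<omega>, W n p i \<omega>)) {1..n}"
    and \<kappa>: "\<kappa> \<in> borel_measurable borel"
    and \<kappa>_bd: "\<And>z. \<bar>\<kappa> z\<bar> \<le> B * indicator {- c..c} z" and pos: "0 \<le> B" "0 \<le> c" "\<And>n. 0 < h n"
    and ball: "\<And>n i a b. i \<in> {1..n} \<Longrightarrow> a \<le> b \<Longrightarrow> prob {\<omega> \<in> space M. V n i \<omega> \<in> {a..b}} \<le> c2 * (b - a)"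
    and c2: "0 \<le> c2"
    and m0: "2 < m0" and C: "0 \<le> C" and \<mu>: "0 \<le> \<mu>"
    and W_int: "\<And>n p i. p \<in> J n \<Longrightarrow> i \<in> {1..n} \<Longrightarrow> integrable M (\<lambda>\<omega>. \<bar>W n p i \<omega>\<bar> powr m0)"
    and W_mom: "\<And>n p i S. p \<in> J n \<Longrightarrow> i \<in> {1..n} \<Longrightarrow> S \<in> sets borel \<Longrightarrow>
      expectation (\<lambda>\<omega>. indicator S (V n i \<omega>) * \<bar>W n p i \<omega>\<bar> powr m0) \<le> C * prob {\<omega> \<in> space M. V n i \<omega> \<in> S}"
    and W_mean: "\<And>n p i u. p \<in> J n \<Longrightarrow> i \<in> {1..n} \<Longrightarrow> \<bar>expectation (\<lambda>\<omega>. W n p i \<omega> * \<kappa> ((V n i \<omega> - u) / h n))\<bar>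
      \<le> \<mu> * B * prob {\<omega> \<in> space M. V n i \<omega> \<in> {u - c * h n..u + c * h n}}"
    and d: "\<And>n. 1 \<le> d n"
    and tau: "0 \<le> \<tau>" "propto (\<lambda>n. real (d n)) (\<lambda>n. real n powr \<tau>)"
    and del: "0 < \<delta>1" "propto h (\<lambda>n. real n powr (- \<delta>1))"
    and rate: "filterlim (\<lambda>n. real n * h n /
          ((real n * real (d n) ^ 3) powr (2 / m0) * ln (1 / h n))) at_top sequentially"
  shows "\<exists>C'\<ge>0. with_prob_to_1 M (\<lambda>n \<omega>. \<forall>k\<in>{1..n}. \<forall>p\<in>J n.
      \<bar>1 / n * (\<Sum>i=1..n. W n p i \<omega> * (\<kappa> ((V n i \<omega> - V n k \<omega>) / h n) / h n))\<bar>
      \<le> C' * (\<mu> + sqrt (ln (1 / h n) / (real n * h n))))"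
proof -
  define l where "l = (\<lambda>n. sqrt (ln (1 / h n) / (real n * h n)))"
  obtain A3 T where A3: "0 \<le> A3"
    and ev: "\<forall>\<^sub>F n in sequentially. 1 \<le> n \<and> 0 < T n \<and> 0 < l n \<and> l n * T n * B \<le> 1 \<and>
       1 \<le> ln (1 / h n) \<and> (l n)\<^sup>2 * (real n * h n) = ln (1 / h n) \<and> T n powr (1 - m0) \<le> l n"
    and lim: "(\<lambda>n. real n * real (d n) ^ 3 * C / T n powr m0
        + 2 * real n * real (d n) ^ 3 * exp (- A3 * ln (1 / h n))) \<longlonglongrightarrow> 0"
    using kernel_rate_facts[OF pos(3) d m0 tau del rate, of B C] unfolding l_def by blast
  define a' where "a' = B * (c2 * (2 * c))"
  define v' where "v' = B\<^sup>2 * (C + 1) * (c2 * (2 * c))"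
  define C' where "C' = a' + (C * a' + v' + A3 + 1)"
  have nn: "0 \<le> a'" "0 \<le> v'" using pos c2 C by (auto simp: a'_def v'_def)
  have C'0: "0 \<le> C'" using nn C A3 by (simp add: C'_def)
  have "with_prob_to_1 M (\<lambda>n \<omega>. \<forall>k\<in>{1..n}. \<forall>p\<in>J n.
      \<bar>1 / n * (\<Sum>i=1..n. W n p i \<omega> * (\<kappa> ((V n i \<omega> - V n k \<omega>) / h n) / h n))\<bar> \<le> C' * (\<mu> + l n))"
    unfolding with_prob_to_1_iff_eps
  proof (intro allI impI)
    fix \<epsilon> :: real assume "0 < \<epsilon>"
    from order_tendstoD(2)[OF lim this] ev
    show "\<forall>\<^sub>F n in sequentially. \<exists>A\<in>sets M. A \<subseteq> {\<omega> \<in> space M. \<forall>k\<in>{1..n}. \<forall>p\<in>J n.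
      \<bar>1 / n * (\<Sum>i=1..n. W n p i \<omega> * (\<kappa> ((V n i \<omega> - V n k \<omega>) / h n) / h n))\<bar> \<le> C' * (\<mu> + l n)} \<and> 1 - \<epsilon> \<le> prob A"
    proof eventually_elim
      case (elim n)
      then have e: "1 \<le> n" "0 < T n" "0 < l n" "l n * T n * B \<le> 1" "1 \<le> ln (1 / h n)"
        "(l n)\<^sup>2 * (real n * h n) = ln (1 / h n)" "T n powr (1 - m0) \<le> l n" by auto
      obtain A where A: "A \<in> sets M" and sub: "A \<subseteq> {\<omega> \<in> space M. \<forall>k\<in>{1..n}. \<forall>p\<in>J n.
        \<bar>1 / n * (\<Sum>i=1..n. W n p i \<omega> * (\<kappa> ((V n i \<omega> - V n k \<omega>) / h n) / h n))\<bar> \<le> \<mu> * a' + l n * (C * a' + v' + A3 + 1)}"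
        and pr: "1 - (n * card (J n) * C / T n powr m0 + 2 * n * card (J n) * exp (- A3 * ln (1 / h n))) \<le> prob A"
      proof -
        have "\<exists>A\<in>sets M. A \<subseteq> {\<omega> \<in> space M. \<forall>k\<in>{1..n}. \<forall>p\<in>J n.
            \<bar>1 / n * (\<Sum>i=1..n. W n p i \<omega> * (\<kappa> ((V n i \<omega> - V n k \<omega>) / h n) / h n))\<bar> \<le> \<mu> * a' + l n * (C * a' + v' + A3 + 1)} \<and>
          1 - (n * card (J n) * C / T n powr m0 + 2 * n * card (J n) * exp (- A3 * ln (1 / h n))) \<le> prob A"
          by (rule kernel_average_event[where V = "V n" and W = "W n" and T = "T n"])
            (rule J e ind \<kappa> \<kappa>_bd pos ball c2 m0 C \<mu> W_int W_mom W_mean a'_def v'_def; assumption)+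
        then show ?thesis by (elim bexE conjE) (rule that)
      qed
      have card: "real (card (J n)) \<le> real (d n) ^ 3"
        using J(2)[of n] by (simp add: of_nat_power[symmetric] del: of_nat_power)
      have "n * card (J n) * C / T n powr m0 + 2 * n * card (J n) * exp (- A3 * ln (1 / h n))
          \<le> real n * real (d n) ^ 3 * C / T n powr m0 + 2 * real n * real (d n) ^ 3 * exp (- A3 * ln (1 / h n))"
        using card C by (intro add_mono divide_right_mono mult_right_mono) (auto intro: mult_left_mono)
      then have "1 - \<epsilon> \<le> prob A" using pr elim by linarith
      moreover have "\<mu> * a' + l n * (C * a' + v' + A3 + 1) \<le> C' * (\<mu> + l n)"
      proof -
        have "0 \<le> \<mu> * (C * a' + v' + A3 + 1)" "0 \<le> l n * a'" using \<mu> nn C A3 e(3) by auto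
        then show ?thesis by (simp add: C'_def algebra_simps)
      qed
      ultimately show ?case using A sub by (intro bexI[of _ A]) (auto intro: order_trans)
    qed
  qed
  then show ?thesis using C'0 unfolding l_def by blast
qed

end

section \<open>A local penalised fit under the restricted eigenvalue condition\<close>

lemma sum_abs_le_sqrt_card:
  fixes v :: "'r \<Rightarrow> real"
  assumes "finite J" "S \<subseteq> J"
  shows "(\<Sum>r\<in>S. \<bar>v r\<bar>) \<le> sqrt (card S) * L2_set v J"
proof -
  have fS: "finite S" using assms finite_subset by blast
  have "(\<Sum>r\<in>S. \<bar>1\<bar> * \<bar>v r\<bar>) \<le> L2_set (\<lambda>_. 1) S * L2_set v S"
    by (rule L2_set_mult_ineq)
  also have "L2_set (\<lambda>_. 1 :: real) S = sqrt (card S)" by (simp add: L2_set_def)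
  also have "L2_set v S \<le> L2_set v J"
    unfolding L2_set_def using assms by (intro real_sqrt_le_mono sum_mono2) auto
  finally show ?thesis by (simp add: mult_left_mono)
qed

text \<open>A local likelihood fit: the log-likelihood is a weighted sum of functions \<open>f i\<close> of the linear
  predictors \<open>z\<^sub>i\<^sup>Tv\<close>, \<open>\<eta> i\<close> are the true predictors, and \<open>\<theta>\<close> is the local approximation of the
  truth, whose predictors are off by the smoothing bias \<open>\<beta>\<close>. \<open>S\<close> indexes the cone of the restricted
  eigenvalue condition and \<open>A\<close> the support of the oracle.\<close>

locale local_fit =
  fixes I :: "'i set" and J S A :: "'r set"
    and w Mf \<eta> :: "'i \<Rightarrow> real" and z :: "'i \<Rightarrow> 'r \<Rightarrow> real" and f f' f'' :: "'i \<Rightarrow> real \<Rightarrow> real"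
    and \<theta> lam :: "'r \<Rightarrow> real" and lmin lmax e C \<beta> \<rho> B Crow :: real
  assumes fin: "finite I" "finite J" and sub: "A \<subseteq> S" "S \<subseteq> J"
    and w: "\<And>i. i \<in> I \<Longrightarrow> 0 \<le> w i"
    and f': "\<And>i s. i \<in> I \<Longrightarrow> (f i has_real_derivative f' i s) (at s)"
    and f'': "\<And>i s. i \<in> I \<Longrightarrow> (f' i has_real_derivative f'' i s) (at s)"
    and neg: "\<And>i s. i \<in> I \<Longrightarrow> f'' i s \<le> 0"
    and Mf: "\<And>i. i \<in> I \<Longrightarrow> 0 \<le> Mf i"
    and lip: "\<And>i t. i \<in> I \<Longrightarrow> \<bar>f'' i (\<eta> i + t) - f'' i (\<eta> i)\<bar> \<le> Mf i * \<bar>t\<bar>"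
    and score: "\<And>r. r \<in> J \<Longrightarrow> \<bar>\<Sum>i\<in>I. w i * f' i (\<eta> i) * z i r\<bar> \<le> e"
    and C2: "\<And>r c. r \<in> J \<Longrightarrow> c \<in> J \<Longrightarrow> (\<Sum>i\<in>I. w i * \<bar>f'' i (\<eta> i)\<bar> * (\<bar>z i r\<bar> * \<bar>z i c\<bar>)) \<le> C"
    and C3: "\<And>r c p. r \<in> J \<Longrightarrow> c \<in> J \<Longrightarrow> p \<in> J \<Longrightarrow>
      (\<Sum>i\<in>I. w i * Mf i * (\<bar>z i r\<bar> * \<bar>z i c\<bar> * \<bar>z i p\<bar>)) \<le> C"
    and \<theta>_supp: "\<And>r. r \<in> J - A \<Longrightarrow> \<theta> r = 0"
    and bias: "\<And>i. i \<in> I \<Longrightarrow> w i \<noteq> 0 \<Longrightarrow> \<bar>(\<Sum>r\<in>J. \<theta> r * z i r) - \<eta> i\<bar> \<le> \<beta> * (\<Sum>r\<in>S. \<bar>z i r\<bar>)"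
    and RE: "\<And>v. (\<Sum>r\<in>J. \<bar>v r\<bar>) \<le> B * (\<Sum>r\<in>S. \<bar>v r\<bar>) \<Longrightarrow>
      \<rho> * (L2_set v J)\<^sup>2 \<le> (\<Sum>i\<in>I. w i * (- f'' i (\<eta> i)) * (\<Sum>r\<in>J. v r * z i r)\<^sup>2)"
    and row: "\<And>r v. r \<in> J - A \<Longrightarrow> (\<And>c. c \<in> J - A \<Longrightarrow> v c = 0) \<Longrightarrow>
      \<bar>\<Sum>i\<in>I. w i * f'' i (\<eta> i) * z i r * (\<Sum>c\<in>J. v c * z i c)\<bar> \<le> Crow * L2_set v J"
    and lam: "\<And>r. r \<in> J \<Longrightarrow> lmin \<le> lam r \<and> lam r \<le> lmax" and lmin: "0 < lmin" and lmm: "lmin \<le> lmax"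
    and nonneg: "0 \<le> C" "0 \<le> \<beta>" "0 < \<rho>" "0 \<le> e" "0 \<le> Crow"
    and B: "2 * (1 + lmax / lmin) \<le> B"
    and S_ne: "S \<noteq> {}"
begin

definition ip :: "('r \<Rightarrow> real) \<Rightarrow> 'i \<Rightarrow> real" where "ip v i = (\<Sum>r\<in>J. v r * z i r)"
definition az :: "('r \<Rightarrow> real) \<Rightarrow> 'i \<Rightarrow> real" where "az v i = (\<Sum>r\<in>J. \<bar>v r\<bar> * \<bar>z i r\<bar>)"
definition n1 :: "('r \<Rightarrow> real) \<Rightarrow> real" where "n1 v = (\<Sum>r\<in>J. \<bar>v r\<bar>)"
abbreviation "n2 v \<equiv> L2_set v J"
definition s :: real where "s = real (card S)"
text \<open>Indicator vectors let the smoothing bias (\<open>ind S\<close>), a single coordinate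
  (\<open>ind {r}\<close>) and a parameter direction all enter the same bilinear and trilinear
  bounds.\<close>

definition ind :: "'r set \<Rightarrow> 'r \<Rightarrow> real" where "ind K r = of_bool (r \<in> K)"
text \<open>Sup-norm bound on the gradient at \<theta>: the score noise at the truth, plus what the
  predictor bias adds through the Hessian (linear in \<open>\<beta> * s\<close>) and through its
  Lipschitz remainder (quadratic).\<close>

definition \<epsilon> :: real where "\<epsilon> = e + C * (\<beta> * s + (\<beta> * s)\<^sup>2)"
text \<open>Twice the radius that the basic inequality yields, so that an improving step of length
  at most \<open>R\<close> is forced into the ball of radius \<open>R / 2\<close>; \<open>N\<close>
  is the l1 radius that the cone attaches to it.\<close>

definition R :: real where "R = 8 * (\<epsilon> * B + lmax) * sqrt s / \<rho>"
definition N :: real where "N = B * sqrt s * R"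
definition F :: "('r \<Rightarrow> real) \<Rightarrow> real" where
  "F v = (\<Sum>i\<in>I. w i * f i (ip v i)) - (\<Sum>r\<in>J. lam r * \<bar>v r\<bar>)"

lemma finS: "finite S" using fin sub finite_subset by blast

lemma s1: "1 \<le> s"
  using finS S_ne by (simp add: s_def Suc_le_eq card_gt_0_iff)

lemma B4: "4 \<le> B"
proof -
  have "2 * (1 + 1) \<le> 2 * (1 + lmax / lmin)"
    using lmin lmm by (intro mult_left_mono add_left_mono) auto
  from order_trans[OF this B] show ?thesis by simp
qed

lemma \<epsilon>0: "0 \<le> \<epsilon>"
  using nonneg s1 unfolding \<epsilon>_def by (intro add_nonneg_nonneg mult_nonneg_nonneg) auto

lemma R0: "0 < R"
proof -
  have "0 \<le> \<epsilon> * B" using \<epsilon>0 B4 by simp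
  then have "0 < \<epsilon> * B + lmax" using lmin lmm by linarith
  then show ?thesis using s1 nonneg unfolding R_def by (intro divide_pos_pos mult_pos_pos) auto
qed

lemma N0: "0 \<le> N" using R0 B4 s1 by (simp add: N_def)

lemma \<beta>sN: "0 \<le> \<beta> * s + N" using nonneg s1 N0 by simp

lemma az_nonneg: "0 \<le> az v i" by (simp add: az_def sum_nonneg)

lemma n1_nonneg: "0 \<le> n1 v" by (simp add: n1_def sum_nonneg)

lemma ip_le_az: "\<bar>ip v i\<bar> \<le> az v i"
  unfolding ip_def az_def by (rule order_trans[OF sum_abs]) (simp add: abs_mult)

lemma az_indS: "az (ind S) i = (\<Sum>r\<in>S. \<bar>z i r\<bar>)"
proof -
  have "az (ind S) i = (\<Sum>r\<in>J. if r \<in> S then \<bar>z i r\<bar> else 0)"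
    unfolding az_def ind_def by (intro sum.cong) auto
  also have "\<dots> = (\<Sum>r\<in>J \<inter> S. \<bar>z i r\<bar>)" using fin by (simp add: sum.inter_restrict)
  also have "J \<inter> S = S" using sub by auto
  finally show ?thesis .
qed

lemma az_indr: "r \<in> J \<Longrightarrow> az (ind {r}) i = \<bar>z i r\<bar>"
proof -
  assume r: "r \<in> J"
  have "az (ind {r}) i = (\<Sum>c\<in>J. if c = r then \<bar>z i c\<bar> else 0)"
    unfolding az_def ind_def by (intro sum.cong) auto
  then show ?thesis using r fin by simp
qed

lemma n1_indS: "n1 (ind S) = s"
proof -
  have "n1 (ind S) = (\<Sum>r\<in>J. if r \<in> S then 1 else 0)"
    unfolding n1_def ind_def by (intro sum.cong) auto
  also have "\<dots> = (\<Sum>r\<in>J \<inter> S. 1)"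
    by (rule sum.inter_restrict[symmetric, where g = "\<lambda>_. 1"]) (rule fin)
  also have "J \<inter> S = S" using sub by auto
  finally show ?thesis by (simp add: s_def)
qed

lemma n1_indr: "r \<in> J \<Longrightarrow> n1 (ind {r}) = 1"
proof -
  assume r: "r \<in> J"
  have "n1 (ind {r}) = (\<Sum>c\<in>J. if c = r then 1 else 0)"
    unfolding n1_def ind_def by (intro sum.cong) auto
  then show ?thesis using r fin by simp
qed

text \<open>Expanding the products and exchanging sums leaves entrywise averages, each at most
  \<open>C\<close>; the l1 norms are the total mass of the coefficients. The trilinear version below
  is the same with one more factor.\<close>

lemma bilinear_bound:
  "(\<Sum>i\<in>I. w i * \<bar>f'' i (\<eta> i)\<bar> * (az a i * az b i)) \<le> C * (n1 a * n1 b)"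
proof -
  have "(\<Sum>i\<in>I. w i * \<bar>f'' i (\<eta> i)\<bar> * (az a i * az b i))
      = (\<Sum>i\<in>I. \<Sum>r\<in>J. \<Sum>c\<in>J. (\<bar>a r\<bar> * \<bar>b c\<bar>) * (w i * \<bar>f'' i (\<eta> i)\<bar> * (\<bar>z i r\<bar> * \<bar>z i c\<bar>)))"
    unfolding az_def sum_product unfolding sum_distrib_left by (intro sum.cong refl) (simp add: algebra_simps)
  also have "\<dots> = (\<Sum>r\<in>J. \<Sum>c\<in>J. \<Sum>i\<in>I. (\<bar>a r\<bar> * \<bar>b c\<bar>) * (w i * \<bar>f'' i (\<eta> i)\<bar> * (\<bar>z i r\<bar> * \<bar>z i c\<bar>)))"
    by (subst sum.swap[of _ J I], intro sum.cong refl, subst sum.swap[of _ J I]) simp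
  also have "\<dots> = (\<Sum>r\<in>J. \<Sum>c\<in>J. (\<bar>a r\<bar> * \<bar>b c\<bar>) * (\<Sum>i\<in>I. w i * \<bar>f'' i (\<eta> i)\<bar> * (\<bar>z i r\<bar> * \<bar>z i c\<bar>)))"
    by (simp add: sum_distrib_left)
  also have "\<dots> \<le> (\<Sum>r\<in>J. \<Sum>c\<in>J. (\<bar>a r\<bar> * \<bar>b c\<bar>) * C)"
    by (intro sum_mono mult_left_mono C2) auto
  also have "\<dots> = C * (n1 a * n1 b)"
    unfolding n1_def sum_product unfolding sum_distrib_left by (intro sum.cong refl) (simp add: algebra_simps)
  finally show ?thesis .
qed

lemma trilinear_bound:
  "(\<Sum>i\<in>I. w i * Mf i * (az a i * az b i * az c i)) \<le> C * (n1 a * n1 b * n1 c)"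
proof -
  have prod3: "sum x J * sum y J * sum t J = (\<Sum>r\<in>J. \<Sum>q\<in>J. \<Sum>p\<in>J. x r * (y q * t p))" for x y t :: "'r \<Rightarrow> real"
    by (simp only: sum_distrib_left[symmetric] sum_distrib_right[symmetric] mult.assoc)
  have az3: "az a i * az b i * az c i
      = (\<Sum>r\<in>J. \<Sum>q\<in>J. \<Sum>p\<in>J. (\<bar>a r\<bar> * \<bar>z i r\<bar>) * ((\<bar>b q\<bar> * \<bar>z i q\<bar>) * (\<bar>c p\<bar> * \<bar>z i p\<bar>)))" for i
    unfolding az_def by (rule prod3)
  have n3: "n1 a * n1 b * n1 c = (\<Sum>r\<in>J. \<Sum>q\<in>J. \<Sum>p\<in>J. \<bar>a r\<bar> * (\<bar>b q\<bar> * \<bar>c p\<bar>))"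
    unfolding n1_def by (rule prod3)
  have "(\<Sum>i\<in>I. w i * Mf i * (az a i * az b i * az c i))
      = (\<Sum>i\<in>I. \<Sum>r\<in>J. \<Sum>q\<in>J. \<Sum>p\<in>J. (\<bar>a r\<bar> * \<bar>b q\<bar> * \<bar>c p\<bar>) * (w i * Mf i * (\<bar>z i r\<bar> * \<bar>z i q\<bar> * \<bar>z i p\<bar>)))"
    unfolding az3 sum_distrib_left by (intro sum.cong refl) (simp add: algebra_simps)
  also have "\<dots> = (\<Sum>r\<in>J. \<Sum>q\<in>J. \<Sum>p\<in>J. \<Sum>i\<in>I. (\<bar>a r\<bar> * \<bar>b q\<bar> * \<bar>c p\<bar>) * (w i * Mf i * (\<bar>z i r\<bar> * \<bar>z i q\<bar> * \<bar>z i p\<bar>)))"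
    by (subst sum.swap[of _ J I], intro sum.cong refl, subst sum.swap[of _ J I], intro sum.cong refl,
        subst sum.swap[of _ J I]) simp
  also have "\<dots> = (\<Sum>r\<in>J. \<Sum>q\<in>J. \<Sum>p\<in>J. (\<bar>a r\<bar> * \<bar>b q\<bar> * \<bar>c p\<bar>) * (\<Sum>i\<in>I. w i * Mf i * (\<bar>z i r\<bar> * \<bar>z i q\<bar> * \<bar>z i p\<bar>)))"
    by (simp add: sum_distrib_left)
  also have "\<dots> \<le> (\<Sum>r\<in>J. \<Sum>q\<in>J. \<Sum>p\<in>J. (\<bar>a r\<bar> * \<bar>b q\<bar> * \<bar>c p\<bar>) * C)"
    by (intro sum_mono mult_left_mono C3) auto
  also have "\<dots> = C * (n1 a * n1 b * n1 c)"
    unfolding n3 sum_distrib_left by (intro sum.cong refl) (simp add: algebra_simps)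
  finally show ?thesis .
qed

lemma lip_at: "i \<in> I \<Longrightarrow> \<bar>f'' i \<xi> - f'' i (\<eta> i)\<bar> \<le> Mf i * \<bar>\<xi> - \<eta> i\<bar>"
  using lip[of i "\<xi> - \<eta> i"] by simp

lemma bias_az: "i \<in> I \<Longrightarrow> w i \<noteq> 0 \<Longrightarrow> \<bar>ip \<theta> i - \<eta> i\<bar> \<le> \<beta> * az (ind S) i"
  using bias unfolding ip_def az_indS .

lemma f'_mvt:
  assumes "i \<in> I"
  obtains \<xi> where "f' i t - f' i q = f'' i \<xi> * (t - q)" "\<bar>\<xi> - q\<bar> \<le> \<bar>t - q\<bar>"
proof (cases t q rule: linorder_cases)
  case less
  from MVT2[OF less, of "f' i" "f'' i"] f''[OF assms]
  obtain \<xi> where "t < \<xi>" "\<xi> < q" "f' i q - f' i t = (q - t) * f'' i \<xi>" by blast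
  with that[of \<xi>] show ?thesis by (simp add: algebra_simps)
next
  case equal
  with that[of q] show ?thesis by simp
next
  case greater
  from MVT2[OF greater, of "f' i" "f'' i"] f''[OF assms]
  obtain \<xi> where "q < \<xi>" "\<xi> < t" "f' i t - f' i q = (t - q) * f'' i \<xi>" by blast
  with that[of \<xi>] show ?thesis by (simp add: algebra_simps)
qed

lemma f_taylor:
  assumes "i \<in> I"
  obtains \<xi> where "f i t = f i q + f' i q * (t - q) + f'' i \<xi> / 2 * (t - q)\<^sup>2" "\<bar>\<xi> - q\<bar> \<le> \<bar>t - q\<bar>"
proof (cases "t = q")
  case True
  with that[of q] show ?thesis by simp
next
  case False
  define D where "D = (\<lambda>m::nat. if m = 0 then f i else if m = 1 then f' i else f'' i)"
  have "\<exists>\<xi>. (if t < q then t < \<xi> \<and> \<xi> < q else q < \<xi> \<and> \<xi> < t) \<and>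
      f i t = (\<Sum>m<2. D m q / fact m * (t - q) ^ m) + D 2 \<xi> / fact 2 * (t - q) ^ 2"
  proof (rule Taylor[where a = "min t q" and b = "max t q"])
    show "\<forall>m x. m < 2 \<and> min t q \<le> x \<and> x \<le> max t q \<longrightarrow> (D m has_real_derivative D (Suc m) x) (at x)"
      using f'[OF assms] f''[OF assms] by (auto simp: D_def less_2_cases_iff)
  qed (use False in \<open>auto simp: D_def\<close>)
  then obtain \<xi> where "if t < q then t < \<xi> \<and> \<xi> < q else q < \<xi> \<and> \<xi> < t"
    "f i t = f i q + f' i q * (t - q) + f'' i \<xi> / 2 * (t - q)\<^sup>2"
    by (auto simp: D_def numeral_2_eq_2)
  with that[of \<xi>] show ?thesis by (auto split: if_splits)
qed

text \<open>Curvature at points near the truth, possibly a different one for each observation, is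
  exchanged for curvature at the truth. The Lipschitz bound turns the distance of the points into a
  third factor, and the trilinear bound finishes. Zero weights are set apart because the bias is
  controlled only inside the kernel window.\<close>

lemma curvature_perturbation:
  assumes "\<And>i. i \<in> I \<Longrightarrow> w i \<noteq> 0 \<Longrightarrow> \<bar>\<xi> i - \<eta> i\<bar> \<le> \<beta> * az (ind S) i + az u i"
    and "\<And>i. i \<in> I \<Longrightarrow> \<bar>x i\<bar> \<le> az a i" "\<And>i. i \<in> I \<Longrightarrow> \<bar>y i\<bar> \<le> az b i"
  shows "\<bar>(\<Sum>i\<in>I. w i * f'' i (\<xi> i) * (x i * y i)) - (\<Sum>i\<in>I. w i * f'' i (\<eta> i) * (x i * y i))\<bar>
    \<le> C * ((\<beta> * s + n1 u) * (n1 a * n1 b))"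
proof -
  have "\<bar>(\<Sum>i\<in>I. w i * f'' i (\<xi> i) * (x i * y i)) - (\<Sum>i\<in>I. w i * f'' i (\<eta> i) * (x i * y i))\<bar>
      = \<bar>\<Sum>i\<in>I. w i * (f'' i (\<xi> i) - f'' i (\<eta> i)) * (x i * y i)\<bar>"
    by (simp add: sum_subtractf[symmetric] algebra_simps)
  also have "\<dots> \<le> (\<Sum>i\<in>I. \<bar>w i * (f'' i (\<xi> i) - f'' i (\<eta> i)) * (x i * y i)\<bar>)" by (rule sum_abs)
  also have "\<dots> \<le> (\<Sum>i\<in>I. \<beta> * (w i * Mf i * (az (ind S) i * az a i * az b i)) + w i * Mf i * (az u i * az a i * az b i))"
  proof (intro sum_mono)
    fix i assume i: "i \<in> I"
    show "\<bar>w i * (f'' i (\<xi> i) - f'' i (\<eta> i)) * (x i * y i)\<bar>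
      \<le> \<beta> * (w i * Mf i * (az (ind S) i * az a i * az b i)) + w i * Mf i * (az u i * az a i * az b i)"
    proof (cases "w i = 0")
      case False
      have "\<bar>f'' i (\<xi> i) - f'' i (\<eta> i)\<bar> \<le> Mf i * (\<beta> * az (ind S) i + az u i)"
        using lip_at[OF i, of "\<xi> i"] assms(1)[OF i False] Mf[OF i]
        by (meson mult_left_mono order_trans)
      then have "w i * \<bar>f'' i (\<xi> i) - f'' i (\<eta> i)\<bar> * (\<bar>x i\<bar> * \<bar>y i\<bar>)
          \<le> w i * (Mf i * (\<beta> * az (ind S) i + az u i)) * (az a i * az b i)"
        using w[OF i] Mf[OF i] nonneg az_nonneg assms(2,3)[OF i]
        by (intro mult_mono mult_left_mono) auto
      then have "\<bar>w i * (f'' i (\<xi> i) - f'' i (\<eta> i)) * (x i * y i)\<bar>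
          \<le> w i * (Mf i * (\<beta> * az (ind S) i + az u i)) * (az a i * az b i)"
        using w[OF i] by (simp add: abs_mult)
      also have "\<dots> = \<beta> * (w i * Mf i * (az (ind S) i * az a i * az b i)) + w i * Mf i * (az u i * az a i * az b i)"
        by (simp add: algebra_simps)
      finally show ?thesis .
    qed simp
  qed
  also have "\<dots> = \<beta> * (\<Sum>i\<in>I. w i * Mf i * (az (ind S) i * az a i * az b i)) + (\<Sum>i\<in>I. w i * Mf i * (az u i * az a i * az b i))"
    by (simp add: sum.distrib sum_distrib_left)
  also have "\<dots> \<le> \<beta> * (C * (n1 (ind S) * n1 a * n1 b)) + C * (n1 u * n1 a * n1 b)"
    using nonneg by (intro add_mono mult_left_mono trilinear_bound) auto
  also have "\<dots> = C * ((\<beta> * s + n1 u) * (n1 a * n1 b))"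
    by (simp add: n1_indS algebra_simps)
  finally show ?thesis .
qed

text \<open>The mean value theorem moves the score from \<eta> to the predictor of \<theta>. The
  curvature at the intermediate point is its value at the truth plus a Lipschitz term, which gives
  the linear and the quadratic part of \<open>\<epsilon>\<close>.\<close>

lemma gradient_bound:
  assumes r: "r \<in> J"
  shows "\<bar>\<Sum>i\<in>I. w i * f' i (ip \<theta> i) * z i r\<bar> \<le> \<epsilon>"
proof -
  have tm: "\<bar>w i * (f' i (ip \<theta> i) - f' i (\<eta> i)) * z i r\<bar>
      \<le> \<beta> * (w i * \<bar>f'' i (\<eta> i)\<bar> * (az (ind S) i * az (ind {r}) i))
        + \<beta>\<^sup>2 * (w i * Mf i * (az (ind S) i * az (ind S) i * az (ind {r}) i))" if i: "i \<in> I" for i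
  proof (cases "w i = 0")
    case False
    define b where "b = \<beta> * az (ind S) i"
    have b: "\<bar>ip \<theta> i - \<eta> i\<bar> \<le> b" using bias_az[OF i False] by (simp add: b_def)
    then have b0: "0 \<le> b" by linarith
    obtain \<xi> where \<xi>: "f' i (ip \<theta> i) - f' i (\<eta> i) = f'' i \<xi> * (ip \<theta> i - \<eta> i)" "\<bar>\<xi> - \<eta> i\<bar> \<le> \<bar>ip \<theta> i - \<eta> i\<bar>"
      by (rule f'_mvt[OF i])
    have "\<bar>f'' i \<xi>\<bar> \<le> \<bar>f'' i (\<eta> i)\<bar> + Mf i * b"
      using lip_at[OF i, of \<xi>] \<xi>(2) b Mf[OF i] mult_left_mono[of "\<bar>\<xi> - \<eta> i\<bar>" b "Mf i"] by linarith
    then have "\<bar>f' i (ip \<theta> i) - f' i (\<eta> i)\<bar> \<le> (\<bar>f'' i (\<eta> i)\<bar> + Mf i * b) * b"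
      unfolding \<xi>(1) abs_mult using b by (intro mult_mono) auto
    then have "w i * \<bar>f' i (ip \<theta> i) - f' i (\<eta> i)\<bar> * \<bar>z i r\<bar> \<le> w i * ((\<bar>f'' i (\<eta> i)\<bar> + Mf i * b) * b) * \<bar>z i r\<bar>"
      using w[OF i] by (intro mult_right_mono mult_left_mono) auto
    then have "\<bar>w i * (f' i (ip \<theta> i) - f' i (\<eta> i)) * z i r\<bar> \<le> w i * ((\<bar>f'' i (\<eta> i)\<bar> + Mf i * b) * b) * \<bar>z i r\<bar>"
      using w[OF i] by (simp add: abs_mult)
    also have "\<dots> = \<beta> * (w i * \<bar>f'' i (\<eta> i)\<bar> * (az (ind S) i * az (ind {r}) i))
        + \<beta>\<^sup>2 * (w i * Mf i * (az (ind S) i * az (ind S) i * az (ind {r}) i))"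
      by (simp add: az_indr[OF r] b_def algebra_simps power2_eq_square)
    finally show ?thesis .
  qed simp
  have "\<bar>(\<Sum>i\<in>I. w i * f' i (ip \<theta> i) * z i r) - (\<Sum>i\<in>I. w i * f' i (\<eta> i) * z i r)\<bar>
      = \<bar>\<Sum>i\<in>I. w i * (f' i (ip \<theta> i) - f' i (\<eta> i)) * z i r\<bar>"
    by (simp add: sum_subtractf[symmetric] algebra_simps)
  also have "\<dots> \<le> (\<Sum>i\<in>I. \<bar>w i * (f' i (ip \<theta> i) - f' i (\<eta> i)) * z i r\<bar>)" by (rule sum_abs)
  also have "\<dots> \<le> (\<Sum>i\<in>I. \<beta> * (w i * \<bar>f'' i (\<eta> i)\<bar> * (az (ind S) i * az (ind {r}) i))
        + \<beta>\<^sup>2 * (w i * Mf i * (az (ind S) i * az (ind S) i * az (ind {r}) i)))"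
    by (intro sum_mono tm)
  also have "\<dots> = \<beta> * (\<Sum>i\<in>I. w i * \<bar>f'' i (\<eta> i)\<bar> * (az (ind S) i * az (ind {r}) i))
        + \<beta>\<^sup>2 * (\<Sum>i\<in>I. w i * Mf i * (az (ind S) i * az (ind S) i * az (ind {r}) i))"
    by (simp add: sum.distrib sum_distrib_left)
  also have "\<dots> \<le> \<beta> * (C * (n1 (ind S) * n1 (ind {r}))) + \<beta>\<^sup>2 * (C * (n1 (ind S) * n1 (ind S) * n1 (ind {r})))"
    using nonneg by (intro add_mono mult_left_mono trilinear_bound bilinear_bound) auto
  also have "\<dots> = C * (\<beta> * s + (\<beta> * s)\<^sup>2)"
    by (simp add: n1_indS n1_indr[OF r] algebra_simps power2_eq_square)
  finally show ?thesis using score[OF r] unfolding \<epsilon>_def by linarith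
qed

lemma ip_add: "ip (\<lambda>r. u r + t * v r) i = ip u i + t * ip v i"
  unfolding ip_def by (simp add: sum.distrib sum_distrib_left algebra_simps)

lemma gradient_ip:
  "(\<Sum>i\<in>I. w i * g i * ip v i) = (\<Sum>r\<in>J. v r * (\<Sum>i\<in>I. w i * g i * z i r))"
proof -
  have "(\<Sum>i\<in>I. w i * g i * ip v i) = (\<Sum>i\<in>I. \<Sum>r\<in>J. v r * (w i * g i * z i r))"
    unfolding ip_def by (simp add: sum_distrib_left algebra_simps)
  also have "\<dots> = (\<Sum>r\<in>J. v r * (\<Sum>i\<in>I. w i * g i * z i r))"
    by (subst sum.swap) (simp add: sum_distrib_left)
  finally show ?thesis .
qed

lemma gradient_n1: "\<bar>\<Sum>i\<in>I. w i * f' i (ip \<theta> i) * ip v i\<bar> \<le> \<epsilon> * n1 v"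
proof -
  have "\<bar>\<Sum>i\<in>I. w i * f' i (ip \<theta> i) * ip v i\<bar> \<le> (\<Sum>r\<in>J. \<bar>v r * (\<Sum>i\<in>I. w i * f' i (ip \<theta> i) * z i r)\<bar>)"
    unfolding gradient_ip by (rule sum_abs)
  also have "\<dots> \<le> (\<Sum>r\<in>J. \<bar>v r\<bar> * \<epsilon>)"
    unfolding abs_mult by (intro sum_mono mult_left_mono gradient_bound) auto
  also have "\<dots> = \<epsilon> * n1 v" by (simp add: n1_def sum_distrib_left mult.commute)
  finally show ?thesis .
qed

text \<open>Off \<open>S\<close> the vector \<theta> vanishes, so there the penalty grows by the
  full weight of \<open>v\<close>; on \<open>S\<close> the triangle inequality limits the decrease
  to that weight.\<close>

lemma penalty_diff:
  "(\<Sum>r\<in>J - S. lam r * \<bar>v r\<bar>) - (\<Sum>r\<in>S. lam r * \<bar>v r\<bar>)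
    \<le> (\<Sum>r\<in>J. lam r * \<bar>\<theta> r + v r\<bar>) - (\<Sum>r\<in>J. lam r * \<bar>\<theta> r\<bar>)"
proof -
  have J: "J = S \<union> (J - S)" "S \<inter> (J - S) = {}" using sub by auto
  have split: "(\<Sum>r\<in>J. g r) = (\<Sum>r\<in>S. g r) + (\<Sum>r\<in>J - S. g r)" for g :: "'r \<Rightarrow> real"
    using fin finS by (subst J(1), subst sum.union_disjoint) (use J in auto)
  have l0: "0 \<le> lam r" if "r \<in> J" for r using lam[OF that] lmin by linarith
  have \<theta>0: "\<theta> r = 0" if "r \<in> J - S" for r using \<theta>_supp[of r] that sub by auto
  have "(\<Sum>r\<in>J - S. lam r * \<bar>\<theta> r + v r\<bar>) = (\<Sum>r\<in>J - S. lam r * \<bar>v r\<bar>)"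
    by (intro sum.cong refl) (simp add: \<theta>0)
  moreover have "(\<Sum>r\<in>J - S. lam r * \<bar>\<theta> r\<bar>) = 0"
    by (intro sum.neutral) (simp add: \<theta>0)
  moreover have "(\<Sum>r\<in>S. lam r * \<bar>\<theta> r\<bar>) \<le> (\<Sum>r\<in>S. lam r * \<bar>\<theta> r + v r\<bar> + lam r * \<bar>v r\<bar>)"
    unfolding distrib_left[symmetric] using l0 sub by (intro sum_mono mult_left_mono) auto
  ultimately show ?thesis unfolding split by (simp add: sum.distrib)
qed

lemma likelihood_ip_diff_le:
  "(\<Sum>i\<in>I. w i * f i (ip \<theta> i + ip v i)) - (\<Sum>i\<in>I. w i * f i (ip \<theta> i)) \<le> \<epsilon> * n1 v"
proof -
  have "(\<Sum>i\<in>I. w i * f i (ip \<theta> i + ip v i)) \<le> (\<Sum>i\<in>I. w i * f i (ip \<theta> i) + w i * f' i (ip \<theta> i) * ip v i)"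
  proof (intro sum_mono)
    fix i assume i: "i \<in> I"
    obtain \<xi> where "f i (ip \<theta> i + ip v i) = f i (ip \<theta> i) + f' i (ip \<theta> i) * ip v i + f'' i \<xi> / 2 * (ip v i)\<^sup>2"
      using f_taylor[OF i, of "ip \<theta> i + ip v i" "ip \<theta> i"] by (metis add_diff_cancel_left')
    moreover have "f'' i \<xi> / 2 * (ip v i)\<^sup>2 \<le> 0"
      using neg[OF i, of \<xi>] by (intro mult_nonpos_nonneg) auto
    ultimately have "f i (ip \<theta> i + ip v i) \<le> f i (ip \<theta> i) + f' i (ip \<theta> i) * ip v i" by linarith
    from mult_left_mono[OF this w[OF i]]
    show "w i * f i (ip \<theta> i + ip v i) \<le> w i * f i (ip \<theta> i) + w i * f' i (ip \<theta> i) * ip v i"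
      by (simp add: algebra_simps)
  qed
  then show ?thesis using gradient_n1[of v] by (simp add: sum.distrib)
qed

text \<open>Second-order Taylor expansion at \<theta>. The restricted eigenvalue condition is
  available only at the truth, so the curvature at the intermediate points is first exchanged for
  the one at \<eta>; the term with \<open>C\<close> is the price.\<close>

lemma likelihood_ip_diff_curvature:
  assumes cone: "n1 v \<le> B * (\<Sum>r\<in>S. \<bar>v r\<bar>)"
  shows "(\<Sum>i\<in>I. w i * f i (ip \<theta> i + ip v i)) - (\<Sum>i\<in>I. w i * f i (ip \<theta> i))
    \<le> \<epsilon> * n1 v - (\<rho> * (n2 v)\<^sup>2 - C * ((\<beta> * s + n1 v) * (n1 v * n1 v))) / 2"
proof -
  have "\<exists>\<xi>. f i (ip \<theta> i + ip v i) = f i (ip \<theta> i) + f' i (ip \<theta> i) * ip v i + f'' i \<xi> / 2 * (ip v i)\<^sup>2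
      \<and> \<bar>\<xi> - ip \<theta> i\<bar> \<le> \<bar>ip v i\<bar>" if "i \<in> I" for i
    using f_taylor[OF that, of "ip \<theta> i + ip v i" "ip \<theta> i"] by (metis add_diff_cancel_left')
  then obtain \<xi> where \<xi>: "\<And>i. i \<in> I \<Longrightarrow> f i (ip \<theta> i + ip v i)
      = f i (ip \<theta> i) + f' i (ip \<theta> i) * ip v i + f'' i (\<xi> i) / 2 * (ip v i)\<^sup>2"
    "\<And>i. i \<in> I \<Longrightarrow> \<bar>\<xi> i - ip \<theta> i\<bar> \<le> \<bar>ip v i\<bar>" by metis
  have "(\<Sum>i\<in>I. w i * f i (ip \<theta> i + ip v i)) - (\<Sum>i\<in>I. w i * f i (ip \<theta> i))
      = (\<Sum>i\<in>I. w i * f' i (ip \<theta> i) * ip v i) + (\<Sum>i\<in>I. w i * f'' i (\<xi> i) * (ip v i * ip v i)) / 2"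
    by (simp add: \<xi>(1) sum_subtractf[symmetric] sum.distrib[symmetric] sum_divide_distrib power2_eq_square
        algebra_simps cong: sum.cong)
  moreover have "\<bar>(\<Sum>i\<in>I. w i * f'' i (\<xi> i) * (ip v i * ip v i)) - (\<Sum>i\<in>I. w i * f'' i (\<eta> i) * (ip v i * ip v i))\<bar>
      \<le> C * ((\<beta> * s + n1 v) * (n1 v * n1 v))"
  proof (rule curvature_perturbation)
    fix i assume i: "i \<in> I" "w i \<noteq> 0"
    show "\<bar>\<xi> i - \<eta> i\<bar> \<le> \<beta> * az (ind S) i + az v i"
      using \<xi>(2)[OF i(1)] bias_az[OF i] ip_le_az[of v i] by linarith
  qed (rule ip_le_az)+
  moreover have "\<rho> * (n2 v)\<^sup>2 \<le> - (\<Sum>i\<in>I. w i * f'' i (\<eta> i) * (ip v i * ip v i))"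
    using RE[of v] cone by (simp add: n1_def ip_def sum_negf power2_eq_square)
  ultimately show ?thesis using gradient_n1[of v] by argo
qed

text \<open>The lasso cone argument. The gradient is dominated by a quarter of the smallest penalty,
  so the l1 mass off \<open>S\<close> is paid for by the mass on \<open>S\<close>; collecting terms
  gives the factor \<open>2 * (1 + lmax / lmin)\<close>, the origin of the lower bound on
  \<open>B\<close>.\<close>

lemma cone_of_improvement:
  assumes imp: "F \<theta> \<le> F (\<lambda>r. \<theta> r + v r)" and \<epsilon>: "\<epsilon> \<le> lmin / 4"
  shows "n1 v \<le> B * (\<Sum>r\<in>S. \<bar>v r\<bar>)"
proof -
  let ?a = "\<Sum>r\<in>S. \<bar>v r\<bar>" and ?b = "\<Sum>r\<in>J - S. \<bar>v r\<bar>"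
  have n1: "n1 v = ?a + ?b"
    unfolding n1_def using sum.subset_diff[OF sub(2) fin(2), of "\<lambda>r. \<bar>v r\<bar>"] by simp
  have ab: "0 \<le> ?a" "0 \<le> ?b" by (auto intro: sum_nonneg)
  have "(\<Sum>r\<in>J - S. lam r * \<bar>v r\<bar>) - (\<Sum>r\<in>S. lam r * \<bar>v r\<bar>) \<le> \<epsilon> * n1 v"
    using imp likelihood_ip_diff_le[of v] penalty_diff[of v] ip_add[of \<theta> 1 v] unfolding F_def by simp
  moreover have "lmin * ?b \<le> (\<Sum>r\<in>J - S. lam r * \<bar>v r\<bar>)"
    unfolding sum_distrib_left using lam by (intro sum_mono mult_right_mono) auto
  moreover have "(\<Sum>r\<in>S. lam r * \<bar>v r\<bar>) \<le> lmax * ?a"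
    unfolding sum_distrib_left using lam sub by (intro sum_mono mult_right_mono) auto
  moreover have "\<epsilon> * n1 v \<le> lmin / 4 * n1 v" using \<epsilon> n1_nonneg by (rule mult_right_mono)
  ultimately have "lmin * ?b - lmax * ?a \<le> lmin / 4 * (?a + ?b)" unfolding n1 by linarith
  then have "3 * (lmin * ?b) \<le> 4 * (lmax * ?a) + lmin * ?a" by argo
  moreover have "lmin * ?a \<le> lmax * ?a" using lmm ab(1) by (rule mult_right_mono)
  moreover have "0 \<le> lmin * ?a" using lmin ab by simp
  ultimately have ba: "lmin * ?b \<le> lmin * ?a + 2 * (lmax * ?a)" by linarith
  then have "lmin * n1 v \<le> lmin * ((2 * (1 + lmax / lmin)) * ?a)"
  proof -
    have "lmin * (2 * (1 + lmax / lmin)) = 2 * lmin + 2 * lmax" using lmin by (simp add: field_simps)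
    then have "lmin * ((2 * (1 + lmax / lmin)) * ?a) = (2 * lmin + 2 * lmax) * ?a" by (simp only: mult.assoc[symmetric])
    also have "\<dots> = 2 * (lmin * ?a) + 2 * (lmax * ?a)" by (simp add: algebra_simps)
    finally show ?thesis unfolding n1 using ba by (simp add: distrib_left)
  qed
  then have "n1 v \<le> (2 * (1 + lmax / lmin)) * ?a" using lmin by simp
  also have "\<dots> \<le> B * ?a" using B ab(1) by (rule mult_right_mono)
  finally show ?thesis .
qed

lemma n1_le_of_cone:
  assumes "n1 v \<le> B * (\<Sum>r\<in>S. \<bar>v r\<bar>)"
  shows "n1 v \<le> B * sqrt s * n2 v"
proof -
  have "B * (\<Sum>r\<in>S. \<bar>v r\<bar>) \<le> B * (sqrt s * n2 v)"
    using sum_abs_le_sqrt_card[OF fin(2) sub(2), of v] B4 by (intro mult_left_mono) (auto simp: s_def)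
  then show ?thesis using assms by simp
qed

section \<open>Radius, curvature and oracle gradient when noise and third-order terms are
  small\<close>

context
  assumes \<epsilon>_small: "\<epsilon> \<le> lmin / 4"
    and R_small: "C * (\<beta> * s + N) * (B\<^sup>2 * s) \<le> \<rho> / 2"
begin

text \<open>Comparing gain and loss gives \<open>\<rho> / 4 * (n2 v)^2 \<le> (\<epsilon> * B + lmax)
  * sqrt s * n2 v\<close>. The a priori bound by \<open>R\<close> keeps the third-order term below
  the curvature, and the conclusion improves on it by a factor of two.\<close>

lemma improvement_radius:
  assumes imp: "F \<theta> \<le> F (\<lambda>r. \<theta> r + v r)" and D: "n2 v \<le> R"
  shows "n2 v \<le> R / 2"
proof (cases "n2 v = 0")
  case True
  then show ?thesis using R0 by simp
next
  case False
  then have D0: "0 < n2 v" using L2_set_nonneg[of v J] by linarith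
  have cone: "n1 v \<le> B * (\<Sum>r\<in>S. \<bar>v r\<bar>)" by (rule cone_of_improvement[OF imp \<epsilon>_small])
  have nD: "n1 v \<le> B * sqrt s * n2 v" by (rule n1_le_of_cone[OF cone])
  have "B * sqrt s * n2 v \<le> N" unfolding N_def using D B4 s1 by (intro mult_left_mono) auto
  with nD have nN: "n1 v \<le> N" by linarith
  have "- (\<Sum>r\<in>S. lam r * \<bar>v r\<bar>) \<le> (\<Sum>r\<in>J - S. lam r * \<bar>v r\<bar>) - (\<Sum>r\<in>S. lam r * \<bar>v r\<bar>)"
  proof -
    have "0 \<le> lam r" if "r \<in> J" for r using lam[OF that] lmin by linarith
    then have "0 \<le> (\<Sum>r\<in>J - S. lam r * \<bar>v r\<bar>)" by (intro sum_nonneg) auto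
    then show ?thesis by simp
  qed
  moreover have "(\<Sum>r\<in>S. lam r * \<bar>v r\<bar>) \<le> lmax * (\<Sum>r\<in>S. \<bar>v r\<bar>)"
    unfolding sum_distrib_left using lam sub by (intro sum_mono mult_right_mono) auto
  moreover have "lmax * (\<Sum>r\<in>S. \<bar>v r\<bar>) \<le> lmax * (sqrt s * n2 v)"
    using sum_abs_le_sqrt_card[OF fin(2) sub(2), of v] lmin lmm by (intro mult_left_mono) (auto simp: s_def)
  ultimately have pen: "- (lmax * (sqrt s * n2 v)) \<le> (\<Sum>r\<in>J. lam r * \<bar>\<theta> r + v r\<bar>) - (\<Sum>r\<in>J. lam r * \<bar>\<theta> r\<bar>)"
    using penalty_diff[of v] by linarith
  have "- (lmax * (sqrt s * n2 v)) \<le> \<epsilon> * n1 v - (\<rho> * (n2 v)\<^sup>2 - C * ((\<beta> * s + n1 v) * (n1 v * n1 v))) / 2"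
    using imp pen likelihood_ip_diff_curvature[OF cone] ip_add[of \<theta> 1 v] unfolding F_def by simp
  \<comment> \<open>Inside the ball of radius \<open>R\<close> the l1 norm is at most
    \<open>N\<close>, and then \<open>R_small\<close> says precisely that the third-order cost
    consumes at most half of the curvature.\<close>
  moreover have "C * ((\<beta> * s + n1 v) * (n1 v * n1 v)) \<le> \<rho> / 2 * (n2 v)\<^sup>2"
  proof -
    have "C * ((\<beta> * s + n1 v) * (n1 v * n1 v))
        \<le> C * ((\<beta> * s + N) * ((B * sqrt s * n2 v) * (B * sqrt s * n2 v)))"
      using nN nD nonneg(1) \<beta>sN n1_nonneg[of v] order_trans[OF n1_nonneg nD]
      by (intro mult_left_mono mult_mono add_left_mono) auto
    also have "\<dots> = C * (\<beta> * s + N) * (B\<^sup>2 * (sqrt s * sqrt s)) * (n2 v)\<^sup>2"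
      by (simp add: power2_eq_square algebra_simps)
    also have "\<dots> = C * (\<beta> * s + N) * (B\<^sup>2 * s) * (n2 v)\<^sup>2" using s1 by simp
    also have "\<dots> \<le> \<rho> / 2 * (n2 v)\<^sup>2" using R_small by (intro mult_right_mono) auto
    finally show ?thesis .
  qed
  moreover have "\<epsilon> * n1 v \<le> \<epsilon> * (B * sqrt s * n2 v)" using nD \<epsilon>0 by (rule mult_left_mono)
  ultimately have "\<rho> / 4 * (n2 v)\<^sup>2 \<le> \<epsilon> * (B * sqrt s * n2 v) + lmax * (sqrt s * n2 v)" by argo
  then have "n2 v * (\<rho> / 4 * n2 v) \<le> n2 v * ((\<epsilon> * B + lmax) * sqrt s)"
    by (simp add: power2_eq_square algebra_simps)
  then have "\<rho> / 4 * n2 v \<le> (\<epsilon> * B + lmax) * sqrt s" using D0 by simp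
  then show ?thesis using nonneg by (simp add: R_def field_simps)
qed

lemma F_concave:
  assumes t: "0 \<le> t" "t \<le> 1"
  shows "(1 - t) * F \<theta> + t * F (\<lambda>r. \<theta> r + v r) \<le> F (\<lambda>r. \<theta> r + t * v r)"
proof -
  have fc: "(1 - t) * f i x + t * f i y \<le> f i ((1 - t) * x + t * y)" if i: "i \<in> I" for i x y
  proof -
    have "concave_on UNIV (f i)"
      by (rule f''_le0_imp_concave[where f'="f' i" and f''="f'' i"]) (use f'[OF i] f''[OF i] neg[OF i] in auto)
    then show ?thesis using t by (auto simp: concave_on_iff)
  qed
  have "(1 - t) * (\<Sum>i\<in>I. w i * f i (ip \<theta> i)) + t * (\<Sum>i\<in>I. w i * f i (ip (\<lambda>r. \<theta> r + v r) i))
      = (\<Sum>i\<in>I. w i * ((1 - t) * f i (ip \<theta> i) + t * f i (ip \<theta> i + ip v i)))"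
    using ip_add[of \<theta> 1 v] by (simp add: sum_distrib_left sum.distrib[symmetric] algebra_simps)
  also have "\<dots> \<le> (\<Sum>i\<in>I. w i * f i ((1 - t) * ip \<theta> i + t * (ip \<theta> i + ip v i)))"
    using w fc by (intro sum_mono mult_left_mono) auto
  also have "\<dots> = (\<Sum>i\<in>I. w i * f i (ip (\<lambda>r. \<theta> r + t * v r) i))"
    by (simp add: ip_add algebra_simps)
  finally have 1: "(1 - t) * (\<Sum>i\<in>I. w i * f i (ip \<theta> i)) + t * (\<Sum>i\<in>I. w i * f i (ip (\<lambda>r. \<theta> r + v r) i))
      \<le> (\<Sum>i\<in>I. w i * f i (ip (\<lambda>r. \<theta> r + t * v r) i))" .
  have "(\<Sum>r\<in>J. lam r * \<bar>\<theta> r + t * v r\<bar>) \<le> (\<Sum>r\<in>J. (1 - t) * (lam r * \<bar>\<theta> r\<bar>) + t * (lam r * \<bar>\<theta> r + v r\<bar>))"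
  proof (intro sum_mono)
    fix r assume r: "r \<in> J"
    have "\<bar>\<theta> r + t * v r\<bar> = \<bar>(1 - t) * \<theta> r + t * (\<theta> r + v r)\<bar>" by (simp add: algebra_simps)
    also have "\<dots> \<le> \<bar>(1 - t) * \<theta> r\<bar> + \<bar>t * (\<theta> r + v r)\<bar>" by (rule abs_triangle_ineq)
    also have "\<dots> = (1 - t) * \<bar>\<theta> r\<bar> + t * \<bar>\<theta> r + v r\<bar>" using t by (simp add: abs_mult)
    finally have "\<bar>\<theta> r + t * v r\<bar> \<le> (1 - t) * \<bar>\<theta> r\<bar> + t * \<bar>\<theta> r + v r\<bar>" .
    from mult_left_mono[OF this, of "lam r"] lam[OF r] lmin
    show "lam r * \<bar>\<theta> r + t * v r\<bar> \<le> (1 - t) * (lam r * \<bar>\<theta> r\<bar>) + t * (lam r * \<bar>\<theta> r + v r\<bar>)"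
      by (simp add: algebra_simps)
  qed
  then have 2: "(\<Sum>r\<in>J. lam r * \<bar>\<theta> r + t * v r\<bar>)
      \<le> (1 - t) * (\<Sum>r\<in>J. lam r * \<bar>\<theta> r\<bar>) + t * (\<Sum>r\<in>J. lam r * \<bar>\<theta> r + v r\<bar>)"
    by (simp add: sum.distrib sum_distrib_left)
  show ?thesis using 1 2 unfolding F_def by (simp add: algebra_simps)
qed

text \<open>A step longer than \<open>R\<close> is shrunk to length exactly \<open>R\<close>.
  Concavity keeps it an improvement over \<theta>, and the self-improvement to \<open>R / 2\<close>
  is then contradictory. Only an inequality between two values of \<open>F\<close> enters.\<close>

lemma estimator_radius:
  assumes est: "F \<theta> \<le> F (\<lambda>r. \<theta> r + v r)"
  shows "n2 v \<le> R" "n1 v \<le> N"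
proof -
  show R: "n2 v \<le> R"
  proof (rule ccontr)
    assume "\<not> n2 v \<le> R"
    then have big: "R < n2 v" by simp
    define t where "t = R / n2 v"
    have t: "0 \<le> t" "t \<le> 1" using big R0 by (auto simp: t_def)
    have "F \<theta> \<le> (1 - t) * F \<theta> + t * F (\<lambda>r. \<theta> r + v r)"
      using mult_left_mono[OF est t(1)] by (simp add: algebra_simps)
    also note F_concave[OF t, of v]
    finally have "F \<theta> \<le> F (\<lambda>r. \<theta> r + t * v r)" .
    moreover have "n2 (\<lambda>r. t * v r) = R"
      using t(1) big R0 L2_set_right_distrib[of t v J] by (simp add: t_def)
    ultimately have "R \<le> R / 2" using improvement_radius[of "\<lambda>r. t * v r"] by simp
    then show False using R0 by simp
  qed
  have "n1 v \<le> B * sqrt s * n2 v"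
    by (rule n1_le_of_cone[OF cone_of_improvement[OF est \<epsilon>_small]])
  also have "\<dots> \<le> N" unfolding N_def using R B4 s1 by (intro mult_left_mono) auto
  finally show "n1 v \<le> N" .
qed

context
  fixes \<theta>t :: "'r \<Rightarrow> real"
  assumes est: "F \<theta> \<le> F \<theta>t"
begin

definition \<delta> :: "'r \<Rightarrow> real" where "\<delta> r = \<theta>t r - \<theta> r"

lemma \<delta>: "n2 \<delta> \<le> R" "n1 \<delta> \<le> N"
  using estimator_radius[of \<delta>] est by (auto simp: \<delta>_def)

lemma ip_\<theta>t: "ip \<theta>t i = ip \<theta> i + ip \<delta> i"
  using ip_add[of \<theta> 1 \<delta> i] by (simp add: \<delta>_def)

lemma pred_error: "i \<in> I \<Longrightarrow> w i \<noteq> 0 \<Longrightarrow> \<bar>ip \<theta>t i - \<eta> i\<bar> \<le> \<beta> * az (ind S) i + az \<delta> i"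
  using bias_az[of i] ip_le_az[of \<delta> i] ip_\<theta>t[of i] by linarith

lemma n1_A:
  assumes "\<And>c. c \<in> J - A \<Longrightarrow> v c = 0"
  shows "n1 v = (\<Sum>r\<in>S. \<bar>v r\<bar>)" "n1 v \<le> sqrt s * n2 v"
proof -
  show *: "n1 v = (\<Sum>r\<in>S. \<bar>v r\<bar>)"
    unfolding n1_def using assms sub fin by (intro sum.mono_neutral_right) auto
  show "n1 v \<le> sqrt s * n2 v"
    unfolding * using sum_abs_le_sqrt_card[OF fin(2) sub(2), of v] by (simp add: s_def)
qed

text \<open>A vector supported on \<open>A\<close> satisfies the cone condition trivially, since its
  l1 mass lies in \<open>S\<close> and \<open>B \<ge> 4\<close>. Exchanging the curvature at the
  preliminary fit for the one at the truth costs at most half of \<rho> by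
  \<open>R_small\<close>.\<close>

lemma curvature_at_estimator:
  assumes v: "\<And>c. c \<in> J - A \<Longrightarrow> v c = 0"
  shows "\<rho> / 2 * (n2 v)\<^sup>2 \<le> - (\<Sum>i\<in>I. w i * f'' i (ip \<theta>t i) * (ip v i * ip v i))"
proof -
  have "(\<Sum>r\<in>J. \<bar>v r\<bar>) \<le> B * (\<Sum>r\<in>S. \<bar>v r\<bar>)"
    using n1_A(1)[OF v] B4 mult_right_mono[of 1 B "\<Sum>r\<in>S. \<bar>v r\<bar>"] by (simp add: n1_def sum_nonneg)
  from RE[OF this] have "\<rho> * (n2 v)\<^sup>2 \<le> - (\<Sum>i\<in>I. w i * f'' i (\<eta> i) * (ip v i * ip v i))"
    by (simp add: ip_def sum_negf power2_eq_square)
  moreover have "\<bar>(\<Sum>i\<in>I. w i * f'' i (ip \<theta>t i) * (ip v i * ip v i)) - (\<Sum>i\<in>I. w i * f'' i (\<eta> i) * (ip v i * ip v i))\<bar>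
      \<le> C * ((\<beta> * s + n1 \<delta>) * (n1 v * n1 v))"
    by (rule curvature_perturbation[OF pred_error]) (auto intro: ip_le_az)
  moreover have "C * ((\<beta> * s + n1 \<delta>) * (n1 v * n1 v)) \<le> \<rho> / 2 * (n2 v)\<^sup>2"
  proof -
    have "C * ((\<beta> * s + n1 \<delta>) * (n1 v * n1 v)) \<le> C * ((\<beta> * s + N) * ((sqrt s * n2 v) * (sqrt s * n2 v)))"
      using n1_A(2)[of v, OF v] \<delta>(2) nonneg(1) \<beta>sN n1_nonneg[of v] order_trans[OF n1_nonneg n1_A(2)[of v, OF v]]
      by (intro mult_left_mono mult_mono add_left_mono) auto
    also have "\<dots> = C * (\<beta> * s + N) * (1 * (sqrt s * sqrt s)) * (n2 v)\<^sup>2"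
      by (simp add: power2_eq_square algebra_simps)
    also have "\<dots> \<le> C * (\<beta> * s + N) * (B\<^sup>2 * (sqrt s * sqrt s)) * (n2 v)\<^sup>2"
      using B4 nonneg s1 N0 one_le_power[of B 2] by (intro mult_right_mono mult_left_mono) auto
    also have "\<dots> = C * (\<beta> * s + N) * (B\<^sup>2 * s) * (n2 v)\<^sup>2" using s1 by simp
    also have "\<dots> \<le> \<rho> / 2 * (n2 v)\<^sup>2" using R_small by (intro mult_right_mono) auto
    finally show ?thesis .
  qed
  ultimately show ?thesis by argo
qed

text \<open>Error budget for the next comparison: the gradient at \<theta>, and two exchanges of
  curvature along \<open>\<delta>\<close>, one at the mean value points and one at the preliminary
  fit.\<close>

definition \<kappa> :: real where "\<kappa> = \<epsilon> + 2 * C * ((\<beta> * s + N) * N)"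

lemma \<kappa>0: "0 \<le> \<kappa>"
  using \<epsilon>0 nonneg s1 N0 by (simp add: \<kappa>_def)

text \<open>Along the shift \<open>\<delta>\<close> from \<theta> to the preliminary fit, the score
  changes by \<open>f'' \<xi>\<close> times the shift. Hence the linearised score at
  \<open>u\<close> is the Hessian form in \<open>u - \<theta>\<close>, plus the gradient at
  \<theta>, plus the difference of the curvatures at \<xi> and at the fit, applied to the shift.
  Expanding around an estimate instead of the truth thus costs only \<kappa>.\<close>

lemma quadratic_gradient_approx:
  assumes r: "r \<in> J"
  shows "\<bar>(\<Sum>i\<in>I. w i * (f' i (ip \<theta>t i) + f'' i (ip \<theta>t i) * (ip u i - ip \<theta>t i)) * z i r)
    - (\<Sum>i\<in>I. w i * f'' i (ip \<theta>t i) * (z i r * (ip u i - ip \<theta> i)))\<bar> \<le> \<kappa>"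
proof -
  have "\<exists>\<xi>. f' i (ip \<theta>t i) = f' i (ip \<theta> i) + f'' i \<xi> * ip \<delta> i \<and> \<bar>\<xi> - ip \<theta> i\<bar> \<le> \<bar>ip \<delta> i\<bar>" if i: "i \<in> I" for i
  proof -
    obtain \<xi> where \<xi>: "f' i (ip \<theta>t i) - f' i (ip \<theta> i) = f'' i \<xi> * (ip \<theta>t i - ip \<theta> i)"
      "\<bar>\<xi> - ip \<theta> i\<bar> \<le> \<bar>ip \<theta>t i - ip \<theta> i\<bar>"
      by (rule f'_mvt[OF i])
    have d: "ip \<theta>t i - ip \<theta> i = ip \<delta> i" using ip_\<theta>t by simp
    show ?thesis using \<xi> unfolding d by (intro exI[of _ \<xi>]) auto
  qed
  then obtain \<xi> where \<xi>: "\<And>i. i \<in> I \<Longrightarrow> f' i (ip \<theta>t i) = f' i (ip \<theta> i) + f'' i (\<xi> i) * ip \<delta> i"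
    "\<And>i. i \<in> I \<Longrightarrow> \<bar>\<xi> i - ip \<theta> i\<bar> \<le> \<bar>ip \<delta> i\<bar>" by metis
  have eq: "(\<Sum>i\<in>I. w i * (f' i (ip \<theta>t i) + f'' i (ip \<theta>t i) * (ip u i - ip \<theta>t i)) * z i r)
      - (\<Sum>i\<in>I. w i * f'' i (ip \<theta>t i) * (z i r * (ip u i - ip \<theta> i)))
    = (\<Sum>i\<in>I. w i * f' i (ip \<theta> i) * z i r)
      + ((\<Sum>i\<in>I. w i * f'' i (\<xi> i) * (z i r * ip \<delta> i)) - (\<Sum>i\<in>I. w i * f'' i (ip \<theta>t i) * (z i r * ip \<delta> i)))"
    unfolding sum_subtractf[symmetric] sum.distrib[symmetric]
  proof (intro sum.cong refl)
    fix i assume i: "i \<in> I"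
    have d: "ip u i - ip \<theta>t i = (ip u i - ip \<theta> i) - ip \<delta> i" using ip_\<theta>t by simp
    show "w i * (f' i (ip \<theta>t i) + f'' i (ip \<theta>t i) * (ip u i - ip \<theta>t i)) * z i r
        - w i * f'' i (ip \<theta>t i) * (z i r * (ip u i - ip \<theta> i))
      = w i * f' i (ip \<theta> i) * z i r
        + (w i * f'' i (\<xi> i) * (z i r * ip \<delta> i) - w i * f'' i (ip \<theta>t i) * (z i r * ip \<delta> i))"
      unfolding \<xi>(1)[OF i] d by (simp add: algebra_simps)
  qed
  have zr: "\<bar>z i r\<bar> \<le> az (ind {r}) i" for i by (simp add: az_indr[OF r])
  have "\<bar>(\<Sum>i\<in>I. w i * f'' i (\<xi> i) * (z i r * ip \<delta> i)) - (\<Sum>i\<in>I. w i * f'' i (\<eta> i) * (z i r * ip \<delta> i))\<bar>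
      \<le> C * ((\<beta> * s + n1 \<delta>) * (n1 (ind {r}) * n1 \<delta>))"
  proof (rule curvature_perturbation)
    fix i assume i: "i \<in> I" "w i \<noteq> 0"
    show "\<bar>\<xi> i - \<eta> i\<bar> \<le> \<beta> * az (ind S) i + az \<delta> i"
      using \<xi>(2)[OF i(1)] bias_az[OF i] ip_le_az[of \<delta> i] by linarith
  qed (rule zr ip_le_az)+
  moreover have "\<bar>(\<Sum>i\<in>I. w i * f'' i (ip \<theta>t i) * (z i r * ip \<delta> i)) - (\<Sum>i\<in>I. w i * f'' i (\<eta> i) * (z i r * ip \<delta> i))\<bar>
      \<le> C * ((\<beta> * s + n1 \<delta>) * (n1 (ind {r}) * n1 \<delta>))"
    by (rule curvature_perturbation[OF pred_error]) (auto intro: zr ip_le_az)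
  moreover have "C * ((\<beta> * s + n1 \<delta>) * (n1 (ind {r}) * n1 \<delta>)) \<le> C * ((\<beta> * s + N) * N)"
    unfolding n1_indr[OF r] using \<delta>(2) nonneg s1 n1_nonneg N0
    by (intro mult_left_mono mult_mono add_left_mono) auto
  ultimately show ?thesis unfolding eq \<kappa>_def using gradient_bound[OF r] by linarith
qed

text \<open>With \<open>v = u - \<theta>\<close>, stationarity on \<open>A\<close> bounds the
  entries of the Hessian form there by \<kappa>; pairing with \<open>v\<close> and using the
  curvature then bounds \<open>n2 v\<close>. Entries off the model follow from the row condition at
  the truth and one more exchange of curvature.\<close>

lemma oracle_gradient:
  assumes u: "\<And>c. c \<in> J - A \<Longrightarrow> u c = 0"
    and stat: "\<And>r. r \<in> A \<Longrightarrow>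
      (\<Sum>i\<in>I. w i * (f' i (ip \<theta>t i) + f'' i (ip \<theta>t i) * (ip u i - ip \<theta>t i)) * z i r) = 0"
    and r: "r \<in> J - A"
  shows "\<bar>\<Sum>i\<in>I. w i * (f' i (ip \<theta>t i) + f'' i (ip \<theta>t i) * (ip u i - ip \<theta>t i)) * z i r\<bar>
    \<le> \<kappa> + (Crow + C * (\<beta> * s + N) * sqrt s) * (2 * \<kappa> * sqrt s / \<rho>)"
proof -
  define v where "v = (\<lambda>r. u r - \<theta> r)"
  have v: "v c = 0" if "c \<in> J - A" for c using u[OF that] \<theta>_supp[OF that] by (simp add: v_def)
  have ipv: "ip u i - ip \<theta> i = ip v i" for i
    by (simp add: ip_def v_def sum_subtractf[symmetric] left_diff_distrib)
  let ?H = "\<lambda>r. \<Sum>i\<in>I. w i * f'' i (ip \<theta>t i) * (z i r * ip v i)"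
  have HA: "\<bar>?H r\<bar> \<le> \<kappa>" if "r \<in> A" for r
    using quadratic_gradient_approx[of r u] stat[OF that] that sub unfolding ipv by auto
  have norm: "n2 v \<le> 2 * \<kappa> * sqrt s / \<rho>"
  proof (cases "n2 v = 0")
    case True
    then show ?thesis using \<kappa>0 s1 nonneg by simp
  next
    case False
    then have D0: "0 < n2 v" using L2_set_nonneg[of v J] by linarith
    have "(\<Sum>i\<in>I. w i * f'' i (ip \<theta>t i) * (ip v i * ip v i)) = (\<Sum>r\<in>J. v r * ?H r)"
      using gradient_ip[of "\<lambda>i. f'' i (ip \<theta>t i) * ip v i" v] by (simp add: algebra_simps)
    \<comment> \<open>Off \<open>A\<close> the vector \<open>v\<close> vanishes, so only entries
      covered by stationarity survive.\<close>
    also have "\<dots> = (\<Sum>r\<in>A. v r * ?H r)"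
      using v sub fin by (intro sum.mono_neutral_right) auto
    finally have "\<rho> / 2 * (n2 v)\<^sup>2 \<le> \<bar>\<Sum>r\<in>A. v r * ?H r\<bar>"
      using curvature_at_estimator[of v, OF v] by linarith
    also have "\<dots> \<le> (\<Sum>r\<in>A. \<bar>v r\<bar> * \<bar>?H r\<bar>)"
      using sum_abs[of "\<lambda>r. v r * ?H r" A] by (simp only: abs_mult)
    also have "\<dots> \<le> (\<Sum>r\<in>A. \<bar>v r\<bar> * \<kappa>)" by (intro sum_mono mult_left_mono HA) auto
    also have "\<dots> = \<kappa> * (\<Sum>r\<in>A. \<bar>v r\<bar>)" by (simp only: sum_distrib_right[symmetric] mult.commute)
    also have "\<dots> \<le> \<kappa> * n1 v"
      unfolding n1_def using \<kappa>0 sub fin by (intro mult_left_mono sum_mono2) auto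
    also have "\<dots> \<le> \<kappa> * (sqrt s * n2 v)" using n1_A(2)[of v] v \<kappa>0 by (intro mult_left_mono) auto
    finally have "n2 v * (\<rho> / 2 * n2 v) \<le> n2 v * (\<kappa> * sqrt s)" by (simp add: power2_eq_square algebra_simps)
    then have "\<rho> / 2 * n2 v \<le> \<kappa> * sqrt s" using D0 by simp
    then show ?thesis using nonneg by (simp add: field_simps)
  qed
  have rJ: "r \<in> J" using r by simp
  have zr: "\<bar>z i r\<bar> \<le> az (ind {r}) i" for i by (simp add: az_indr[OF rJ])
  have "\<bar>?H r - (\<Sum>i\<in>I. w i * f'' i (\<eta> i) * (z i r * ip v i))\<bar> \<le> C * ((\<beta> * s + n1 \<delta>) * (n1 (ind {r}) * n1 v))"
    by (rule curvature_perturbation[OF pred_error]) (auto intro: zr ip_le_az)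
  also have "\<dots> \<le> C * ((\<beta> * s + N) * (sqrt s * n2 v))"
    unfolding n1_indr[OF rJ] mult_1 using \<delta>(2) nonneg(1) \<beta>sN n1_nonneg[of v] n1_A(2)[of v, OF v]
    by (intro mult_left_mono mult_mono add_left_mono) auto
  finally have "\<bar>?H r\<bar> \<le> \<bar>\<Sum>i\<in>I. w i * f'' i (\<eta> i) * (z i r * ip v i)\<bar> + C * ((\<beta> * s + N) * (sqrt s * n2 v))"
    by linarith
  also have "\<bar>\<Sum>i\<in>I. w i * f'' i (\<eta> i) * (z i r * ip v i)\<bar> \<le> Crow * n2 v"
    using row[OF r, of v] v by (simp add: ip_def mult.assoc)
  finally have "\<bar>?H r\<bar> \<le> (Crow + C * (\<beta> * s + N) * sqrt s) * n2 v" by (simp add: algebra_simps)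
  also have "\<dots> \<le> (Crow + C * (\<beta> * s + N) * sqrt s) * (2 * \<kappa> * sqrt s / \<rho>)"
    using norm nonneg s1 N0 by (intro mult_left_mono) auto
  finally show ?thesis using quadratic_gradient_approx[OF rJ, of u] unfolding ipv by linarith
qed

end

end

end

section \<open>The group-penalised quadratic and its unpenalised restriction\<close>

lemma linear_plus_square_nonpos:
  fixes a b :: real
  assumes "\<And>t. t * a + t\<^sup>2 * b \<le> 0"
  shows "a = 0"
proof (rule ccontr)
  assume a: "a \<noteq> 0"
  \<comment> \<open>With this step the linear term equals \<open>t^2 * (1 + |b|)\<close>, strictly
    more than the quadratic term can take away.\<close>
  define t where "t = a / (1 + \<bar>b\<bar>)"
  have t0: "t \<noteq> 0" using a by (simp add: t_def)
  have "1 + \<bar>b\<bar> \<noteq> 0" using abs_ge_zero[of b] by linarith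
  then have "t * (1 + \<bar>b\<bar>) = a" by (simp add: t_def)
  then have "t * a = t\<^sup>2 * (1 + \<bar>b\<bar>)" by (simp add: power2_eq_square mult.assoc)
  then have "t * a + t\<^sup>2 * b = t\<^sup>2 * (1 + \<bar>b\<bar> + b)" by (simp add: algebra_simps)
  moreover have "0 < t\<^sup>2 * (1 + \<bar>b\<bar> + b)" using t0 by (intro mult_pos_pos) auto
  ultimately show False using assms[of t] by simp
qed

lemma sum_double:
  fixes g :: "nat \<Rightarrow> real"
  shows "(\<Sum>r=1..2*d. g r) = (\<Sum>j=1..d. g j + g (d + j))"
proof -
  have "{1..2*d} = {1..d} \<union> {d+1..2*d}" by auto
  then have "(\<Sum>r=1..2*d. g r) = (\<Sum>j=1..d. g j) + (\<Sum>r=d+1..2*d. g r)"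
    by (simp add: sum.union_disjoint)
  also have "(\<Sum>r=d+1..2*d. g r) = (\<Sum>j=1..d. g (d + j))"
    by (rule sum.reindex_bij_witness[of _ "\<lambda>j. d + j" "\<lambda>r. r - d"]) auto
  finally show ?thesis by (simp add: sum.distrib)
qed

text \<open>A concave quadratic with a group penalty that vanishes on \<open>A\<close> and dominates the gradient
  off \<open>A\<close> is maximised only at the maximiser over arrays supported on \<open>A\<close>.\<close>

lemma group_penalty_oracle:
  fixes \<Theta> \<Theta>0 \<Gamma> :: "nat \<Rightarrow> nat \<Rightarrow> real" and p :: "nat \<Rightarrow> real" and H :: "nat \<Rightarrow> (nat \<Rightarrow> real) \<Rightarrow> real"
  assumes fin: "finite K" "finite J" and A: "A \<subseteq> J"
    and gain: "(\<Sum>r\<in>J. p r * L2_set (\<lambda>k. \<Theta> k r) K) - (\<Sum>r\<in>J. p r * L2_set (\<lambda>k. \<Theta>0 k r) K)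
      \<le> (\<Sum>k\<in>K. (\<Sum>r\<in>J. (\<Theta> k r - \<Theta>0 k r) * \<Gamma> k r) + H k (\<lambda>r. \<Theta> k r - \<Theta>0 k r) / 2)"
    and \<Gamma>A: "\<And>k r. k \<in> K \<Longrightarrow> r \<in> A \<Longrightarrow> \<Gamma> k r = 0"
    and \<Gamma>G: "\<And>k r. k \<in> K \<Longrightarrow> r \<in> J - A \<Longrightarrow> \<bar>\<Gamma> k r\<bar> \<le> G"
    and \<Theta>0: "\<And>k r. k \<in> K \<Longrightarrow> r \<in> J - A \<Longrightarrow> \<Theta>0 k r = 0"
    and H: "\<And>k v. k \<in> K \<Longrightarrow> H k v \<le> 0"
    and HA: "\<And>k v. k \<in> K \<Longrightarrow> (\<And>r. r \<in> J - A \<Longrightarrow> v r = 0) \<Longrightarrow> H k v \<le> - (c * (L2_set v J)\<^sup>2)"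
    and c: "0 < c" and pA: "\<And>r. r \<in> A \<Longrightarrow> p r = 0"
    and pG: "\<And>r. r \<in> J - A \<Longrightarrow> sqrt (card K) * G < p r"
  shows "\<And>k r. k \<in> K \<Longrightarrow> r \<in> J \<Longrightarrow> \<Theta> k r = \<Theta>0 k r"
proof -
  let ?n = "\<lambda>r. L2_set (\<lambda>k. \<Theta> k r) K"
  have split: "(\<Sum>r\<in>J. g r) = (\<Sum>r\<in>J - A. g r)" if "\<And>r. r \<in> A \<Longrightarrow> g r = 0" for g :: "nat \<Rightarrow> real"
    using that fin A by (intro sum.mono_neutral_right) auto
  have p0: "(\<Sum>r\<in>J. p r * L2_set (\<lambda>k. \<Theta>0 k r) K) = 0"
  proof (intro sum.neutral ballI)
    fix r assume "r \<in> J"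
    then show "p r * L2_set (\<lambda>k. \<Theta>0 k r) K = 0"
      using pA \<Theta>0 by (cases "r \<in> A") (auto simp: L2_set_def)
  qed
  \<comment> \<open>Summing over observations turns the entrywise bound \<open>G\<close> into
    \<open>sqrt (card K) * G\<close> times a group norm by Cauchy-Schwarz; this is the origin of the
    factor in \<open>pG\<close>.\<close>
  have lin: "(\<Sum>k\<in>K. \<Sum>r\<in>J. (\<Theta> k r - \<Theta>0 k r) * \<Gamma> k r) \<le> (\<Sum>r\<in>J - A. sqrt (card K) * G * ?n r)"
  proof -
    have "(\<Sum>k\<in>K. \<Sum>r\<in>J. (\<Theta> k r - \<Theta>0 k r) * \<Gamma> k r) = (\<Sum>k\<in>K. \<Sum>r\<in>J - A. \<Theta> k r * \<Gamma> k r)"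
      using \<Gamma>A \<Theta>0 by (intro sum.cong refl trans[OF split]) auto
    also have "\<dots> = (\<Sum>r\<in>J - A. \<Sum>k\<in>K. \<Theta> k r * \<Gamma> k r)" by (rule sum.swap)
    also have "\<dots> \<le> (\<Sum>r\<in>J - A. sqrt (card K) * G * ?n r)"
    proof (rule sum_mono)
      fix r assume r: "r \<in> J - A"
      show "(\<Sum>k\<in>K. \<Theta> k r * \<Gamma> k r) \<le> sqrt (card K) * G * ?n r"
      proof (cases "K = {}")
        case False
        then obtain k where "k \<in> K" by blast
        then have G0: "0 \<le> G" using \<Gamma>G[OF _ r] abs_ge_zero order_trans by blast
        have "(\<Sum>k\<in>K. \<Theta> k r * \<Gamma> k r) \<le> (\<Sum>k\<in>K. \<bar>\<Theta> k r\<bar> * G)"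
        proof (rule sum_mono)
          fix k assume k: "k \<in> K"
          have "\<Theta> k r * \<Gamma> k r \<le> \<bar>\<Theta> k r\<bar> * \<bar>\<Gamma> k r\<bar>" by (simp add: abs_mult[symmetric])
          also have "\<dots> \<le> \<bar>\<Theta> k r\<bar> * G" using \<Gamma>G[OF k r] by (intro mult_left_mono) auto
          finally show "\<Theta> k r * \<Gamma> k r \<le> \<bar>\<Theta> k r\<bar> * G" .
        qed
        also have "\<dots> = G * (\<Sum>k\<in>K. \<bar>\<Theta> k r\<bar>)" by (simp add: sum_distrib_left mult.commute)
        also have "\<dots> \<le> G * (sqrt (card K) * ?n r)"
          using sum_abs_le_sqrt_card[OF fin(1) order_refl, of "\<lambda>k. \<Theta> k r"] G0 by (rule mult_left_mono)
        finally show ?thesis by (simp add: mult.commute mult.left_commute)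
      qed simp
    qed
    finally show ?thesis .
  qed
  \<comment> \<open>The penalty surplus. It is nonnegative, yet at most half of a nonpositive
    Hessian form, so it vanishes and with it every group off \<open>A\<close>. The Hessian form then
    vanishes too, and strong curvature on \<open>A\<close> forces equality there.\<close>
  define X where "X = (\<Sum>r\<in>J - A. (p r - sqrt (card K) * G) * ?n r)"
  have XH: "X \<le> (\<Sum>k\<in>K. H k (\<lambda>r. \<Theta> k r - \<Theta>0 k r)) / 2"
    using gain lin split[of "\<lambda>r. p r * ?n r"] pA unfolding p0 X_def
    by (simp add: sum.distrib sum_divide_distrib[symmetric] left_diff_distrib sum_subtractf)
  have Xpos: "0 \<le> (p r - sqrt (card K) * G) * ?n r" if "r \<in> J - A" for r
    using pG[OF that] by (intro mult_nonneg_nonneg L2_set_nonneg) simp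
  have X0: "X = 0"
  proof (rule antisym)
    have "(\<Sum>k\<in>K. H k (\<lambda>r. \<Theta> k r - \<Theta>0 k r)) \<le> 0" by (intro sum_nonpos H)
    then show "X \<le> 0" using XH by simp
    show "0 \<le> X" unfolding X_def by (rule sum_nonneg) (rule Xpos)
  qed
  have off: "\<Theta> k r = 0" if k: "k \<in> K" and r: "r \<in> J - A" for k r
  proof -
    have "(p r - sqrt (card K) * G) * ?n r = 0"
      using X0 sum_nonneg_eq_0_iff[of "J - A" "\<lambda>r. (p r - sqrt (card K) * G) * ?n r"] Xpos r fin
      unfolding X_def by auto
    then have "?n r = 0" using pG[OF r] by simp
    then show ?thesis using L2_set_eq_0_iff[OF fin(1), of "\<lambda>k. \<Theta> k r"] k by simp
  qed
  have supp: "\<Theta> k r - \<Theta>0 k r = 0" if "k \<in> K" "r \<in> J - A" for k r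
    using off[OF that] \<Theta>0[OF that] by simp
  have "(\<Sum>k\<in>K. c * (L2_set (\<lambda>r. \<Theta> k r - \<Theta>0 k r) J)\<^sup>2) \<le> (\<Sum>k\<in>K. - H k (\<lambda>r. \<Theta> k r - \<Theta>0 k r))"
  proof (rule sum_mono)
    fix k assume k: "k \<in> K"
    show "c * (L2_set (\<lambda>r. \<Theta> k r - \<Theta>0 k r) J)\<^sup>2 \<le> - H k (\<lambda>r. \<Theta> k r - \<Theta>0 k r)"
      using HA[OF k, of "\<lambda>r. \<Theta> k r - \<Theta>0 k r"] supp[OF k] by simp
  qed
  also have "\<dots> \<le> 0" using XH X0 by (simp add: sum_negf)
  finally have "(\<Sum>k\<in>K. c * (L2_set (\<lambda>r. \<Theta> k r - \<Theta>0 k r) J)\<^sup>2) = 0"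
    using c by (intro antisym sum_nonneg) auto
  then have z: "c * (L2_set (\<lambda>r. \<Theta> k r - \<Theta>0 k r) J)\<^sup>2 = 0" if "k \<in> K" for k
    using sum_nonneg_eq_0_iff[OF fin(1), of "\<lambda>k. c * (L2_set (\<lambda>r. \<Theta> k r - \<Theta>0 k r) J)\<^sup>2"] c that by auto
  show "\<Theta> k r = \<Theta>0 k r" if "k \<in> K" "r \<in> J" for k r
    using z[OF that(1)] c L2_set_eq_0_iff[OF fin(2), of "\<lambda>r. \<Theta> k r - \<Theta>0 k r"] that by auto
qed

section \<open>Group norms, deviations and the flat regions of the SCAD derivative\<close>

lemma deviation_le_L2_set: "deviation n v \<le> L2_set v {1..n}"
proof (cases "n = 0")
  case True
  then show ?thesis by (simp add: deviation_def)
next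
  case False
  define m where "m = 1 / real n * (\<Sum>l=1..n. v l)"
  have sm: "(\<Sum>l=1..n. v l) = real n * m" using False by (simp add: m_def)
  have "(\<Sum>k=1..n. (v k - m)\<^sup>2) = (\<Sum>k=1..n. (v k)\<^sup>2) - 2 * m * (\<Sum>k=1..n. v k) + real n * m\<^sup>2"
    by (simp add: power2_diff sum.distrib sum_subtractf sum_distrib_left algebra_simps)
  also have "\<dots> = (\<Sum>k=1..n. (v k)\<^sup>2) - real n * m\<^sup>2"
    unfolding sm by (simp add: power2_eq_square algebra_simps)
  also have "\<dots> \<le> (\<Sum>k=1..n. (v k)\<^sup>2)" by simp
  finally show ?thesis
    unfolding deviation_def L2_set_def m_def[symmetric] by (rule real_sqrt_le_mono)
qed

text \<open>Centring is linear and does not increase the Euclidean norm, so an error in the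
  coefficients enters the deviation with factor one.\<close>

lemma deviation_triangle: "deviation n v \<le> deviation n u + L2_set (\<lambda>k. v k - u k) {1..n}"
proof -
  let ?c = "\<lambda>v k. v k - 1 / real n * (\<Sum>l=1..n. v l)"
  have L: "deviation n v = L2_set (?c v) {1..n}" for v by (simp add: deviation_def L2_set_def)
  have "L2_set (?c v) {1..n} = L2_set (\<lambda>k. ?c u k + ?c (\<lambda>k. v k - u k) k) {1..n}"
    by (simp add: sum_subtractf right_diff_distrib)
  also have "\<dots> \<le> L2_set (?c u) {1..n} + L2_set (?c (\<lambda>k. v k - u k)) {1..n}"
    by (rule L2_set_triangle_ineq)
  also have "L2_set (?c (\<lambda>k. v k - u k)) {1..n} \<le> L2_set (\<lambda>k. v k - u k) {1..n}"
    using deviation_le_L2_set[of n "\<lambda>k. v k - u k"] unfolding L .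
  finally show ?thesis unfolding L by simp
qed

lemma L2_set_diff_triangle: "L2_set v K \<le> L2_set u K + L2_set (\<lambda>k. v k - u k) K"
  using L2_set_triangle_ineq[of u "\<lambda>k. v k - u k" K] by simp

lemma L2_set_le_sqrt_card:
  assumes "\<And>k. k \<in> K \<Longrightarrow> \<bar>v k\<bar> \<le> R" "0 \<le> R"
  shows "L2_set v K \<le> sqrt (card K) * R"
proof -
  have "L2_set v K \<le> sqrt (\<Sum>k\<in>K. R\<^sup>2)"
    unfolding L2_set_def using assms by (intro real_sqrt_le_mono sum_mono) (auto simp: abs_le_square_iff[symmetric])
  also have "\<dots> = sqrt (card K) * R" using assms by (simp add: real_sqrt_mult)
  finally show ?thesis .
qed

lemma member_le_L2_set_abs: "finite J \<Longrightarrow> r \<in> J \<Longrightarrow> \<bar>v r\<bar> \<le> L2_set v J"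
  using member_le_L2_set[of J r "\<lambda>r. \<bar>v r\<bar>"] by (simp add: L2_set_def)

lemma scad_deriv_small: "z \<le> lam \<Longrightarrow> scad_deriv lam z = lam"
  by (simp add: scad_deriv_def Let_def)

lemma scad_deriv_large: "0 < lam \<Longrightarrow> 37 / 10 * lam \<le> z \<Longrightarrow> scad_deriv lam z = 0"
  by (simp add: scad_deriv_def Let_def max_def)

text \<open>The local objects at \<open>u\<close> in stacked form: weights, regressors, and parameters, with the slope
  coefficients scaled by the bandwidth.\<close>

definition wt :: "problem \<Rightarrow> real \<Rightarrow> nat \<Rightarrow> real" where
  "wt P u i = Kh P (idx P i - u) / real (nobs P)"

definition zt :: "problem \<Rightarrow> real \<Rightarrow> nat \<Rightarrow> nat \<Rightarrow> real" where
  "zt P u i = stack (dim P) (cov P i) (\<lambda>j. (idx P i - u) / bw P * cov P i j)"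

definition par :: "problem \<Rightarrow> (nat \<Rightarrow> nat \<Rightarrow> real) \<Rightarrow> (nat \<Rightarrow> nat \<Rightarrow> real) \<Rightarrow> nat \<Rightarrow> nat \<Rightarrow> real" where
  "par P A B k = stack (dim P) (\<lambda>j. A j k) (\<lambda>j. bw P * B j k)"

definition predt :: "problem \<Rightarrow> real \<Rightarrow> (nat \<Rightarrow> real) \<Rightarrow> nat \<Rightarrow> real" where
  "predt P u v i = (\<Sum>r=1..2 * dim P. v r * zt P u i r)"

lemma stack_simps [simp]: "j \<le> d \<Longrightarrow> stack d v w j = v j" "1 \<le> j \<Longrightarrow> stack d v w (d + j) = w j"
  by (auto simp: stack_def)

lemma scaled_slope: "h \<noteq> 0 \<Longrightarrow> h * b * (x / h * c) = b * x * (c :: real)"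
  by simp

lemma local_pred_stack:
  assumes "bw P \<noteq> 0"
  shows "local_pred P k \<alpha> \<beta> i = predt P (idx P k) (stack (dim P) \<alpha> (\<lambda>j. bw P * \<beta> j)) i"
  unfolding local_pred_def predt_def sum_double zt_def using assms
  by (intro sum.cong refl) (simp add: scaled_slope distrib_right)

lemma L_nk_stack:
  assumes "bw P \<noteq> 0"
  shows "L_nk P k \<alpha> \<beta> = (\<Sum>i=1..nobs P. wt P (idx P k) i *
    lik P (predt P (idx P k) (stack (dim P) \<alpha> (\<lambda>j. bw P * \<beta> j)) i) (resp P i))"
  unfolding L_nk_def local_pred_stack[OF assms] wt_def by (simp add: sum_distrib_left algebra_simps)

lemma prelim_objective_stack:
  assumes "0 < bw P"
  shows "prelim_objective P lam1 lam2 k \<alpha> \<beta> = (\<Sum>i=1..nobs P. wt P (idx P k) i *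
      lik P (predt P (idx P k) (stack (dim P) \<alpha> (\<lambda>j. bw P * \<beta> j)) i) (resp P i))
    - (\<Sum>r=1..2 * dim P. (if r \<le> dim P then lam1 else lam2) * \<bar>stack (dim P) \<alpha> (\<lambda>j. bw P * \<beta> j) r\<bar>)"
proof -
  have "(\<Sum>r=1..2 * dim P. (if r \<le> dim P then lam1 else lam2) * \<bar>stack (dim P) \<alpha> (\<lambda>j. bw P * \<beta> j) r\<bar>)
    = lam1 * (\<Sum>j=1..dim P. \<bar>\<alpha> j\<bar>) + lam2 * (\<Sum>j=1..dim P. bw P * \<bar>\<beta> j\<bar>)"
    unfolding sum_double sum_distrib_left sum.distrib[symmetric]
    using assms by (intro sum.cong refl) (simp add: abs_mult)
  then show ?thesis using assms unfolding prelim_objective_def by (simp add: L_nk_stack)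
qed

lemma dL_nk_stack:
  assumes "bw P \<noteq> 0"
  shows "dL_nk P k \<alpha> \<beta> r = (\<Sum>i=1..nobs P. wt P (idx P k) i *
    q1 (lik P) (predt P (idx P k) (stack (dim P) \<alpha> (\<lambda>j. bw P * \<beta> j)) i) (resp P i) * zt P (idx P k) i r)"
  unfolding dL_nk_def local_pred_stack[OF assms] wt_def zt_def by (simp add: sum_distrib_left algebra_simps)

lemma ddL_nk_stack:
  assumes "bw P \<noteq> 0" "r \<in> {1..2 * dim P}" "c \<in> {1..2 * dim P}"
  shows "ddL_nk P k \<alpha> \<beta> r c = (\<Sum>i=1..nobs P. wt P (idx P k) i *
    q2 (lik P) (predt P (idx P k) (stack (dim P) \<alpha> (\<lambda>j. bw P * \<beta> j)) i) (resp P i)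
      * (zt P (idx P k) i r * zt P (idx P k) i c))"
  unfolding ddL_nk_def block_matrix_def ddL_nk_block_def local_pred_stack[OF assms(1)] wt_def zt_def
    stack_def sum_distrib_left
  by (intro sum.cong refl) (auto simp: power2_eq_square)

lemma ddL_stack:
  assumes "r \<in> {1..2 * dim P}" "c \<in> {1..2 * dim P}"
  shows "ddL P \<eta> u r c = (\<Sum>i=1..nobs P. wt P u i * q2 (lik P) (\<eta> i) (resp P i) * (zt P u i r * zt P u i c))"
  unfolding ddL_def block_matrix_def ddL_block_def wt_def zt_def stack_def sum_distrib_left
  by (intro sum.cong refl) (auto simp: power2_eq_square)

lemma quad_form_stack:
  assumes "\<And>r c. r \<in> {1..2 * dim P} \<Longrightarrow> c \<in> {1..2 * dim P} \<Longrightarrow>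
    Hm r c = (\<Sum>i=1..n. g i * (zt P u i r * zt P u i c))"
  shows "quad_form (2 * dim P) Hm v = (\<Sum>i=1..n. g i * (predt P u v i)\<^sup>2)"
proof -
  let ?J = "{1..2 * dim P}"
  have "quad_form (2 * dim P) Hm v = (\<Sum>r\<in>?J. \<Sum>c\<in>?J. \<Sum>i=1..n. g i * ((v r * zt P u i r) * (v c * zt P u i c)))"
    unfolding quad_form_def
    by (intro sum.cong refl) (simp add: assms sum_distrib_left sum_distrib_right algebra_simps)
  also have "\<dots> = (\<Sum>r\<in>?J. \<Sum>i=1..n. \<Sum>c\<in>?J. g i * ((v r * zt P u i r) * (v c * zt P u i c)))"
    by (intro sum.cong refl sum.swap)
  also have "\<dots> = (\<Sum>i=1..n. \<Sum>r\<in>?J. \<Sum>c\<in>?J. g i * ((v r * zt P u i r) * (v c * zt P u i c)))"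
    by (rule sum.swap)
  also have "\<dots> = (\<Sum>i=1..n. g i * (predt P u v i)\<^sup>2)"
    unfolding predt_def power2_eq_square sum_product unfolding sum_distrib_left by simp
  finally show ?thesis .
qed

lemma predt_diff: "predt P u (\<lambda>r. v r - v' r) i = predt P u v i - predt P u v' i"
  by (simp add: predt_def left_diff_distrib sum_subtractf)

text \<open>Block by block the gradient and Hessian act through the predictors, so the quadratic
  approximation is a weighted sum of scalar Taylor polynomials of the log-likelihood, one for each
  predictor.\<close>

lemma L_diamond_stack:
  assumes "bw P \<noteq> 0"
  shows "L_diamond P At Bt A B = L_n P At Bt + (\<Sum>k=1..nobs P. \<Sum>i=1..nobs P. wt P (idx P k) i *
    (q1 (lik P) (predt P (idx P k) (par P At Bt k) i) (resp P i)
        * (predt P (idx P k) (par P A B k) i - predt P (idx P k) (par P At Bt k) i)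
      + q2 (lik P) (predt P (idx P k) (par P At Bt k) i) (resp P i) / 2
        * (predt P (idx P k) (par P A B k) i - predt P (idx P k) (par P At Bt k) i)\<^sup>2))"
proof -
  have D: "Delta_block P A B At Bt k = (\<lambda>r. par P A B k r - par P At Bt k r)" for k
    by (auto simp: Delta_block_def par_def stack_def fun_eq_iff)
  have lin: "(\<Sum>r=1..2 * dim P. Delta_block P A B At Bt k r * dL_nk P k (\<lambda>j. At j k) (\<lambda>j. Bt j k) r)
    = (\<Sum>i=1..nobs P. wt P (idx P k) i * (q1 (lik P) (predt P (idx P k) (par P At Bt k) i) (resp P i)
        * (predt P (idx P k) (par P A B k) i - predt P (idx P k) (par P At Bt k) i)))" for k
    unfolding D dL_nk_stack[OF assms] par_def[symmetric] predt_diff[symmetric]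
    unfolding sum_distrib_left predt_def[of P _ "\<lambda>r. par P A B k r - par P At Bt k r"]
    by (subst sum.swap) (simp add: sum_distrib_left algebra_simps)
  have quad: "quad_form (2 * dim P) (ddL_nk P k (\<lambda>j. At j k) (\<lambda>j. Bt j k)) (Delta_block P A B At Bt k)
    = (\<Sum>i=1..nobs P. wt P (idx P k) i * q2 (lik P) (predt P (idx P k) (par P At Bt k) i) (resp P i)
        * (predt P (idx P k) (par P A B k) i - predt P (idx P k) (par P At Bt k) i)\<^sup>2)" for k
    unfolding D predt_diff[symmetric] par_def[of P At Bt]
    by (rule quad_form_stack) (rule ddL_nk_stack[OF assms])
  show ?thesis
    unfolding L_diamond_def lin quad
    by (simp add: sum.distrib[symmetric] sum_distrib_left algebra_simps)
qed

text \<open>\<open>S\<close> carries the cone of the restricted eigenvalue condition, \<open>A\<close> the oracle model.\<close>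

locale sample =
  fixes P :: problem and \<eta> Mf :: "nat \<Rightarrow> real" and a a' :: "nat \<Rightarrow> real \<Rightarrow> real" and s1 s2 :: nat
    and lam1 lam2 e C0 Ca cK \<rho> b Crow :: real
  assumes n: "1 \<le> nobs P" and h: "0 < bw P" and ord: "1 \<le> s1" "s1 < s2" "s2 < dim P"
    and K: "\<And>t. 0 \<le> kern P t" "\<And>t. kern P t \<noteq> 0 \<Longrightarrow> \<bar>t\<bar> \<le> cK" "1 \<le> cK"
    and U: "\<And>i. i \<in> {1..nobs P} \<Longrightarrow> idx P i \<in> {0..1}"
    and d1: "\<And>i t. i \<in> {1..nobs P} \<Longrightarrow> ((\<lambda>t. lik P t (resp P i)) has_real_derivative q1 (lik P) t (resp P i)) (at t)"
    and d2: "\<And>i t. i \<in> {1..nobs P} \<Longrightarrow> ((\<lambda>t. q1 (lik P) t (resp P i)) has_real_derivative q2 (lik P) t (resp P i)) (at t)"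
    and neg: "\<And>i t. i \<in> {1..nobs P} \<Longrightarrow> q2 (lik P) t (resp P i) < 0"
    and Mf: "\<And>i. i \<in> {1..nobs P} \<Longrightarrow> 0 \<le> Mf i"
    and lip: "\<And>i t. i \<in> {1..nobs P} \<Longrightarrow>
      \<bar>q2 (lik P) (\<eta> i + t) (resp P i) - q2 (lik P) (\<eta> i) (resp P i)\<bar> \<le> Mf i * \<bar>t\<bar>"
    and \<eta>: "\<And>i. i \<in> {1..nobs P} \<Longrightarrow> \<eta> i = (\<Sum>j=1..dim P. a j (idx P i) * cov P i j)"
    and taylor: "\<And>j u v. j \<in> {1..dim P} \<Longrightarrow> u \<in> {0..1} \<Longrightarrow> v \<in> {0..1} \<Longrightarrow>
      \<bar>a j u - a j v - a' j v * (u - v)\<bar> \<le> Ca * (u - v)\<^sup>2"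
    and a0: "\<And>j u. j \<in> {s2 + 1..dim P} \<Longrightarrow> u \<in> {0..1} \<Longrightarrow> a j u = 0"
    and a'0: "\<And>j u. j \<in> {s1 + 1..dim P} \<Longrightarrow> u \<in> {0..1} \<Longrightarrow> a' j u = 0"
    and score: "\<And>k j l. k \<in> {1..nobs P} \<Longrightarrow> j \<in> {1..dim P} \<Longrightarrow> l \<in> {0, 1} \<Longrightarrow>
      \<bar>\<Sum>i=1..nobs P. wt P (idx P k) i * (((idx P i - idx P k) / bw P) ^ l * (q1 (lik P) (\<eta> i) (resp P i) * cov P i j))\<bar> \<le> e"
    and C2: "\<And>k j j'. k \<in> {1..nobs P} \<Longrightarrow> j \<in> {1..dim P} \<Longrightarrow> j' \<in> {1..dim P} \<Longrightarrow>
      (\<Sum>i=1..nobs P. wt P (idx P k) i * \<bar>q2 (lik P) (\<eta> i) (resp P i) * cov P i j * cov P i j'\<bar>) \<le> C0"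
    and C3: "\<And>k j j' j''. k \<in> {1..nobs P} \<Longrightarrow> j \<in> {1..dim P} \<Longrightarrow> j' \<in> {1..dim P} \<Longrightarrow> j'' \<in> {1..dim P} \<Longrightarrow>
      (\<Sum>i=1..nobs P. wt P (idx P k) i * \<bar>cov P i j * cov P i j' * cov P i j'' * Mf i\<bar>) \<le> C0"
    and RE: "\<And>u v. u \<in> {0..1} \<Longrightarrow> v \<in> Omega0 (dim P) s2 b \<Longrightarrow>
      \<rho> \<le> quad_form (2 * dim P) (\<lambda>j k. - ddL P \<eta> u j k) v"
    and row: "\<And>u w r. u \<in> {0..1} \<Longrightarrow> w \<in> oracle_directions (dim P) s1 s2 \<Longrightarrow>
      r \<in> {s2 + 1..dim P} \<union> {dim P + s1 + 1..2 * dim P} \<Longrightarrow>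
      \<bar>\<Sum>c=1..2 * dim P. ddL P \<eta> u r c * w c\<bar> \<le> Crow"
    and lam: "0 < lam1" "0 < lam2" and b: "max (lam1 / lam2) (lam2 / lam1) \<le> b"
    and const: "0 \<le> e" "0 \<le> C0" "0 \<le> Ca" "0 < \<rho>" "0 \<le> Crow"
begin

abbreviation "NN \<equiv> {1..nobs P}"
abbreviation "JJ \<equiv> {1..2 * dim P}"
text \<open>The cone of \<open>Omega0\<close> counts \<open>s2\<close> coordinates in both blocks,
  so slopes of constant coefficients belong to \<open>SS\<close>; the oracle sets them to zero, so
  they are missing from \<open>AA\<close>.\<close>

definition "SS = {1..s2} \<union> {dim P + 1..dim P + s2}"
definition "AA = {1..s1} \<union> ({s1 + 1..s2} \<union> {dim P + 1..dim P + s1})"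
definition "\<theta> k = stack (dim P) (\<lambda>j. a j (idx P k)) (\<lambda>j. bw P * a' j (idx P k))"
definition "lm r = (if r \<le> dim P then lam1 else lam2)"
text \<open>Within the kernel window a slope regressor is at most \<open>cK\<close> times its
  covariate, and at most three regressors meet in one average.\<close>

definition "CC = cK ^ 3 * C0"
text \<open>Taylor remainder of a coefficient across the kernel window, whose half-width is
  \<open>cK * bw P\<close>.\<close>

definition "bet = Ca * (cK * bw P)\<^sup>2"
definition "BB = 2 * (1 + b)"

text \<open>For the fit centred at observation \<open>k\<close>, conditions phrased in blocks,
  levels and slopes are transported to one index set of length \<open>2 * dim P\<close>. The
  resulting constants do not depend on \<open>k\<close>, so later bounds hold for all local fits at
  once.\<close>

lemma local_fit_k:
  assumes k: "k \<in> NN"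
  shows "local_fit NN JJ SS AA (wt P (idx P k)) Mf \<eta> (zt P (idx P k))
    (\<lambda>i t. lik P t (resp P i)) (\<lambda>i t. q1 (lik P) t (resp P i)) (\<lambda>i t. q2 (lik P) t (resp P i))
    (\<theta> k) lm (min lam1 lam2) (max lam1 lam2) e CC bet \<rho> BB Crow"
proof -
  let ?u = "idx P k" let ?w = "wt P ?u" let ?z = "zt P ?u"
  have u: "?u \<in> {0..1}" using U[OF k] .
  have w0: "0 \<le> ?w i" for i using K(1) h by (simp add: wt_def Kh_def)
  have supp: "\<bar>(idx P i - ?u) / bw P\<bar> \<le> cK" if "?w i \<noteq> 0" for i
    using that K(2)[of "(idx P i - ?u) / bw P"] by (auto simp: wt_def Kh_def)
  define base where "base r = (if r \<le> dim P then r else r - dim P)" for r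
  have base: "base r \<in> {1..dim P}" if "r \<in> JJ" for r using that by (auto simp: base_def)
  have zb: "\<bar>?z i r\<bar> \<le> cK * \<bar>cov P i (base r)\<bar>" if "?w i \<noteq> 0" for i r
  proof (cases "r \<le> dim P")
    case True
    then have "\<bar>?z i r\<bar> = 1 * \<bar>cov P i (base r)\<bar>" by (simp add: zt_def stack_def base_def)
    also have "\<dots> \<le> cK * \<bar>cov P i (base r)\<bar>" using K(3) by (intro mult_right_mono) auto
    finally show ?thesis .
  next
    case False
    then have "\<bar>?z i r\<bar> = \<bar>(idx P i - ?u) / bw P\<bar> * \<bar>cov P i (base r)\<bar>"
      by (simp add: zt_def stack_def base_def abs_mult)
    also have "\<dots> \<le> cK * \<bar>cov P i (base r)\<bar>" using supp[OF that] by (intro mult_right_mono) auto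
    finally show ?thesis .
  qed
  have SJ: "SS \<subseteq> JJ" and AS: "AA \<subseteq> SS" using ord by (auto simp: SS_def AA_def)
  \<comment> \<open>Two regressors produce only \<open>cK^2\<close>; as \<open>cK \<ge> 1\<close>,
    the cubic constant serves both orders.\<close>
  have cK23: "cK * cK \<le> cK ^ 3" using K(3) by (simp add: power3_eq_cube mult_left_mono)
  have predt: "(\<Sum>r\<in>JJ. v r * ?z i r) = predt P ?u v i" for v i by (simp add: predt_def)
  have neg_form: "quad_form (2 * dim P) (\<lambda>j k. - ddL P \<eta> ?u j k) v
      = (\<Sum>i\<in>NN. ?w i * (- q2 (lik P) (\<eta> i) (resp P i)) * (predt P ?u v i)\<^sup>2)" for v
    by (rule quad_form_stack) (simp add: ddL_stack sum_negf)
  show ?thesis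
  proof
    show "finite NN" "finite JJ" "AA \<subseteq> SS" "SS \<subseteq> JJ" using SJ AS by auto
    show "SS \<noteq> {}" using ord by (auto simp: SS_def)
    show "0 \<le> ?w i" for i by (rule w0)
    show "((\<lambda>t. lik P t (resp P i)) has_real_derivative q1 (lik P) t (resp P i)) (at t)"
      "((\<lambda>t. q1 (lik P) t (resp P i)) has_real_derivative q2 (lik P) t (resp P i)) (at t)"
      "q2 (lik P) t (resp P i) \<le> 0" "0 \<le> Mf i"
      "\<bar>q2 (lik P) (\<eta> i + t) (resp P i) - q2 (lik P) (\<eta> i) (resp P i)\<bar> \<le> Mf i * \<bar>t\<bar>"
      if "i \<in> NN" for i t
      using d1[OF that] d2[OF that] neg[OF that] Mf[OF that] lip[OF that] by (auto intro: less_imp_le)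
    show "\<bar>\<Sum>i\<in>NN. ?w i * q1 (lik P) (\<eta> i) (resp P i) * ?z i r\<bar> \<le> e" if r: "r \<in> JJ" for r
    proof -
      have "(\<Sum>i\<in>NN. ?w i * q1 (lik P) (\<eta> i) (resp P i) * ?z i r)
        = (\<Sum>i\<in>NN. ?w i * (((idx P i - ?u) / bw P) ^ (of_bool (dim P < r)) * (q1 (lik P) (\<eta> i) (resp P i) * cov P i (base r))))"
        by (intro sum.cong refl) (auto simp: zt_def stack_def base_def)
      then show ?thesis using score[OF k base[OF r], of "of_bool (dim P < r)"] by (simp add: of_bool_def)
    qed
    show "(\<Sum>i\<in>NN. ?w i * \<bar>q2 (lik P) (\<eta> i) (resp P i)\<bar> * (\<bar>?z i r\<bar> * \<bar>?z i c\<bar>)) \<le> CC"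
      if r: "r \<in> JJ" and c: "c \<in> JJ" for r c
    proof -
      have "(\<Sum>i\<in>NN. ?w i * \<bar>q2 (lik P) (\<eta> i) (resp P i)\<bar> * (\<bar>?z i r\<bar> * \<bar>?z i c\<bar>))
        \<le> (\<Sum>i\<in>NN. cK ^ 3 * (?w i * \<bar>q2 (lik P) (\<eta> i) (resp P i) * cov P i (base r) * cov P i (base c)\<bar>))"
      proof (rule sum_mono)
        fix i
        show "?w i * \<bar>q2 (lik P) (\<eta> i) (resp P i)\<bar> * (\<bar>?z i r\<bar> * \<bar>?z i c\<bar>)
          \<le> cK ^ 3 * (?w i * \<bar>q2 (lik P) (\<eta> i) (resp P i) * cov P i (base r) * cov P i (base c)\<bar>)"
        proof (cases "?w i = 0")
          case False
          have "\<bar>?z i r\<bar> * \<bar>?z i c\<bar> \<le> (cK * \<bar>cov P i (base r)\<bar>) * (cK * \<bar>cov P i (base c)\<bar>)"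
            using zb[OF False] K(3) by (intro mult_mono) auto
          also have "\<dots> = cK * cK * (\<bar>cov P i (base r)\<bar> * \<bar>cov P i (base c)\<bar>)" by simp
          also have "\<dots> \<le> cK ^ 3 * (\<bar>cov P i (base r)\<bar> * \<bar>cov P i (base c)\<bar>)"
            using cK23 by (intro mult_right_mono) auto
          finally have "\<bar>?z i r\<bar> * \<bar>?z i c\<bar> \<le> cK ^ 3 * (\<bar>cov P i (base r)\<bar> * \<bar>cov P i (base c)\<bar>)" .
          from mult_left_mono[OF this, of "?w i * \<bar>q2 (lik P) (\<eta> i) (resp P i)\<bar>"] w0[of i]
          show ?thesis by (simp add: abs_mult algebra_simps)
        qed simp
      qed
      also have "\<dots> \<le> CC"
        unfolding sum_distrib_left[symmetric] CC_def using K(3) C2[OF k base[OF r] base[OF c]]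
        by (intro mult_left_mono) auto
      finally show ?thesis .
    qed
    show "(\<Sum>i\<in>NN. ?w i * Mf i * (\<bar>?z i r\<bar> * \<bar>?z i c\<bar> * \<bar>?z i p\<bar>)) \<le> CC"
      if r: "r \<in> JJ" and c: "c \<in> JJ" and p: "p \<in> JJ" for r c p
    proof -
      have "(\<Sum>i\<in>NN. ?w i * Mf i * (\<bar>?z i r\<bar> * \<bar>?z i c\<bar> * \<bar>?z i p\<bar>))
        \<le> (\<Sum>i\<in>NN. cK ^ 3 * (?w i * \<bar>cov P i (base r) * cov P i (base c) * cov P i (base p) * Mf i\<bar>))"
      proof (rule sum_mono)
        fix i assume i: "i \<in> NN"
        show "?w i * Mf i * (\<bar>?z i r\<bar> * \<bar>?z i c\<bar> * \<bar>?z i p\<bar>)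
          \<le> cK ^ 3 * (?w i * \<bar>cov P i (base r) * cov P i (base c) * cov P i (base p) * Mf i\<bar>)"
        proof (cases "?w i = 0")
          case False
          have "\<bar>?z i r\<bar> * \<bar>?z i c\<bar> * \<bar>?z i p\<bar>
              \<le> (cK * \<bar>cov P i (base r)\<bar>) * (cK * \<bar>cov P i (base c)\<bar>) * (cK * \<bar>cov P i (base p)\<bar>)"
            using zb[OF False] K(3) by (intro mult_mono) auto
          from mult_left_mono[OF this, of "?w i * Mf i"] w0[of i] Mf[OF i]
          show ?thesis by (simp add: abs_mult power3_eq_cube algebra_simps)
        qed simp
      qed
      also have "\<dots> \<le> CC"
        unfolding sum_distrib_left[symmetric] CC_def using K(3) C3[OF k base[OF r] base[OF c] base[OF p]]
        by (intro mult_left_mono) auto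
      finally show ?thesis .
    qed
    show "\<theta> k r = 0" if "r \<in> JJ - AA" for r
    proof (cases "r \<le> dim P")
      case True
      then have "r \<in> {s2 + 1..dim P}" using that ord by (auto simp: AA_def)
      from a0[OF this u] True show ?thesis by (simp add: \<theta>_def stack_def)
    next
      case False
      then have "r - dim P \<in> {s1 + 1..dim P}" using that ord by (auto simp: AA_def)
      from a'0[OF this u] False show ?thesis by (simp add: \<theta>_def stack_def)
    qed
    show "\<bar>(\<Sum>r\<in>JJ. \<theta> k r * ?z i r) - \<eta> i\<bar> \<le> bet * (\<Sum>r\<in>SS. \<bar>?z i r\<bar>)" if i: "i \<in> NN" "?w i \<noteq> 0" for i
    proof -
      have ui: "idx P i \<in> {0..1}" using U[OF i(1)] .
      let ?D = "\<lambda>j. (a j ?u + a' j ?u * (idx P i - ?u) - a j (idx P i)) * cov P i j"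
      have "(\<Sum>r\<in>JJ. \<theta> k r * ?z i r) = (\<Sum>j=1..dim P. (a j ?u + a' j ?u * (idx P i - ?u)) * cov P i j)"
        unfolding sum_double \<theta>_def zt_def using h by (intro sum.cong refl) (simp add: scaled_slope distrib_right)
      then have "(\<Sum>r\<in>JJ. \<theta> k r * ?z i r) - \<eta> i = (\<Sum>j=1..dim P. ?D j)"
        unfolding \<eta>[OF i(1)] by (simp add: sum_subtractf[symmetric] left_diff_distrib)
      \<comment> \<open>Beyond \<open>s2\<close> both the coefficient and its derivative vanish, so
        the bias involves only covariates of the true model rather than all
        \<open>dim P\<close>.\<close>
      also have "\<dots> = (\<Sum>j=1..s2. ?D j)"
        using ord a0 a'0 u ui by (intro sum.mono_neutral_right) auto
      finally have "\<bar>(\<Sum>r\<in>JJ. \<theta> k r * ?z i r) - \<eta> i\<bar> \<le> (\<Sum>j=1..s2. \<bar>?D j\<bar>)"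
        using sum_abs[of ?D "{1..s2}"] by simp
      also have "\<dots> \<le> (\<Sum>j=1..s2. bet * \<bar>cov P i j\<bar>)"
      proof (rule sum_mono)
        fix j assume j: "j \<in> {1..s2}"
        then have "\<bar>a j (idx P i) - a j ?u - a' j ?u * (idx P i - ?u)\<bar> \<le> Ca * (idx P i - ?u)\<^sup>2"
          using taylor[OF _ ui u, of j] ord by auto
        also have "\<dots> \<le> bet"
        proof -
          have "\<bar>idx P i - ?u\<bar> \<le> cK * bw P"
            using supp[OF i(2)] h by (simp add: abs_divide pos_divide_le_eq)
          then have "(idx P i - ?u)\<^sup>2 \<le> (cK * bw P)\<^sup>2"
            by (metis abs_ge_zero power2_abs power_mono)
          then show ?thesis unfolding bet_def using const by (intro mult_left_mono) auto
        qed
        finally have "\<bar>a j ?u + a' j ?u * (idx P i - ?u) - a j (idx P i)\<bar> \<le> bet" by linarith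
        then show "\<bar>?D j\<bar> \<le> bet * \<bar>cov P i j\<bar>" unfolding abs_mult by (rule mult_right_mono) simp
      qed
      also have "\<dots> = bet * (\<Sum>j=1..s2. \<bar>?z i j\<bar>)"
        unfolding sum_distrib_left using ord by (intro sum.cong refl) (simp add: zt_def stack_def)
      also have "\<dots> \<le> bet * (\<Sum>r\<in>SS. \<bar>?z i r\<bar>)"
        using const by (intro mult_left_mono sum_mono2) (auto simp: SS_def bet_def)
      finally show ?thesis .
    qed
    show "\<rho> * (L2_set v JJ)\<^sup>2 \<le> (\<Sum>i\<in>NN. ?w i * (- q2 (lik P) (\<eta> i) (resp P i)) * (\<Sum>r\<in>JJ. v r * ?z i r)\<^sup>2)"
      if cone: "(\<Sum>r\<in>JJ. \<bar>v r\<bar>) \<le> BB * (\<Sum>r\<in>SS. \<bar>v r\<bar>)" for v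
    \<comment> \<open>\<open>Omega0\<close> consists of unit vectors, so a general \<open>v\<close>
      is normalised; for the zero vector the claim is that a sum of nonnegative terms is
      nonnegative.\<close>
    proof (cases "L2_set v JJ = 0")
      case True
      have p: "0 \<le> ?w i * (- q2 (lik P) (\<eta> i) (resp P i)) * (\<Sum>r\<in>JJ. v r * ?z i r)\<^sup>2" if "i \<in> NN" for i
        using w0[of i] neg[OF that, of "\<eta> i"] by (intro mult_nonneg_nonneg) auto
      have "0 \<le> (\<Sum>i\<in>NN. ?w i * (- q2 (lik P) (\<eta> i) (resp P i)) * (\<Sum>r\<in>JJ. v r * ?z i r)\<^sup>2)"
        by (intro sum_nonneg p)
      moreover have "\<rho> * (L2_set v JJ)\<^sup>2 = 0" using True by simp
      ultimately show ?thesis by linarith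
    next
      case False
      define D where "D = L2_set v JJ"
      have D: "0 < D" using False L2_set_nonneg[of v JJ] unfolding D_def by linarith
      have sS: "(\<Sum>r\<in>SS. \<bar>v r\<bar>) = (\<Sum>j=1..s2. \<bar>v j\<bar> + \<bar>v (dim P + j)\<bar>)"
      proof -
        have "(\<Sum>r\<in>SS. \<bar>v r\<bar>) = (\<Sum>j=1..s2. \<bar>v j\<bar>) + (\<Sum>r=dim P + 1..dim P + s2. \<bar>v r\<bar>)"
          unfolding SS_def using ord by (intro sum.union_disjoint) auto
        also have "(\<Sum>r=dim P + 1..dim P + s2. \<bar>v r\<bar>) = (\<Sum>j=1..s2. \<bar>v (dim P + j)\<bar>)"
          by (rule sum.reindex_bij_witness[of _ "\<lambda>j. dim P + j" "\<lambda>r. r - dim P"]) auto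
        finally show ?thesis by (simp add: sum.distrib)
      qed
      have "(\<lambda>r. 1 / D * v r) \<in> Omega0 (dim P) s2 b"
      proof -
        have "L2_set (\<lambda>r. 1 / D * v r) JJ = 1"
          using D L2_set_right_distrib[of "1 / D" v JJ] by (simp add: D_def)
        moreover have "(\<Sum>j=1..dim P. \<bar>1 / D * v j\<bar> + \<bar>1 / D * v (dim P + j)\<bar>)
            \<le> 2 * (1 + b) * (\<Sum>j=1..s2. \<bar>1 / D * v j\<bar> + \<bar>1 / D * v (dim P + j)\<bar>)"
        proof -
          have f: "(\<Sum>j\<in>T. \<bar>1 / D * v j\<bar> + \<bar>1 / D * v (dim P + j)\<bar>) = 1 / D * (\<Sum>j\<in>T. \<bar>v j\<bar> + \<bar>v (dim P + j)\<bar>)" for T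
            unfolding sum_distrib_left using D by (intro sum.cong refl) (simp add: add_divide_distrib)
          have "1 / D * (\<Sum>j=1..dim P. \<bar>v j\<bar> + \<bar>v (dim P + j)\<bar>)
              \<le> 1 / D * (BB * (\<Sum>j=1..s2. \<bar>v j\<bar> + \<bar>v (dim P + j)\<bar>))"
            using cone D unfolding sum_double sS by (intro mult_left_mono) auto
          then show ?thesis unfolding f BB_def by (simp only: ac_simps)
        qed
        ultimately show ?thesis by (simp add: Omega0_def)
      qed
      from RE[OF u this] have "\<rho> \<le> (\<Sum>i\<in>NN. ?w i * (- q2 (lik P) (\<eta> i) (resp P i)) * (predt P ?u (\<lambda>r. 1 / D * v r) i)\<^sup>2)"
        unfolding neg_form .
      also have "\<dots> = (\<Sum>i\<in>NN. ?w i * (- q2 (lik P) (\<eta> i) (resp P i)) * (predt P ?u v i)\<^sup>2) / D\<^sup>2"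
      proof -
        have "predt P ?u (\<lambda>r. 1 / D * v r) i = predt P ?u v i / D" for i
          unfolding predt_def sum_divide_distrib by (intro sum.cong refl) simp
        then show ?thesis unfolding sum_divide_distrib by (simp add: power_divide)
      qed
      finally show ?thesis using D unfolding predt D_def[symmetric] by (simp add: pos_le_divide_eq)
    qed
    show "\<bar>\<Sum>i\<in>NN. ?w i * q2 (lik P) (\<eta> i) (resp P i) * ?z i r * (\<Sum>c\<in>JJ. v c * ?z i c)\<bar> \<le> Crow * L2_set v JJ"
      if r: "r \<in> JJ - AA" and v: "\<And>c. c \<in> JJ - AA \<Longrightarrow> v c = 0" for r v
    proof -
      define D where "D = L2_set v JJ"
      have eq: "(\<Sum>i\<in>NN. ?w i * q2 (lik P) (\<eta> i) (resp P i) * ?z i r * (\<Sum>c\<in>JJ. v c * ?z i c))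
        = (\<Sum>c\<in>JJ. ddL P \<eta> ?u r c * v c)"
      proof -
        have "(\<Sum>i\<in>NN. ?w i * q2 (lik P) (\<eta> i) (resp P i) * ?z i r * (\<Sum>c\<in>JJ. v c * ?z i c))
          = (\<Sum>i\<in>NN. \<Sum>c\<in>JJ. ?w i * q2 (lik P) (\<eta> i) (resp P i) * (?z i r * ?z i c) * v c)"
          unfolding sum_distrib_left by (intro sum.cong refl) simp
        also have "\<dots> = (\<Sum>c\<in>JJ. \<Sum>i\<in>NN. ?w i * q2 (lik P) (\<eta> i) (resp P i) * (?z i r * ?z i c) * v c)"
          by (rule sum.swap)
        also have "\<dots> = (\<Sum>c\<in>JJ. ddL P \<eta> ?u r c * v c)"
          using r by (intro sum.cong refl) (simp add: ddL_stack sum_distrib_right)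
        finally show ?thesis .
      qed
      show ?thesis
      proof (cases "D = 0")
        case True
        then have "v c = 0" if "c \<in> JJ" for c using L2_set_eq_0_iff[of JJ v] that by (auto simp: D_def)
        then show ?thesis unfolding eq using True by (simp add: D_def)
      next
        case False
        then have D: "0 < D" using L2_set_nonneg[of v JJ] unfolding D_def by linarith
        have "(\<lambda>r. 1 / D * v r) \<in> oracle_directions (dim P) s1 s2"
        proof -
          have "L2_set (\<lambda>r. 1 / D * v r) JJ = 1"
            using D L2_set_right_distrib[of "1 / D" v JJ] by (simp add: D_def)
          moreover have "v j = 0" if "j \<in> {s2 + 1..dim P}" for j using v[of j] that ord by (auto simp: AA_def)
          moreover have "v (dim P + j) = 0" if "j \<in> {s1 + 1..dim P}" for j
            using v[of "dim P + j"] that ord by (auto simp: AA_def)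
          ultimately show ?thesis by (simp add: oracle_directions_def)
        qed
        moreover have "r \<in> {s2 + 1..dim P} \<union> {dim P + s1 + 1..2 * dim P}" using r ord by (auto simp: AA_def)
        ultimately have "\<bar>\<Sum>c=1..2 * dim P. ddL P \<eta> ?u r c * (1 / D * v c)\<bar> \<le> Crow" using row[OF u] by blast
        moreover have "(\<Sum>c=1..2 * dim P. ddL P \<eta> ?u r c * (1 / D * v c)) = (\<Sum>c\<in>JJ. ddL P \<eta> ?u r c * v c) / D"
          unfolding sum_divide_distrib by (intro sum.cong refl) simp
        ultimately show ?thesis unfolding eq D_def[symmetric] using D by (simp add: abs_divide pos_divide_le_eq)
      qed
    qed
    show "min lam1 lam2 \<le> lm r \<and> lm r \<le> max lam1 lam2" for r by (simp add: lm_def)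
    show "0 < min lam1 lam2" "min lam1 lam2 \<le> max lam1 lam2" using lam by auto
    show "0 \<le> CC" "0 \<le> bet" "0 < \<rho>" "0 \<le> e" "0 \<le> Crow"
      using const K(3) by (auto simp: CC_def bet_def)
    \<comment> \<open>The ratio demanded by the lasso argument is the one inside \<open>b\<close>:
      the maximum of the two quotients is the larger tuning parameter over the smaller.\<close>
    have "max lam1 lam2 / min lam1 lam2 \<le> max (lam1 / lam2) (lam2 / lam1)"
      by (cases "lam1 \<le> lam2") auto
    from order_trans[OF this b] show "2 * (1 + max lam1 lam2 / min lam1 lam2) \<le> BB"
      unfolding BB_def by (intro mult_left_mono add_left_mono) auto
  qed
qed

end

section \<open>The quadratic approximation as an exact second-order expansion\<close>

definition quad_fit :: "problem \<Rightarrow> (nat \<Rightarrow> nat \<Rightarrow> real) \<Rightarrow> (nat \<Rightarrow> nat \<Rightarrow> real) \<Rightarrow> real" where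
  "quad_fit P \<Theta>t \<Theta> = (\<Sum>k=1..nobs P. \<Sum>i=1..nobs P. wt P (idx P k) i *
    (q1 (lik P) (predt P (idx P k) (\<Theta>t k) i) (resp P i)
        * (predt P (idx P k) (\<Theta> k) i - predt P (idx P k) (\<Theta>t k) i)
      + q2 (lik P) (predt P (idx P k) (\<Theta>t k) i) (resp P i) / 2
        * (predt P (idx P k) (\<Theta> k) i - predt P (idx P k) (\<Theta>t k) i)\<^sup>2))"

definition quad_grad :: "problem \<Rightarrow> (nat \<Rightarrow> nat \<Rightarrow> real) \<Rightarrow> (nat \<Rightarrow> nat \<Rightarrow> real) \<Rightarrow> nat \<Rightarrow> nat \<Rightarrow> real" where
  "quad_grad P \<Theta>t \<Theta> k r = (\<Sum>i=1..nobs P. wt P (idx P k) i *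
    (q1 (lik P) (predt P (idx P k) (\<Theta>t k) i) (resp P i)
      + q2 (lik P) (predt P (idx P k) (\<Theta>t k) i) (resp P i)
        * (predt P (idx P k) (\<Theta> k) i - predt P (idx P k) (\<Theta>t k) i)) * zt P (idx P k) i r)"

definition quad_hess :: "problem \<Rightarrow> (nat \<Rightarrow> nat \<Rightarrow> real) \<Rightarrow> nat \<Rightarrow> (nat \<Rightarrow> real) \<Rightarrow> real" where
  "quad_hess P \<Theta>t k v = (\<Sum>i=1..nobs P. wt P (idx P k) i *
    q2 (lik P) (predt P (idx P k) (\<Theta>t k) i) (resp P i) * (predt P (idx P k) v i)\<^sup>2)"

lemma L_diamond_quad_fit:
  assumes "bw P \<noteq> 0"
  shows "L_diamond P At Bt A B = L_n P At Bt + quad_fit P (par P At Bt) (par P A B)"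
  using L_diamond_stack[OF assms] by (simp add: quad_fit_def)

text \<open>An identity, not an approximation: the Hessian is frozen at \<open>\<Theta>t\<close>, so
  re-expansion around \<open>\<Theta>0\<close> changes only the gradient.\<close>

lemma quad_fit_diff:
  "quad_fit P \<Theta>t \<Theta> - quad_fit P \<Theta>t \<Theta>0 = (\<Sum>k=1..nobs P.
     (\<Sum>r=1..2 * dim P. (\<Theta> k r - \<Theta>0 k r) * quad_grad P \<Theta>t \<Theta>0 k r) + quad_hess P \<Theta>t k (\<lambda>r. \<Theta> k r - \<Theta>0 k r) / 2)"
proof -
  have pt: "w * (c1 * (x - t) + c2 / 2 * (x - t)\<^sup>2) - w * (c1 * (y - t) + c2 / 2 * (y - t)\<^sup>2)
      = w * (c1 + c2 * (y - t)) * (x - y) + w * c2 * (x - y)\<^sup>2 / 2" for w c1 c2 x y t :: real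
    by (simp add: power2_eq_square field_simps)
  have lin: "(\<Sum>i=1..nobs P. g i * (predt P u v i - predt P u v' i))
      = (\<Sum>r=1..2 * dim P. (v r - v' r) * (\<Sum>i=1..nobs P. g i * zt P u i r))" for g u v v'
    unfolding predt_diff[symmetric] unfolding predt_def sum_distrib_left
    by (subst sum.swap) (simp add: mult_ac)
  show ?thesis
    unfolding quad_fit_def sum_subtractf[symmetric] pt quad_grad_def quad_hess_def lin[symmetric] predt_diff
    by (simp add: sum.distrib sum_divide_distrib)
qed

section \<open>Oracle recovery for one regular sample\<close>

context sample
begin

text \<open>The constants of \<open>local_fit\<close> written without reference to \<open>k\<close>:
  \<open>s\<close> is the cardinality of \<open>SS\<close>, and \<open>GG\<close> is the off-model
  gradient bound from \<open>oracle_gradient\<close>.\<close>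

definition "s = real (2 * s2)"
definition "eps = e + CC * (bet * s + (bet * s)\<^sup>2)"
definition "RR = 8 * (eps * BB + max lam1 lam2) * sqrt s / \<rho>"
definition "NR = BB * sqrt s * RR"
definition "kap = eps + 2 * CC * ((bet * s + NR) * NR)"
definition "GG = kap + (Crow + CC * (bet * s + NR) * sqrt s) * (2 * kap * sqrt s / \<rho>)"

lemma card_SS: "real (card SS) = s"
proof -
  have "card SS = card {1..s2} + card {dim P + 1..dim P + s2}"
    unfolding SS_def using ord by (intro card_Un_disjoint) auto
  then show ?thesis by (simp add: s_def)
qed

lemma RR0: "0 < RR"
proof -
  have "1 \<in> NN" using n by simp
  then interpret L: local_fit NN JJ SS AA "wt P (idx P 1)" Mf \<eta> "zt P (idx P 1)"
    "\<lambda>i t. lik P t (resp P i)" "\<lambda>i t. q1 (lik P) t (resp P i)" "\<lambda>i t. q2 (lik P) t (resp P i)"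
    "\<theta> 1" lm "min lam1 lam2" "max lam1 lam2" e CC bet \<rho> BB Crow
    by (rule local_fit_k)
  have "L.R = RR" by (simp add: L.R_def L.\<epsilon>_def L.s_def card_SS RR_def eps_def)
  then show ?thesis using L.R0 by simp
qed

context
  fixes At Bt :: "nat \<Rightarrow> nat \<Rightarrow> real"
  assumes prelim: "is_prelim_estimator P lam1 lam2 At Bt"
    and eps_small: "eps \<le> min lam1 lam2 / 4"
    and R_small: "CC * (bet * s + NR) * (BB\<^sup>2 * s) \<le> \<rho> / 2"
begin

text \<open>The preliminary estimator enters only through its advantage over the competitor
  \<open>\<theta> k\<close>, the true levels with slopes scaled by the bandwidth; everything else is
  the local analysis with constants rewritten.\<close>

lemma local_results:
  assumes k: "k \<in> NN"
  shows "L2_set (\<lambda>r. par P At Bt k r - \<theta> k r) JJ \<le> RR"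
    and "\<And>v. (\<And>r. r \<in> JJ - AA \<Longrightarrow> v r = 0) \<Longrightarrow> quad_hess P (par P At Bt) k v \<le> - (\<rho> / 2 * (L2_set v JJ)\<^sup>2)"
    and "\<And>\<Theta> r. (\<And>r. r \<in> JJ - AA \<Longrightarrow> \<Theta> k r = 0) \<Longrightarrow> (\<And>r. r \<in> AA \<Longrightarrow> quad_grad P (par P At Bt) \<Theta> k r = 0) \<Longrightarrow>
      r \<in> JJ - AA \<Longrightarrow> \<bar>quad_grad P (par P At Bt) \<Theta> k r\<bar> \<le> GG"
proof -
  interpret L: local_fit NN JJ SS AA "wt P (idx P k)" Mf \<eta> "zt P (idx P k)"
    "\<lambda>i t. lik P t (resp P i)" "\<lambda>i t. q1 (lik P) t (resp P i)" "\<lambda>i t. q2 (lik P) t (resp P i)"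
    "\<theta> k" lm "min lam1 lam2" "max lam1 lam2" e CC bet \<rho> BB Crow
    by (rule local_fit_k[OF k])
  have ss: "L.s = s" by (simp add: L.s_def card_SS)
  have eps: "L.\<epsilon> = eps" by (simp add: L.\<epsilon>_def ss eps_def)
  have RR: "L.R = RR" by (simp add: L.R_def ss eps RR_def)
  have NR: "L.N = NR" by (simp add: L.N_def ss RR NR_def)
  have ip: "L.ip v i = predt P (idx P k) v i" for v i unfolding L.ip_def predt_def ..
  have small: "L.\<epsilon> \<le> min lam1 lam2 / 4" "CC * (bet * L.s + L.N) * (BB\<^sup>2 * L.s) \<le> \<rho> / 2"
    using eps_small R_small by (simp_all add: eps ss NR)
  have F: "L.F (stack (dim P) \<alpha> (\<lambda>j. bw P * \<beta> j)) = prelim_objective P lam1 lam2 k \<alpha> \<beta>" for \<alpha> \<beta>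
    unfolding prelim_objective_stack[OF h] L.F_def ip lm_def by simp
  have est: "L.F (\<theta> k) \<le> L.F (par P At Bt k)"
    unfolding \<theta>_def par_def F using prelim k unfolding is_prelim_estimator_def by blast
  have kap: "L.\<kappa> = kap" using L.\<kappa>_def[OF small est] by (simp add: ss eps NR kap_def)
  show "L2_set (\<lambda>r. par P At Bt k r - \<theta> k r) JJ \<le> RR"
    using L.\<delta>(1)[OF small est] unfolding RR L.\<delta>_def[OF small est] .
  show "quad_hess P (par P At Bt) k v \<le> - (\<rho> / 2 * (L2_set v JJ)\<^sup>2)" if "\<And>r. r \<in> JJ - AA \<Longrightarrow> v r = 0" for v
    using L.curvature_at_estimator[OF small est, where v = v, OF that] unfolding ip quad_hess_def power2_eq_square by simp
  show "\<bar>quad_grad P (par P At Bt) \<Theta> k r\<bar> \<le> GG"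
    if "\<And>r. r \<in> JJ - AA \<Longrightarrow> \<Theta> k r = 0" "\<And>r. r \<in> AA \<Longrightarrow> quad_grad P (par P At Bt) \<Theta> k r = 0" "r \<in> JJ - AA" for \<Theta> r
    using L.oracle_gradient[OF small est, of "\<Theta> k" r] that
    unfolding ip quad_grad_def GG_def ss kap NR by blast
qed

lemma prelim_close:
  assumes "k \<in> NN" "j \<in> {1..dim P}"
  shows "\<bar>At j k - a j (idx P k)\<bar> \<le> RR"
  using member_le_L2_set_abs[of JJ j "\<lambda>r. par P At Bt k r - \<theta> k r"] local_results(1)[OF assms(1)] assms(2)
  by (auto simp: par_def \<theta>_def)

lemma prelim_group_close:
  assumes "j \<in> {1..dim P}"
  shows "L2_set (\<lambda>k. At j k - a j (idx P k)) NN \<le> sqrt (nobs P) * RR"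
  using L2_set_le_sqrt_card[of NN "\<lambda>k. At j k - a j (idx P k)" RR] prelim_close[OF _ assms] RR0 by simp

context
  fixes Auo Buo :: "nat \<Rightarrow> nat \<Rightarrow> real"
  assumes orc: "is_oracle_estimator P s1 s2 At Bt Auo Buo"
begin

lemma oracle_supported:
  assumes k: "k \<in> NN" and r: "r \<in> JJ - AA"
  shows "par P Auo Buo k r = 0"
proof -
  have f: "oracle_feasible P s1 s2 Auo Buo" using orc by (simp add: is_oracle_estimator_def)
  show ?thesis
  proof (cases "r \<le> dim P")
    case True
    then have "r \<in> {s2 + 1..dim P}" using r ord by (auto simp: AA_def)
    then show ?thesis using f k True by (simp add: oracle_feasible_def par_def stack_def)
  next
    case False
    then have "r - dim P \<in> {s1 + 1..dim P}" using r ord by (auto simp: AA_def)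
    then show ?thesis using f k False by (simp add: oracle_feasible_def par_def stack_def)
  qed
qed

text \<open>The bandwidth scaling of the slopes can be undone, so every stacked array comes from a
  pair of coefficient arrays, and maximality over pairs is maximality over stacked arrays.\<close>

lemma oracle_max:
  assumes "\<And>k r. k \<in> NN \<Longrightarrow> r \<in> JJ - AA \<Longrightarrow> \<Theta> k r = 0"
  shows "quad_fit P (par P At Bt) \<Theta> \<le> quad_fit P (par P At Bt) (par P Auo Buo)"
proof -
  define A where "A = (\<lambda>j k. \<Theta> k j)"
  define B where "B = (\<lambda>j k. \<Theta> k (dim P + j) / bw P)"
  have par: "par P A B = \<Theta>"
    using h by (auto simp: par_def stack_def A_def B_def fun_eq_iff)
  have "oracle_feasible P s1 s2 A B"
    unfolding oracle_feasible_def A_def B_def using assms ord by (auto simp: AA_def)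
  then have "L_diamond P At Bt A B \<le> L_diamond P At Bt Auo Buo"
    using orc by (simp add: is_oracle_estimator_def)
  then show ?thesis using h by (simp add: L_diamond_quad_fit par)
qed

text \<open>Moving a single coordinate of a single local fit inside the model keeps the array
  feasible, and along this line the quadratic approximation changes by \<open>t\<close> times the
  gradient plus a multiple of \<open>t^2\<close>.\<close>

lemma oracle_stationary:
  assumes k: "k \<in> NN" and r: "r \<in> AA"
  shows "quad_grad P (par P At Bt) (par P Auo Buo) k r = 0"
proof (rule linear_plus_square_nonpos)
  fix t :: real
  have rJ: "r \<in> JJ" using r ord by (auto simp: AA_def)
  let ?\<Theta>0 = "par P Auo Buo"
  define v where "v = (\<lambda>k' r'. if k' = k \<and> r' = r then t else 0)"
  define \<Theta> where "\<Theta> = (\<lambda>k' r'. ?\<Theta>0 k' r' + v k' r')"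
  have d: "\<Theta> k' r' - ?\<Theta>0 k' r' = v k' r'" for k' r' by (simp add: \<Theta>_def)
  have "quad_fit P (par P At Bt) \<Theta> - quad_fit P (par P At Bt) ?\<Theta>0 \<le> 0"
  proof -
    have "\<Theta> k' r' = 0" if "k' \<in> NN" "r' \<in> JJ - AA" for k' r'
      using oracle_supported[OF that] that r by (auto simp: \<Theta>_def v_def)
    from oracle_max[of \<Theta>, OF this] show ?thesis by simp
  qed
  moreover have lin: "(\<Sum>r'\<in>JJ. v k' r' * g r') = (if k' = k then t * g r else 0)" for k' and g :: "nat \<Rightarrow> real"
  proof -
    have "(\<Sum>r'\<in>JJ. v k' r' * g r') = (\<Sum>r'\<in>JJ. if r' = r then (if k' = k then t * g r' else 0) else 0)"
      by (intro sum.cong refl) (simp add: v_def)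
    then show ?thesis using rJ by simp
  qed
  have quad: "quad_hess P (par P At Bt) k' (v k') = (if k' = k then t\<^sup>2 * quad_hess P (par P At Bt) k (\<lambda>r'. of_bool (r' = r)) else 0)" for k'
  proof -
    have p: "predt P (idx P k') (v k') i = (if k' = k then t * zt P (idx P k') i r else 0)" for i
      unfolding predt_def by (rule lin)
    have q: "predt P (idx P k) (\<lambda>r'. of_bool (r' = r)) i = zt P (idx P k) i r" for i
    proof -
      have "predt P (idx P k) (\<lambda>r'. of_bool (r' = r)) i = (\<Sum>r'\<in>JJ. if r' = r then zt P (idx P k) i r' else 0)"
        unfolding predt_def by (intro sum.cong refl) simp
      then show ?thesis using rJ by simp
    qed
    show ?thesis unfolding quad_hess_def p q
      by (simp add: sum_distrib_left power_mult_distrib algebra_simps)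
  qed
  have "quad_fit P (par P At Bt) \<Theta> - quad_fit P (par P At Bt) ?\<Theta>0
    = (\<Sum>k'\<in>NN. if k' = k then t * quad_grad P (par P At Bt) ?\<Theta>0 k r
        + t\<^sup>2 * quad_hess P (par P At Bt) k (\<lambda>r'. of_bool (r' = r)) / 2 else 0)"
    unfolding quad_fit_diff d lin quad by (intro sum.cong refl) simp
  also have "\<dots> = t * quad_grad P (par P At Bt) ?\<Theta>0 k r
        + t\<^sup>2 * quad_hess P (par P At Bt) k (\<lambda>r'. of_bool (r' = r)) / 2"
    using k by simp
  finally show "t * quad_grad P (par P At Bt) ?\<Theta>0 k r + t\<^sup>2 * (quad_hess P (par P At Bt) k (\<lambda>r'. of_bool (r' = r)) / 2) \<le> 0"
    using \<open>quad_fit P (par P At Bt) \<Theta> - quad_fit P (par P At Bt) ?\<Theta>0 \<le> 0\<close> by simp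
qed

text \<open>The SCAD derivative is read only on its flat parts: groups off the model have estimated
  size at most the tuning parameter, where the weight is full, and groups in the model reach
  \<open>37 / 10\<close> times it, where the weight is zero. With these weights
  \<open>group_penalty_oracle\<close> applies to the stacked arrays.\<close>

theorem oracle_recovery:
  assumes scad: "is_scad_estimator P lam4 lam4s At Bt Ab Bb"
    and pos: "0 < lam4" "0 < lam4s"
    and G: "sqrt (nobs P) * GG < lam4" "sqrt (nobs P) * GG < lam4s"
    and R: "sqrt (nobs P) * RR \<le> lam4" "sqrt (nobs P) * RR \<le> lam4s"
    and big: "37 / 10 * lam4 \<le> sqrt (nobs P) * (bs - RR)" "37 / 10 * lam4s \<le> sqrt (nobs P) * (bs - RR)"
    and sigA: "\<And>j. j \<in> {1..s2} \<Longrightarrow> bs * sqrt (nobs P) \<le> L2_set (\<lambda>k. a j (idx P k)) NN"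
    and sigD: "\<And>j. j \<in> {1..s1} \<Longrightarrow> bs * sqrt (nobs P) \<le> deviation (nobs P) (\<lambda>k. a j (idx P k))"
    and aconst: "\<And>j. j \<in> {s1 + 1..dim P} \<Longrightarrow> \<exists>c. \<forall>u\<in>{0..1}. a j u = c"
    and kj: "k \<in> NN" "j \<in> {1..dim P}"
  shows "Ab j k = Auo j k"
proof -
  define p where "p = (\<lambda>r. if r \<le> dim P then scad_deriv lam4 (L2_set (At r) NN)
    else scad_deriv lam4s (deviation (nobs P) (At (r - dim P))))"
  have Q2: "Q2_objective P lam4 lam4s At Bt A B = L_n P At Bt + quad_fit P (par P At Bt) (par P A B)
    - (\<Sum>r\<in>JJ. p r * L2_set (\<lambda>k. par P A B k r) NN)" for A B
  proof -
    have "(\<Sum>r\<in>JJ. p r * L2_set (\<lambda>k. par P A B k r) NN)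
      = (\<Sum>j=1..dim P. scad_deriv lam4 (L2_set (At j) NN) * L2_set (A j) NN)
      + (\<Sum>j=1..dim P. scad_deriv lam4s (deviation (nobs P) (At j)) * L2_set (\<lambda>k. bw P * B j k) NN)"
      unfolding sum_double sum.distrib[symmetric] by (intro sum.cong refl) (simp add: p_def par_def)
    then show ?thesis unfolding Q2_objective_def L_diamond_quad_fit[OF less_imp_neq[OF h, symmetric]] by simp
  qed
  \<comment> \<open>Which tuning parameter is the weight depends on the block; the disjunction
    suffices because the gradient bound lies below both.\<close>
  have p_small: "lam4 \<le> p r \<or> lam4s \<le> p r" if r: "r \<in> JJ - AA" for r
  proof (cases "r \<le> dim P")
    case True
    then have r': "r \<in> {s2 + 1..dim P}" "r \<in> {1..dim P}" using r ord by (auto simp: AA_def)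
    have "L2_set (At r) NN = L2_set (\<lambda>k. At r k - a r (idx P k)) NN"
      using a0[OF r'(1)] U unfolding L2_set_def by simp
    also have "\<dots> \<le> lam4" using prelim_group_close[OF r'(2)] R by linarith
    finally show ?thesis using True by (simp add: p_def scad_deriv_small)
  next
    case False
    then have r': "r - dim P \<in> {s1 + 1..dim P}" "r - dim P \<in> {1..dim P}" using r ord by (auto simp: AA_def)
    obtain c where c: "\<And>u. u \<in> {0..1} \<Longrightarrow> a (r - dim P) u = c" using aconst[OF r'(1)] by blast
    \<comment> \<open>A constant coefficient has deviation zero, so the deviation of its estimate is
      pure estimation error and its slope group receives the full weight.\<close>
    have "deviation (nobs P) (\<lambda>k. a (r - dim P) (idx P k)) = deviation (nobs P) (\<lambda>k. c)"
      using c U unfolding deviation_def by simp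
    also have "\<dots> = 0" using n by (simp add: deviation_def)
    finally have "deviation (nobs P) (At (r - dim P)) \<le> lam4s"
      using deviation_triangle[of "nobs P" "At (r - dim P)" "\<lambda>k. a (r - dim P) (idx P k)"]
        prelim_group_close[OF r'(2)] R by linarith
    then show ?thesis using False by (simp add: p_def scad_deriv_small)
  qed
  have p_zero: "p r = 0" if r: "r \<in> AA" for r
  proof (cases "r \<le> dim P")
    case True
    then have r': "r \<in> {1..s2}" "r \<in> {1..dim P}" using r ord by (auto simp: AA_def)
    have "bs * sqrt (nobs P) \<le> L2_set (\<lambda>k. a r (idx P k)) NN" using sigA[OF r'(1)] .
    also have "\<dots> \<le> L2_set (At r) NN + L2_set (\<lambda>k. a r (idx P k) - At r k) NN" by (rule L2_set_diff_triangle)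
    also have "L2_set (\<lambda>k. a r (idx P k) - At r k) NN = L2_set (\<lambda>k. At r k - a r (idx P k)) NN"
      unfolding L2_set_def by (simp add: power2_commute)
    also have "\<dots> \<le> sqrt (nobs P) * RR" by (rule prelim_group_close[OF r'(2)])
    finally have "37 / 10 * lam4 \<le> L2_set (At r) NN" using big by (simp add: algebra_simps)
    then show ?thesis using True pos by (simp add: p_def scad_deriv_large)
  next
    case False
    then have r': "r - dim P \<in> {1..s1}" "r - dim P \<in> {1..dim P}" using r ord by (auto simp: AA_def)
    let ?j = "r - dim P"
    have "bs * sqrt (nobs P) \<le> deviation (nobs P) (\<lambda>k. a ?j (idx P k))" using sigD[OF r'(1)] .
    also have "\<dots> \<le> deviation (nobs P) (At ?j) + L2_set (\<lambda>k. a ?j (idx P k) - At ?j k) NN"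
      by (rule deviation_triangle)
    also have "L2_set (\<lambda>k. a ?j (idx P k) - At ?j k) NN = L2_set (\<lambda>k. At ?j k - a ?j (idx P k)) NN"
      unfolding L2_set_def by (simp add: power2_commute)
    also have "\<dots> \<le> sqrt (nobs P) * RR" by (rule prelim_group_close[OF r'(2)])
    finally have "37 / 10 * lam4s \<le> deviation (nobs P) (At ?j)" using big by (simp add: algebra_simps)
    then show ?thesis using False pos by (simp add: p_def scad_deriv_large)
  qed
  have grad: "\<bar>quad_grad P (par P At Bt) (par P Auo Buo) k r\<bar> \<le> GG" if "k \<in> NN" "r \<in> JJ - AA" for k r
    using local_results(3)[OF that(1), of "par P Auo Buo" r] oracle_supported[OF that(1)] oracle_stationary[OF that(1)] that(2)
    by blast
  have "par P Ab Bb k j = par P Auo Buo k j"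
  proof (rule group_penalty_oracle[where K = NN and J = JJ and A = AA and p = p and G = GG and c = "\<rho> / 2"
        and \<Gamma> = "quad_grad P (par P At Bt) (par P Auo Buo)" and H = "quad_hess P (par P At Bt)"])
    show "AA \<subseteq> JJ" using ord by (auto simp: AA_def)
    show "(\<Sum>r\<in>JJ. p r * L2_set (\<lambda>k. par P Ab Bb k r) NN) - (\<Sum>r\<in>JJ. p r * L2_set (\<lambda>k. par P Auo Buo k r) NN)
      \<le> (\<Sum>k\<in>NN. (\<Sum>r\<in>JJ. (par P Ab Bb k r - par P Auo Buo k r) * quad_grad P (par P At Bt) (par P Auo Buo) k r)
        + quad_hess P (par P At Bt) k (\<lambda>r. par P Ab Bb k r - par P Auo Buo k r) / 2)"
    proof -
      have "Q2_objective P lam4 lam4s At Bt Auo Buo \<le> Q2_objective P lam4 lam4s At Bt Ab Bb"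
        using scad by (simp add: is_scad_estimator_def)
      then show ?thesis unfolding quad_fit_diff[symmetric] Q2 by simp
    qed
    show "quad_hess P (par P At Bt) k v \<le> 0" if "k \<in> NN" for k v
      unfolding quad_hess_def using neg K(1) h
      by (intro sum_nonpos mult_nonpos_nonneg mult_nonneg_nonpos) (auto simp: wt_def Kh_def intro: less_imp_le)
    show "sqrt (card NN) * GG < p r" if "r \<in> JJ - AA" for r
      using p_small[OF that] G by auto
  qed (use oracle_stationary grad oracle_supported local_results(2) const p_zero kj in auto)
  then show ?thesis using kj by (simp add: par_def)
qed

end

end

end

section \<open>Kernel averages in the varying coefficient model\<close>

text \<open>The derivative is the limit of difference quotients with steps \<open>1 / Suc m\<close>,
  each measurable in both arguments. Differentiability is known only for responses in
  \<open>R\<close>, hence the value 0 elsewhere.\<close>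

lemma deriv_measurable_on:
  fixes f :: "real \<Rightarrow> real \<Rightarrow> real"
  assumes f: "(\<lambda>(s, y). f s y) \<in> borel_measurable (borel \<Otimes>\<^sub>M borel)" and R[measurable]: "R \<in> sets borel"
    and diff: "\<And>y s. y \<in> R \<Longrightarrow> (\<lambda>t. f t y) differentiable (at s)"
  shows "(\<lambda>(s, y). if y \<in> R then deriv (\<lambda>t. f t y) s else 0) \<in> borel_measurable (borel \<Otimes>\<^sub>M borel)"
proof (rule borel_measurable_LIMSEQ_real)
  define e where "e = (\<lambda>m. inverse (real (Suc m)))"
  let ?g = "\<lambda>m (s, y). if y \<in> R then (f (s + e m) y - f s y) / e m else 0"
  show "(\<lambda>m. ?g m z) \<longlonglongrightarrow> (case z of (s, y) \<Rightarrow> if y \<in> R then deriv (\<lambda>t. f t y) s else 0)" for z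
  proof (cases z)
    case (Pair s y)
    show ?thesis
    proof (cases "y \<in> R")
      case True
      have "((\<lambda>t. f t y) has_real_derivative deriv (\<lambda>t. f t y) s) (at s)"
        using diff[OF True] by (simp add: DERIV_deriv_iff_real_differentiable)
      then have "((\<lambda>t. (f (s + t) y - f s y) / t) \<longlongrightarrow> deriv (\<lambda>t. f t y) s) (at 0)"
        by (simp add: DERIV_def)
      moreover have "filterlim e (at 0) sequentially"
        unfolding e_def filterlim_at using LIMSEQ_inverse_real_of_nat by auto
      ultimately have "(\<lambda>m. (f (s + e m) y - f s y) / e m) \<longlonglongrightarrow> deriv (\<lambda>t. f t y) s"
        by (rule filterlim_compose)
      then show ?thesis using True Pair by simp
    qed (simp add: Pair)
  qed
  show "?g m \<in> borel_measurable (borel \<Otimes>\<^sub>M borel)" for m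
  proof -
    have [measurable]: "(\<lambda>z. f (fst z + c) (snd z)) \<in> borel_measurable (borel \<Otimes>\<^sub>M borel)" for c
    proof -
      have "(\<lambda>z::real \<times> real. (fst z + c, snd z)) \<in> measurable (borel \<Otimes>\<^sub>M borel) (borel \<Otimes>\<^sub>M borel)" by measurable
      from measurable_compose[OF this f] show ?thesis by simp
    qed
    have [measurable]: "(\<lambda>z. f (fst z) (snd z)) \<in> borel_measurable (borel \<Otimes>\<^sub>M borel)"
      using f by (simp add: case_prod_beta')
    show ?thesis unfolding case_prod_beta' by measurable
  qed
qed

section \<open>Conditional moments and kernel windows\<close>

context prob_space
begin

text \<open>Integrating the almost sure bound on the conditional expectation over an event
  determined by \<open>V\<close> produces the probability of that event as a factor, the form in
  which the kernel inequalities use moments.\<close>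

lemma cond_moment_bound:
  fixes V f :: "'a \<Rightarrow> real"
  assumes V[measurable]: "V \<in> borel_measurable M" and f[measurable]: "f \<in> borel_measurable M"
    and nn: "\<And>\<omega>. 0 \<le> f \<omega>" and C: "0 \<le> C"
    and bd: "AE \<omega> in M. nn_cond_exp M (vimage_algebra (space M) V borel) (\<lambda>\<omega>. ennreal (f \<omega>)) \<omega> \<le> ennreal C"
  shows "integrable M f"
    and "\<And>S. S \<in> sets borel \<Longrightarrow> expectation (\<lambda>\<omega>. indicator S (V \<omega>) * f \<omega>) \<le> C * prob {\<omega> \<in> space M. V \<omega> \<in> S}"
proof -
  define G where "G = vimage_algebra (space M) V borel"
  have sub: "subalgebra M G"
    unfolding subalgebra_def G_def using V by (auto simp: sets_vimage_algebra2 measurable_sets)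
  interpret G: finite_measure_subalgebra M G by unfold_locales (rule sub)
  have main: "(\<integral>\<^sup>+\<omega>. ennreal (indicator S (V \<omega>) * f \<omega>) \<partial>M) \<le> ennreal (C * prob {\<omega> \<in> space M. V \<omega> \<in> S})"
    if S[measurable]: "S \<in> sets borel" for S
  proof -
    have VG: "V \<in> measurable G borel" unfolding G_def by (rule measurable_vimage_algebra1) simp
    have iG: "(\<lambda>\<omega>. indicator S (V \<omega>) :: ennreal) \<in> borel_measurable G"
      using VG by measurable
    have "(\<integral>\<^sup>+\<omega>. ennreal (indicator S (V \<omega>) * f \<omega>) \<partial>M) = (\<integral>\<^sup>+\<omega>. indicator S (V \<omega>) * ennreal (f \<omega>) \<partial>M)"
      by (intro nn_integral_cong) (simp add: indicator_def)
    also have "\<dots> = (\<integral>\<^sup>+\<omega>. indicator S (V \<omega>) * nn_cond_exp M G (\<lambda>\<omega>. ennreal (f \<omega>)) \<omega> \<partial>M)"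
      by (rule G.nn_cond_exp_intg[OF iG, symmetric]) simp
    also have "\<dots> \<le> (\<integral>\<^sup>+\<omega>. indicator S (V \<omega>) * ennreal C \<partial>M)"
      using bd unfolding G_def[symmetric] by (intro nn_integral_mono_AE) (auto elim!: eventually_mono intro!: mult_left_mono)
    also have "\<dots> = (\<integral>\<^sup>+\<omega>. ennreal C * indicator {\<omega> \<in> space M. V \<omega> \<in> S} \<omega> \<partial>M)"
      by (intro nn_integral_cong) (simp add: indicator_def)
    also have "\<dots> = ennreal C * emeasure M {\<omega> \<in> space M. V \<omega> \<in> S}"
      by (rule nn_integral_cmult_indicator) simp
    also have "\<dots> = ennreal (C * prob {\<omega> \<in> space M. V \<omega> \<in> S})"
      using C by (simp add: emeasure_eq_measure ennreal_mult)
    finally show ?thesis .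
  qed
  show int: "integrable M f"
  proof (rule integrableI_nonneg)
    have "(\<integral>\<^sup>+\<omega>. ennreal (f \<omega>) \<partial>M) \<le> ennreal C"
      using main[of UNIV] by (simp add: prob_space)
    then show "(\<integral>\<^sup>+\<omega>. ennreal (f \<omega>) \<partial>M) < \<infinity>" by (auto intro: le_less_trans)
  qed (use nn in auto)
  show "expectation (\<lambda>\<omega>. indicator S (V \<omega>) * f \<omega>) \<le> C * prob {\<omega> \<in> space M. V \<omega> \<in> S}" if [measurable]: "S \<in> sets borel" for S
  proof -
    have "integrable M (\<lambda>\<omega>. indicator S (V \<omega>) * f \<omega>)"
      by (rule Bochner_Integration.integrable_bound[OF int]) (use nn in \<open>auto simp: indicator_def\<close>)
    then have "ennreal (expectation (\<lambda>\<omega>. indicator S (V \<omega>) * f \<omega>)) = (\<integral>\<^sup>+\<omega>. ennreal (indicator S (V \<omega>) * f \<omega>) \<partial>M)"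
      using nn by (intro nn_integral_eq_integral[symmetric]) auto
    then have "ennreal (expectation (\<lambda>\<omega>. indicator S (V \<omega>) * f \<omega>)) \<le> ennreal (C * prob {\<omega> \<in> space M. V \<omega> \<in> S})"
      using main[OF that] by simp
    then show ?thesis using C by (simp add: ennreal_le_iff)
  qed
qed

lemma expectation_cond_mean_zero:
  fixes f g :: "'a \<Rightarrow> real"
  assumes sub: "subalgebra M G" and int: "integrable M (\<lambda>\<omega>. f \<omega> * g \<omega>)"
    and f: "f \<in> borel_measurable G" and g: "g \<in> borel_measurable M"
    and z: "AE \<omega> in M. real_cond_exp M G g \<omega> = 0"
  shows "expectation (\<lambda>\<omega>. f \<omega> * g \<omega>) = 0"
proof -
  interpret G: finite_measure_subalgebra M G by unfold_locales (rule sub)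
  have fM[measurable]: "f \<in> borel_measurable M" by (rule measurable_from_subalg[OF sub f])
  have [measurable]: "real_cond_exp M G g \<in> borel_measurable M" by simp
  have "expectation (\<lambda>\<omega>. f \<omega> * g \<omega>) = expectation (\<lambda>\<omega>. f \<omega> * real_cond_exp M G g \<omega>)"
    by (rule G.real_cond_exp_intg(2)[OF int f g, symmetric])
  also have "\<dots> = expectation (\<lambda>\<omega>. 0)"
    using z by (intro integral_cong_AE) auto
  finally show ?thesis by simp
qed

end

lemma has_density_ball:
  assumes "prob_space M" and D: "distributed M lborel V (\<lambda>u. ennreal (fU u) * indicator {0..1} u)"
    and fU: "\<And>u. u \<in> {0..1} \<Longrightarrow> fU u \<le> c2" and c2: "0 \<le> c2"
  shows "AE \<omega> in M. V \<omega> \<in> {0..1}"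
    and "a \<le> b \<Longrightarrow> measure M {\<omega> \<in> space M. V \<omega> \<in> {a..b}} \<le> c2 * (b - a)"
proof -
  interpret prob_space M by fact
  have V[measurable]: "V \<in> borel_measurable M" using distributed_measurable[OF D] by simp
  have em: "emeasure M {\<omega> \<in> space M. V \<omega> \<in> S} = (\<integral>\<^sup>+u. ennreal (fU u) * indicator {0..1} u * indicator S u \<partial>lborel)"
    if "S \<in> sets borel" for S
    using distributed_emeasure[OF D, of S] that by (simp add: vimage_def Int_def conj_commute)
  show "AE \<omega> in M. V \<omega> \<in> {0..1}"
  proof (rule AE_I[where N="{\<omega> \<in> space M. V \<omega> \<in> - {0..1}}"])
    have "emeasure M {\<omega> \<in> space M. V \<omega> \<in> - {0..1}}
        = (\<integral>\<^sup>+u. ennreal (fU u) * indicator {0..1} u * indicator (- {0..1}) u \<partial>lborel)"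
      by (rule em) simp
    also have "\<dots> = (\<integral>\<^sup>+u. 0 \<partial>(lborel :: real measure))"
      by (intro nn_integral_cong) (auto simp: indicator_def)
    finally show "emeasure M {\<omega> \<in> space M. V \<omega> \<in> - {0..1}} = 0" by simp
  qed auto
  show "measure M {\<omega> \<in> space M. V \<omega> \<in> {a..b}} \<le> c2 * (b - a)" if ab: "a \<le> b"
  proof -
    have "emeasure M {\<omega> \<in> space M. V \<omega> \<in> {a..b}} \<le> (\<integral>\<^sup>+u. ennreal c2 * indicator {a..b} u \<partial>lborel)"
      by (subst em) (auto intro!: nn_integral_mono simp: indicator_def ennreal_leI fU)
    also have "\<dots> = ennreal (c2 * (b - a))"
      using ab c2 by (simp add: nn_integral_cmult_indicator ennreal_mult)
    finally show ?thesis using ab c2 by (simp add: emeasure_eq_measure)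
  qed
qed

section \<open>The model: measurable versions of the summands, their moments and averages\<close>

locale gsvcm = prob_space M
  for M :: "'w measure" +
  fixes U :: "nat \<Rightarrow> nat \<Rightarrow> 'w \<Rightarrow> real"
    and X :: "nat \<Rightarrow> nat \<Rightarrow> nat \<Rightarrow> 'w \<Rightarrow> real"
    and Y :: "nat \<Rightarrow> nat \<Rightarrow> 'w \<Rightarrow> real"
    and d s1 s2 :: "nat \<Rightarrow> nat"
    and a :: "nat \<Rightarrow> nat \<Rightarrow> real \<Rightarrow> real"
    and R :: "real set"
    and likf :: "real \<Rightarrow> real \<Rightarrow> real"
    and r :: "nat \<Rightarrow> nat \<Rightarrow> 'w \<Rightarrow> real"
    and Z :: "nat \<Rightarrow> nat \<Rightarrow> 'w \<Rightarrow> real \<times> (nat \<Rightarrow> real)"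
    and \<sigma>U \<sigma>XU :: "nat \<Rightarrow> nat \<Rightarrow> 'w measure"
    and Q1 Q2 :: "nat \<Rightarrow> nat \<Rightarrow> 'w \<Rightarrow> real"
    and K :: "real \<Rightarrow> real" and h :: "nat \<Rightarrow> real"
    and fU :: "real \<Rightarrow> real"
    and m0 \<tau>1 \<delta>1 :: real
  assumes r_def: "r = (\<lambda>n i \<omega>. \<Sum>j=1..d n. a n j (U n i \<omega>) * X n i j \<omega>)"
    and Z_def: "Z = (\<lambda>n i \<omega>. (U n i \<omega>, \<lambda>j\<in>{1..d n}. X n i j \<omega>))"
    and \<sigma>U_def: "\<sigma>U = (\<lambda>n i. vimage_algebra (space M) (U n i) borel)"
    and \<sigma>XU_def: "\<sigma>XU = (\<lambda>n i. vimage_algebra (space M) (Z n i) (regressor_space (d n)))"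
    and Q1_def: "Q1 = (\<lambda>n i \<omega>. q1 likf (r n i \<omega>) (Y n i \<omega>))"
    and Q2_def: "Q2 = (\<lambda>n i \<omega>. q2 likf (r n i \<omega>) (Y n i \<omega>))"
    and indep: "\<And>n. indep_vars (\<lambda>_. obs_space (d n)) (\<lambda>i \<omega>. (Z n i \<omega>, Y n i \<omega>)) {1..n}"
    and densU: "\<And>n i. i \<in> {1..n} \<Longrightarrow>
          distributed M lborel (U n i) (\<lambda>u. ennreal (fU u) * indicator {0..1} u)"
    and range_meas: "R \<in> sets borel"
    and range_Y: "\<And>n i \<omega>. i \<in> {1..n} \<Longrightarrow> \<omega> \<in> space M \<Longrightarrow> Y n i \<omega> \<in> R"
    and lik_meas: "(\<lambda>(s, y). likf s y) \<in> borel_measurable (borel \<Otimes>\<^sub>M borel)"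
    and lik_diff1: "\<And>y s. y \<in> R \<Longrightarrow> (\<lambda>t. likf t y) differentiable (at s)"
    and lik_diff2: "\<And>y s. y \<in> R \<Longrightarrow> (\<lambda>t. q1 likf t y) differentiable (at s)"
    and s_ord: "\<And>n. 1 \<le> s1 n \<and> s1 n < s2 n \<and> s2 n < d n"
    and h_pos: "\<And>n. 0 < h n"
    and K_cont: "continuous_on UNIV K"
    and K_nonneg: "\<And>z. 0 \<le> K z"
    and K_supp: "compact (closure {z. K z \<noteq> 0})"
    and m0: "2 < m0"
    and Q1_int: "\<And>n i. i \<in> {1..n} \<Longrightarrow> integrable M (Q1 n i)"
    and Q1_mean: "\<And>n i. i \<in> {1..n} \<Longrightarrow> (AE \<omega> in M. real_cond_exp M (\<sigma>XU n i) (Q1 n i) \<omega> = 0)"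
    and moments: "\<exists>C::real. \<forall>n. \<forall>i\<in>{1..n}. AE \<omega> in M.
          (MAX j\<in>{1..d n}.
             nn_cond_exp M (\<sigma>U n i) (\<lambda>\<omega>. ennreal (\<bar>Q1 n i \<omega> * X n i j \<omega>\<bar> powr m0)) \<omega>)
          + (MAX (j, k)\<in>{1..d n} \<times> {1..d n}.
             nn_cond_exp M (\<sigma>U n i) (\<lambda>\<omega>. ennreal (\<bar>Q2 n i \<omega> * X n i j \<omega> * X n i k \<omega>\<bar> powr m0)) \<omega>)
          \<le> ennreal C"
    and q2_lip: "\<exists>Mf. \<exists>C::real. \<forall>n. Mf n \<in> borel_measurable (obs_space (d n)) \<and>
          (\<forall>i\<in>{1..n}. (AE \<omega> in M. 0 < Mf n (Z n i \<omega>, Y n i \<omega>) \<and>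
              (\<forall>\<delta>'. \<bar>q2 likf (r n i \<omega> + \<delta>') (Y n i \<omega>) - q2 likf (r n i \<omega>) (Y n i \<omega>)\<bar>
                    \<le> Mf n (Z n i \<omega>, Y n i \<omega>) * \<bar>\<delta>'\<bar>)) \<and>
            (AE \<omega> in M. (MAX (j, k, l)\<in>{1..d n} \<times> {1..d n} \<times> {1..d n}.
              nn_cond_exp M (\<sigma>U n i) (\<lambda>\<omega>. ennreal
                (\<bar>X n i j \<omega> * X n i k \<omega> * X n i l \<omega> * Mf n (Z n i \<omega>, Y n i \<omega>)\<bar> powr m0)) \<omega>)
              \<le> ennreal C))"
    and fU_bounds: "\<exists>c1 c2. 0 < c1 \<and> (\<forall>u\<in>{0..1}. c1 \<le> fU u \<and> fU u \<le> c2)"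
    and a_smooth: "\<exists>C. \<forall>n. \<forall>j\<in>{1..d n}. \<exists>f2. cont_second_deriv (a n j) f2 \<and> (\<forall>u\<in>{0..1}. \<bar>f2 u\<bar> \<le> C)"
    and tau1: "0 \<le> \<tau>1" "propto (\<lambda>n. real (d n)) (\<lambda>n. real n powr \<tau>1)"
    and rate_nh: "filterlim (\<lambda>n. real n * h n /
          ((real n * real (d n) ^ 3) powr (2 / m0) * ln (1 / h n))) at_top sequentially"
    and delta1: "0 < \<delta>1" "propto h (\<lambda>n. real n powr (- \<delta>1))"
begin

definition clamp01 :: "real \<Rightarrow> real" where "clamp01 u = max 0 (min 1 u)"

lemma clamp01: "clamp01 u \<in> {0..1}" "u \<in> {0..1} \<Longrightarrow> clamp01 u = u"
  by (auto simp: clamp01_def)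

lemma a_cont: "j \<in> {1..d n} \<Longrightarrow> continuous_on {0..1} (a n j)"
  using a_smooth unfolding cont_second_deriv_def
  by (metis (no_types, lifting) DERIV_continuous_on)

lemma a_clamp_meas [measurable]:
  assumes "j \<in> {1..d n}"
  shows "(\<lambda>u. a n j (clamp01 u)) \<in> borel_measurable borel"
proof (rule borel_measurable_continuous_onI)
  show "continuous_on UNIV (\<lambda>u. a n j (clamp01 u))"
  proof (rule continuous_on_compose2[OF a_cont[OF assms]])
    show "continuous_on UNIV clamp01" unfolding clamp01_def by (intro continuous_intros)
  qed (use clamp01(1) in auto)
qed

lemma obs_meas: "i \<in> {1..n} \<Longrightarrow> (\<lambda>\<omega>. (Z n i \<omega>, Y n i \<omega>)) \<in> measurable M (obs_space (d n))"
  using indep[of n] by (auto simp: indep_vars_def)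

lemma obs_fst_meas: "(\<lambda>z. fst (fst z)) \<in> borel_measurable (obs_space D)"
  unfolding obs_space_def regressor_space_def by measurable

lemma obs_resp_meas: "(\<lambda>z. snd z) \<in> borel_measurable (obs_space D)"
  unfolding obs_space_def regressor_space_def by measurable

lemma obs_cov_meas: "j \<in> {1..D} \<Longrightarrow> (\<lambda>z. snd (fst z) j) \<in> borel_measurable (obs_space D)"
  unfolding obs_space_def regressor_space_def by measurable

lemma UXY_meas:
  assumes "i \<in> {1..n}"
  shows "U n i \<in> borel_measurable M" "j \<in> {1..d n} \<Longrightarrow> X n i j \<in> borel_measurable M" "Y n i \<in> borel_measurable M"
  using measurable_compose[OF obs_meas[OF assms] obs_fst_meas] measurable_compose[OF obs_meas[OF assms] obs_cov_meas]
    measurable_compose[OF obs_meas[OF assms] obs_resp_meas] by (auto simp: Z_def)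

text \<open>Set to zero off the range \<open>R\<close>, where differentiability is not assumed; this
  makes the derivatives jointly measurable and changes no observed value.\<close>

definition q1R :: "real \<Rightarrow> real \<Rightarrow> real" where "q1R s y = (if y \<in> R then q1 likf s y else 0)"
definition q2R :: "real \<Rightarrow> real \<Rightarrow> real" where "q2R s y = (if y \<in> R then q2 likf s y else 0)"

lemma q1R_meas: "(\<lambda>(s, y). q1R s y) \<in> borel_measurable (borel \<Otimes>\<^sub>M borel)"
proof -
  have "(\<lambda>(s, y). if y \<in> R then deriv (\<lambda>t. likf t y) s else 0) \<in> borel_measurable (borel \<Otimes>\<^sub>M borel)"
    by (rule deriv_measurable_on[OF lik_meas range_meas]) (rule lik_diff1)
  then show ?thesis unfolding q1R_def q1_def .
qed

lemma q2R_meas: "(\<lambda>(s, y). q2R s y) \<in> borel_measurable (borel \<Otimes>\<^sub>M borel)"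
proof -
  have e: "(\<lambda>t. q1R t y) = (\<lambda>t. q1 likf t y)" if "y \<in> R" for y using that by (simp add: q1R_def)
  have "(\<lambda>(s, y). if y \<in> R then deriv (\<lambda>t. q1R t y) s else 0) \<in> borel_measurable (borel \<Otimes>\<^sub>M borel)"
    using e lik_diff2 by (intro deriv_measurable_on[OF q1R_meas range_meas]) auto
  also have "(\<lambda>(s, y). if y \<in> R then deriv (\<lambda>t. q1R t y) s else 0) = (\<lambda>(s, y). q2R s y)"
    using e by (auto simp: q2R_def q2_def fun_eq_iff)
  finally show ?thesis .
qed

text \<open>The clamping makes the predictor a measurable function of the observation; it is inactive
  almost surely because \<open>U\<close> is supported on the unit interval.\<close>

definition predictor :: "nat \<Rightarrow> (real \<times> (nat \<Rightarrow> real)) \<times> real \<Rightarrow> real" where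
  "predictor n z = (\<Sum>j=1..d n. a n j (clamp01 (fst (fst z))) * snd (fst z) j)"

lemma predictor_meas: "predictor n \<in> borel_measurable (obs_space (d n))"
  unfolding predictor_def
proof (rule borel_measurable_sum)
  fix j assume j: "j \<in> {1..d n}"
  show "(\<lambda>z. a n j (clamp01 (fst (fst z))) * snd (fst z) j) \<in> borel_measurable (obs_space (d n))"
    by (intro borel_measurable_times measurable_compose[OF obs_fst_meas a_clamp_meas[OF j]] obs_cov_meas[OF j])
qed

text \<open>As functions of one observation the summands inherit independence by composition. They
  agree with the terms of the moment conditions wherever the index variable lies in the unit
  interval.\<close>

definition score_fun :: "nat \<Rightarrow> nat \<Rightarrow> (real \<times> (nat \<Rightarrow> real)) \<times> real \<Rightarrow> real" where
  "score_fun n j z = q1R (predictor n z) (snd z) * snd (fst z) j"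

definition hess_fun :: "nat \<Rightarrow> nat \<times> nat \<Rightarrow> (real \<times> (nat \<Rightarrow> real)) \<times> real \<Rightarrow> real" where
  "hess_fun n p z = q2R (predictor n z) (snd z) * snd (fst z) (fst p) * snd (fst z) (snd p)"

definition third_fun :: "((real \<times> (nat \<Rightarrow> real)) \<times> real \<Rightarrow> real) \<Rightarrow> nat \<times> nat \<times> nat
    \<Rightarrow> (real \<times> (nat \<Rightarrow> real)) \<times> real \<Rightarrow> real" where
  "third_fun m p z = snd (fst z) (fst p) * snd (fst z) (fst (snd p)) * snd (fst z) (snd (snd p)) * m z"

lemma score_fun_meas:
  assumes "j \<in> {1..d n}"
  shows "score_fun n j \<in> borel_measurable (obs_space (d n))"
proof -
  have "(\<lambda>z. (predictor n z, snd z)) \<in> measurable (obs_space (d n)) (borel \<Otimes>\<^sub>M borel)"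
    using predictor_meas obs_resp_meas by measurable
  from measurable_compose[OF this q1R_meas] obs_cov_meas[OF assms]
  show ?thesis unfolding score_fun_def[abs_def] by simp
qed

lemma hess_fun_meas:
  assumes "p \<in> {1..d n} \<times> {1..d n}"
  shows "hess_fun n p \<in> borel_measurable (obs_space (d n))"
proof -
  have "(\<lambda>z. (predictor n z, snd z)) \<in> measurable (obs_space (d n)) (borel \<Otimes>\<^sub>M borel)"
    using predictor_meas obs_resp_meas by measurable
  from measurable_compose[OF this q2R_meas] obs_cov_meas[of "fst p" "d n"] obs_cov_meas[of "snd p" "d n"] assms
  show ?thesis unfolding hess_fun_def[abs_def] by auto
qed

lemma third_fun_meas:
  assumes "p \<in> {1..d n} \<times> {1..d n} \<times> {1..d n}" "m \<in> borel_measurable (obs_space (d n))"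
  shows "third_fun m p \<in> borel_measurable (obs_space (d n))"
  using assms obs_cov_meas[of "fst p" "d n"] obs_cov_meas[of "fst (snd p)" "d n"] obs_cov_meas[of "snd (snd p)" "d n"]
  unfolding third_fun_def[abs_def] by auto

lemma fun_at_obs:
  assumes i: "i \<in> {1..n}" and \<omega>: "\<omega> \<in> space M" "U n i \<omega> \<in> {0..1}"
  shows "j \<in> {1..d n} \<Longrightarrow> score_fun n j (Z n i \<omega>, Y n i \<omega>) = Q1 n i \<omega> * X n i j \<omega>"
    and "j \<in> {1..d n} \<Longrightarrow> k \<in> {1..d n} \<Longrightarrow>
      hess_fun n (j, k) (Z n i \<omega>, Y n i \<omega>) = Q2 n i \<omega> * X n i j \<omega> * X n i k \<omega>"
    and "j \<in> {1..d n} \<Longrightarrow> k \<in> {1..d n} \<Longrightarrow> l \<in> {1..d n} \<Longrightarrow>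
      third_fun m (j, k, l) (Z n i \<omega>, Y n i \<omega>) = X n i j \<omega> * X n i k \<omega> * X n i l \<omega> * m (Z n i \<omega>, Y n i \<omega>)"
proof -
  have "predictor n (Z n i \<omega>, Y n i \<omega>) = r n i \<omega>"
    unfolding predictor_def r_def Z_def using clamp01(2)[OF \<omega>(2)] by (intro sum.cong) auto
  moreover have "Y n i \<omega> \<in> R" using range_Y[OF i \<omega>(1)] .
  ultimately show "j \<in> {1..d n} \<Longrightarrow> score_fun n j (Z n i \<omega>, Y n i \<omega>) = Q1 n i \<omega> * X n i j \<omega>"
    "j \<in> {1..d n} \<Longrightarrow> k \<in> {1..d n} \<Longrightarrow>
      hess_fun n (j, k) (Z n i \<omega>, Y n i \<omega>) = Q2 n i \<omega> * X n i j \<omega> * X n i k \<omega>"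
    "j \<in> {1..d n} \<Longrightarrow> k \<in> {1..d n} \<Longrightarrow> l \<in> {1..d n} \<Longrightarrow>
      third_fun m (j, k, l) (Z n i \<omega>, Y n i \<omega>) = X n i j \<omega> * X n i k \<omega> * X n i l \<omega> * m (Z n i \<omega>, Y n i \<omega>)"
    by (simp_all add: score_fun_def hess_fun_def third_fun_def Q1_def Q2_def q1R_def q2R_def Z_def)
qed

lemma pair_indep:
  assumes "\<phi> \<in> borel_measurable (obs_space (d n))"
  shows "indep_vars (\<lambda>_. borel \<Otimes>\<^sub>M borel) (\<lambda>i \<omega>. (U n i \<omega>, \<phi> (Z n i \<omega>, Y n i \<omega>))) {1..n}"
proof -
  have "(\<lambda>z. (fst (fst z), \<phi> z)) \<in> measurable (obs_space (d n)) (borel \<Otimes>\<^sub>M borel)"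
    using obs_fst_meas assms by measurable
  from indep_vars_compose2[OF indep[of n], of "\<lambda>_ z. (fst (fst z), \<phi> z)" "\<lambda>_. borel \<Otimes>\<^sub>M borel"] this
  show ?thesis by (simp add: Z_def)
qed

definition fmax :: real where "fmax = (SOME c2. 0 \<le> c2 \<and> (\<forall>u\<in>{0..1}. fU u \<le> c2))"

lemma fmax: "0 \<le> fmax" "\<And>u. u \<in> {0..1} \<Longrightarrow> fU u \<le> fmax"
proof -
  obtain c1 c2 where "0 < c1" "\<forall>u\<in>{0..1}. c1 \<le> fU u \<and> fU u \<le> c2" using fU_bounds by blast
  then have "0 \<le> max 0 c2 \<and> (\<forall>u\<in>{0..1}. fU u \<le> max 0 c2)" by (auto intro: order_trans max.cobounded2)
  then have "0 \<le> fmax \<and> (\<forall>u\<in>{0..1}. fU u \<le> fmax)" unfolding fmax_def by (rule someI)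
  then show "0 \<le> fmax" "\<And>u. u \<in> {0..1} \<Longrightarrow> fU u \<le> fmax" by auto
qed

lemma U_unit: "i \<in> {1..n} \<Longrightarrow> AE \<omega> in M. U n i \<omega> \<in> {0..1}"
  by (rule has_density_ball(1)[OF prob_space_axioms densU fmax(2,1)])

lemma U_ball: "i \<in> {1..n} \<Longrightarrow> x \<le> y \<Longrightarrow> prob {\<omega> \<in> space M. U n i \<omega> \<in> {x..y}} \<le> fmax * (y - x)"
  by (rule has_density_ball(2)[OF prob_space_axioms densU fmax(2,1)])

text \<open>The moment conditions concern \<open>W\<close>, the literal term of the model, whereas
  the kernel inequalities need a measurable function of the observation. Almost sure equality
  transfers the moments.\<close>

lemma moment_of_cond:
  assumes i: "i \<in> {1..n}" and \<phi>: "\<phi> \<in> borel_measurable (obs_space (d n))" and C: "0 \<le> C"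
    and W[measurable]: "W \<in> borel_measurable M"
    and eq: "AE \<omega> in M. \<phi> (Z n i \<omega>, Y n i \<omega>) = W \<omega>"
    and bd: "AE \<omega> in M. nn_cond_exp M (\<sigma>U n i) (\<lambda>\<omega>. ennreal (\<bar>W \<omega>\<bar> powr m0)) \<omega> \<le> ennreal C"
  shows "integrable M (\<lambda>\<omega>. \<bar>\<phi> (Z n i \<omega>, Y n i \<omega>)\<bar> powr m0)"
    and "S \<in> sets borel \<Longrightarrow> expectation (\<lambda>\<omega>. indicator S (U n i \<omega>) * \<bar>\<phi> (Z n i \<omega>, Y n i \<omega>)\<bar> powr m0)
      \<le> C * prob {\<omega> \<in> space M. U n i \<omega> \<in> S}"
proof -
  have [measurable]: "(\<lambda>\<omega>. \<phi> (Z n i \<omega>, Y n i \<omega>)) \<in> borel_measurable M"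
    by (rule measurable_compose[OF obs_meas[OF i] \<phi>])
  note [measurable] = UXY_meas(1)[OF i]
  note c = cond_moment_bound[OF UXY_meas(1)[OF i], of "\<lambda>\<omega>. \<bar>W \<omega>\<bar> powr m0" C, OF _ _ C bd[unfolded \<sigma>U_def]]
  have "integrable M (\<lambda>\<omega>. \<bar>W \<omega>\<bar> powr m0)" by (rule c(1)) auto
  then show "integrable M (\<lambda>\<omega>. \<bar>\<phi> (Z n i \<omega>, Y n i \<omega>)\<bar> powr m0)"
    using eq by (subst integrable_cong_AE[where g="\<lambda>\<omega>. \<bar>W \<omega>\<bar> powr m0"]) auto
  show "expectation (\<lambda>\<omega>. indicator S (U n i \<omega>) * \<bar>\<phi> (Z n i \<omega>, Y n i \<omega>)\<bar> powr m0)
      \<le> C * prob {\<omega> \<in> space M. U n i \<omega> \<in> S}" if [measurable]: "S \<in> sets borel"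
  proof -
    have "expectation (\<lambda>\<omega>. indicator S (U n i \<omega>) * \<bar>\<phi> (Z n i \<omega>, Y n i \<omega>)\<bar> powr m0)
      = expectation (\<lambda>\<omega>. indicator S (U n i \<omega>) * \<bar>W \<omega>\<bar> powr m0)"
      using eq by (intro integral_cong_AE) auto
    also have "\<dots> \<le> C * prob {\<omega> \<in> space M. U n i \<omega> \<in> S}" by (rule c(2)) (use that in auto)
    finally show ?thesis .
  qed
qed

lemma kernel_support: "\<exists>c\<ge>1. \<exists>B\<ge>0. \<forall>z. \<bar>K z\<bar> \<le> B * indicator {- c..c} z"
proof -
  have "bounded {z. K z \<noteq> 0}"
    using K_supp compact_imp_bounded bounded_subset closure_subset by blast
  then obtain b where b: "\<And>z. K z \<noteq> 0 \<Longrightarrow> \<bar>z\<bar> \<le> b" by (auto simp: bounded_iff)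
  define c where "c = max 1 b"
  have "compact (K ` {- c..c})"
    by (intro compact_continuous_image continuous_on_subset[OF K_cont]) auto
  then have "bounded (K ` {- c..c})" by (rule compact_imp_bounded)
  then obtain B where "\<forall>x\<in>K ` {- c..c}. norm x \<le> B" unfolding bounded_iff by blast
  then have B: "\<bar>K z\<bar> \<le> B" if "z \<in> {- c..c}" for z using that by simp
  have "\<bar>K z\<bar> \<le> max 0 B * indicator {- c..c} z" for z
  proof (cases "z \<in> {- c..c}")
    case True
    then show ?thesis using B[OF True] by simp
  next
    case False
    have "K z = 0"
    proof (rule ccontr)
      assume "K z \<noteq> 0"
      from b[OF this] have "\<bar>z\<bar> \<le> c" by (simp add: c_def)
      then show False using False by (simp add: abs_le_iff)
    qed
    then show ?thesis using False by simp
  qed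
  then show ?thesis by (intro exI[of _ c] conjI exI[of _ "max 0 B"]) (auto simp: c_def)
qed

lemma K_meas: "K \<in> borel_measurable borel"
  using K_cont by (rule borel_measurable_continuous_onI)

text \<open>No cancellation is sought, so the mean itself has to be bounded:
  \<open>|w| \<le> 1 + |w| powr m0\<close> gives at most \<open>1 + C\<close> times the kernel bound
  and the window probability, and \<open>1 + C\<close> is the \<mu> handed to the general
  bound.\<close>

lemma uniform_abs_average:
  fixes \<phi> :: "nat \<Rightarrow> 'p \<Rightarrow> (real \<times> (nat \<Rightarrow> real)) \<times> real \<Rightarrow> real"
  assumes J: "\<And>n. finite (J n)" "\<And>n. card (J n) \<le> d n ^ 3" and C: "0 \<le> C"
    and \<phi>: "\<And>n p. p \<in> J n \<Longrightarrow> \<phi> n p \<in> borel_measurable (obs_space (d n))"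
    and int: "\<And>n p i. p \<in> J n \<Longrightarrow> i \<in> {1..n} \<Longrightarrow> integrable M (\<lambda>\<omega>. \<bar>\<phi> n p (Z n i \<omega>, Y n i \<omega>)\<bar> powr m0)"
    and mom: "\<And>n p i S. p \<in> J n \<Longrightarrow> i \<in> {1..n} \<Longrightarrow> S \<in> sets borel \<Longrightarrow>
      expectation (\<lambda>\<omega>. indicator S (U n i \<omega>) * \<bar>\<phi> n p (Z n i \<omega>, Y n i \<omega>)\<bar> powr m0)
        \<le> C * prob {\<omega> \<in> space M. U n i \<omega> \<in> S}"
  shows "\<exists>C'\<ge>0. with_prob_to_1 M (\<lambda>n \<omega>. \<forall>k\<in>{1..n}. \<forall>p\<in>J n.
      \<bar>1 / n * (\<Sum>i=1..n. \<bar>\<phi> n p (Z n i \<omega>, Y n i \<omega>)\<bar> * (K ((U n i \<omega> - U n k \<omega>) / h n) / h n))\<bar>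
      \<le> C' * ((1 + C) + sqrt (ln (1 / h n) / (real n * h n))))"
proof -
  obtain c B where c: "1 \<le> c" and B: "0 \<le> B" and K_bd: "\<And>z. \<bar>K z\<bar> \<le> B * indicator {- c..c} z"
    using kernel_support by blast
  show ?thesis
  proof (rule kernel_average_bound[where V = U and W = "\<lambda>n p i \<omega>. \<bar>\<phi> n p (Z n i \<omega>, Y n i \<omega>)\<bar>" and C = C and ?c2.0 = fmax])
    show "indep_vars (\<lambda>_. borel \<Otimes>\<^sub>M borel) (\<lambda>i \<omega>. (U n i \<omega>, \<bar>\<phi> n p (Z n i \<omega>, Y n i \<omega>)\<bar>)) {1..n}" if "p \<in> J n" for n p
      using pair_indep[of "\<lambda>z. \<bar>\<phi> n p z\<bar>" n] \<phi>[OF that] by simp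
    show "\<bar>expectation (\<lambda>\<omega>. \<bar>\<phi> n p (Z n i \<omega>, Y n i \<omega>)\<bar> * K ((U n i \<omega> - u) / h n))\<bar>
      \<le> (1 + C) * B * prob {\<omega> \<in> space M. U n i \<omega> \<in> {u - c * h n..u + c * h n}}"
      if p: "p \<in> J n" and i: "i \<in> {1..n}" for n p i u
    proof -
      let ?W = "\<lambda>\<omega>. \<bar>\<phi> n p (Z n i \<omega>, Y n i \<omega>)\<bar>"
      let ?S = "{u - c * h n..u + c * h n}"
      have [measurable]: "(\<lambda>\<omega>. \<phi> n p (Z n i \<omega>, Y n i \<omega>)) \<in> borel_measurable M"
        by (rule measurable_compose[OF obs_meas[OF i] \<phi>[OF p]])
      note [measurable] = UXY_meas(1)[OF i] K_meas
      have pt: "\<bar>?W \<omega> * K ((U n i \<omega> - u) / h n)\<bar> \<le> B * (indicator ?S (U n i \<omega>) + indicator ?S (U n i \<omega>) * ?W \<omega> powr m0)" for \<omega>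
      proof -
        have "\<bar>K ((U n i \<omega> - u) / h n)\<bar> \<le> B * indicator ?S (U n i \<omega>)"
          using K_bd[of "(U n i \<omega> - u) / h n"] h_pos[of n] B
          by (auto simp: indicator_def field_simps split: if_splits)
        moreover have "?W \<omega> \<le> 1 + ?W \<omega> powr m0"
        proof (cases "?W \<omega> \<le> 1")
          case True then show ?thesis by (simp add: add_increasing2)
        next
          case False
          then have "?W \<omega> powr 1 \<le> ?W \<omega> powr m0" using m0 by (intro powr_mono) auto
          then show ?thesis using False by simp
        qed
        ultimately have "?W \<omega> * \<bar>K ((U n i \<omega> - u) / h n)\<bar> \<le> (1 + ?W \<omega> powr m0) * (B * indicator ?S (U n i \<omega>))"
          by (intro mult_mono) auto
        then show ?thesis by (simp add: abs_mult algebra_simps)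
      qed
      have iS: "integrable M (\<lambda>\<omega>. indicator ?S (U n i \<omega>) :: real)"
        by (rule integrable_const_bound[where B=1]) (auto simp: indicator_def)
      have iW: "integrable M (\<lambda>\<omega>. indicator ?S (U n i \<omega>) * ?W \<omega> powr m0)"
        by (rule Bochner_Integration.integrable_bound[OF int[OF p i]]) (auto simp: indicator_def)
      have iB: "integrable M (\<lambda>\<omega>. B * (indicator ?S (U n i \<omega>) + indicator ?S (U n i \<omega>) * ?W \<omega> powr m0))"
        by (intro integrable_mult_right Bochner_Integration.integrable_add iS iW)
      have iK: "integrable M (\<lambda>\<omega>. ?W \<omega> * K ((U n i \<omega> - u) / h n))"
      proof (rule Bochner_Integration.integrable_bound[OF iB])
        show "AE \<omega> in M. norm (?W \<omega> * K ((U n i \<omega> - u) / h n))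
            \<le> norm (B * (indicator ?S (U n i \<omega>) + indicator ?S (U n i \<omega>) * ?W \<omega> powr m0))"
          unfolding real_norm_def by (intro AE_I2 order_trans[OF pt abs_ge_self])
      qed simp
      have "\<bar>expectation (\<lambda>\<omega>. ?W \<omega> * K ((U n i \<omega> - u) / h n))\<bar> \<le> expectation (\<lambda>\<omega>. \<bar>?W \<omega> * K ((U n i \<omega> - u) / h n)\<bar>)"
        by (rule integral_abs_bound)
      also have "\<dots> \<le> expectation (\<lambda>\<omega>. B * (indicator ?S (U n i \<omega>) + indicator ?S (U n i \<omega>) * ?W \<omega> powr m0))"
        using iK iB pt by (intro integral_mono) auto
      also have "\<dots> = B * (expectation (\<lambda>\<omega>. indicator ?S (U n i \<omega>)) + expectation (\<lambda>\<omega>. indicator ?S (U n i \<omega>) * ?W \<omega> powr m0))"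
        using iS iW by simp
      also have "expectation (\<lambda>\<omega>. indicator ?S (U n i \<omega>)) = prob {\<omega> \<in> space M. U n i \<omega> \<in> ?S}"
      proof -
        have "expectation (\<lambda>\<omega>. indicator ?S (U n i \<omega>)) = expectation (indicator {\<omega> \<in> space M. U n i \<omega> \<in> ?S})"
          by (intro Bochner_Integration.integral_cong) (auto simp: indicator_def)
        also have "\<dots> = prob {\<omega> \<in> space M. U n i \<omega> \<in> ?S}" by simp
        finally show ?thesis .
      qed
      also have "B * (prob {\<omega> \<in> space M. U n i \<omega> \<in> ?S} + expectation (\<lambda>\<omega>. indicator ?S (U n i \<omega>) * ?W \<omega> powr m0))
        \<le> B * (prob {\<omega> \<in> space M. U n i \<omega> \<in> ?S} + C * prob {\<omega> \<in> space M. U n i \<omega> \<in> ?S})"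
        using B mom[OF p i, of ?S] by (intro mult_left_mono add_left_mono) auto
      finally show ?thesis by (simp add: algebra_simps)
    qed
    show "1 \<le> d n" for n using s_ord[of n] by linarith
  qed (use J K_meas K_bd B c h_pos U_ball fmax m0 C int mom tau1 delta1 rate_nh in auto)
qed

text \<open>The score average is the only one that has to be small; its terms have conditional mean zero.\<close>

lemma uniform_score_average:
  "\<exists>C'\<ge>0. with_prob_to_1 M (\<lambda>n \<omega>. \<forall>k\<in>{1..n}. \<forall>j\<in>{1..d n}.
      \<bar>1 / n * (\<Sum>i=1..n. score_fun n j (Z n i \<omega>, Y n i \<omega>) *
         ((((U n i \<omega> - U n k \<omega>) / h n) ^ l * K ((U n i \<omega> - U n k \<omega>) / h n)) / h n))\<bar>
      \<le> C' * sqrt (ln (1 / h n) / (real n * h n)))"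
proof -
  obtain c B where c: "1 \<le> c" and B: "0 \<le> B" and K_bd: "\<And>z. \<bar>K z\<bar> \<le> B * indicator {- c..c} z"
    using kernel_support by blast
  obtain C0 :: real where C0: "\<And>n i. i \<in> {1..n} \<Longrightarrow> AE \<omega> in M.
          (MAX j\<in>{1..d n}.
             nn_cond_exp M (\<sigma>U n i) (\<lambda>\<omega>. ennreal (\<bar>Q1 n i \<omega> * X n i j \<omega>\<bar> powr m0)) \<omega>)
          + (MAX (j, k)\<in>{1..d n} \<times> {1..d n}.
             nn_cond_exp M (\<sigma>U n i) (\<lambda>\<omega>. ennreal (\<bar>Q2 n i \<omega> * X n i j \<omega> * X n i k \<omega>\<bar> powr m0)) \<omega>)
          \<le> ennreal C0"
    using moments by blast
  define C where "C = max 0 C0"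
  \<comment> \<open>Powers of the scaled distance are absorbed into the kernel: exponent 0 belongs
    to the levels and 1 to the slopes. The support window stays the same and the bound grows by
    \<open>c ^ l\<close>.\<close>
  define \<kappa> where "\<kappa> = (\<lambda>z. z ^ l * K z)"
  have \<kappa>_meas: "\<kappa> \<in> borel_measurable borel" unfolding \<kappa>_def using K_meas by measurable
  have \<kappa>_bd: "\<bar>\<kappa> z\<bar> \<le> (c ^ l * B) * indicator {- c..c} z" for z
  proof (cases "z \<in> {- c..c}")
    case True
    then have "\<bar>z\<bar> ^ l \<le> c ^ l" by (intro power_mono) auto
    then have "\<bar>z\<bar> ^ l * \<bar>K z\<bar> \<le> c ^ l * B"
      using K_bd[of z] True c by (intro mult_mono) auto
    then show ?thesis using True by (simp add: \<kappa>_def abs_mult power_abs)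
  next
    case False
    then show ?thesis using K_bd[of z] by (simp add: \<kappa>_def)
  qed
  have cB: "0 \<le> c ^ l * B" using c B by simp
  have Q1m: "Q1 n i \<in> borel_measurable M" if "i \<in> {1..n}" for n i
    using Q1_int[OF that] by simp
  have eq: "AE \<omega> in M. score_fun n j (Z n i \<omega>, Y n i \<omega>) = Q1 n i \<omega> * X n i j \<omega>"
    if "j \<in> {1..d n}" "i \<in> {1..n}" for n j i
    using U_unit[OF that(2)] AE_space[of M]
  proof eventually_elim
    case (elim \<omega>)
    show ?case by (rule fun_at_obs(1)[OF that(2) elim(2,1) that(1)])
  qed
  have bd: "AE \<omega> in M. nn_cond_exp M (\<sigma>U n i) (\<lambda>\<omega>. ennreal (\<bar>Q1 n i \<omega> * X n i j \<omega>\<bar> powr m0)) \<omega> \<le> ennreal C"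
    if j: "j \<in> {1..d n}" and i: "i \<in> {1..n}" for n j i
    using C0[OF i]
  proof eventually_elim
    case (elim \<omega>)
    have "nn_cond_exp M (\<sigma>U n i) (\<lambda>\<omega>. ennreal (\<bar>Q1 n i \<omega> * X n i j \<omega>\<bar> powr m0)) \<omega>
      \<le> (MAX j\<in>{1..d n}. nn_cond_exp M (\<sigma>U n i) (\<lambda>\<omega>. ennreal (\<bar>Q1 n i \<omega> * X n i j \<omega>\<bar> powr m0)) \<omega>)"
      using j by (intro Max_ge) auto
    also have "\<dots> \<le> ennreal C0" using elim by (rule order_trans[OF add_increasing2[OF zero_le order_refl]])
    also have "\<dots> \<le> ennreal C" by (intro ennreal_leI) (simp add: C_def)
    finally show ?case .
  qed
  have Wm: "(\<lambda>\<omega>. Q1 n i \<omega> * X n i j \<omega>) \<in> borel_measurable M" if "j \<in> {1..d n}" "i \<in> {1..n}" for n j i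
    using Q1m[OF that(2)] UXY_meas(2)[OF that(2,1)] by measurable
  have C: "0 \<le> C" by (simp add: C_def)
  note mom = moment_of_cond[OF _ score_fun_meas C Wm eq bd]
  have "\<exists>C'\<ge>0. with_prob_to_1 M (\<lambda>n \<omega>. \<forall>k\<in>{1..n}. \<forall>j\<in>{1..d n}.
      \<bar>1 / n * (\<Sum>i=1..n. score_fun n j (Z n i \<omega>, Y n i \<omega>) * (\<kappa> ((U n i \<omega> - U n k \<omega>) / h n) / h n))\<bar>
      \<le> C' * (0 + sqrt (ln (1 / h n) / (real n * h n))))"
  proof (rule kernel_average_bound[where V = U and W = "\<lambda>n j i \<omega>. score_fun n j (Z n i \<omega>, Y n i \<omega>)"
        and C = C and B = "c ^ l * B" and c = c and \<mu> = 0 and ?c2.0 = fmax and d = d and h = h and J = "\<lambda>n. {1..d n}"])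
    show "card {1..d n} \<le> d n ^ 3" for n
      using s_ord[of n] self_le_power[of "d n" 3] by simp
    show "indep_vars (\<lambda>_. borel \<Otimes>\<^sub>M borel) (\<lambda>i \<omega>. (U n i \<omega>, score_fun n j (Z n i \<omega>, Y n i \<omega>))) {1..n}" if "j \<in> {1..d n}" for n j
      by (rule pair_indep[OF score_fun_meas[OF that]])
    show "integrable M (\<lambda>\<omega>. \<bar>score_fun n j (Z n i \<omega>, Y n i \<omega>)\<bar> powr m0)" if "j \<in> {1..d n}" "i \<in> {1..n}" for n j i
      by (rule mom(1)) (use that in auto)
    show "expectation (\<lambda>\<omega>. indicator S (U n i \<omega>) * \<bar>score_fun n j (Z n i \<omega>, Y n i \<omega>)\<bar> powr m0)
      \<le> C * prob {\<omega> \<in> space M. U n i \<omega> \<in> S}" if "j \<in> {1..d n}" "i \<in> {1..n}" "S \<in> sets borel" for n j i S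
      by (rule mom(2)) (use that in auto)
    show "\<bar>expectation (\<lambda>\<omega>. score_fun n j (Z n i \<omega>, Y n i \<omega>) * \<kappa> ((U n i \<omega> - u) / h n))\<bar>
      \<le> 0 * (c ^ l * B) * prob {\<omega> \<in> space M. U n i \<omega> \<in> {u - c * h n..u + c * h n}}"
      if j: "j \<in> {1..d n}" and i: "i \<in> {1..n}" for n j i u
    proof -
      \<comment> \<open>Covariate and kernel factor are functions of \<open>Z n i\<close> alone, so
        the conditional mean zero of the score annihilates the expectation for every fixed centre
        \<open>u\<close>.\<close>
      let ?f = "\<lambda>\<omega>. X n i j \<omega> * \<kappa> ((U n i \<omega> - u) / h n)"
      note [measurable] = UXY_meas(1)[OF i] UXY_meas(2)[OF i j] Q1m[OF i] \<kappa>_meas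
      have Zr: "Z n i \<in> measurable M (regressor_space (d n))"
      proof -
        have "fst \<in> measurable (obs_space (d n)) (regressor_space (d n))"
          unfolding obs_space_def by (rule measurable_fst)
        from measurable_compose[OF obs_meas[OF i] this] show ?thesis by simp
      qed
      have Zs: "Z n i \<in> space M \<rightarrow> space (regressor_space (d n))"
        using measurable_space[OF Zr] by blast
      have sub: "subalgebra M (\<sigma>XU n i)"
        unfolding subalgebra_def \<sigma>XU_def
        by (auto simp: sets_vimage_algebra2[OF Zs] intro: measurable_sets[OF Zr])
      have Zm: "Z n i \<in> measurable (\<sigma>XU n i) (regressor_space (d n))"
        unfolding \<sigma>XU_def by (rule measurable_vimage_algebra1[OF Zs])
      have Xm: "X n i j \<in> borel_measurable (\<sigma>XU n i)"
      proof -
        have "(\<lambda>z. snd z j) \<in> borel_measurable (regressor_space (d n))"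
          unfolding regressor_space_def using j by measurable
        from measurable_compose[OF Zm this] j show ?thesis by (simp add: Z_def)
      qed
      have Um: "U n i \<in> borel_measurable (\<sigma>XU n i)"
      proof -
        have "(\<lambda>z. fst z) \<in> borel_measurable (regressor_space (d n))"
          unfolding regressor_space_def by measurable
        from measurable_compose[OF Zm this] show ?thesis by (simp add: Z_def)
      qed
      have fm: "?f \<in> borel_measurable (\<sigma>XU n i)"
        using Xm Um \<kappa>_meas by measurable
      have absk: "\<bar>\<kappa> z\<bar> \<le> c ^ l * B" for z using \<kappa>_bd[of z] cB by (cases "z \<in> {- c..c}") auto
      have iQX: "integrable M (\<lambda>\<omega>. Q1 n i \<omega> * X n i j \<omega>)"
      proof (rule Bochner_Integration.integrable_bound)
        show "integrable M (\<lambda>\<omega>. 1 + \<bar>Q1 n i \<omega> * X n i j \<omega>\<bar> powr m0)"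
        proof -
          have "integrable M (\<lambda>\<omega>. \<bar>score_fun n j (Z n i \<omega>, Y n i \<omega>)\<bar> powr m0)" by (rule mom(1)) (use i j in auto)
          moreover have "(\<lambda>\<omega>. score_fun n j (Z n i \<omega>, Y n i \<omega>)) \<in> borel_measurable M"
            by (rule measurable_compose[OF obs_meas[OF i] score_fun_meas[OF j]])
          ultimately have "integrable M (\<lambda>\<omega>. \<bar>Q1 n i \<omega> * X n i j \<omega>\<bar> powr m0)"
            using eq[OF j i] by (subst integrable_cong_AE[where g="\<lambda>\<omega>. \<bar>score_fun n j (Z n i \<omega>, Y n i \<omega>)\<bar> powr m0"]) auto
          then show ?thesis by simp
        qed
        have le: "\<bar>w\<bar> \<le> 1 + \<bar>w\<bar> powr m0" for w :: real
        proof (cases "\<bar>w\<bar> \<le> 1")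
          case True then show ?thesis by (simp add: add_increasing2)
        next
          case False
          then have "\<bar>w\<bar> powr 1 \<le> \<bar>w\<bar> powr m0" using m0 by (intro powr_mono) auto
          then show ?thesis using False by simp
        qed
        show "AE \<omega> in M. norm (Q1 n i \<omega> * X n i j \<omega>) \<le> norm (1 + \<bar>Q1 n i \<omega> * X n i j \<omega>\<bar> powr m0)"
        proof (rule AE_I2)
          fix \<omega>
          have "0 \<le> 1 + \<bar>Q1 n i \<omega> * X n i j \<omega>\<bar> powr m0" by (simp add: add_nonneg_nonneg)
          then show "norm (Q1 n i \<omega> * X n i j \<omega>) \<le> norm (1 + \<bar>Q1 n i \<omega> * X n i j \<omega>\<bar> powr m0)"
            using le[of "Q1 n i \<omega> * X n i j \<omega>"] by simp
        qed
      qed simp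
      have int: "integrable M (\<lambda>\<omega>. ?f \<omega> * Q1 n i \<omega>)"
      proof (rule Bochner_Integration.integrable_bound)
        show "integrable M (\<lambda>\<omega>. (c ^ l * B) * (Q1 n i \<omega> * X n i j \<omega>))" using iQX by simp
        show "AE \<omega> in M. norm (?f \<omega> * Q1 n i \<omega>) \<le> norm ((c ^ l * B) * (Q1 n i \<omega> * X n i j \<omega>))"
        proof (rule AE_I2)
          fix \<omega>
          have "norm (?f \<omega> * Q1 n i \<omega>) = \<bar>\<kappa> ((U n i \<omega> - u) / h n)\<bar> * \<bar>Q1 n i \<omega> * X n i j \<omega>\<bar>"
            by (simp add: abs_mult)
          also have "\<dots> \<le> (c ^ l * B) * \<bar>Q1 n i \<omega> * X n i j \<omega>\<bar>" using absk by (intro mult_right_mono) auto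
          also have "\<dots> = \<bar>c ^ l * B\<bar> * \<bar>Q1 n i \<omega> * X n i j \<omega>\<bar>"
            using cB by (simp only: abs_of_nonneg)
          also have "\<dots> = norm ((c ^ l * B) * (Q1 n i \<omega> * X n i j \<omega>))"
            by (simp only: real_norm_def abs_mult)
          finally show "norm (?f \<omega> * Q1 n i \<omega>) \<le> norm ((c ^ l * B) * (Q1 n i \<omega> * X n i j \<omega>))" .
        qed
      qed simp
      have "expectation (\<lambda>\<omega>. score_fun n j (Z n i \<omega>, Y n i \<omega>) * \<kappa> ((U n i \<omega> - u) / h n)) = expectation (\<lambda>\<omega>. ?f \<omega> * Q1 n i \<omega>)"
      proof (rule integral_cong_AE)
        show "(\<lambda>\<omega>. score_fun n j (Z n i \<omega>, Y n i \<omega>) * \<kappa> ((U n i \<omega> - u) / h n)) \<in> borel_measurable M"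
        proof -
          have [measurable]: "(\<lambda>\<omega>. score_fun n j (Z n i \<omega>, Y n i \<omega>)) \<in> borel_measurable M"
            by (rule measurable_compose[OF obs_meas[OF i] score_fun_meas[OF j]])
          show ?thesis by measurable
        qed
        show "AE \<omega> in M. score_fun n j (Z n i \<omega>, Y n i \<omega>) * \<kappa> ((U n i \<omega> - u) / h n) = ?f \<omega> * Q1 n i \<omega>"
          using eq[OF j i] by eventually_elim simp
      qed simp
      also have "\<dots> = 0" by (rule expectation_cond_mean_zero[OF sub int fm Q1m[OF i] Q1_mean[OF i]])
      finally show ?thesis by simp
    qed
    show "1 \<le> d n" for n using s_ord[of n] by linarith
    show "\<bar>\<kappa> z\<bar> \<le> (c ^ l * B) * indicator {- c..c} z" for z by (rule \<kappa>_bd)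
  qed (use \<kappa>_meas cB c h_pos U_ball fmax m0 C tau1 delta1 rate_nh in auto)
  then show ?thesis by (simp add: \<kappa>_def)
qed

end

section \<open>Recovery of the unbiased estimator\<close>

text \<open>Every local constant becomes a fixed multiple of \<open>lam1\<close> times a power of
  \<open>s2\<close>: \<open>K1\<close> belongs to the radius, \<open>K2\<close> to the l1 radius of
  order \<open>lam1 * s2\<close>, \<open>K4\<close> to the gradient error, \<open>K5\<close> to the
  off-model gradient. The factors \<open>sqrt 2\<close> stem from \<open>s = 2 * s2\<close>, and
  third-order terms are controlled by \<open>s2^2 * lam1 \<le> q\<close>.\<close>

lemma (in sample) rates:
  fixes Lr Bb q :: real
  defines "K1 \<equiv> 8 * (Bb + Lr) * sqrt 2 / \<rho>"
  defines "K2 \<equiv> Bb * sqrt 2 * K1"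
  defines "K4 \<equiv> 1 + 2 * CC * ((1 + K2) * K2)"
  defines "K5 \<equiv> K4 + (Crow + CC * (1 + K2) * sqrt 2) * (2 * K4 * sqrt 2 / \<rho>)"
  assumes Lr: "lam1 \<le> Lr * lam2" "lam2 \<le> Lr * lam1" "1 \<le> Lr" and Bb: "BB \<le> Bb"
    and eps: "eps \<le> lam1 / (4 * Lr)" and bets: "bet * s \<le> lam1"
    and q: "(real s2)\<^sup>2 * lam1 \<le> q" "q \<le> 1" "CC * (1 + K2) * (Bb\<^sup>2 * 2) * q \<le> \<rho> / 2"
  shows "eps \<le> min lam1 lam2 / 4" "CC * (bet * s + NR) * (BB\<^sup>2 * s) \<le> \<rho> / 2"
    "RR \<le> K1 * (lam1 * sqrt s2)" "GG \<le> K5 * (lam1 * sqrt s2)"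
proof -
  define x where "x = real s2"
  have x: "1 \<le> x" using ord by (simp add: x_def)
  have sx: "s = 2 * x" by (simp add: s_def x_def)
  have CC: "0 \<le> CC" and bet: "0 \<le> bet" using const K(3) by (auto simp: CC_def bet_def)
  have BB: "2 \<le> BB" using b lam unfolding BB_def
    by (smt (verit) divide_nonneg_nonneg max.cobounded1)
  have l: "lam1 / Lr \<le> min lam1 lam2"
  proof -
    have "lam1 / Lr \<le> lam1 / 1" using Lr lam by (intro divide_left_mono) auto
    moreover have "lam1 / Lr \<le> lam2" using Lr lam by (simp add: pos_divide_le_eq mult.commute)
    ultimately show ?thesis by simp
  qed
  show e1: "eps \<le> min lam1 lam2 / 4" using eps l by simp
  have e2: "eps \<le> lam1"
  proof -
    have "lam1 / (4 * Lr) \<le> lam1 / 1" using Lr lam by (intro divide_left_mono) auto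
    then show ?thesis using eps by simp
  qed
  have eps0: "0 \<le> eps" using CC bet const(1) sx x unfolding eps_def
    by (intro add_nonneg_nonneg mult_nonneg_nonneg) auto
  have K10: "0 \<le> K1" and K20: "0 \<le> K2" using BB Bb Lr const unfolding K1_def K2_def by auto
  have K40: "1 \<le> K4" using CC K20 unfolding K4_def by simp
  have sqx: "1 \<le> sqrt x" "sqrt x * sqrt x = x" using x by auto
  have sqs: "sqrt s = sqrt 2 * sqrt x" by (simp add: sx real_sqrt_mult)
  have "eps * BB + max lam1 lam2 \<le> lam1 * Bb + Lr * lam1"
    using e2 eps0 Bb BB lam Lr by (intro add_mono mult_mono) (auto intro: mult_right_mono simp: mult_le_cancel_right1)
  then have "RR \<le> 8 * (lam1 * Bb + Lr * lam1) * sqrt s / \<rho>"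
    unfolding RR_def using const sx x by (intro divide_right_mono mult_right_mono mult_left_mono) auto
  also have "\<dots> = K1 * (lam1 * sqrt x)" unfolding sqs K1_def by (simp add: algebra_simps)
  finally have RR: "RR \<le> K1 * (lam1 * sqrt x)" .
  then show "RR \<le> K1 * (lam1 * sqrt s2)" by (simp add: x_def)
  have NR: "NR \<le> K2 * (lam1 * x)"
  proof -
    have "NR \<le> Bb * sqrt s * (K1 * (lam1 * sqrt x))"
      unfolding NR_def using RR RR0 Bb BB by (intro mult_mono) (auto simp: sx x_def)
    also have "\<dots> = K2 * (lam1 * (sqrt x * sqrt x))" unfolding sqs K2_def by (simp add: algebra_simps)
    finally show ?thesis unfolding sqx .
  qed
  have NR0: "0 \<le> NR" using RR0 BB unfolding NR_def by (simp add: sx x_def)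
  have lx: "lam1 \<le> lam1 * x" using lam x by simp
  have bN: "bet * s + NR \<le> (1 + K2) * (lam1 * x)"
    using bets NR lx by (simp add: distrib_right)
  have bN0: "0 \<le> bet * s + NR" using bet NR0 sx x by simp
  have x2: "x\<^sup>2 * lam1 \<le> q" using q by (simp add: x_def)
  show "CC * (bet * s + NR) * (BB\<^sup>2 * s) \<le> \<rho> / 2"
  proof -
    have "CC * (bet * s + NR) * (BB\<^sup>2 * s) \<le> CC * ((1 + K2) * (lam1 * x)) * (Bb\<^sup>2 * s)"
      using CC bN bN0 Bb BB sx x K20 lam
      by (intro mult_mono mult_left_mono mult_right_mono power_mono) auto
    also have "\<dots> = CC * (1 + K2) * (Bb\<^sup>2 * 2) * (x\<^sup>2 * lam1)"
      unfolding sx by (simp add: power2_eq_square algebra_simps)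
    also have "\<dots> \<le> CC * (1 + K2) * (Bb\<^sup>2 * 2) * q"
      using x2 CC K20 by (intro mult_left_mono) auto
    finally show ?thesis using q(3) by linarith
  qed
  have kap: "kap \<le> K4 * lam1"
  proof -
    have "(bet * s + NR) * NR \<le> ((1 + K2) * (lam1 * x)) * (K2 * (lam1 * x))"
      using bN NR NR0 bN0 by (intro mult_mono) auto
    also have "\<dots> = (1 + K2) * K2 * lam1 * (x\<^sup>2 * lam1)" by (simp add: power2_eq_square algebra_simps)
    also have "\<dots> \<le> (1 + K2) * K2 * lam1 * 1"
      using x2 q K20 lam by (intro mult_left_mono) auto
    finally have "2 * CC * ((bet * s + NR) * NR) \<le> 2 * CC * ((1 + K2) * K2 * lam1)"
      using CC by (intro mult_left_mono) auto
    then show ?thesis unfolding kap_def K4_def using e2 by (simp add: algebra_simps)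
  qed
  have kap0: "0 \<le> kap" unfolding kap_def using eps0 CC bN0 NR0 by simp
  have "(bet * s + NR) * sqrt s \<le> (1 + K2) * sqrt 2"
  proof -
    have "(bet * s + NR) * sqrt s \<le> ((1 + K2) * (lam1 * x)) * sqrt s"
      using bN sx x by (intro mult_right_mono) auto
    also have "\<dots> = (1 + K2) * sqrt 2 * (lam1 * (x * sqrt x))" unfolding sqs by (simp add: algebra_simps)
    \<comment> \<open>Here \<open>lam1\<close> carries only the power 3/2 of \<open>s2\<close>,
      which is below the square that \<open>q\<close> controls since
      \<open>s2 \<ge> 1\<close>.\<close>
    also have "\<dots> \<le> (1 + K2) * sqrt 2 * 1"
    proof (intro mult_left_mono)
      have "sqrt x \<le> x" using sqx x mult_left_mono[of 1 "sqrt x" "sqrt x"] by simp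
      then have "x * sqrt x \<le> x\<^sup>2" using x by (simp add: power2_eq_square)
      then have "lam1 * (x * sqrt x) \<le> x\<^sup>2 * lam1" using lam by (simp add: mult.commute mult_left_mono)
      then show "lam1 * (x * sqrt x) \<le> 1" using x2 q by linarith
    qed (use K20 in auto)
    finally show ?thesis by simp
  qed
  then have c: "Crow + CC * (bet * s + NR) * sqrt s \<le> Crow + CC * (1 + K2) * sqrt 2"
    using CC by (simp add: mult.assoc mult_left_mono)
  have "GG \<le> K4 * lam1 + (Crow + CC * (1 + K2) * sqrt 2) * (2 * (K4 * lam1) * sqrt s / \<rho>)"
  proof -
    have s0: "0 \<le> sqrt s" using sx x by simp
    have c0: "0 \<le> Crow + CC * (1 + K2) * sqrt 2" using const CC K20 by simp
    have k: "2 * kap * sqrt s / \<rho> \<le> 2 * (K4 * lam1) * sqrt s / \<rho>"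
      using kap s0 const by (intro divide_right_mono mult_right_mono mult_left_mono) auto
    have k0: "0 \<le> 2 * kap * sqrt s / \<rho>" using kap0 s0 const by simp
    show ?thesis unfolding GG_def by (intro add_mono kap mult_mono c k c0 k0)
  qed
  also have "\<dots> \<le> K4 * lam1 * sqrt x + (Crow + CC * (1 + K2) * sqrt 2) * (2 * (K4 * lam1) * sqrt s / \<rho>)"
    using sqx K40 lam by simp
  also have "\<dots> = K5 * (lam1 * sqrt x)" unfolding sqs K5_def by (simp add: algebra_simps)
  finally show "GG \<le> K5 * (lam1 * sqrt s2)" by (simp add: x_def)
qed

text \<open>The mean value bound used twice, for \<open>f1\<close> and then for \<open>f\<close>
  minus its tangent at \<open>v\<close>; it copes with one-sided derivatives at the end points and
  loses only the factor 1/2 of Taylor's formula.\<close>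

lemma second_order_taylor:
  assumes f1: "\<And>u. u \<in> {0..1} \<Longrightarrow> (f has_real_derivative f1 u) (at u within {0..1})"
    and f2: "\<And>u. u \<in> {0..1} \<Longrightarrow> (f1 has_real_derivative f2 u) (at u within {0..1})"
    and C: "\<And>u. u \<in> {0..1} \<Longrightarrow> \<bar>f2 u\<bar> \<le> C" and u: "u \<in> {0..1}" and v: "v \<in> {0..1}"
  shows "\<bar>f u - f v - f1 v * (u - v)\<bar> \<le> C * (u - v)\<^sup>2"
proof -
  have C0: "0 \<le> C" using C[OF u] by linarith
  have lip: "\<bar>f1 x - f1 y\<bar> \<le> C * \<bar>x - y\<bar>" if "x \<in> {0..1}" "y \<in> {0..1}" for x y
    using field_differentiable_bound[of "{0..1}" f1 f2 C x y] f2 C that by (auto simp: convex_real_interval)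
  let ?S = "closed_segment v u"
  have S: "?S \<subseteq> {0..1}" using u v by (auto simp: closed_segment_eq_real_ivl)
  have "norm ((f u - f1 v * u) - (f v - f1 v * v)) \<le> C * \<bar>u - v\<bar> * norm (u - v)"
  proof (rule field_differentiable_bound[of ?S "\<lambda>t. f t - f1 v * t" "\<lambda>t. f1 t - f1 v"])
    fix t assume t: "t \<in> ?S"
    then have t01: "t \<in> {0..1}" using S by blast
    have "(f has_real_derivative f1 t) (at t within ?S)"
      using DERIV_subset[OF f1[OF t01] S] .
    then show "((\<lambda>t. f t - f1 v * t) has_real_derivative f1 t - f1 v) (at t within ?S)"
      by (auto intro!: derivative_eq_intros)
    have "\<bar>t - v\<bar> \<le> \<bar>u - v\<bar>" using t by (auto simp: closed_segment_eq_real_ivl split: if_splits)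
    then have "C * \<bar>t - v\<bar> \<le> C * \<bar>u - v\<bar>" using C0 by (rule mult_left_mono)
    then show "norm (f1 t - f1 v) \<le> C * \<bar>u - v\<bar>" using lip[OF t01 v] by simp
  qed auto
  then show ?thesis by (simp add: algebra_simps power2_eq_square)
qed

section \<open>The fitted model: tuning parameters, estimators, Hessian and third-order
  averages\<close>

locale gsvcm_fit = gsvcm M U X Y d s1 s2 a R likf r Z \<sigma>U \<sigma>XU Q1 Q2 K h fU m0 \<tau>1 \<delta>1
  for M :: "'w measure"
    and U :: "nat \<Rightarrow> nat \<Rightarrow> 'w \<Rightarrow> real"
    and X :: "nat \<Rightarrow> nat \<Rightarrow> nat \<Rightarrow> 'w \<Rightarrow> real"
    and Y :: "nat \<Rightarrow> nat \<Rightarrow> 'w \<Rightarrow> real"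
    and d s1 s2 :: "nat \<Rightarrow> nat"
    and a :: "nat \<Rightarrow> nat \<Rightarrow> real \<Rightarrow> real"
    and R :: "real set"
    and likf :: "real \<Rightarrow> real \<Rightarrow> real"
    and r :: "nat \<Rightarrow> nat \<Rightarrow> 'w \<Rightarrow> real"
    and Z :: "nat \<Rightarrow> nat \<Rightarrow> 'w \<Rightarrow> real \<times> (nat \<Rightarrow> real)"
    and \<sigma>U \<sigma>XU :: "nat \<Rightarrow> nat \<Rightarrow> 'w measure"
    and Q1 Q2 :: "nat \<Rightarrow> nat \<Rightarrow> 'w \<Rightarrow> real"
    and K :: "real \<Rightarrow> real" and h :: "nat \<Rightarrow> real"
    and fU :: "real \<Rightarrow> real"
    and m0 \<tau>1 \<delta>1 :: real +
  fixes lam1 lam2 lam4 lam4s :: "nat \<Rightarrow> real" and \<delta> \<rho>1 \<rho>2 b\<^sub>d :: real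
    and P :: "nat \<Rightarrow> 'w \<Rightarrow> problem"
    and At Bt Ab Bb Auo Buo :: "nat \<Rightarrow> 'w \<Rightarrow> nat \<Rightarrow> nat \<Rightarrow> real"
  assumes P_def: "P = (\<lambda>n \<omega>. \<lparr>nobs = n, dim = d n, idx = (\<lambda>i. U n i \<omega>),
          cov = (\<lambda>i j. X n i j \<omega>), resp = (\<lambda>i. Y n i \<omega>), lik = likf, kern = K, bw = h n\<rparr>)"
    and q2_neg: "\<And>s y. y \<in> R \<Longrightarrow> q2 likf s y < 0"
    and coef_const: "\<And>n j. j \<in> {s1 n + 1..s2 n} \<Longrightarrow> \<exists>c. c \<noteq> 0 \<and> (\<forall>u\<in>{0..1}. a n j u = c)"
    and coef_zero: "\<And>n j. j \<in> {s2 n + 1..d n} \<Longrightarrow> \<forall>u\<in>{0..1}. a n j u = 0"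
    and pos: "\<And>n. 0 < h n \<and> 0 < lam1 n \<and> 0 < lam2 n \<and> 0 < lam4 n \<and> 0 < lam4s n"
    and delta: "0 < \<delta>"
    and rho: "0 < \<rho>1" "\<rho>1 \<le> \<rho>2"
    and restricted_eigen: "with_prob_to_1 M (\<lambda>n \<omega>.
          let \<Omega> = Omega0 (d n) (s2 n) (max (lam1 n / lam2 n) (lam2 n / lam1 n) + \<delta>);
              q = (\<lambda>u v. ereal (quad_form (2 * d n) (\<lambda>j k. - ddL (P n \<omega>) (\<lambda>i. r n i \<omega>) u j k) v))
          in ereal \<rho>1 \<le> (INF u\<in>{0..1}. INF v\<in>\<Omega>. q u v) \<and>
             (INF u\<in>{0..1}. INF v\<in>\<Omega>. q u v) \<le> (SUP u\<in>{0..1}. SUP v\<in>\<Omega>. q u v) \<and>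
             (SUP u\<in>{0..1}. SUP v\<in>\<Omega>. q u v) \<le> ereal \<rho>2)"
    and rate_lam1: "(\<lambda>n. real (s2 n) * (h n)\<^sup>2 + sqrt (ln (1 / h n) / (real n * h n))) \<in> o(lam1)"
    and lam12: "propto lam1 lam2"
    and rate_s2: "(\<lambda>n. real (s2 n) * (lam1 n)\<^sup>2 / (h n)\<^sup>2 + (real (s2 n))\<^sup>2 * lam1 n) \<in> o(\<lambda>_. 1)"
    and lam4_equiv: "lam4 \<sim>[sequentially] lam4s"
    and lam4_up: "lam4 \<in> o(\<lambda>n. sqrt (real n))"
    and lam4_low: "(\<lambda>n. 1 / sqrt (h n) * (sqrt (ln (1 / h n))
          + sqrt (real (s2 n)) * (1 + lam1 n * sqrt (real n * h n)))) \<in> o(lam4)"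
    and b_pos: "0 < b\<^sub>d"
    and signal: "with_prob_to_1 M (\<lambda>n \<omega>.
          (MIN j\<in>{1..s2 n}. L2_set (\<lambda>k. a n j (U n k \<omega>)) {1..n}) \<ge> b\<^sub>d * sqrt (real n) \<and>
          (MIN j\<in>{1..s1 n}. deviation n (\<lambda>k. a n j (U n k \<omega>))) \<ge> b\<^sub>d * sqrt (real n))"
    and row_bound: "Op_one M (\<lambda>n \<omega>.
          SUP k\<in>{s2 n + 1..d n} \<union> {d n + s1 n + 1..2 * d n}.
          SUP u\<in>{0..1}. SUP w\<in>oracle_directions (d n) (s1 n) (s2 n).
            ereal \<bar>\<Sum>c=1..2 * d n. ddL (P n \<omega>) (\<lambda>i. r n i \<omega>) u k c * w c\<bar>)"
    and prelim: "\<And>n \<omega>. \<omega> \<in> space M \<Longrightarrow>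
          is_prelim_estimator (P n \<omega>) (lam1 n) (lam2 n) (At n \<omega>) (Bt n \<omega>)"
    and scad: "\<And>n \<omega>. \<omega> \<in> space M \<Longrightarrow>
          is_scad_estimator (P n \<omega>) (lam4 n) (lam4s n) (At n \<omega>) (Bt n \<omega>) (Ab n \<omega>) (Bb n \<omega>)"
    and unb_oracle: "\<And>n \<omega>. \<omega> \<in> space M \<Longrightarrow>
          is_oracle_estimator (P n \<omega>) (s1 n) (s2 n) (At n \<omega>) (Bt n \<omega>) (Auo n \<omega>) (Buo n \<omega>)"
begin

lemma d1R: "y \<in> R \<Longrightarrow> ((\<lambda>t. likf t y) has_real_derivative q1 likf t y) (at t)"
  using lik_diff1[of y t] by (simp add: q1_def DERIV_deriv_iff_real_differentiable)

lemma d2R: "y \<in> R \<Longrightarrow> ((\<lambda>t. q1 likf t y) has_real_derivative q2 likf t y) (at t)"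
  using lik_diff2[of y t] by (simp add: q2_def DERIV_deriv_iff_real_differentiable)

lemma q1_decreasing: "y \<in> R \<Longrightarrow> s < t \<Longrightarrow> q1 likf t y < q1 likf s y"
  by (rule DERIV_neg_imp_decreasing) (use d2R q2_neg in blast)+

text \<open>The coefficients are unconstrained off the unit interval, so measurability of the predictor is
  recovered from that of the score, which is strictly decreasing in it.\<close>

lemma r_meas:
  assumes i: "i \<in> {1..n}"
  shows "r n i \<in> borel_measurable M"
proof (rule borel_measurableI_le)
  fix c :: real
  have Q1m: "Q1 n i \<in> borel_measurable M" using Q1_int[OF i] by simp
  have "(\<lambda>\<omega>. (c, Y n i \<omega>)) \<in> measurable M (borel \<Otimes>\<^sub>M borel)" using UXY_meas(3)[OF i] by measurable
  from measurable_compose[OF this q1R_meas] have cm: "(\<lambda>\<omega>. q1R c (Y n i \<omega>)) \<in> borel_measurable M" by simp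
  have "r n i \<omega> \<le> c \<longleftrightarrow> q1R c (Y n i \<omega>) \<le> Q1 n i \<omega>" if "\<omega> \<in> space M" for \<omega>
  proof -
    have y: "Y n i \<omega> \<in> R" using range_Y[OF i that] .
    show ?thesis
      using q1_decreasing[OF y, of c "r n i \<omega>"] q1_decreasing[OF y, of "r n i \<omega>" c] y
      by (cases "r n i \<omega>" c rule: linorder_cases) (auto simp: q1R_def Q1_def)
  qed
  then have "{\<omega> \<in> space M. r n i \<omega> \<le> c} = {\<omega> \<in> space M. q1R c (Y n i \<omega>) \<le> Q1 n i \<omega>}" by auto
  also have "\<dots> \<in> sets M" using cm Q1m by measurable
  finally show "{\<omega> \<in> space M. r n i \<omega> \<le> c} \<in> sets M" .
qed

lemma Q2_meas:
  assumes i: "i \<in> {1..n}"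
  shows "Q2 n i \<in> borel_measurable M"
proof -
  have "(\<lambda>\<omega>. (r n i \<omega>, Y n i \<omega>)) \<in> measurable M (borel \<Otimes>\<^sub>M borel)"
    using r_meas[OF i] UXY_meas(3)[OF i] by measurable
  from measurable_compose[OF this q2R_meas] have "(\<lambda>\<omega>. q2R (r n i \<omega>) (Y n i \<omega>)) \<in> borel_measurable M" by simp
  moreover have "q2R (r n i \<omega>) (Y n i \<omega>) = Q2 n i \<omega>" if "\<omega> \<in> space M" for \<omega>
    using range_Y[OF i that] by (simp add: q2R_def Q2_def)
  ultimately show ?thesis by (subst measurable_cong[of _ _ "\<lambda>\<omega>. q2R (r n i \<omega>) (Y n i \<omega>)"]) auto
qed

lemma h_lim: "h \<longlonglongrightarrow> 0"
proof -
  obtain c where c: "0 < c" "\<forall>\<^sub>F n in sequentially. h n \<le> c * real n powr (- \<delta>1)"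
    using delta1(2) unfolding propto_def by (metis (mono_tags, lifting) eventually_mono less_le_trans)
  show ?thesis
  proof (rule tendsto_sandwich[of "\<lambda>_. 0"])
    show "(\<lambda>n. c * real n powr (- \<delta>1)) \<longlonglongrightarrow> 0"
      using tendsto_mult_right_zero[OF tendsto_neg_powr[OF _ filterlim_real_sequentially], of "- \<delta>1" c] delta1 by simp
  qed (use c h_pos in \<open>auto intro: less_imp_le always_eventually\<close>)
qed

lemma ln_inv_h_nonneg: "\<forall>\<^sub>F n in sequentially. 0 \<le> ln (1 / h n)"
  using order_tendstoD(2)[OF h_lim zero_less_one]
proof eventually_elim
  case (elim n)
  then have "1 \<le> 1 / h n" using h_pos[of n] by simp
  then show ?case by (rule ln_ge_zero)
qed

lemma rate_const_le:
  fixes C C' :: real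
  assumes C': "0 \<le> C'" and C: "0 \<le> C"
  shows "\<forall>\<^sub>F n in sequentially. C' * ((1 + C) + sqrt (ln (1 / h n) / (real n * h n)))
      \<le> (C' * (1 + C)) * (1 + sqrt (ln (1 / h n) / (real n * h n)))"
  using ln_inv_h_nonneg
proof eventually_elim
  case (elim n)
  define x where "x = sqrt (ln (1 / h n) / (real n * h n))"
  have "0 \<le> x"
    unfolding x_def using elim h_pos[of n] by (intro real_sqrt_ge_zero divide_nonneg_nonneg elim) auto
  then have "(1 + C) + x \<le> (1 + C) * (1 + x)" using C by (simp add: algebra_simps)
  from mult_left_mono[OF this C'] show ?case unfolding x_def by (simp only: mult.assoc)
qed

text \<open>The pairs of covariates also number at most \<open>d^3\<close>. The moment condition
  bounds a sum of two nonnegative maxima, so each maximum, and every member of it, obeys the same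
  bound.\<close>

lemma uniform_hess_average:
  "\<exists>C'\<ge>0. with_prob_to_1 M (\<lambda>n \<omega>. \<forall>k\<in>{1..n}. \<forall>p\<in>{1..d n} \<times> {1..d n}.
      \<bar>1 / n * (\<Sum>i=1..n. \<bar>hess_fun n p (Z n i \<omega>, Y n i \<omega>)\<bar> * (K ((U n i \<omega> - U n k \<omega>) / h n) / h n))\<bar>
      \<le> C' * (1 + sqrt (ln (1 / h n) / (real n * h n))))"
proof -
  obtain C0 :: real where C0: "\<And>n i. i \<in> {1..n} \<Longrightarrow> AE \<omega> in M.
          (MAX j\<in>{1..d n}.
             nn_cond_exp M (\<sigma>U n i) (\<lambda>\<omega>. ennreal (\<bar>Q1 n i \<omega> * X n i j \<omega>\<bar> powr m0)) \<omega>)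
          + (MAX (j, k)\<in>{1..d n} \<times> {1..d n}.
             nn_cond_exp M (\<sigma>U n i) (\<lambda>\<omega>. ennreal (\<bar>Q2 n i \<omega> * X n i j \<omega> * X n i k \<omega>\<bar> powr m0)) \<omega>)
          \<le> ennreal C0"
    using moments by blast
  define C where "C = max 0 C0"
  have C: "0 \<le> C" by (simp add: C_def)
  let ?J = "\<lambda>n. {1..d n} \<times> {1..d n}"
  let ?W = "\<lambda>n p i \<omega>. Q2 n i \<omega> * X n i (fst p) \<omega> * X n i (snd p) \<omega>"
  have eq: "AE \<omega> in M. hess_fun n p (Z n i \<omega>, Y n i \<omega>) = ?W n p i \<omega>" if "p \<in> ?J n" "i \<in> {1..n}" for n p i
    using U_unit[OF that(2)] AE_space[of M]
  proof eventually_elim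
    case (elim \<omega>)
    show ?case using fun_at_obs(2)[OF that(2) elim(2,1), of "fst p" "snd p"] that(1) by auto
  qed
  have bd: "AE \<omega> in M. nn_cond_exp M (\<sigma>U n i) (\<lambda>\<omega>. ennreal (\<bar>?W n p i \<omega>\<bar> powr m0)) \<omega> \<le> ennreal C"
    if p: "p \<in> ?J n" and i: "i \<in> {1..n}" for n p i
    using C0[OF i]
  proof eventually_elim
    case (elim \<omega>)
    have "nn_cond_exp M (\<sigma>U n i) (\<lambda>\<omega>. ennreal (\<bar>?W n p i \<omega>\<bar> powr m0)) \<omega>
      \<le> (MAX (j, k)\<in>?J n. nn_cond_exp M (\<sigma>U n i) (\<lambda>\<omega>. ennreal (\<bar>Q2 n i \<omega> * X n i j \<omega> * X n i k \<omega>\<bar> powr m0)) \<omega>)"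
      using p by (intro Max_ge) (auto intro!: image_eqI[of _ _ p] simp: case_prod_beta)
    also have "\<dots> \<le> ennreal C0" using elim by (rule order_trans[OF add_increasing[OF zero_le order_refl]])
    also have "\<dots> \<le> ennreal C" by (intro ennreal_leI) (simp add: C_def)
    finally show ?case .
  qed
  have Wm: "?W n p i \<in> borel_measurable M" if p: "p \<in> ?J n" and i: "i \<in> {1..n}" for n p i
  proof -
    have "fst p \<in> {1..d n}" "snd p \<in> {1..d n}" using p by auto
    then show ?thesis using Q2_meas[OF i] UXY_meas(2)[OF i] by (intro borel_measurable_times) auto
  qed
  have m: "integrable M (\<lambda>\<omega>. \<bar>hess_fun n p (Z n i \<omega>, Y n i \<omega>)\<bar> powr m0)"
    "S \<in> sets borel \<Longrightarrow> expectation (\<lambda>\<omega>. indicator S (U n i \<omega>) * \<bar>hess_fun n p (Z n i \<omega>, Y n i \<omega>)\<bar> powr m0)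
      \<le> C * prob {\<omega> \<in> space M. U n i \<omega> \<in> S}"
    if "p \<in> ?J n" "i \<in> {1..n}" for n p i S
    using moment_of_cond[OF that(2) hess_fun_meas[OF that(1)] C Wm[OF that] eq[OF that] bd[OF that]] by auto
  have "\<exists>C'\<ge>0. with_prob_to_1 M (\<lambda>n \<omega>. \<forall>k\<in>{1..n}. \<forall>p\<in>?J n.
      \<bar>1 / n * (\<Sum>i=1..n. \<bar>hess_fun n p (Z n i \<omega>, Y n i \<omega>)\<bar> * (K ((U n i \<omega> - U n k \<omega>) / h n) / h n))\<bar>
      \<le> C' * ((1 + C) + sqrt (ln (1 / h n) / (real n * h n))))"
  proof (rule uniform_abs_average[OF _ _ C hess_fun_meas m])
    show "card (?J n) \<le> d n ^ 3" for n
      using s_ord[of n] power_increasing[of 2 3 "d n"] by (simp add: power2_eq_square)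
  qed auto
  then obtain C' where C': "0 \<le> C'" and w: "with_prob_to_1 M (\<lambda>n \<omega>. \<forall>k\<in>{1..n}. \<forall>p\<in>?J n.
      \<bar>1 / n * (\<Sum>i=1..n. \<bar>hess_fun n p (Z n i \<omega>, Y n i \<omega>)\<bar> * (K ((U n i \<omega> - U n k \<omega>) / h n) / h n))\<bar>
      \<le> C' * ((1 + C) + sqrt (ln (1 / h n) / (real n * h n))))" by blast
  have "with_prob_to_1 M (\<lambda>n \<omega>. \<forall>k\<in>{1..n}. \<forall>p\<in>?J n.
      \<bar>1 / n * (\<Sum>i=1..n. \<bar>hess_fun n p (Z n i \<omega>, Y n i \<omega>)\<bar> * (K ((U n i \<omega> - U n k \<omega>) / h n) / h n))\<bar>
      \<le> (C' * (1 + C)) * (1 + sqrt (ln (1 / h n) / (real n * h n))))"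
    by (rule with_prob_to_1_mono[OF w]) (use rate_const_le[OF C' C] in eventually_elim, blast intro: order_trans)
  then show ?thesis using C C' by (intro exI[of _ "C' * (1 + C)"]) auto
qed

text \<open>The Lipschitz factor is only known to exist, so one and the same witness has to carry
  both the Lipschitz property and the bounded averages; hence the joint existential.\<close>

lemma uniform_third_average:
  "\<exists>Mf. (\<forall>n. \<forall>i\<in>{1..n}. AE \<omega> in M. 0 < Mf n (Z n i \<omega>, Y n i \<omega>) \<and>
      (\<forall>\<delta>'. \<bar>q2 likf (r n i \<omega> + \<delta>') (Y n i \<omega>) - q2 likf (r n i \<omega>) (Y n i \<omega>)\<bar>
        \<le> Mf n (Z n i \<omega>, Y n i \<omega>) * \<bar>\<delta>'\<bar>)) \<and>
    (\<exists>C'\<ge>0. with_prob_to_1 M (\<lambda>n \<omega>. \<forall>k\<in>{1..n}. \<forall>p\<in>{1..d n} \<times> {1..d n} \<times> {1..d n}.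
      \<bar>1 / n * (\<Sum>i=1..n. \<bar>third_fun (Mf n) p (Z n i \<omega>, Y n i \<omega>)\<bar> * (K ((U n i \<omega> - U n k \<omega>) / h n) / h n))\<bar>
      \<le> C' * (1 + sqrt (ln (1 / h n) / (real n * h n)))))"
proof -
  obtain Mf and C0 :: real where Mfm: "\<And>n. Mf n \<in> borel_measurable (obs_space (d n))"
    and lip: "\<And>n i. i \<in> {1..n} \<Longrightarrow> AE \<omega> in M. 0 < Mf n (Z n i \<omega>, Y n i \<omega>) \<and>
      (\<forall>\<delta>'. \<bar>q2 likf (r n i \<omega> + \<delta>') (Y n i \<omega>) - q2 likf (r n i \<omega>) (Y n i \<omega>)\<bar>
        \<le> Mf n (Z n i \<omega>, Y n i \<omega>) * \<bar>\<delta>'\<bar>)"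
    and C0: "\<And>n i. i \<in> {1..n} \<Longrightarrow> AE \<omega> in M. (MAX (j, k, l)\<in>{1..d n} \<times> {1..d n} \<times> {1..d n}.
        nn_cond_exp M (\<sigma>U n i) (\<lambda>\<omega>. ennreal
          (\<bar>X n i j \<omega> * X n i k \<omega> * X n i l \<omega> * Mf n (Z n i \<omega>, Y n i \<omega>)\<bar> powr m0)) \<omega>) \<le> ennreal C0"
    using q2_lip by blast
  define C where "C = max 0 C0"
  have C: "0 \<le> C" by (simp add: C_def)
  let ?J = "\<lambda>n. {1..d n} \<times> {1..d n} \<times> {1..d n}"
  let ?W = "\<lambda>n p i \<omega>. X n i (fst p) \<omega> * X n i (fst (snd p)) \<omega> * X n i (snd (snd p)) \<omega> * Mf n (Z n i \<omega>, Y n i \<omega>)"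
  have eq: "AE \<omega> in M. third_fun (Mf n) p (Z n i \<omega>, Y n i \<omega>) = ?W n p i \<omega>" if "p \<in> ?J n" "i \<in> {1..n}" for n p i
    using U_unit[OF that(2)] AE_space[of M]
  proof eventually_elim
    case (elim \<omega>)
    show ?case using fun_at_obs(3)[OF that(2) elim(2,1), of "fst p" "fst (snd p)" "snd (snd p)"] that(1) by auto
  qed
  have bd: "AE \<omega> in M. nn_cond_exp M (\<sigma>U n i) (\<lambda>\<omega>. ennreal (\<bar>?W n p i \<omega>\<bar> powr m0)) \<omega> \<le> ennreal C"
    if p: "p \<in> ?J n" and i: "i \<in> {1..n}" for n p i
    using C0[OF i]
  proof eventually_elim
    case (elim \<omega>)
    have "nn_cond_exp M (\<sigma>U n i) (\<lambda>\<omega>. ennreal (\<bar>?W n p i \<omega>\<bar> powr m0)) \<omega>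
      \<le> (MAX (j, k, l)\<in>?J n. nn_cond_exp M (\<sigma>U n i) (\<lambda>\<omega>. ennreal
          (\<bar>X n i j \<omega> * X n i k \<omega> * X n i l \<omega> * Mf n (Z n i \<omega>, Y n i \<omega>)\<bar> powr m0)) \<omega>)"
      using p by (intro Max_ge) (auto intro!: image_eqI[of _ _ p] simp: case_prod_beta)
    also have "\<dots> \<le> ennreal C0" by (rule elim)
    also have "\<dots> \<le> ennreal C" by (intro ennreal_leI) (simp add: C_def)
    finally show ?case .
  qed
  have Wm: "?W n p i \<in> borel_measurable M" if p: "p \<in> ?J n" and i: "i \<in> {1..n}" for n p i
  proof -
    have "fst p \<in> {1..d n}" "fst (snd p) \<in> {1..d n}" "snd (snd p) \<in> {1..d n}" using p by auto
    then show ?thesis using measurable_compose[OF obs_meas[OF i] Mfm] UXY_meas(2)[OF i]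
      by (intro borel_measurable_times) auto
  qed
  have m: "integrable M (\<lambda>\<omega>. \<bar>third_fun (Mf n) p (Z n i \<omega>, Y n i \<omega>)\<bar> powr m0)"
    "S \<in> sets borel \<Longrightarrow> expectation (\<lambda>\<omega>. indicator S (U n i \<omega>) * \<bar>third_fun (Mf n) p (Z n i \<omega>, Y n i \<omega>)\<bar> powr m0)
      \<le> C * prob {\<omega> \<in> space M. U n i \<omega> \<in> S}"
    if "p \<in> ?J n" "i \<in> {1..n}" for n p i S
    using moment_of_cond[OF that(2) third_fun_meas[OF that(1) Mfm] C Wm[OF that] eq[OF that] bd[OF that]] by auto
  have "\<exists>C'\<ge>0. with_prob_to_1 M (\<lambda>n \<omega>. \<forall>k\<in>{1..n}. \<forall>p\<in>?J n.
      \<bar>1 / n * (\<Sum>i=1..n. \<bar>third_fun (Mf n) p (Z n i \<omega>, Y n i \<omega>)\<bar> * (K ((U n i \<omega> - U n k \<omega>) / h n) / h n))\<bar>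
      \<le> C' * ((1 + C) + sqrt (ln (1 / h n) / (real n * h n))))"
  proof (rule uniform_abs_average[OF _ _ C third_fun_meas[OF _ Mfm] m])
    show "card (?J n) \<le> d n ^ 3" for n by (simp add: power3_eq_cube)
  qed auto
  then obtain C' where C': "0 \<le> C'" and w: "with_prob_to_1 M (\<lambda>n \<omega>. \<forall>k\<in>{1..n}. \<forall>p\<in>?J n.
      \<bar>1 / n * (\<Sum>i=1..n. \<bar>third_fun (Mf n) p (Z n i \<omega>, Y n i \<omega>)\<bar> * (K ((U n i \<omega> - U n k \<omega>) / h n) / h n))\<bar>
      \<le> C' * ((1 + C) + sqrt (ln (1 / h n) / (real n * h n))))" by blast
  have "with_prob_to_1 M (\<lambda>n \<omega>. \<forall>k\<in>{1..n}. \<forall>p\<in>?J n.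
      \<bar>1 / n * (\<Sum>i=1..n. \<bar>third_fun (Mf n) p (Z n i \<omega>, Y n i \<omega>)\<bar> * (K ((U n i \<omega> - U n k \<omega>) / h n) / h n))\<bar>
      \<le> (C' * (1 + C)) * (1 + sqrt (ln (1 / h n) / (real n * h n))))"
    by (rule with_prob_to_1_mono[OF w]) (use rate_const_le[OF C' C] in eventually_elim, blast intro: order_trans)
  then have "\<exists>C'\<ge>0. with_prob_to_1 M (\<lambda>n \<omega>. \<forall>k\<in>{1..n}. \<forall>p\<in>?J n.
      \<bar>1 / n * (\<Sum>i=1..n. \<bar>third_fun (Mf n) p (Z n i \<omega>, Y n i \<omega>)\<bar> * (K ((U n i \<omega> - U n k \<omega>) / h n) / h n))\<bar>
      \<le> C' * (1 + sqrt (ln (1 / h n) / (real n * h n))))"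
    using C C' by (intro exI[of _ "C' * (1 + C)"]) auto
  with lip show ?thesis by (intro exI[of _ Mf]) blast
qed

end

section \<open>Regular samples, thresholds for the sample size, and recovery\<close>

context gsvcm_fit
begin

lemma coef_flat: "j \<in> {s1 n + 1..d n} \<Longrightarrow> \<exists>c. \<forall>u\<in>{0..1}. a n j u = c"
  using coef_const[of j n] coef_zero[of j n] by (cases "j \<le> s2 n") auto

text \<open>For constant and zero coefficients the derivative is chosen to be 0 outright; for the
  others it comes from the smoothness condition. The second derivatives are bounded uniformly in
  \<open>n\<close> and \<open>j\<close>, so one \<open>Ca\<close> serves all coefficients.\<close>

lemma coef_derivatives:
  "\<exists>a' Ca. 0 \<le> Ca \<and>
    (\<forall>n. \<forall>j\<in>{1..d n}. \<forall>u\<in>{0..1}. \<forall>v\<in>{0..1}. \<bar>a n j u - a n j v - a' n j v * (u - v)\<bar> \<le> Ca * (u - v)\<^sup>2) \<and>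
    (\<forall>n. \<forall>j\<in>{s1 n + 1..d n}. \<forall>u\<in>{0..1}. a' n j u = 0)"
proof -
  obtain C where C': "\<forall>n. \<forall>j\<in>{1..d n}. \<exists>f2. cont_second_deriv (a n j) f2 \<and> (\<forall>u\<in>{0..1}. \<bar>f2 u\<bar> \<le> C)"
    using a_smooth ..
  note C = C'[THEN spec, THEN bspec]
  define D where "D n j f1 \<longleftrightarrow> (\<forall>u\<in>{0..1}. \<forall>v\<in>{0..1}. \<bar>a n j u - a n j v - f1 v * (u - v)\<bar> \<le> max 0 C * (u - v)\<^sup>2) \<and>
      (j \<in> {s1 n + 1..d n} \<longrightarrow> (\<forall>u\<in>{0..1}. f1 u = 0))" for n j and f1 :: "real \<Rightarrow> real"
  have ex: "\<exists>f1. D n j f1" if j: "j \<in> {1..d n}" for n j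
    unfolding D_def
  proof (cases "j \<in> {s1 n + 1..d n}")
    case True
    then obtain c where "\<And>u. u \<in> {0..1} \<Longrightarrow> a n j u = c" using coef_flat[OF True] by (elim exE) (rule that, rule bspec)
    then show "\<exists>f1. (\<forall>u\<in>{0..1}. \<forall>v\<in>{0..1}. \<bar>a n j u - a n j v - f1 v * (u - v)\<bar> \<le> max 0 C * (u - v)\<^sup>2) \<and>
      (j \<in> {s1 n + 1..d n} \<longrightarrow> (\<forall>u\<in>{0..1}. f1 u = 0))"
      by (intro exI[of _ "\<lambda>_. 0"]) auto
  next
    case False
    obtain f2 where f2: "cont_second_deriv (a n j) f2" "\<forall>u\<in>{0..1}. \<bar>f2 u\<bar> \<le> C"
      using C[OF j] by (elim exE conjE) (rule that)
    obtain f1 where f1: "\<forall>u\<in>{0..1}. (a n j has_real_derivative f1 u) (at u within {0..1}) \<and>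
        (f1 has_real_derivative f2 u) (at u within {0..1})"
      using f2(1) unfolding cont_second_deriv_def by (elim exE conjE) (rule that)
    have f: "\<And>u. u \<in> {0..1} \<Longrightarrow> (a n j has_real_derivative f1 u) (at u within {0..1})"
      "\<And>u. u \<in> {0..1} \<Longrightarrow> (f1 has_real_derivative f2 u) (at u within {0..1})"
      "\<And>u. u \<in> {0..1} \<Longrightarrow> \<bar>f2 u\<bar> \<le> max 0 C"
      using f1 f2(2) by (auto simp: le_max_iff_disj)
    note t = second_order_taylor[OF f]
    show "\<exists>f1. (\<forall>u\<in>{0..1}. \<forall>v\<in>{0..1}. \<bar>a n j u - a n j v - f1 v * (u - v)\<bar> \<le> max 0 C * (u - v)\<^sup>2) \<and>
      (j \<in> {s1 n + 1..d n} \<longrightarrow> (\<forall>u\<in>{0..1}. f1 u = 0))"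
      using False by (intro exI[of _ f1] conjI ballI t impI) auto
  qed
  define a' where "a' n j = (SOME f1. D n j f1)" for n j
  have a': "D n j (a' n j)" if "j \<in> {1..d n}" for n j
    unfolding a'_def using ex[OF that] by (rule someI_ex)
  show ?thesis
  proof (intro exI[of _ a'] exI[of _ "max 0 C"] conjI allI ballI)
    show "0 \<le> max 0 C" by simp
    show "\<bar>a n j u - a n j v - a' n j v * (u - v)\<bar> \<le> max 0 C * (u - v)\<^sup>2"
      if "j \<in> {1..d n}" "u \<in> {0..1}" "v \<in> {0..1}" for n j u v
      using a'[OF that(1)] that(2,3) unfolding D_def by blast
    show "a' n j u = 0" if "j \<in> {s1 n + 1..d n}" "u \<in> {0..1}" for n j u
    proof -
      have "j \<in> {1..d n}" using that(1) by simp
      from a'[OF this] that show ?thesis unfolding D_def by blast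
    qed
  qed
qed

abbreviation "rt n \<equiv> sqrt (ln (1 / h n) / (real n * h n))"

lemma wt_P: "wt (P n \<omega>) (U n k \<omega>) i = 1 / n * (K ((U n i \<omega> - U n k \<omega>) / h n) / h n)"
  by (simp add: wt_def Kh_def P_def)

lemma P_simps: "nobs (P n \<omega>) = n" "dim (P n \<omega>) = d n" "idx (P n \<omega>) i = U n i \<omega>" "cov (P n \<omega>) i j = X n i j \<omega>"
  "resp (P n \<omega>) i = Y n i \<omega>" "lik (P n \<omega>) = likf" "kern (P n \<omega>) = K" "bw (P n \<omega>) = h n"
  by (simp_all add: P_def)

text \<open>Translation at a fixed outcome: bounds on averages of \<open>score_fun\<close>,
  \<open>hess_fun\<close> and \<open>third_fun\<close> become deterministic hypotheses of
  \<open>sample\<close>, and the infimum and supremum in the eigenvalue and row conditions are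
  resolved into pointwise inequalities.\<close>

lemma sample_at:
  assumes \<omega>: "\<omega> \<in> space M" and n: "1 \<le> n" and cK: "1 \<le> cK" "\<And>t. K t \<noteq> 0 \<Longrightarrow> \<bar>t\<bar> \<le> cK"
    and Uu: "\<And>i. i \<in> {1..n} \<Longrightarrow> U n i \<omega> \<in> {0..1}"
    and Mf: "\<And>i. i \<in> {1..n} \<Longrightarrow> 0 < m (Z n i \<omega>, Y n i \<omega>)"
    and lip: "\<And>i t. i \<in> {1..n} \<Longrightarrow> \<bar>q2 likf (r n i \<omega> + t) (Y n i \<omega>) - q2 likf (r n i \<omega>) (Y n i \<omega>)\<bar>
      \<le> m (Z n i \<omega>, Y n i \<omega>) * \<bar>t\<bar>"
    and taylor: "\<And>j u v. j \<in> {1..d n} \<Longrightarrow> u \<in> {0..1} \<Longrightarrow> v \<in> {0..1} \<Longrightarrow>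
      \<bar>a n j u - a n j v - a' j v * (u - v)\<bar> \<le> Ca * (u - v)\<^sup>2"
    and a'0: "\<And>j u. j \<in> {s1 n + 1..d n} \<Longrightarrow> u \<in> {0..1} \<Longrightarrow> a' j u = 0"
    and score: "\<And>l k j. l \<in> {0, 1} \<Longrightarrow> k \<in> {1..n} \<Longrightarrow> j \<in> {1..d n} \<Longrightarrow>
      \<bar>1 / n * (\<Sum>i=1..n. score_fun n j (Z n i \<omega>, Y n i \<omega>) *
         ((((U n i \<omega> - U n k \<omega>) / h n) ^ l * K ((U n i \<omega> - U n k \<omega>) / h n)) / h n))\<bar> \<le> e"
    and hess: "\<And>k p. k \<in> {1..n} \<Longrightarrow> p \<in> {1..d n} \<times> {1..d n} \<Longrightarrow>
      \<bar>1 / n * (\<Sum>i=1..n. \<bar>hess_fun n p (Z n i \<omega>, Y n i \<omega>)\<bar> * (K ((U n i \<omega> - U n k \<omega>) / h n) / h n))\<bar> \<le> C0"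
    and third: "\<And>k p. k \<in> {1..n} \<Longrightarrow> p \<in> {1..d n} \<times> {1..d n} \<times> {1..d n} \<Longrightarrow>
      \<bar>1 / n * (\<Sum>i=1..n. \<bar>third_fun m p (Z n i \<omega>, Y n i \<omega>)\<bar> * (K ((U n i \<omega> - U n k \<omega>) / h n) / h n))\<bar> \<le> C0"
    and RE: "ereal \<rho>1 \<le> (INF u\<in>{0..1}. INF v\<in>Omega0 (d n) (s2 n) (max (lam1 n / lam2 n) (lam2 n / lam1 n) + \<delta>).
      ereal (quad_form (2 * d n) (\<lambda>j k. - ddL (P n \<omega>) (\<lambda>i. r n i \<omega>) u j k) v))"
    and row: "(SUP k\<in>{s2 n + 1..d n} \<union> {d n + s1 n + 1..2 * d n}.
          SUP u\<in>{0..1}. SUP w\<in>oracle_directions (d n) (s1 n) (s2 n).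
            ereal \<bar>\<Sum>c=1..2 * d n. ddL (P n \<omega>) (\<lambda>i. r n i \<omega>) u k c * w c\<bar>) \<le> ereal Crow"
    and const: "0 \<le> e" "0 \<le> C0" "0 \<le> Ca" "0 \<le> Crow"
  shows "sample (P n \<omega>) (\<lambda>i. r n i \<omega>) (\<lambda>i. m (Z n i \<omega>, Y n i \<omega>)) (a n) a' (s1 n) (s2 n)
    (lam1 n) (lam2 n) e C0 Ca cK \<rho>1 (max (lam1 n / lam2 n) (lam2 n / lam1 n) + \<delta>) Crow"
proof
  have Yr: "Y n i \<omega> \<in> R" if "i \<in> {1..n}" for i using range_Y[OF that \<omega>] .
  show "1 \<le> nobs (P n \<omega>)" "0 < bw (P n \<omega>)" "1 \<le> s1 n" "s1 n < s2 n" "s2 n < dim (P n \<omega>)"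
    using n pos s_ord by (auto simp: P_simps)
  show "0 \<le> kern (P n \<omega>) t" for t using K_nonneg by (simp add: P_simps)
  show "kern (P n \<omega>) t \<noteq> 0 \<Longrightarrow> \<bar>t\<bar> \<le> cK" for t using cK by (simp add: P_simps)
  show "1 \<le> cK" by (rule cK)
  show "idx (P n \<omega>) i \<in> {0..1}" if "i \<in> {1..nobs (P n \<omega>)}" for i using that Uu[of i] unfolding P_simps by blast
  show "((\<lambda>t. lik (P n \<omega>) t (resp (P n \<omega>) i)) has_real_derivative q1 (lik (P n \<omega>)) t (resp (P n \<omega>) i)) (at t)"
    "((\<lambda>t. q1 (lik (P n \<omega>)) t (resp (P n \<omega>) i)) has_real_derivative q2 (lik (P n \<omega>)) t (resp (P n \<omega>) i)) (at t)"
    "q2 (lik (P n \<omega>)) t (resp (P n \<omega>) i) < 0"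
    if "i \<in> {1..nobs (P n \<omega>)}" for i t
    using that d1R[OF Yr] d2R[OF Yr] q2_neg[OF Yr] unfolding P_simps by blast+
  show "0 \<le> m (Z n i \<omega>, Y n i \<omega>)" if "i \<in> {1..nobs (P n \<omega>)}" for i
    using that Mf[of i] unfolding P_simps by (auto intro: less_imp_le)
  show "\<bar>q2 (lik (P n \<omega>)) (r n i \<omega> + t) (resp (P n \<omega>) i) - q2 (lik (P n \<omega>)) (r n i \<omega>) (resp (P n \<omega>) i)\<bar>
      \<le> m (Z n i \<omega>, Y n i \<omega>) * \<bar>t\<bar>" if "i \<in> {1..nobs (P n \<omega>)}" for i t
    using that lip[of i t] unfolding P_simps by blast
  show "r n i \<omega> = (\<Sum>j=1..dim (P n \<omega>). a n j (idx (P n \<omega>) i) * cov (P n \<omega>) i j)" for i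
    by (simp add: P_simps r_def)
  show "\<bar>a n j u - a n j v - a' j v * (u - v)\<bar> \<le> Ca * (u - v)\<^sup>2"
    if "j \<in> {1..dim (P n \<omega>)}" "u \<in> {0..1}" "v \<in> {0..1}" for j u v
    using that taylor[of j u v] unfolding P_simps by blast
  show "a n j u = 0" if "j \<in> {s2 n + 1..dim (P n \<omega>)}" "u \<in> {0..1}" for j u
    using that coef_zero[of j n] unfolding P_simps by blast
  show "a' j u = 0" if "j \<in> {s1 n + 1..dim (P n \<omega>)}" "u \<in> {0..1}" for j u
    using that a'0[of j u] unfolding P_simps by blast
  show "\<bar>\<Sum>i=1..nobs (P n \<omega>). wt (P n \<omega>) (idx (P n \<omega>) k) i * (((idx (P n \<omega>) i - idx (P n \<omega>) k) / bw (P n \<omega>)) ^ l *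
      (q1 (lik (P n \<omega>)) (r n i \<omega>) (resp (P n \<omega>) i) * cov (P n \<omega>) i j))\<bar> \<le> e"
    if kjl: "k \<in> {1..nobs (P n \<omega>)}" "j \<in> {1..dim (P n \<omega>)}" "l \<in> {0, 1}" for k j l
  proof -
    have "(\<Sum>i=1..n. wt (P n \<omega>) (U n k \<omega>) i * (((U n i \<omega> - U n k \<omega>) / h n) ^ l * (q1 likf (r n i \<omega>) (Y n i \<omega>) * X n i j \<omega>)))
      = 1 / n * (\<Sum>i=1..n. score_fun n j (Z n i \<omega>, Y n i \<omega>) *
         ((((U n i \<omega> - U n k \<omega>) / h n) ^ l * K ((U n i \<omega> - U n k \<omega>) / h n)) / h n))"
      unfolding sum_distrib_left
    proof (intro sum.cong refl)
      fix i assume i: "i \<in> {1..n}"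
      have "score_fun n j (Z n i \<omega>, Y n i \<omega>) = q1 likf (r n i \<omega>) (Y n i \<omega>) * X n i j \<omega>"
        using fun_at_obs(1)[OF i \<omega> Uu[OF i], of j] kjl by (simp add: P_simps Q1_def)
      then show "wt (P n \<omega>) (U n k \<omega>) i * (((U n i \<omega> - U n k \<omega>) / h n) ^ l * (q1 likf (r n i \<omega>) (Y n i \<omega>) * X n i j \<omega>))
        = 1 / n * (score_fun n j (Z n i \<omega>, Y n i \<omega>) *
         ((((U n i \<omega> - U n k \<omega>) / h n) ^ l * K ((U n i \<omega> - U n k \<omega>) / h n)) / h n))"
        by (simp add: wt_P)
    qed
    then show ?thesis using score[of l k j] kjl unfolding P_simps by simp
  qed
  show "(\<Sum>i=1..nobs (P n \<omega>). wt (P n \<omega>) (idx (P n \<omega>) k) i *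
      \<bar>q2 (lik (P n \<omega>)) (r n i \<omega>) (resp (P n \<omega>) i) * cov (P n \<omega>) i j * cov (P n \<omega>) i j'\<bar>) \<le> C0"
    if kjl: "k \<in> {1..nobs (P n \<omega>)}" "j \<in> {1..dim (P n \<omega>)}" "j' \<in> {1..dim (P n \<omega>)}" for k j j'
  proof -
    have "(\<Sum>i=1..n. wt (P n \<omega>) (U n k \<omega>) i * \<bar>q2 likf (r n i \<omega>) (Y n i \<omega>) * X n i j \<omega> * X n i j' \<omega>\<bar>)
      = 1 / n * (\<Sum>i=1..n. \<bar>hess_fun n (j, j') (Z n i \<omega>, Y n i \<omega>)\<bar> * (K ((U n i \<omega> - U n k \<omega>) / h n) / h n))"
      unfolding sum_distrib_left
    proof (intro sum.cong refl)
      fix i assume i: "i \<in> {1..n}"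
      have "hess_fun n (j, j') (Z n i \<omega>, Y n i \<omega>) = q2 likf (r n i \<omega>) (Y n i \<omega>) * X n i j \<omega> * X n i j' \<omega>"
        using fun_at_obs(2)[OF i \<omega> Uu[OF i], of j j'] kjl by (simp add: P_simps Q2_def)
      then show "wt (P n \<omega>) (U n k \<omega>) i * \<bar>q2 likf (r n i \<omega>) (Y n i \<omega>) * X n i j \<omega> * X n i j' \<omega>\<bar>
        = 1 / n * (\<bar>hess_fun n (j, j') (Z n i \<omega>, Y n i \<omega>)\<bar> * (K ((U n i \<omega> - U n k \<omega>) / h n) / h n))"
        by (simp add: wt_P)
    qed
    also have "\<dots> \<le> C0" using abs_le_D1[OF hess[of k "(j, j')"]] kjl unfolding P_simps by simp
    finally show ?thesis unfolding P_simps .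
  qed
  show "(\<Sum>i=1..nobs (P n \<omega>). wt (P n \<omega>) (idx (P n \<omega>) k) i *
      \<bar>cov (P n \<omega>) i j * cov (P n \<omega>) i j' * cov (P n \<omega>) i j'' * m (Z n i \<omega>, Y n i \<omega>)\<bar>) \<le> C0"
    if kjl: "k \<in> {1..nobs (P n \<omega>)}" "j \<in> {1..dim (P n \<omega>)}" "j' \<in> {1..dim (P n \<omega>)}" "j'' \<in> {1..dim (P n \<omega>)}" for k j j' j''
  proof -
    have "(\<Sum>i=1..n. wt (P n \<omega>) (U n k \<omega>) i * \<bar>X n i j \<omega> * X n i j' \<omega> * X n i j'' \<omega> * m (Z n i \<omega>, Y n i \<omega>)\<bar>)
      = 1 / n * (\<Sum>i=1..n. \<bar>third_fun m (j, j', j'') (Z n i \<omega>, Y n i \<omega>)\<bar> * (K ((U n i \<omega> - U n k \<omega>) / h n) / h n))"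
      unfolding sum_distrib_left
    proof (intro sum.cong refl)
      fix i assume i: "i \<in> {1..n}"
      have "third_fun m (j, j', j'') (Z n i \<omega>, Y n i \<omega>) = X n i j \<omega> * X n i j' \<omega> * X n i j'' \<omega> * m (Z n i \<omega>, Y n i \<omega>)"
        using fun_at_obs(3)[OF i \<omega> Uu[OF i], of j j' j'' m] kjl by (simp add: P_simps)
      then show "wt (P n \<omega>) (U n k \<omega>) i * \<bar>X n i j \<omega> * X n i j' \<omega> * X n i j'' \<omega> * m (Z n i \<omega>, Y n i \<omega>)\<bar>
        = 1 / n * (\<bar>third_fun m (j, j', j'') (Z n i \<omega>, Y n i \<omega>)\<bar> * (K ((U n i \<omega> - U n k \<omega>) / h n) / h n))"
        by (simp add: wt_P)
    qed
    also have "\<dots> \<le> C0" using abs_le_D1[OF third[of k "(j, j', j'')"]] kjl unfolding P_simps by simp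
    finally show ?thesis unfolding P_simps .
  qed
  show "\<rho>1 \<le> quad_form (2 * dim (P n \<omega>)) (\<lambda>j k. - ddL (P n \<omega>) (\<lambda>i. r n i \<omega>) u j k) v"
    if "u \<in> {0..1}" "v \<in> Omega0 (dim (P n \<omega>)) (s2 n) (max (lam1 n / lam2 n) (lam2 n / lam1 n) + \<delta>)" for u v
  proof -
    have "ereal \<rho>1 \<le> ereal (quad_form (2 * d n) (\<lambda>j k. - ddL (P n \<omega>) (\<lambda>i. r n i \<omega>) u j k) v)"
      using RE that unfolding le_INF_iff P_simps by blast
    then show ?thesis unfolding P_simps by simp
  qed
  show "\<bar>\<Sum>c=1..2 * dim (P n \<omega>). ddL (P n \<omega>) (\<lambda>i. r n i \<omega>) u r' c * v c\<bar> \<le> Crow"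
    if "u \<in> {0..1}" "v \<in> oracle_directions (dim (P n \<omega>)) (s1 n) (s2 n)"
      "r' \<in> {s2 n + 1..dim (P n \<omega>)} \<union> {dim (P n \<omega>) + s1 n + 1..2 * dim (P n \<omega>)}" for u v r'
  proof -
    have "ereal \<bar>\<Sum>c=1..2 * d n. ddL (P n \<omega>) (\<lambda>i. r n i \<omega>) u r' c * v c\<bar> \<le> ereal Crow"
      using row that unfolding SUP_le_iff P_simps by blast
    then show ?thesis unfolding P_simps by simp
  qed
  show "0 < lam1 n" "0 < lam2 n" using pos by auto
  show "max (lam1 n / lam2 n) (lam2 n / lam1 n) \<le> max (lam1 n / lam2 n) (lam2 n / lam1 n) + \<delta>" using delta by simp
  show "0 \<le> e" "0 \<le> C0" "0 \<le> Ca" "0 < \<rho>1" "0 \<le> Crow" using const rho by auto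
qed

lemma lam_ratio: "\<exists>Lr\<ge>1. \<forall>\<^sub>F n in sequentially. lam1 n \<le> Lr * lam2 n \<and> lam2 n \<le> Lr * lam1 n"
proof -
  obtain c1 c2 where c: "0 < c1" and ev: "\<forall>\<^sub>F n in sequentially. c1 * lam2 n \<le> lam1 n \<and> lam1 n \<le> c2 * lam2 n"
    using lam12 unfolding propto_def by blast
  define Lr where "Lr = max 1 (max c2 (1 / c1))"
  have Lr: "1 \<le> Lr" "c2 \<le> Lr" "1 / c1 \<le> Lr" by (auto simp: Lr_def)
  from ev have "\<forall>\<^sub>F n in sequentially. lam1 n \<le> Lr * lam2 n \<and> lam2 n \<le> Lr * lam1 n"
  proof eventually_elim
    case (elim n)
    have "c2 * lam2 n \<le> Lr * lam2 n" using Lr pos[of n] by (intro mult_right_mono) auto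
    moreover have "lam2 n \<le> 1 / c1 * lam1 n" using elim c by (simp add: field_simps)
    moreover have "1 / c1 * lam1 n \<le> Lr * lam1 n" using Lr pos[of n] by (intro mult_right_mono) auto
    ultimately show ?case using elim by linarith
  qed
  then show ?thesis using Lr by blast
qed

text \<open>Little-o conditions unfolded to inequalities with a prescribed factor. The summands that
  are dropped are eventually nonnegative, so a single term can be kept.\<close>

lemma eventually_rates:
  assumes "0 < \<epsilon>"
  shows "\<forall>\<^sub>F n in sequentially. 0 \<le> ln (1 / h n)"
    and "\<forall>\<^sub>F n in sequentially. real (s2 n) * (h n)\<^sup>2 + rt n \<le> \<epsilon> * lam1 n"
    and "\<forall>\<^sub>F n in sequentially. (real (s2 n))\<^sup>2 * lam1 n \<le> \<epsilon>"
    and "\<forall>\<^sub>F n in sequentially. sqrt (real n) * (lam1 n * sqrt (real (s2 n))) \<le> \<epsilon> * lam4 n"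
    and "\<forall>\<^sub>F n in sequentially. lam4 n \<le> \<epsilon> * sqrt (real n)"
    and "\<forall>\<^sub>F n in sequentially. lam4 n \<le> 2 * lam4s n \<and> lam4s n \<le> 2 * lam4 n"
proof -
  show ln0: "\<forall>\<^sub>F n in sequentially. 0 \<le> ln (1 / h n)" by (rule ln_inv_h_nonneg)
  show "\<forall>\<^sub>F n in sequentially. real (s2 n) * (h n)\<^sup>2 + rt n \<le> \<epsilon> * lam1 n"
    using landau_o.smallD[OF rate_lam1 assms]
  proof eventually_elim
    case (elim n)
    show ?case using order_trans[OF abs_ge_self elim[unfolded real_norm_def]] pos[of n] by simp
  qed
  show "\<forall>\<^sub>F n in sequentially. (real (s2 n))\<^sup>2 * lam1 n \<le> \<epsilon>"
    using landau_o.smallD[OF rate_s2 assms]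
  proof eventually_elim
    case (elim n)
    from order_trans[OF abs_ge_self elim[unfolded real_norm_def]]
    have "real (s2 n) * (lam1 n)\<^sup>2 / (h n)\<^sup>2 + (real (s2 n))\<^sup>2 * lam1 n \<le> \<epsilon>" by simp
    moreover have "0 \<le> real (s2 n) * (lam1 n)\<^sup>2 / (h n)\<^sup>2" by simp
    ultimately show ?case by linarith
  qed
  show "\<forall>\<^sub>F n in sequentially. sqrt (real n) * (lam1 n * sqrt (real (s2 n))) \<le> \<epsilon> * lam4 n"
    using landau_o.smallD[OF lam4_low assms] ln0
  proof eventually_elim
    case (elim n)
    have hp: "0 < h n" and l1: "0 < lam1 n" and l4: "0 < lam4 n" using pos by auto
    \<comment> \<open>The factors \<open>1 / sqrt h\<close> and \<open>sqrt (n * h)\<close> in the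
      lower bound on \<open>lam4\<close> combine to \<open>sqrt n\<close>, the growth of a group
      norm over all observations.\<close>
    have "sqrt (real n) * (lam1 n * sqrt (real (s2 n)))
        = 1 / sqrt (h n) * (sqrt (real (s2 n)) * (lam1 n * sqrt (real n * h n)))"
      using hp by (simp add: real_sqrt_mult)
    also have "\<dots> \<le> 1 / sqrt (h n) * (sqrt (ln (1 / h n)) + sqrt (real (s2 n)) * (1 + lam1 n * sqrt (real n * h n)))"
    proof (rule mult_left_mono)
      have "0 \<le> sqrt (ln (1 / h n))" by (rule real_sqrt_ge_zero) fact
      moreover have "0 \<le> sqrt (real (s2 n))" by simp
      ultimately show "sqrt (real (s2 n)) * (lam1 n * sqrt (real n * h n))
          \<le> sqrt (ln (1 / h n)) + sqrt (real (s2 n)) * (1 + lam1 n * sqrt (real n * h n))"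
        by (simp add: distrib_left)
    qed (use hp in simp)
    also have "\<dots> \<le> \<epsilon> * \<bar>lam4 n\<bar>" by (rule order_trans[OF abs_ge_self elim(1)[unfolded real_norm_def]])
    finally show ?case using l4 by simp
  qed
  show "\<forall>\<^sub>F n in sequentially. lam4 n \<le> \<epsilon> * sqrt (real n)"
    using landau_o.smallD[OF lam4_up assms] by eventually_elim simp
  have lim: "(\<lambda>n. lam4 n / lam4s n) \<longlonglongrightarrow> 1"
    using asymp_equivD_strong[OF lam4_equiv] pos by (auto simp: less_imp_neq[symmetric])
  have "\<forall>\<^sub>F n in sequentially. lam4 n / lam4s n < 2" "\<forall>\<^sub>F n in sequentially. 1 / 2 < lam4 n / lam4s n"
    by (rule order_tendstoD[OF lim], simp)+
  then show "\<forall>\<^sub>F n in sequentially. lam4 n \<le> 2 * lam4s n \<and> lam4s n \<le> 2 * lam4 n"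
  proof eventually_elim
    case (elim n)
    then show ?case using pos[of n] by (simp add: field_simps)
  qed
qed

text \<open>The threshold for \<open>n\<close> must not depend on the outcome or on the witnesses of
  regularity, so all constants are fixed first and the quantifiers over outcomes and witnesses stand
  inside the eventuality. The score level \<open>C1 * rt n\<close> shrinks with \<open>n\<close>,
  while \<open>C0\<close> and \<open>Crow\<close> stay fixed.\<close>

lemma recovery_given_regular_sample:
  fixes C1 C0 Ca cK Crow :: real
  assumes C: "0 \<le> C1" "0 \<le> C0" "0 \<le> Ca" "1 \<le> cK" "0 \<le> Crow"
  shows "\<forall>\<^sub>F n in sequentially. rt n \<le> 1 \<and> (\<forall>\<omega>\<in>space M. \<forall>\<eta> Mf a' .
    sample (P n \<omega>) \<eta> Mf (a n) a' (s1 n) (s2 n) (lam1 n) (lam2 n) (C1 * rt n) C0 Ca cK \<rho>1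
      (max (lam1 n / lam2 n) (lam2 n / lam1 n) + \<delta>) Crow \<longrightarrow>
    (\<forall>j\<in>{1..s2 n}. b\<^sub>d * sqrt (real n) \<le> L2_set (\<lambda>k. a n j (U n k \<omega>)) {1..n}) \<longrightarrow>
    (\<forall>j\<in>{1..s1 n}. b\<^sub>d * sqrt (real n) \<le> deviation n (\<lambda>k. a n j (U n k \<omega>))) \<longrightarrow>
    (\<forall>k\<in>{1..n}. \<forall>j\<in>{1..d n}. Ab n \<omega> j k = Auo n \<omega> j k))"
proof -
  obtain Lr where Lr: "1 \<le> Lr" and ev_lam: "\<forall>\<^sub>F n in sequentially. lam1 n \<le> Lr * lam2 n \<and> lam2 n \<le> Lr * lam1 n"
    using lam_ratio by blast
  define Bb where "Bb = 2 * (1 + (Lr + \<delta>))"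
  define CC where "CC = cK ^ 3 * C0"
  define K1 where "K1 = 8 * (Bb + Lr) * sqrt 2 / \<rho>1"
  define K2 where "K2 = Bb * sqrt 2 * K1"
  define K4 where "K4 = 1 + 2 * CC * ((1 + K2) * K2)"
  define K5 where "K5 = K4 + (Crow + CC * (1 + K2) * sqrt 2) * (2 * K4 * sqrt 2 / \<rho>1)"
  \<comment> \<open>Chosen so that \<open>bet * s = w * (s2 * h^2)\<close>, the smoothing bias in
    the scale of the rate condition.\<close>
  define w where "w = 2 * Ca * cK\<^sup>2"
  \<comment> \<open>Small enough that noise and bias together keep the local gradient below
    \<open>lam1 / (4 * Lr)\<close>, hence below a quarter of either tuning parameter; the extra
    summands 1 and \<open>w\<close> also give \<open>rt n \<le> 1\<close> and
    \<open>bet * s \<le> lam1\<close>.\<close>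
  define e1 where "e1 = 1 / (4 * Lr * (1 + C1 + 2 * CC * w + w))"
  \<comment> \<open>The three members of the minimum bound \<open>s2^2 * lam1\<close> by 1, the
    third-order term by half of the curvature, and the radius \<open>RR\<close> by half of the
    signal strength.\<close>
  define q where "q = min 1 (min (\<rho>1 / (2 * (1 + CC * (1 + K2) * (Bb\<^sup>2 * 2)))) (b\<^sub>d / (2 * (1 + K1))))"
  \<comment> \<open>Makes \<open>sqrt n\<close> times the radius and \<open>sqrt n\<close> times the
    off-model gradient at most \<open>lam4 / 4\<close>; the quarter leaves room for
    \<open>lam4 \<le> 2 * lam4s\<close>.\<close>
  define e2 where "e2 = 1 / (4 * (1 + K1 + K5))"
  define e3 where "e3 = b\<^sub>d / 16"
  have nn: "0 \<le> CC" "0 < Bb" "0 \<le> K1" "0 \<le> K2" "0 \<le> w"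
    using C Lr delta rho by (auto simp: CC_def Bb_def K1_def K2_def w_def)
  have K4: "1 \<le> K4" using nn by (simp add: K4_def)
  have K5: "0 \<le> K5" using nn K4 C rho by (simp add: K5_def)
  have den: "1 \<le> 1 + C1 + 2 * CC * w + w" using nn C by simp
  have e1: "0 < e1" unfolding e1_def using Lr den by (intro divide_pos_pos mult_pos_pos) auto
  have den2: "0 < 2 * (1 + CC * (1 + K2) * (Bb\<^sup>2 * 2))" using nn by (simp add: add_pos_nonneg)
  have q0: "0 < q" unfolding q_def using den2 rho b_pos nn by auto
  have e2: "0 < e2" using nn K5 by (simp add: e2_def)
  have e3: "0 < e3" using b_pos by (simp add: e3_def)
  have qle: "q \<le> 1" "CC * (1 + K2) * (Bb\<^sup>2 * 2) * q \<le> \<rho>1 / 2" "K1 * q \<le> b\<^sub>d / 2"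
  proof -
    have half: "t * (z / (2 * t)) = z / 2" if "0 < t" for t z :: real using that by simp
    show "q \<le> 1" by (simp add: q_def)
    have c0: "0 \<le> CC * (1 + K2) * (Bb\<^sup>2 * 2)" using nn by simp
    have "CC * (1 + K2) * (Bb\<^sup>2 * 2) * q \<le> (1 + CC * (1 + K2) * (Bb\<^sup>2 * 2)) * (\<rho>1 / (2 * (1 + CC * (1 + K2) * (Bb\<^sup>2 * 2))))"
      using c0 q0 by (intro mult_mono) (auto simp: q_def)
    also have "\<dots> = \<rho>1 / 2" by (rule half) (use den2 in simp)
    finally show "CC * (1 + K2) * (Bb\<^sup>2 * 2) * q \<le> \<rho>1 / 2" .
    have "K1 * q \<le> (1 + K1) * (b\<^sub>d / (2 * (1 + K1)))"
      using nn q0 by (intro mult_mono) (auto simp: q_def)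
    also have "\<dots> = b\<^sub>d / 2" by (rule half) (use nn in simp)
    finally show "K1 * q \<le> b\<^sub>d / 2" .
  qed
  show ?thesis
    using ev_lam eventually_rates(1)[OF e1] eventually_rates(2)[OF e1] eventually_rates(3)[OF q0]
      eventually_rates(4)[OF e2] eventually_rates(5)[OF e3] eventually_rates(6)[OF e1] eventually_ge_at_top[of 1]
  proof eventually_elim
    case (elim n)
    note el = elim
    have p: "0 < lam1 n" "0 < lam2 n" "0 < lam4 n" "0 < lam4s n" "0 < h n" using pos by auto
    have x: "1 \<le> real (s2 n)" using s_ord[of n] by simp
    have rt0: "0 \<le> rt n" using el(2) p by (intro real_sqrt_ge_zero divide_nonneg_nonneg) auto
    have l1: "lam1 n \<le> 1"
    proof -
      have "1 * lam1 n \<le> (real (s2 n))\<^sup>2 * lam1 n" using p one_le_power[OF x, of 2] by (intro mult_right_mono) auto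
      then show ?thesis using el(4) qle by linarith
    qed
    have D: "real (s2 n) * (h n)\<^sup>2 \<le> e1 * lam1 n" "rt n \<le> e1 * lam1 n"
    proof -
      have "0 \<le> real (s2 n) * (h n)\<^sup>2" by simp
      then show "real (s2 n) * (h n)\<^sup>2 \<le> e1 * lam1 n" "rt n \<le> e1 * lam1 n" using el(3) rt0 by linarith+
    qed
    have e1c: "e1 * (1 + C1 + 2 * CC * w + w) = 1 / (4 * Lr)"
      unfolding e1_def using den Lr by simp
    have e1s: "w * e1 \<le> 1" "e1 \<le> 1" "(C1 + 2 * CC * w) * e1 \<le> 1 / (4 * Lr)"
    proof -
      have L1: "1 / (4 * Lr) \<le> 1" using Lr by simp
      have s: "e1 * x \<le> 1 / (4 * Lr)" if "x \<le> 1 + C1 + 2 * CC * w + w" for x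
        using mult_left_mono[OF that, of e1] e1 e1c by simp
      show "w * e1 \<le> 1" using s[of w] C nn L1 by (simp add: mult.commute)
      show "e1 \<le> 1" using s[of 1] C nn L1 by simp
      show "(C1 + 2 * CC * w) * e1 \<le> 1 / (4 * Lr)" using s[of "C1 + 2 * CC * w"] nn by (simp add: mult.commute)
    qed
    have rt1: "rt n \<le> 1"
    proof -
      have "e1 * lam1 n \<le> 1 * 1" using e1s l1 p e1 by (intro mult_mono) auto
      then show ?thesis using D by linarith
    qed
    have key: "Ab n \<omega> j k = Auo n \<omega> j k"
      if \<omega>: "\<omega> \<in> space M" and S: "sample (P n \<omega>) \<eta> Mf (a n) a' (s1 n) (s2 n) (lam1 n) (lam2 n) (C1 * rt n) C0 Ca cK \<rho>1
        (max (lam1 n / lam2 n) (lam2 n / lam1 n) + \<delta>) Crow"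
        and sA: "\<forall>j\<in>{1..s2 n}. b\<^sub>d * sqrt (real n) \<le> L2_set (\<lambda>k. a n j (U n k \<omega>)) {1..n}"
        and sD: "\<forall>j\<in>{1..s1 n}. b\<^sub>d * sqrt (real n) \<le> deviation n (\<lambda>k. a n j (U n k \<omega>))"
        and kj: "k \<in> {1..n}" "j \<in> {1..d n}"
      for \<omega> \<eta> Mf a' k j
    proof -
      interpret S: sample "P n \<omega>" \<eta> Mf "a n" a' "s1 n" "s2 n" "lam1 n" "lam2 n" "C1 * rt n" C0 Ca cK \<rho>1
        "max (lam1 n / lam2 n) (lam2 n / lam1 n) + \<delta>" Crow by (rule S)
      have CCS: "S.CC = CC" by (simp add: S.CC_def CC_def)
      have BB: "S.BB \<le> Bb"
      proof -
        have "lam1 n / lam2 n \<le> Lr" "lam2 n / lam1 n \<le> Lr" using el(1) p by (auto simp: pos_divide_le_eq)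
        then show ?thesis by (simp add: S.BB_def Bb_def)
      qed
      have bets: "S.bet * S.s = w * (real (s2 n) * (h n)\<^sup>2)"
        by (simp add: S.bet_def S.s_def w_def P_simps power_mult_distrib)
      have wD: "w * (real (s2 n) * (h n)\<^sup>2) \<le> w * (e1 * lam1 n)" using D(1) nn(5) by (rule mult_left_mono)
      have bets1: "S.bet * S.s \<le> lam1 n"
      proof -
        have "w * e1 * lam1 n \<le> 1 * lam1 n" using e1s(1) p by (intro mult_right_mono) auto
        then show ?thesis unfolding bets using wD by simp
      qed
      have bets0: "0 \<le> S.bet * S.s" unfolding bets using nn by simp
      have eps: "S.eps \<le> lam1 n / (4 * Lr)"
      proof -
        have "(S.bet * S.s)\<^sup>2 \<le> S.bet * S.s"
          using bets0 bets1 l1 mult_left_mono[of "S.bet * S.s" 1 "S.bet * S.s"] by (simp add: power2_eq_square)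
        then have "CC * (S.bet * S.s + (S.bet * S.s)\<^sup>2) \<le> CC * (2 * (w * (e1 * lam1 n)))"
          using wD nn unfolding bets by (intro mult_left_mono) auto
        moreover have "C1 * rt n \<le> C1 * (e1 * lam1 n)" using D(2) C(1) by (rule mult_left_mono)
        ultimately have "S.eps \<le> (C1 + 2 * CC * w) * e1 * lam1 n"
          unfolding S.eps_def CCS by (simp add: algebra_simps)
        also have "\<dots> \<le> 1 / (4 * Lr) * lam1 n" using e1s(3) p by (intro mult_right_mono) auto
        finally show ?thesis by simp
      qed
      have q3: "S.CC * (1 + Bb * sqrt 2 * (8 * (Bb + Lr) * sqrt 2 / \<rho>1)) * (Bb\<^sup>2 * 2) * q \<le> \<rho>1 / 2"
        using qle(2) unfolding CCS K2_def K1_def .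
      note rates = S.rates[OF conjunct1[OF el(1)] conjunct2[OF el(1)] Lr BB eps bets1 el(4) qle(1) q3]
      have RR: "S.RR \<le> K1 * (lam1 n * sqrt (real (s2 n)))" using rates(3) unfolding K1_def .
      have GG: "S.GG \<le> K5 * (lam1 n * sqrt (real (s2 n)))"
        using rates(4) unfolding K5_def K4_def K2_def K1_def CCS .
      define y where "y = lam1 n * sqrt (real (s2 n))"
      have y0: "0 \<le> y" using p by (simp add: y_def)
      have yn: "sqrt (real n) * y \<le> e2 * lam4 n" using el(5) by (simp add: y_def)
      have small: "sqrt (real n) * (c * y) \<le> lam4 n / 4" if c: "0 \<le> c" "c \<le> K1 + K5" for c
      proof -
        have "sqrt (real n) * (c * y) = c * (sqrt (real n) * y)" by simp
        also have "\<dots> \<le> c * (e2 * lam4 n)" using yn c(1) by (rule mult_left_mono)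
        also have "\<dots> \<le> (1 + K1 + K5) * (e2 * lam4 n)" using c e2 p by (intro mult_right_mono) auto
        also have "\<dots> = lam4 n / 4" unfolding e2_def using nn K5 by (simp add: field_simps)
        finally show ?thesis .
      qed
      have nR: "sqrt (real n) * S.RR \<le> lam4 n / 4"
        using mult_left_mono[OF RR[folded y_def], of "sqrt (real n)"] small[of K1] nn K5 by simp
      have nG: "sqrt (real n) * S.GG \<le> lam4 n / 4"
        using mult_left_mono[OF GG[folded y_def], of "sqrt (real n)"] small[of K5] nn K5 by simp
      have RRb: "S.RR \<le> b\<^sub>d / 2"
      proof -
        \<comment> \<open>Since \<open>s2 \<ge> 1\<close>, the condition on
          \<open>s2^2 * lam1\<close> also bounds \<open>lam1 * sqrt s2\<close>, and so brings the
          radius below half of the signal.\<close>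
        have "sqrt (real (s2 n)) \<le> (real (s2 n))\<^sup>2"
          using x self_le_power[OF x, of 4] by (intro real_le_lsqrt) (simp_all add: power_mult[symmetric])
        then have "y \<le> (real (s2 n))\<^sup>2 * lam1 n" unfolding y_def using p by (simp add: mult.commute)
        then have "K1 * y \<le> K1 * q" using el(4) nn by (intro mult_left_mono) auto
        then show ?thesis using RR[folded y_def] qle by linarith
      qed
      \<comment> \<open>The factor 2 covers \<open>lam4s \<le> 2 * lam4\<close>. With
        \<open>lam4 \<le> b\<^sub>d / 16 * sqrt n\<close> the left side is at most
        \<open>37 / 80 * b\<^sub>d * sqrt n\<close>, less than the half of the signal that remains
        after removing \<open>RR\<close>.\<close>
      have big: "37 / 10 * (2 * lam4 n) \<le> sqrt (real n) * (b\<^sub>d - S.RR)"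
      proof -
        have "37 / 10 * (2 * lam4 n) \<le> 37 / 10 * (2 * (b\<^sub>d / 16 * sqrt (real n)))" using el(6) by (simp add: e3_def)
        also have "\<dots> \<le> sqrt (real n) * (b\<^sub>d / 2)" using b_pos by simp
        also have "\<dots> \<le> sqrt (real n) * (b\<^sub>d - S.RR)" using RRb by (intro mult_left_mono) auto
        finally show ?thesis .
      qed
      show ?thesis
      proof (rule S.oracle_recovery[OF prelim[OF \<omega>] rates(1,2) unb_oracle[OF \<omega>] scad[OF \<omega>], where bs = "b\<^sub>d"])
        show "0 < lam4 n" "0 < lam4s n" using p by auto
        show "sqrt (nobs (P n \<omega>)) * S.GG < lam4 n" "sqrt (nobs (P n \<omega>)) * S.GG < lam4s n"
          "sqrt (nobs (P n \<omega>)) * S.RR \<le> lam4 n" "sqrt (nobs (P n \<omega>)) * S.RR \<le> lam4s n"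
          using nG nR el(7) p unfolding P_simps by linarith+
        show "37 / 10 * lam4 n \<le> sqrt (nobs (P n \<omega>)) * (b\<^sub>d - S.RR)"
          "37 / 10 * lam4s n \<le> sqrt (nobs (P n \<omega>)) * (b\<^sub>d - S.RR)"
          using big el(7) p unfolding P_simps by linarith+
        show "b\<^sub>d * sqrt (nobs (P n \<omega>)) \<le> L2_set (\<lambda>k. a n j (idx (P n \<omega>) k)) S.NN" if "j \<in> {1..s2 n}" for j
          using sA that unfolding P_simps by blast
        show "b\<^sub>d * sqrt (nobs (P n \<omega>)) \<le> deviation (nobs (P n \<omega>)) (\<lambda>k. a n j (idx (P n \<omega>) k))" if "j \<in> {1..s1 n}" for j
          using sD that unfolding P_simps by blast
        show "\<exists>c. \<forall>u\<in>{0..1}. a n j u = c" if "j \<in> {s1 n + 1..dim (P n \<omega>)}" for j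
          using coef_flat that unfolding P_simps by blast
        show "k \<in> S.NN" "j \<in> {1..dim (P n \<omega>)}" using kj unfolding P_simps by auto
      qed
    qed
    show ?case by (intro conjI rt1 ballI allI impI) (rule key; assumption)
  qed
qed

text \<open>All regularity events but one have probability tending to one. The row bound holds only
  up to a prescribed probability, with a constant depending on it; so \<epsilon> is split in two,
  \<open>Crow\<close> is fixed from one half, and only then is the threshold for \<open>n\<close>
  taken.\<close>

lemma recovery:
  "with_prob_to_1 M (\<lambda>n \<omega>. \<forall>k\<in>{1..n}. \<forall>j\<in>{1..d n}. Ab n \<omega> j k = Auo n \<omega> j k)"
proof -
  obtain a' Ca where Ca: "0 \<le> Ca"
    and taylor: "\<forall>n. \<forall>j\<in>{1..d n}. \<forall>u\<in>{0..1}. \<forall>v\<in>{0..1}. \<bar>a n j u - a n j v - a' n j v * (u - v)\<bar> \<le> Ca * (u - v)\<^sup>2"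
    and a'0: "\<forall>n. \<forall>j\<in>{s1 n + 1..d n}. \<forall>u\<in>{0..1}. a' n j u = 0"
    using coef_derivatives by (elim exE conjE) (rule that)
  obtain cK B where cK: "1 \<le> cK" and KB: "\<forall>z. \<bar>K z\<bar> \<le> B * indicator {- cK..cK} z"
    using kernel_support by (elim exE conjE) (rule that)
  have Ksupp: "\<bar>t\<bar> \<le> cK" if "K t \<noteq> 0" for t
  proof (rule ccontr)
    assume "\<not> \<bar>t\<bar> \<le> cK"
    then have "t \<notin> {- cK..cK}" by auto
    then show False using KB[THEN spec, of t] that by simp
  qed
  let ?score = "\<lambda>l C' n \<omega>. \<forall>k\<in>{1..n}. \<forall>j\<in>{1..d n}.
      \<bar>1 / n * (\<Sum>i=1..n. score_fun n j (Z n i \<omega>, Y n i \<omega>) *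
         ((((U n i \<omega> - U n k \<omega>) / h n) ^ l * K ((U n i \<omega> - U n k \<omega>) / h n)) / h n))\<bar> \<le> C' * rt n"
  obtain D0 where D0: "0 \<le> D0" and w0: "with_prob_to_1 M (?score 0 D0)"
    using uniform_score_average[of 0] by (elim exE conjE) (rule that)
  obtain D1 where D1: "0 \<le> D1" and w1: "with_prob_to_1 M (?score 1 D1)"
    using uniform_score_average[of 1] by (elim exE conjE) (rule that)
  let ?hess = "\<lambda>C' n \<omega>. \<forall>k\<in>{1..n}. \<forall>p\<in>{1..d n} \<times> {1..d n}.
      \<bar>1 / n * (\<Sum>i=1..n. \<bar>hess_fun n p (Z n i \<omega>, Y n i \<omega>)\<bar> * (K ((U n i \<omega> - U n k \<omega>) / h n) / h n))\<bar> \<le> C' * (1 + rt n)"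
  obtain Ch where Ch: "0 \<le> Ch" and wh: "with_prob_to_1 M (?hess Ch)"
    using uniform_hess_average by (elim exE conjE) (rule that)
  let ?third = "\<lambda>m C' n \<omega>. \<forall>k\<in>{1..n}. \<forall>p\<in>{1..d n} \<times> {1..d n} \<times> {1..d n}.
      \<bar>1 / n * (\<Sum>i=1..n. \<bar>third_fun (m n) p (Z n i \<omega>, Y n i \<omega>)\<bar> * (K ((U n i \<omega> - U n k \<omega>) / h n) / h n))\<bar> \<le> C' * (1 + rt n)"
  let ?lip = "\<lambda>m n i \<omega>. 0 < m n (Z n i \<omega>, Y n i \<omega>) \<and>
      (\<forall>\<delta>'. \<bar>q2 likf (r n i \<omega> + \<delta>') (Y n i \<omega>) - q2 likf (r n i \<omega>) (Y n i \<omega>)\<bar> \<le> m n (Z n i \<omega>, Y n i \<omega>) * \<bar>\<delta>'\<bar>)"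
  obtain m Ct where lip: "\<forall>n. \<forall>i\<in>{1..n}. AE \<omega> in M. ?lip m n i \<omega>"
    and Ct: "0 \<le> Ct" and wt: "with_prob_to_1 M (?third m Ct)"
    using uniform_third_average by (elim exE conjE) (rule that)
  have wU: "with_prob_to_1 M (\<lambda>n \<omega>. \<forall>i\<in>{1..n}. U n i \<omega> \<in> {0..1} \<and> ?lip m n i \<omega>)"
  proof (rule with_prob_to_1_AE)
    fix n
    have "AE \<omega> in M. U n i \<omega> \<in> {0..1} \<and> ?lip m n i \<omega>" if i: "i \<in> {1..n}" for i
      using U_unit[OF i] lip[THEN spec, THEN bspec, OF i] by (rule AE_conjI)
    then show "AE \<omega> in M. \<forall>i\<in>{1..n}. U n i \<omega> \<in> {0..1} \<and> ?lip m n i \<omega>"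
      by (subst AE_ball_countable) auto
  qed
  note good = with_prob_to_1_conj[OF wU with_prob_to_1_conj[OF w0 with_prob_to_1_conj[OF w1
    with_prob_to_1_conj[OF wh with_prob_to_1_conj[OF wt with_prob_to_1_conj[OF restricted_eigen signal]]]]]]
  define C1 where "C1 = D0 + D1"
  \<comment> \<open>The averages are bounded by a constant times \<open>1 + rt n\<close>, and
    \<open>rt n \<le> 1\<close> eventually; hence the factor 2.\<close>
  define C0 where "C0 = 2 * (Ch + Ct)"
  have C: "0 \<le> C1" "0 \<le> C0" using D0 D1 Ch Ct by (auto simp: C1_def C0_def)
  show ?thesis
    unfolding with_prob_to_1_iff_eps
  proof (intro allI impI)
    fix \<epsilon> :: real assume "0 < \<epsilon>"
    then have e: "0 < \<epsilon> / 2" by simp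
    let ?row = "\<lambda>n \<omega>. SUP k\<in>{s2 n + 1..d n} \<union> {d n + s1 n + 1..2 * d n}.
          SUP u\<in>{0..1}. SUP w\<in>oracle_directions (d n) (s1 n) (s2 n).
            ereal \<bar>\<Sum>c=1..2 * d n. ddL (P n \<omega>) (\<lambda>i. r n i \<omega>) u k c * w c\<bar>"
    obtain Cr :: real where Cr: "\<forall>\<^sub>F n in sequentially. \<exists>A\<in>sets M. A \<subseteq> {\<omega> \<in> space M. \<bar>?row n \<omega>\<bar> \<le> ereal Cr} \<and> 1 - \<epsilon> / 2 \<le> prob A"
      using row_bound e unfolding Op_one_def by blast
    \<comment> \<open>For large \<epsilon> the constant of the stochastic bound may be negative,
      while the deterministic part asks for a nonnegative one.\<close>
    define Crow where "Crow = max 0 Cr"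
    have Crow: "0 \<le> Crow" "Cr \<le> Crow" by (auto simp: Crow_def)
    show "\<forall>\<^sub>F n in sequentially. \<exists>A\<in>sets M.
      A \<subseteq> {\<omega> \<in> space M. \<forall>k\<in>{1..n}. \<forall>j\<in>{1..d n}. Ab n \<omega> j k = Auo n \<omega> j k} \<and> 1 - \<epsilon> \<le> prob A"
      using good[unfolded with_prob_to_1_iff_eps, THEN spec, THEN mp, OF e] Cr
        recovery_given_regular_sample[OF C Ca cK Crow(1)] eventually_ge_at_top[of 1] ln_inv_h_nonneg
    proof eventually_elim
      case (elim n)
      have rt1: "rt n \<le> 1" using elim(3) by blast
      have rt0: "0 \<le> rt n" using elim(5) pos[of n] by (intro real_sqrt_ge_zero divide_nonneg_nonneg) auto
      obtain A where A: "A \<in> sets M" "1 - (\<epsilon> / 2 + \<epsilon> / 2) \<le> prob A"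
        and sub: "A \<subseteq> {\<omega> \<in> space M. ((\<forall>i\<in>{1..n}. U n i \<omega> \<in> {0..1} \<and> ?lip m n i \<omega>) \<and> ?score 0 D0 n \<omega> \<and> ?score 1 D1 n \<omega> \<and>
          ?hess Ch n \<omega> \<and> ?third m Ct n \<omega> \<and>
          (let \<Omega> = Omega0 (d n) (s2 n) (max (lam1 n / lam2 n) (lam2 n / lam1 n) + \<delta>);
              q = (\<lambda>u v. ereal (quad_form (2 * d n) (\<lambda>j k. - ddL (P n \<omega>) (\<lambda>i. r n i \<omega>) u j k) v))
          in ereal \<rho>1 \<le> (INF u\<in>{0..1}. INF v\<in>\<Omega>. q u v) \<and>
             (INF u\<in>{0..1}. INF v\<in>\<Omega>. q u v) \<le> (SUP u\<in>{0..1}. SUP v\<in>\<Omega>. q u v) \<and>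
             (SUP u\<in>{0..1}. SUP v\<in>\<Omega>. q u v) \<le> ereal \<rho>2) \<and>
          (MIN j\<in>{1..s2 n}. L2_set (\<lambda>k. a n j (U n k \<omega>)) {1..n}) \<ge> b\<^sub>d * sqrt (real n) \<and>
          (MIN j\<in>{1..s1 n}. deviation n (\<lambda>k. a n j (U n k \<omega>))) \<ge> b\<^sub>d * sqrt (real n)) \<and> \<bar>?row n \<omega>\<bar> \<le> ereal Cr}"
        using inner_prob_conj[OF elim(1,2)] by (elim bexE conjE) (rule that)
      have "Ab n \<omega> j k = Auo n \<omega> j k" if \<omega>A: "\<omega> \<in> A" and kj: "k \<in> {1..n}" "j \<in> {1..d n}" for \<omega> k j
      proof -
        from subsetD[OF sub \<omega>A] have \<omega>: "\<omega> \<in> space M"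
          and g1: "\<forall>i\<in>{1..n}. U n i \<omega> \<in> {0..1} \<and> ?lip m n i \<omega>"
          and g2: "?score 0 D0 n \<omega>" and g3: "?score 1 D1 n \<omega>" and g4: "?hess Ch n \<omega>" and g5: "?third m Ct n \<omega>"
          and g6: "ereal \<rho>1 \<le> (INF u\<in>{0..1}. INF v\<in>Omega0 (d n) (s2 n) (max (lam1 n / lam2 n) (lam2 n / lam1 n) + \<delta>).
            ereal (quad_form (2 * d n) (\<lambda>j k. - ddL (P n \<omega>) (\<lambda>i. r n i \<omega>) u j k) v))"
          and g7: "(MIN j\<in>{1..s2 n}. L2_set (\<lambda>k. a n j (U n k \<omega>)) {1..n}) \<ge> b\<^sub>d * sqrt (real n)"
          and g8: "(MIN j\<in>{1..s1 n}. deviation n (\<lambda>k. a n j (U n k \<omega>))) \<ge> b\<^sub>d * sqrt (real n)"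
          and g9: "\<bar>?row n \<omega>\<bar> \<le> ereal Cr"
          unfolding Let_def mem_Collect_eq by - (elim conjE, assumption)+
        have rowle: "?row n \<omega> \<le> ereal Crow"
        proof -
          have "x \<le> \<bar>x\<bar>" for x :: ereal by (cases x) auto
          also note g9
          also have "ereal Cr \<le> ereal Crow" using Crow by simp
          finally show ?thesis .
        qed
        have Dle: "D0 * rt n \<le> C1 * rt n" "D1 * rt n \<le> C1 * rt n"
          using D0 D1 rt0 by (auto simp: C1_def intro!: mult_right_mono)
        have Cle: "Ch * (1 + rt n) \<le> C0" "Ct * (1 + rt n) \<le> C0"
        proof -
          have "Ch * (1 + rt n) \<le> Ch * 2" "Ct * (1 + rt n) \<le> Ct * 2"
            using Ch Ct rt1 by (auto intro!: mult_left_mono)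
          then show "Ch * (1 + rt n) \<le> C0" "Ct * (1 + rt n) \<le> C0" using Ch Ct by (auto simp: C0_def)
        qed
        have S: "sample (P n \<omega>) (\<lambda>i. r n i \<omega>) (\<lambda>i. m n (Z n i \<omega>, Y n i \<omega>)) (a n) (a' n) (s1 n) (s2 n)
          (lam1 n) (lam2 n) (C1 * rt n) C0 Ca cK \<rho>1 (max (lam1 n / lam2 n) (lam2 n / lam1 n) + \<delta>) Crow"
        proof (rule sample_at[OF \<omega> elim(4) cK Ksupp])
          show "U n i \<omega> \<in> {0..1}" "0 < m n (Z n i \<omega>, Y n i \<omega>)"
            "\<bar>q2 likf (r n i \<omega> + t) (Y n i \<omega>) - q2 likf (r n i \<omega>) (Y n i \<omega>)\<bar> \<le> m n (Z n i \<omega>, Y n i \<omega>) * \<bar>t\<bar>"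
            if "i \<in> {1..n}" for i t
            using g1[THEN bspec, OF that] by (elim conjE; blast)+
          show "\<bar>a n j u - a n j v - a' n j v * (u - v)\<bar> \<le> Ca * (u - v)\<^sup>2"
            if "j \<in> {1..d n}" "u \<in> {0..1}" "v \<in> {0..1}" for j u v
            using taylor that by blast
          show "a' n j u = 0" if "j \<in> {s1 n + 1..d n}" "u \<in> {0..1}" for j u using a'0 that by blast
          show "\<bar>1 / n * (\<Sum>i=1..n. score_fun n j (Z n i \<omega>, Y n i \<omega>) *
             ((((U n i \<omega> - U n k \<omega>) / h n) ^ l * K ((U n i \<omega> - U n k \<omega>) / h n)) / h n))\<bar> \<le> C1 * rt n"
            if "l \<in> {0, 1}" "k \<in> {1..n}" "j \<in> {1..d n}" for l k j
          proof -
            from that(1) consider "l = 0" | "l = 1" by blast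
            then show ?thesis
            proof cases
              case 1
              show ?thesis unfolding 1 by (rule order_trans[OF g2[THEN bspec, THEN bspec, OF that(2,3)] Dle(1)])
            next
              case 2
              show ?thesis unfolding 2 by (rule order_trans[OF g3[THEN bspec, THEN bspec, OF that(2,3)] Dle(2)])
            qed
          qed
          show "\<bar>1 / n * (\<Sum>i=1..n. \<bar>hess_fun n p (Z n i \<omega>, Y n i \<omega>)\<bar> * (K ((U n i \<omega> - U n k \<omega>) / h n) / h n))\<bar> \<le> C0"
            if "k \<in> {1..n}" "p \<in> {1..d n} \<times> {1..d n}" for k p
            by (rule order_trans[OF g4[THEN bspec, THEN bspec, OF that] Cle(1)])
          show "\<bar>1 / n * (\<Sum>i=1..n. \<bar>third_fun (m n) p (Z n i \<omega>, Y n i \<omega>)\<bar> * (K ((U n i \<omega> - U n k \<omega>) / h n) / h n))\<bar> \<le> C0"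
            if "k \<in> {1..n}" "p \<in> {1..d n} \<times> {1..d n} \<times> {1..d n}" for k p
            by (rule order_trans[OF g5[THEN bspec, THEN bspec, OF that] Cle(2)])
          show "0 \<le> C1 * rt n" using C(1) rt0 by (rule mult_nonneg_nonneg)
        qed (assumption | rule g6 rowle C Ca Crow)+
        have sA: "\<forall>j\<in>{1..s2 n}. b\<^sub>d * sqrt (real n) \<le> L2_set (\<lambda>k. a n j (U n k \<omega>)) {1..n}"
          by (intro ballI order_trans[OF g7] Min_le) auto
        have sD: "\<forall>j\<in>{1..s1 n}. b\<^sub>d * sqrt (real n) \<le> deviation n (\<lambda>k. a n j (U n k \<omega>))"
          by (intro ballI order_trans[OF g8] Min_le) auto
        show ?thesis
          using elim(3)[THEN conjunct2, THEN bspec, OF \<omega>, THEN spec, THEN spec, THEN spec, THEN mp, OF S, THEN mp, OF sA, THEN mp, OF sD] kj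
          by blast
      qed
      moreover have "A \<subseteq> space M" using A(1) sets.sets_into_space by blast
      ultimately show ?case using A by (intro bexI[of _ A]) auto
    qed
  qed
qed

end

theorem theorem3p2:
  fixes M :: "'w measure"
    and U :: "nat \<Rightarrow> nat \<Rightarrow> 'w \<Rightarrow> real"
    and X :: "nat \<Rightarrow> nat \<Rightarrow> nat \<Rightarrow> 'w \<Rightarrow> real"
    and Y :: "nat \<Rightarrow> nat \<Rightarrow> 'w \<Rightarrow> real"
    and d s1 s2 :: "nat \<Rightarrow> nat"
    and a :: "nat \<Rightarrow> nat \<Rightarrow> real \<Rightarrow> real"
    and ll :: "real \<Rightarrow> real \<Rightarrow> real" and g :: "real \<Rightarrow> real" and means R :: "real set"
    and \<nu> :: "real measure"
    and likf :: "real \<Rightarrow> real \<Rightarrow> real"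
    and r :: "nat \<Rightarrow> nat \<Rightarrow> 'w \<Rightarrow> real"
    and Z :: "nat \<Rightarrow> nat \<Rightarrow> 'w \<Rightarrow> real \<times> (nat \<Rightarrow> real)"
    and \<sigma>U \<sigma>XU :: "nat \<Rightarrow> nat \<Rightarrow> 'w measure"
    and Q1 Q2 :: "nat \<Rightarrow> nat \<Rightarrow> 'w \<Rightarrow> real"
    and K :: "real \<Rightarrow> real" and h lam1 lam2 lam4 lam4s :: "nat \<Rightarrow> real"
    and fU :: "real \<Rightarrow> real"
    and m0 \<tau>1 \<delta>1 \<delta> \<rho>1 \<rho>2 b\<^sub>d :: real
    and P :: "nat \<Rightarrow> 'w \<Rightarrow> problem"
    and At Bt Ab Bb Auo Buo :: "nat \<Rightarrow> 'w \<Rightarrow> nat \<Rightarrow> nat \<Rightarrow> real"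
  assumes prob: "prob_space M"
    (* notation *)
    and likf_def: "likf = (\<lambda>s y. ll (inv_into means g s) y)"
    and r_def: "r = (\<lambda>n i \<omega>. \<Sum>j=1..d n. a n j (U n i \<omega>) * X n i j \<omega>)"
    and Z_def: "Z = (\<lambda>n i \<omega>. (U n i \<omega>, \<lambda>j\<in>{1..d n}. X n i j \<omega>))"
    and \<sigma>U_def: "\<sigma>U = (\<lambda>n i. vimage_algebra (space M) (U n i) borel)"
    and \<sigma>XU_def: "\<sigma>XU = (\<lambda>n i. vimage_algebra (space M) (Z n i) (regressor_space (d n)))"
    and Q1_def: "Q1 = (\<lambda>n i \<omega>. q1 likf (r n i \<omega>) (Y n i \<omega>))"
    and Q2_def: "Q2 = (\<lambda>n i \<omega>. q2 likf (r n i \<omega>) (Y n i \<omega>))"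
    and P_def: "P = (\<lambda>n \<omega>. \<lparr>nobs = n, dim = d n, idx = (\<lambda>i. U n i \<omega>),
          cov = (\<lambda>i j. X n i j \<omega>), resp = (\<lambda>i. Y n i \<omega>), lik = likf, kern = K, bw = h n\<rparr>)"
    (* the sample of size n is independent and identically distributed *)
    and indep: "\<And>n. prob_space.indep_vars M (\<lambda>_. obs_space (d n)) (\<lambda>i \<omega>. (Z n i \<omega>, Y n i \<omega>)) {1..n}"
    and ident: "\<And>n i k. i \<in> {1..n} \<Longrightarrow> k \<in> {1..n} \<Longrightarrow>
          distr M (obs_space (d n)) (\<lambda>\<omega>. (Z n i \<omega>, Y n i \<omega>)) =
          distr M (obs_space (d n)) (\<lambda>\<omega>. (Z n k \<omega>, Y n k \<omega>))"
    and densU: "\<And>n i. i \<in> {1..n} \<Longrightarrow>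
          distributed M lborel (U n i) (\<lambda>u. ennreal (fU u) * indicator {0..1} u)"
    (* link, range of the response, and conditional density *)
    and link: "bij_betw g means UNIV"
    and range_meas: "R \<in> sets borel"
    and range_Y: "\<And>n i \<omega>. i \<in> {1..n} \<Longrightarrow> \<omega> \<in> space M \<Longrightarrow> Y n i \<omega> \<in> R"
    and ref_meas: "response_measure R \<nu>"
    and lik_meas: "(\<lambda>(s, y). likf s y) \<in> borel_measurable (borel \<Otimes>\<^sub>M borel)"
    and lik_diff1: "\<And>y s. y \<in> R \<Longrightarrow> (\<lambda>t. likf t y) differentiable (at s)"
    and lik_diff2: "\<And>y s. y \<in> R \<Longrightarrow> (\<lambda>t. q1 likf t y) differentiable (at s)"
    and Y_int: "\<And>n i. i \<in> {1..n} \<Longrightarrow> integrable M (Y n i)"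
    and mean_link: "\<And>n i. i \<in> {1..n} \<Longrightarrow> (AE \<omega> in M.
          real_cond_exp M (\<sigma>XU n i) (Y n i) \<omega> \<in> means \<and>
          g (real_cond_exp M (\<sigma>XU n i) (Y n i) \<omega>) = r n i \<omega>)"
    and cond_dens: "\<And>n i. i \<in> {1..n} \<Longrightarrow>
          distr M (obs_space (d n)) (\<lambda>\<omega>. (Z n i \<omega>, Y n i \<omega>)) =
          density (distr M (regressor_space (d n)) (Z n i) \<Otimes>\<^sub>M \<nu>)
            (\<lambda>((u, x), y). ennreal (exp (likf (\<Sum>j=1..d n. a n j u * x j) y)))"
    (* structure of the coefficients *)
    and d_lim: "filterlim d at_top sequentially"
    and s_ord: "\<And>n. 1 \<le> s1 n \<and> s1 n < s2 n \<and> s2 n < d n"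
    and s_small: "(\<lambda>n. real (s2 n)) \<in> o(\<lambda>n. real n)" "(\<lambda>n. real (s2 n)) \<in> o(\<lambda>n. real (d n))"
    and coef_var: "\<And>n j. j \<in> {1..s1 n} \<Longrightarrow> \<not> (\<exists>c. \<forall>u\<in>{0..1}. a n j u = c)"
    and coef_const: "\<And>n j. j \<in> {s1 n + 1..s2 n} \<Longrightarrow> \<exists>c. c \<noteq> 0 \<and> (\<forall>u\<in>{0..1}. a n j u = c)"
    and coef_zero: "\<And>n j. j \<in> {s2 n + 1..d n} \<Longrightarrow> \<forall>u\<in>{0..1}. a n j u = 0"
    and pos: "\<And>n. 0 < h n \<and> 0 < lam1 n \<and> 0 < lam2 n \<and> 0 < lam4 n \<and> 0 < lam4s n"
    (* condition (1) *)
    and K_cont: "continuous_on UNIV K"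
    and K_sym: "\<And>z. K (- z) = K z"
    and K_pdf: "\<And>z. 0 \<le> K z" "integrable lborel K" "(LINT z|lborel. K z) = 1"
    and K_supp: "compact (closure {z. K z \<noteq> 0})"
    (* condition (2a) *)
    and m0: "2 < m0"
    and Q1_int: "\<And>n i. i \<in> {1..n} \<Longrightarrow> integrable M (Q1 n i)"
    and Q1_mean: "\<And>n i. i \<in> {1..n} \<Longrightarrow> (AE \<omega> in M. real_cond_exp M (\<sigma>XU n i) (Q1 n i) \<omega> = 0)"
    and Q1_var: "\<And>n i. i \<in> {1..n} \<Longrightarrow> \<exists>\<phi>. continuous_on {0..1} \<phi> \<and>
          (AE \<omega> in M. nn_cond_exp M (\<sigma>U n i) (\<lambda>\<omega>. ennreal ((Q1 n i \<omega>)\<^sup>2)) \<omega> = ennreal (\<phi> (U n i \<omega>)))"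
    and moments: "\<exists>C::real. \<forall>n. \<forall>i\<in>{1..n}. AE \<omega> in M.
          (MAX j\<in>{1..d n}.
             nn_cond_exp M (\<sigma>U n i) (\<lambda>\<omega>. ennreal (\<bar>Q1 n i \<omega> * X n i j \<omega>\<bar> powr m0)) \<omega>)
          + (MAX (j, k)\<in>{1..d n} \<times> {1..d n}.
             nn_cond_exp M (\<sigma>U n i) (\<lambda>\<omega>. ennreal (\<bar>Q2 n i \<omega> * X n i j \<omega> * X n i k \<omega>\<bar> powr m0)) \<omega>)
          \<le> ennreal C"
    (* condition (2b) *)
    and q2_neg: "\<And>s y. y \<in> R \<Longrightarrow> q2 likf s y < 0"
    and q2_lip: "\<exists>Mf. \<exists>C::real. \<forall>n. Mf n \<in> borel_measurable (obs_space (d n)) \<and>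
          (\<forall>i\<in>{1..n}. (AE \<omega> in M. 0 < Mf n (Z n i \<omega>, Y n i \<omega>) \<and>
              (\<forall>\<delta>'. \<bar>q2 likf (r n i \<omega> + \<delta>') (Y n i \<omega>) - q2 likf (r n i \<omega>) (Y n i \<omega>)\<bar>
                    \<le> Mf n (Z n i \<omega>, Y n i \<omega>) * \<bar>\<delta>'\<bar>)) \<and>
            (AE \<omega> in M. (MAX (j, k, l)\<in>{1..d n} \<times> {1..d n} \<times> {1..d n}.
              nn_cond_exp M (\<sigma>U n i) (\<lambda>\<omega>. ennreal
                (\<bar>X n i j \<omega> * X n i k \<omega> * X n i l \<omega> * Mf n (Z n i \<omega>, Y n i \<omega>)\<bar> powr m0)) \<omega>)
              \<le> ennreal C))"
    (* condition (2c) *)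
    and delta: "0 < \<delta>"
    and rho: "0 < \<rho>1" "\<rho>1 \<le> \<rho>2"
    and restricted_eigen: "with_prob_to_1 M (\<lambda>n \<omega>.
          let \<Omega> = Omega0 (d n) (s2 n) (max (lam1 n / lam2 n) (lam2 n / lam1 n) + \<delta>);
              q = (\<lambda>u v. ereal (quad_form (2 * d n) (\<lambda>j k. - ddL (P n \<omega>) (\<lambda>i. r n i \<omega>) u j k) v))
          in ereal \<rho>1 \<le> (INF u\<in>{0..1}. INF v\<in>\<Omega>. q u v) \<and>
             (INF u\<in>{0..1}. INF v\<in>\<Omega>. q u v) \<le> (SUP u\<in>{0..1}. SUP v\<in>\<Omega>. q u v) \<and>
             (SUP u\<in>{0..1}. SUP v\<in>\<Omega>. q u v) \<le> ereal \<rho>2)"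
    (* condition (3) *)
    and fU_smooth: "\<exists>f2. cont_second_deriv fU f2"
    and fU_bounds: "\<exists>c1 c2. 0 < c1 \<and> (\<forall>u\<in>{0..1}. c1 \<le> fU u \<and> fU u \<le> c2)"
    (* condition (4) *)
    and a_smooth: "\<exists>C. \<forall>n. \<forall>j\<in>{1..d n}. \<exists>f2. cont_second_deriv (a n j) f2 \<and> (\<forall>u\<in>{0..1}. \<bar>f2 u\<bar> \<le> C)"
    (* condition (5) *)
    and tau1: "0 \<le> \<tau>1" "propto (\<lambda>n. real (d n)) (\<lambda>n. real n powr \<tau>1)"
    and rate_nh: "filterlim (\<lambda>n. real n * h n /
          ((real n * real (d n) ^ 3) powr (2 / m0) * ln (1 / h n))) at_top sequentially"
    and delta1: "0 < \<delta>1" "\<delta>1 < 1" "propto h (\<lambda>n. real n powr (- \<delta>1))"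
    and rate_lam1: "(\<lambda>n. real (s2 n) * (h n)\<^sup>2 + sqrt (ln (1 / h n) / (real n * h n))) \<in> o(lam1)"
    and lam12: "propto lam1 lam2"
    and rate_s2: "(\<lambda>n. real (s2 n) * (lam1 n)\<^sup>2 / (h n)\<^sup>2 + (real (s2 n))\<^sup>2 * lam1 n) \<in> o(\<lambda>_. 1)"
    (* condition (6a) *)
    and rate_bias: "propto (\<lambda>n. real (s2 n) * (h n)\<^sup>2) (\<lambda>n. 1 / sqrt (real n * h n))"
    and lam4_equiv: "lam4 \<sim>[sequentially] lam4s"
    and lam4_up: "lam4 \<in> o(\<lambda>n. sqrt (real n))"
    and lam4_low: "(\<lambda>n. 1 / sqrt (h n) * (sqrt (ln (1 / h n))
          + sqrt (real (s2 n)) * (1 + lam1 n * sqrt (real n * h n)))) \<in> o(lam4)"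
    (* condition (6b) *)
    and b_pos: "0 < b\<^sub>d"
    and signal: "with_prob_to_1 M (\<lambda>n \<omega>.
          (MIN j\<in>{1..s2 n}. L2_set (\<lambda>k. a n j (U n k \<omega>)) {1..n}) \<ge> b\<^sub>d * sqrt (real n) \<and>
          (MIN j\<in>{1..s1 n}. deviation n (\<lambda>k. a n j (U n k \<omega>))) \<ge> b\<^sub>d * sqrt (real n))"
    and row_bound: "Op_one M (\<lambda>n \<omega>.
          SUP k\<in>{s2 n + 1..d n} \<union> {d n + s1 n + 1..2 * d n}.
          SUP u\<in>{0..1}. SUP w\<in>oracle_directions (d n) (s1 n) (s2 n).
            ereal \<bar>\<Sum>c=1..2 * d n. ddL (P n \<omega>) (\<lambda>i. r n i \<omega>) u k c * w c\<bar>)"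
    (* the estimators *)
    and prelim: "\<And>n \<omega>. \<omega> \<in> space M \<Longrightarrow>
          is_prelim_estimator (P n \<omega>) (lam1 n) (lam2 n) (At n \<omega>) (Bt n \<omega>)"
    and scad: "\<And>n \<omega>. \<omega> \<in> space M \<Longrightarrow>
          is_scad_estimator (P n \<omega>) (lam4 n) (lam4s n) (At n \<omega>) (Bt n \<omega>) (Ab n \<omega>) (Bb n \<omega>)"
    and unb_oracle: "\<And>n \<omega>. \<omega> \<in> space M \<Longrightarrow>
          is_oracle_estimator (P n \<omega>) (s1 n) (s2 n) (At n \<omega>) (Bt n \<omega>) (Auo n \<omega>) (Buo n \<omega>)"
  shows "(\<forall>B :: nat \<Rightarrow> nat \<Rightarrow> real. (\<forall>n. L2_set (B n) {1..s1 n} = 1) \<longrightarrow>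
           op_one M (\<lambda>n \<omega>. sqrt (real n * h n) *
             (\<Sum>j=1..s1 n. B n j * (MAX k\<in>{1..n}. \<bar>Ab n \<omega> j k - Auo n \<omega> j k\<bar>)))) \<and>
         (\<forall>A :: nat \<Rightarrow> nat \<Rightarrow> real. (\<forall>n. L2_set (A n) {s1 n + 1..s2 n} = 1) \<longrightarrow>
           op_one M (\<lambda>n \<omega>. sqrt (real n) *
             (\<Sum>j=s1 n + 1..s2 n. A n j *
               ((1 / real n) * (\<Sum>i=1..n. Ab n \<omega> j i) - (1 / real n) * (\<Sum>i=1..n. Auo n \<omega> j i)))))"
proof -
  interpret prob_space M by (rule prob)
  interpret gsvcm_fit M U X Y d s1 s2 a R likf r Z \<sigma>U \<sigma>XU Q1 Q2 K h fU m0 \<tau>1 \<delta>1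
    lam1 lam2 lam4 lam4s \<delta> \<rho>1 \<rho>2 b\<^sub>d P At Bt Ab Bb Auo Buo
  proof (intro gsvcm_fit.intro gsvcm.intro gsvcm_axioms.intro gsvcm_fit_axioms.intro)
    show "0 < h n" for n using pos by blast
  qed (fact prob r_def Z_def \<sigma>U_def \<sigma>XU_def Q1_def Q2_def indep densU range_meas range_Y lik_meas lik_diff1 lik_diff2
      s_ord K_cont K_pdf(1) K_supp m0 Q1_int Q1_mean moments q2_lip fU_bounds a_smooth tau1 rate_nh delta1(1,3)
      P_def q2_neg coef_const coef_zero pos delta rho restricted_eigen rate_lam1 lam12 rate_s2 lam4_equiv lam4_up lam4_low
      b_pos signal row_bound prelim scad unb_oracle)+
  show ?thesis
  proof (intro conjI allI impI)
    fix B :: "nat \<Rightarrow> nat \<Rightarrow> real"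
    show "op_one M (\<lambda>n \<omega>. sqrt (real n * h n) *
             (\<Sum>j=1..s1 n. B n j * (MAX k\<in>{1..n}. \<bar>Ab n \<omega> j k - Auo n \<omega> j k\<bar>)))"
      unfolding op_one_def
    proof (intro allI impI with_prob_to_1_mono[OF recovery])
      fix \<epsilon> :: real assume \<epsilon>: "0 < \<epsilon>"
      show "\<forall>\<^sub>F n in sequentially. \<forall>\<omega>\<in>space M. (\<forall>k\<in>{1..n}. \<forall>j\<in>{1..d n}. Ab n \<omega> j k = Auo n \<omega> j k) \<longrightarrow>
        \<bar>sqrt (real n * h n) * (\<Sum>j=1..s1 n. B n j * (MAX k\<in>{1..n}. \<bar>Ab n \<omega> j k - Auo n \<omega> j k\<bar>))\<bar> < \<epsilon>"
        \<comment> \<open>For \<open>n = 0\<close> the maximum ranges over the empty set and has no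
          determined value; from \<open>n = 1\<close> on, the recovery event makes it the maximum of
          \<open>{0}\<close>.\<close>
        using eventually_ge_at_top[of 1]
      proof eventually_elim
        case (elim n)
        have "(MAX k\<in>{1..n}. \<bar>Ab n \<omega> j k - Auo n \<omega> j k\<bar>) = 0"
          if "\<forall>k\<in>{1..n}. \<forall>j\<in>{1..d n}. Ab n \<omega> j k = Auo n \<omega> j k" "j \<in> {1..s1 n}" for \<omega> j
        proof -
          have "j \<in> {1..d n}" using that(2) s_ord[of n] by auto
          then have "(\<lambda>k. \<bar>Ab n \<omega> j k - Auo n \<omega> j k\<bar>) ` {1..n} = {0}"
            using that(1) elim by (auto simp: image_iff intro!: bexI[of _ 1])
          then show ?thesis by simp
        qed
        then show ?case using \<epsilon> by simp
      qed
    qed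
  next
    fix A :: "nat \<Rightarrow> nat \<Rightarrow> real"
    show "op_one M (\<lambda>n \<omega>. sqrt (real n) *
             (\<Sum>j=s1 n + 1..s2 n. A n j *
               ((1 / real n) * (\<Sum>i=1..n. Ab n \<omega> j i) - (1 / real n) * (\<Sum>i=1..n. Auo n \<omega> j i))))"
      unfolding op_one_def
    proof (intro allI impI with_prob_to_1_mono[OF recovery] always_eventually ballI)
      fix \<epsilon> :: real and n \<omega> assume \<epsilon>: "0 < \<epsilon>" and eq: "\<forall>k\<in>{1..n}. \<forall>j\<in>{1..d n}. Ab n \<omega> j k = Auo n \<omega> j k"
      have "(\<Sum>i=1..n. Ab n \<omega> j i) = (\<Sum>i=1..n. Auo n \<omega> j i)" if "j \<in> {s1 n + 1..s2 n}" for j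
      proof -
        have "j \<in> {1..d n}" using that s_ord[of n] by auto
        then show ?thesis using eq by (intro sum.cong) auto
      qed
      then show "\<bar>sqrt (real n) * (\<Sum>j=s1 n + 1..s2 n. A n j *
               ((1 / real n) * (\<Sum>i=1..n. Ab n \<omega> j i) - (1 / real n) * (\<Sum>i=1..n. Auo n \<omega> j i)))\<bar> < \<epsilon>"
        using \<epsilon> by simp
    qed
  qed
qed

end
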